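(* A solvable real Lie algebra of dimension five has a hypo structure if and only if it is isomorphic to one of the following Lie algebras. (A) One of the nine Lie algebras \begin{align*} &(e^{24}+e^{35},0,0,0,0),\\ &(e^{34}+e^{25},e^{35},0,0,0),\\ &\left(-\tfrac{1}{2} e^{15}-e^{23},- e^{25},\tfrac{1}{2} e^{35},\tfrac{3}{2} e^{45},0\right),\\ &\left(-e^{23}-2 e^{15},- e^{25},- e^{35},3 e^{45},0\right),\\ &\left(e^{15}-e^{23},- e^{25},2 e^{35},-3 e^{45},0\right),\\ &\left(-e^{15}-e^{24},- e^{34},e^{35},- e^{45},0\right),\\ &(-e^{14}, -e^{25}, e^{34}+e^{35},0,0),\\ &(2e^{14},-e^{24}-e^{35},e^{25}-e^{34},0,0),\\ &\left(e^{23}+2e^{14},e^{24}+e^{35},e^{34}-e^{25},0,0\right). \end{align*} (B) One of the Lie algebras (where $p,r$ are real parameters) \begin{align*} &(e^{35},e^{45},0,0,0),\\ &(e^{25},e^{35},e^{45},0,0),\\ &(e^{15}, p e^{25},- p e^{35},- e^{45},0),\quad p\neq 0,\\ &(e^{25},0,e^{35}, -e^{45},0),\\ &(e^{15},- e^{25}, r e^{45},- r e^{35},0),\quad r\neq 0,\\ &(e^{25},0,e^{45},- e^{35},0),\\ &(e^{15}+e^{25},e^{25},e^{45}-e^{35},- e^{45},0),\\ &(e^{25},- e^{15}, r e^{45},- r e^{35},0),\quad r\neq 0,\\ &(e^{25}+ p e^{15},-e^{15}+ p e^{25},e^{45}- p e^{35},-e^{35}- p e^{45},0),\\ &(e^{25}+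 p e^{15},-e^{15}+ p e^{25},-e^{45}- p e^{35},e^{35}- p e^{45},0),\\ &(e^{35}+e^{25},-e^{15}+e^{45},e^{45},- e^{35},0). \end{align*} (C) One of the five Lie algebras $$(0,0,0,0,0),\quad (e^{23},0,0,0,0),\quad (e^{23},-e^{13},0,0,0),\quad (e^{13},-e^{23},0,0,0),\quad (e^{23},-e^{13},0,0,e^{45}).$$
   Context: All Lie algebras are real. For a Lie algebra $\mathfrak g$, $d$ denotes the Chevalley--Eilenberg differential on $\Lambda^*\mathfrak g^*$. The notation $(\theta_1,\dots,\theta_5)$, with each $\theta_i$ a $2$-form in $e^1,\dots,e^5$, denotes the $5$-dimensional Lie algebra whose dual has a basis $e^1,\dots,e^5$ with $de^i=\theta_i$; here $e^{ij}=e^i\wedge e^j$. A hypo structure on a $5$-dimensional Lie algebra $\mathfrak g$ is a quadruplet $(\alpha,\omega_1,\omega_2,\omega_3)$, with $\alpha\in\mathfrak g^*$ and $\omega_i\in\Lambda^2\mathfrak g^*$, for which there is a basis $f^1,\dots,f^5$ of $\mathfrak g^*$ such that $$\alpha=f^5,\quad \omega_1=f^{12}+f^{34},\quad \omega_2=f^{13}+f^{42},\quad \omega_3=f^{14}+f^{23}\qquad (f^{ij}=f^i\wedge f^j),$$ and such that $d\omega_1=0$, $d(\omega_2\wedge\alpha)=0$ and $d(\omega_3\wedge\alpha)=0$. *)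

theory Defs
  imports "HOL-Analysis.Analysis" "HOL-Library.Function_Algebras"
begin

section \<open>Real Lie algebras\<close>

text \<open>A Lie algebra is a real vector space (a type of class \<open>real_vector\<close>) with a bracket.
  Its dimension is \<open>dim UNIV\<close>; as \<open>dim\<close> is \<open>0\<close> on infinite-dimensional spaces,
  \<open>dim UNIV = 5\<close> entails finite-dimensionality.\<close>

definition lie_algebra :: "('a::real_vector \<Rightarrow> 'a \<Rightarrow> 'a) \<Rightarrow> bool" where
  "lie_algebra br \<longleftrightarrow> bilinear br \<and> (\<forall>x. br x x = 0) \<and>
     (\<forall>x y z. br x (br y z) + br y (br z x) + br z (br x y) = 0)"

fun derived_series :: "('a::real_vector \<Rightarrow> 'a \<Rightarrow> 'a) \<Rightarrow> nat \<Rightarrow> 'a set" where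
  "derived_series br 0 = UNIV"
| "derived_series br (Suc n) =
     span {br x y | x y. x \<in> derived_series br n \<and> y \<in> derived_series br n}"

definition solvable_lie :: "('a::real_vector \<Rightarrow> 'a \<Rightarrow> 'a) \<Rightarrow> bool" where
  "solvable_lie br \<longleftrightarrow> (\<exists>n. derived_series br n = {0})"

definition lie_isomorphic ::
    "('a::real_vector \<Rightarrow> 'a \<Rightarrow> 'a) \<Rightarrow> ('b::real_vector \<Rightarrow> 'b \<Rightarrow> 'b) \<Rightarrow> bool"
    (infix "\<simeq>\<^sub>L" 50) where
  "br \<simeq>\<^sub>L br' \<longleftrightarrow> (\<exists>f. linear f \<and> bij f \<and> (\<forall>x y. f (br x y) = br' (f x) (f y)))"


section \<open>Exterior forms\<close>

text \<open>A form is a function of the list of its arguments; a form of degree \<open>k\<close> vanishes on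
  lists whose length is not \<open>k\<close>. Sums, differences and the zero form are the
  pointwise ones.\<close>

type_synonym 'a form = "'a list \<Rightarrow> real"

definition alt_forms :: "nat \<Rightarrow> 'a::real_vector form set" where
  "alt_forms k = {\<phi>.
     (\<forall>xs. length xs \<noteq> k \<longrightarrow> \<phi> xs = 0) \<and>
     (\<forall>xs i. length xs = k \<and> i < k \<longrightarrow> linear (\<lambda>v. \<phi> (xs[i := v]))) \<and>
     (\<forall>xs. length xs = k \<and> \<not> distinct xs \<longrightarrow> \<phi> xs = 0)}"

definition scale_form :: "real \<Rightarrow> 'a form \<Rightarrow> 'a form" (infixr "*\<^sub>F" 75) where
  "c *\<^sub>F \<phi> = (\<lambda>xs. c * \<phi> xs)"

text \<open>The exterior product as a sum over shuffles: \<open>S\<close> is the set of positions of the arguments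
  passed to the first factor, and the exponent of the sign counts inversions. On one-forms this
  is the convention \<open>(\<phi> \<and> \<psi>)(x, y) = \<phi>(x) \<psi>(y) - \<phi>(y) \<psi>(x)\<close>.\<close>

definition wedge :: "'a form \<Rightarrow> 'a form \<Rightarrow> 'a form" (infixl "\<^bold>\<and>" 80) where
  "\<phi> \<^bold>\<and> \<psi> = (\<lambda>xs. \<Sum>S\<in>Pow {..<length xs}.
     (- 1) ^ card {(i, j). i \<in> S \<and> j \<notin> S \<and> j < i} * \<phi> (nths xs S) * \<psi> (nths xs (- S)))"

text \<open>The Chevalley--Eilenberg differential
  \<open>(d\<phi>)(x\<^sub>0, \<dots>, x\<^sub>k) = \<Sum>\<^bsub>i<j\<^esub> (-1)\<^bsup>i+j\<^esup> \<phi>([x\<^sub>i, x\<^sub>j], x\<^sub>0, \<dots>, x\<^sub>k)\<close> (with \<open>x\<^sub>i\<close> and \<open>x\<^sub>j\<close> omitted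
  from the remaining arguments); on one-forms it reads \<open>(d\<phi>)(x, y) = - \<phi>([x, y])\<close>.\<close>

definition ce_diff :: "('a \<Rightarrow> 'a \<Rightarrow> 'a) \<Rightarrow> 'a form \<Rightarrow> 'a form" where
  "ce_diff br \<phi> = (\<lambda>xs. \<Sum>j<length xs. \<Sum>i<j.
     (- 1) ^ (i + j) * \<phi> (br (xs ! i) (xs ! j) # nths xs (- {i, j})))"

text \<open>The index type \<open>5\<close> has the elements \<open>1\<close>, \<open>2\<close>, \<open>3\<close>, \<open>4\<close> and \<open>5\<close>, where \<open>5 = 0\<close>.\<close>

definition dual_basis :: "(5 \<Rightarrow> 'a::real_vector form) \<Rightarrow> bool" where
  "dual_basis f \<longleftrightarrow> (\<forall>i. f i \<in> alt_forms 1) \<and>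
     (\<forall>\<phi>\<in>alt_forms 1. \<exists>!c::5 \<Rightarrow> real. \<phi> = (\<Sum>i\<in>UNIV. c i *\<^sub>F f i))"


section \<open>Hypo structures\<close>

definition hypo_structure :: "('a::real_vector \<Rightarrow> 'a \<Rightarrow> 'a) \<Rightarrow>
    'a form \<Rightarrow> 'a form \<Rightarrow> 'a form \<Rightarrow> 'a form \<Rightarrow> bool" where
  "hypo_structure br \<alpha> \<omega>1 \<omega>2 \<omega>3 \<longleftrightarrow>
     \<alpha> \<in> alt_forms 1 \<and> \<omega>1 \<in> alt_forms 2 \<and> \<omega>2 \<in> alt_forms 2 \<and> \<omega>3 \<in> alt_forms 2 \<and>
     (\<exists>f. dual_basis f \<and>
        \<alpha> = f 5 \<and>
        \<omega>1 = f 1 \<^bold>\<and> f 2 + f 3 \<^bold>\<and> f 4 \<and>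
        \<omega>2 = f 1 \<^bold>\<and> f 3 + f 4 \<^bold>\<and> f 2 \<and>
        \<omega>3 = f 1 \<^bold>\<and> f 4 + f 2 \<^bold>\<and> f 3) \<and>
     ce_diff br \<omega>1 = 0 \<and> ce_diff br (\<omega>2 \<^bold>\<and> \<alpha>) = 0 \<and> ce_diff br (\<omega>3 \<^bold>\<and> \<alpha>) = 0"

definition has_hypo_structure :: "('a::real_vector \<Rightarrow> 'a \<Rightarrow> 'a) \<Rightarrow> bool" where
  "has_hypo_structure br \<longleftrightarrow> (\<exists>\<alpha> \<omega>1 \<omega>2 \<omega>3. hypo_structure br \<alpha> \<omega>1 \<omega>2 \<omega>3)"


section \<open>Lie algebras given by structure equations\<close>

definition coframe :: "5 \<Rightarrow> (real^5) form" where
  "coframe i = (\<lambda>xs. case xs of [x] \<Rightarrow> x $ i | _ \<Rightarrow> 0)"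

definition e2 :: "5 \<Rightarrow> 5 \<Rightarrow> (real^5) form" where
  "e2 i j = coframe i \<^bold>\<and> coframe j"

text \<open>The bracket on \<open>real^5\<close> whose Chevalley--Eilenberg differential satisfies
  \<open>d(coframe 1) = \<theta>1\<close>, \dots, \<open>d(coframe 5) = \<theta>5\<close>; see \<open>ce_diff_coframe\<close> below.\<close>

definition structure_bracket :: "(real^5) form \<Rightarrow> (real^5) form \<Rightarrow> (real^5) form \<Rightarrow>
    (real^5) form \<Rightarrow> (real^5) form \<Rightarrow> real^5 \<Rightarrow> real^5 \<Rightarrow> real^5" where
  "structure_bracket \<theta>1 \<theta>2 \<theta>3 \<theta>4 \<theta>5 =
     (\<lambda>x y. - vector [\<theta>1 [x, y], \<theta>2 [x, y], \<theta>3 [x, y], \<theta>4 [x, y], \<theta>5 [x, y]])"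


section \<open>Basic facts\<close>

lemma wedge_one_forms:
  assumes "\<phi> \<in> alt_forms 1" and "\<psi> \<in> alt_forms 1"
  shows "(\<phi> \<^bold>\<and> \<psi>) [x, y] = \<phi> [x] * \<psi> [y] - \<phi> [y] * \<psi> [x]"
proof -
  have z: "\<phi> xs = 0" "\<psi> xs = 0" if "length xs \<noteq> 1" for xs
    using assms that by (auto simp: alt_forms_def)
  have P: "Pow {..<Suc (Suc 0)} = {{}, {0}, {1}, {0, 1}}"
    by (simp add: lessThan_Suc Pow_insert) auto
  have "{(i :: nat, j :: nat). i = 0 \<and> 0 < j \<and> j < i} = {}" by auto
  then have "card {(i :: nat, j :: nat). i = 0 \<and> 0 < j \<and> j < i} = 0" by (simp only: card.empty)
  moreover have "{(i, j). i = Suc 0 \<and> j \<noteq> Suc 0 \<and> j < i} = {(1, 0)}" by auto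
  ultimately show ?thesis
    by (simp add: wedge_def P nths_Cons z)
qed

lemma wedge_two_one_forms:
  assumes "\<phi> \<in> alt_forms 2" and "\<psi> \<in> alt_forms 1"
  shows "(\<phi> \<^bold>\<and> \<psi>) [x, y, z] =
    \<phi> [x, y] * \<psi> [z] - \<phi> [x, z] * \<psi> [y] + \<phi> [y, z] * \<psi> [x]"
proof -
  have z: "length xs \<noteq> 2 \<Longrightarrow> \<phi> xs = 0" "length xs \<noteq> 1 \<Longrightarrow> \<psi> xs = 0" for xs
    using assms by (auto simp: alt_forms_def)
  define T where "T S = (- 1) ^ card {(i, j). i \<in> S \<and> j \<notin> S \<and> j < i} *
    \<phi> (nths [x, y, z] S) * \<psi> (nths [x, y, z] (- S))" for S
  have P: "Pow {..<Suc (Suc (Suc 0))} = {{}, {0}, {1}, {2}, {0, 1}, {0, 2}, {1, 2}, {0, 1, 2}}"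
    by (simp add: lessThan_Suc Pow_insert numeral_2_eq_2) auto
  have "(\<phi> \<^bold>\<and> \<psi>) [x, y, z] = sum T (Pow {..<Suc (Suc (Suc 0))})"
    by (simp add: wedge_def T_def)
  also have "\<dots> = sum T {{0, 1}, {0, 2}, {1, 2}}"
  proof (rule sum.mono_neutral_right)
    have "T {} = 0" "T {0} = 0" "T {1} = 0" "T {2} = 0" "T {0, 1, 2} = 0"
      unfolding T_def by (simp_all add: nths_Cons z)
    then show "\<forall>S\<in>Pow {..<Suc (Suc (Suc 0))} - {{0, 1}, {0, 2}, {1, 2}}. T S = 0"
      unfolding P by blast
    show "{{0, 1}, {0, 2}, {1, 2}} \<subseteq> Pow {..<Suc (Suc (Suc 0))}"
      by auto
  qed simp
  also have "\<dots> = T {0, 1} + T {0, 2} + T {1, 2}"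
  proof -
    have "{0::nat, 1} \<noteq> {0, 2}" "{0::nat, 1} \<noteq> {1, 2}" "{0::nat, 2} \<noteq> {1, 2}"
      by (simp_all add: doubleton_eq_iff)
    then show ?thesis by simp
  qed
  also have "T {0, 1} = \<phi> [x, y] * \<psi> [z]"
  proof -
    have "{(i::nat, j). i \<in> {0, 1} \<and> j \<notin> {0, 1} \<and> j < i} = {}" by auto
    then show ?thesis unfolding T_def by (simp only: card.empty) (simp add: nths_Cons)
  qed
  also have "T {0, 2} = - (\<phi> [x, z] * \<psi> [y])"
  proof -
    have "{(i::nat, j). i \<in> {0, 2} \<and> j \<notin> {0, 2} \<and> j < i} = {(2, 1)}" by auto
    then have "card {(i::nat, j). i \<in> {0, 2} \<and> j \<notin> {0, 2} \<and> j < i} = 1" by (simp only:) simp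
    then show ?thesis unfolding T_def by (simp only:) (simp add: nths_Cons)
  qed
  also have "T {1, 2} = \<phi> [y, z] * \<psi> [x]"
  proof -
    have "{(i::nat, j). i \<in> {1, 2} \<and> j \<notin> {1, 2} \<and> j < i} = {(1, 0), (2, 0)}" by auto
    then have "card {(i::nat, j). i \<in> {1, 2} \<and> j \<notin> {1, 2} \<and> j < i} = 2" by (simp only:) simp
    then show ?thesis unfolding T_def by (simp only:) (simp add: nths_Cons)
  qed
  finally show ?thesis by simp
qed

lemma ce_diff_one_form: "ce_diff br \<phi> [x, y] = - \<phi> [br x y]"
  by (simp add: ce_diff_def lessThan_Suc nths_Cons)

lemma ce_diff_two_form:
  "ce_diff br \<phi> [x, y, z] = - \<phi> [br x y, z] + \<phi> [br x z, y] - \<phi> [br y z, x]"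
  by (simp add: ce_diff_def lessThan_Suc nths_Cons numeral_2_eq_2)

lemma coframe_in_alt_forms: "coframe i \<in> alt_forms 1"
  by (auto simp: alt_forms_def coframe_def length_Suc_conv linear_iff split: list.splits)

lemma nths_pair_length:
  assumes "length xs \<noteq> 2" shows "length (nths xs S) \<noteq> 1 \<or> length (nths xs (- S)) \<noteq> 1"
proof -
  have "card {i. i < length xs \<and> i \<in> S} + card {i. i < length xs \<and> i \<notin> S} = card ({i. i < length xs \<and> i \<in> S} \<union> {i. i < length xs \<and> i \<notin> S})"
    by (intro card_Un_disjoint [symmetric]) auto
  also have "{i. i < length xs \<and> i \<in> S} \<union> {i. i < length xs \<and> i \<notin> S} = {..<length xs}" by auto
  finally have "card {i. i < length xs \<and> i \<in> S} + card {i. i < length xs \<and> i \<notin> S} = length xs"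
    by simp
  then show ?thesis using assms by (auto simp: length_nths)
qed

lemma wedge_one_forms_in_alt_forms:
  assumes "\<phi> \<in> alt_forms 1" and "\<psi> \<in> alt_forms 1"
  shows "\<phi> \<^bold>\<and> \<psi> \<in> alt_forms 2"
proof -
  have z: "\<phi> xs = 0" "\<psi> xs = 0" if "length xs \<noteq> 1" for xs
    using assms that by (auto simp: alt_forms_def)
  have lin: "linear (\<lambda>v. \<phi> [v])" "linear (\<lambda>v. \<psi> [v])"
    using assms by (auto simp: alt_forms_def dest!: spec [of _ "[undefined]"])
  have "(\<phi> \<^bold>\<and> \<psi>) xs = 0" if "length xs \<noteq> 2" for xs
    unfolding wedge_def using nths_pair_length [OF that] z by (intro sum.neutral) fastforce
  moreover have "linear (\<lambda>v. (\<phi> \<^bold>\<and> \<psi>) (xs[i := v]))" if len: "length xs = 2" "i < 2" for xs i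
  proof -
    obtain x y where xs: "xs = [x, y]" using len(1) by (auto simp: numeral_2_eq_2 length_Suc_conv)
    have "i = 0 \<or> i = 1" using len(2) by auto
    then show ?thesis
      using lin by (auto simp: xs wedge_one_forms [OF assms] linear_iff algebra_simps)
  qed
  moreover have "(\<phi> \<^bold>\<and> \<psi>) xs = 0" if "length xs = 2" "\<not> distinct xs" for xs
    using that by (auto simp: numeral_2_eq_2 length_Suc_conv wedge_one_forms [OF assms])
  ultimately show ?thesis by (auto simp: alt_forms_def)
qed

lemma e2_apply: "e2 i j [x, y] = x $ i * y $ j - x $ j * y $ i"
  unfolding e2_def wedge_one_forms [OF coframe_in_alt_forms coframe_in_alt_forms]
  by (simp add: coframe_def)

lemma vector_5:
  "(vector [a, b, c, d, e] :: 'a::zero^5) $ 1 = a"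
  "(vector [a, b, c, d, e] :: 'a::zero^5) $ 2 = b"
  "(vector [a, b, c, d, e] :: 'a::zero^5) $ 3 = c"
  "(vector [a, b, c, d, e] :: 'a::zero^5) $ 4 = d"
  "(vector [a, b, c, d, e] :: 'a::zero^5) $ 5 = e"
  by (simp_all add: vector_def)

lemma ce_diff_coframe:
  assumes "\<theta>1 \<in> alt_forms 2" "\<theta>2 \<in> alt_forms 2" "\<theta>3 \<in> alt_forms 2" "\<theta>4 \<in> alt_forms 2" "\<theta>5 \<in> alt_forms 2"
  defines "br \<equiv> structure_bracket \<theta>1 \<theta>2 \<theta>3 \<theta>4 \<theta>5"
  shows "ce_diff br (coframe 1) = \<theta>1" "ce_diff br (coframe 2) = \<theta>2" "ce_diff br (coframe 3) = \<theta>3"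
    "ce_diff br (coframe 4) = \<theta>4" "ce_diff br (coframe 5) = \<theta>5"
proof -
  have *: "ce_diff br (coframe i) = \<theta>"
    if t: "\<theta> \<in> alt_forms 2" and b: "\<And>x y. br x y $ i = - \<theta> [x, y]" for i \<theta>
  proof
    fix xs
    show "ce_diff br (coframe i) xs = \<theta> xs"
    proof (cases "length xs = 2")
      case True
      then obtain x y where "xs = [x, y]" by (auto simp: numeral_2_eq_2 length_Suc_conv)
      then show ?thesis using b by (simp add: ce_diff_one_form) (simp add: coframe_def)
    next
      case False
      have "nths xs (- {i, j}) \<noteq> []" if "i < j" "j < length xs" for i j
      proof -
        have "\<exists>k<length xs. k \<noteq> i \<and> k \<noteq> j"
        proof (rule ccontr)
          assume "\<not> ?thesis"
          then have "{..<length xs} = {i, j}" using that by auto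
          then have "card {..<length xs} = card {i, j}" by simp
          then show False using that False by simp
        qed
        then have "set (nths xs (- {i, j})) \<noteq> {}" by (auto simp: set_nths)
        then show ?thesis by auto
      qed
      then have "ce_diff br (coframe i) xs = 0"
        unfolding ce_diff_def coframe_def
        by (intro sum.neutral ballI) (auto split: list.splits)
      then show ?thesis using t False by (simp add: alt_forms_def)
    qed
  qed
  show "ce_diff br (coframe 1) = \<theta>1" "ce_diff br (coframe 2) = \<theta>2" "ce_diff br (coframe 3) = \<theta>3"
    "ce_diff br (coframe 4) = \<theta>4" "ce_diff br (coframe 5) = \<theta>5"
    by (rule *; simp add: assms(1-5) br_def structure_bracket_def vector_5)+
qed

lemma dual_basis_coframe: "dual_basis coframe"
proof -
  have "\<exists>!c. \<phi> = (\<Sum>i\<in>UNIV. c i *\<^sub>F coframe i)" if p: "\<phi> \<in> alt_forms 1" for \<phi>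
  proof (rule ex1I)
    have lin: "linear (\<lambda>v. \<phi> [v])"
      using p by (auto simp: alt_forms_def dest!: spec [of _ "[undefined]"])
    have s: "(\<Sum>i\<in>UNIV. c i *\<^sub>F coframe i) xs = (\<Sum>i\<in>UNIV. c i * coframe i xs)" for c :: "5 \<Rightarrow> real" and xs
    proof -
      have "(\<Sum>i\<in>A. c i *\<^sub>F coframe i) xs = (\<Sum>i\<in>A. c i * coframe i xs)" for A
        by (induction A rule: infinite_finite_induct) (simp_all add: scale_form_def)
      then show ?thesis .
    qed
    show "\<phi> = (\<Sum>i\<in>UNIV. \<phi> [axis i 1] *\<^sub>F coframe i)"
    proof
      fix xs
      show "\<phi> xs = (\<Sum>i\<in>UNIV. \<phi> [axis i 1] *\<^sub>F coframe i) xs"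
      proof (cases "length xs = 1")
        case True
        then obtain x where x: "xs = [x]" by (auto simp: length_Suc_conv)
        have "\<phi> [x] = \<phi> [\<Sum>i\<in>UNIV. x $ i *\<^sub>R axis i 1]"
          using basis_expansion [of x] by (simp add: scalar_mult_eq_scaleR)
        also have "\<dots> = (\<Sum>i\<in>UNIV. x $ i * \<phi> [axis i 1])"
          using linear_sum [OF lin, of "\<lambda>i. x $ i *\<^sub>R axis i 1" UNIV] linear_cmul [OF lin] by simp
        finally show ?thesis unfolding s x by (simp add: coframe_def mult.commute)
      next
        case False
        then have "coframe i xs = 0" "\<phi> xs = 0" for i
          using p coframe_in_alt_forms [of i] by (auto simp: alt_forms_def)
        then show ?thesis by (simp add: s)
      qed
    qed
    fix c assume "\<phi> = (\<Sum>i\<in>UNIV. c i *\<^sub>F coframe i)"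
    then have "\<phi> [axis j 1] = (\<Sum>i\<in>UNIV. c i * coframe i [axis j 1])" for j
      by (simp only: s)
    moreover have "coframe i [axis j 1] = (if i = j then 1 else 0)" for i j
      by (simp add: coframe_def axis_def)
    ultimately have "\<phi> [axis j 1] = c j" for j
      by (simp add: if_distrib [of "(*) _"] cong: if_cong)
    then show "c = (\<lambda>i. \<phi> [axis i 1])" by auto
  qed
  then show ?thesis unfolding dual_basis_def using coframe_in_alt_forms by blast
qed

end

theory Submission
  imports Defs
begin

text \<open>A hypo structure is a coframe \<open>\<phi> 1, \<dots>, \<phi> 5\<close> for which the two-form
\<open>om1 = \<phi> 1 \<and> \<phi> 2 + \<phi> 3 \<and> \<phi> 4\<close> and the three-forms \<open>om2 \<and> \<phi> 5\<close> and \<open>om3 \<and> \<phi> 5\<close> are closed, and all this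
can be said with ordinary linear functionals and the bracket (\<open>has_hypo_structure_iff_coframe\<close>). For
each algebra of the list such a coframe is written down, so that one direction is a verification
(\<open>listed_imp_has_hypo_structure\<close>).

For the converse let \<open>e 1, \<dots>, e 5\<close> be the dual frame. The vector \<open>e 5\<close>, called the Reeb vector below,
spans the common kernel of the three two-forms. Since \<open>om1\<close> is closed and vanishes on \<open>e 5\<close>,
the adjoint action of \<open>e 5\<close> preserves \<open>om1\<close>; in particular it is traceless, so the trace form
\<open>x \<mapsto> tr (ad x)\<close>, which is closed, vanishes on \<open>e 5\<close>. The proof splits according to whether some nonzero
closed one-form vanishes on \<open>e 5\<close>.

If there is one, choose it to be the trace form unless that is zero; its kernel is then a unimodular
ideal. The group SU(2) fixes \<open>\<phi> 5\<close> and the three two-forms and acts transitively on the unit sphere of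
the span of \<open>\<phi> 1, \<dots>, \<phi> 4\<close> (\<open>rotate_hypo\<close>), so this form may be taken to be a multiple of \<open>\<phi> 4\<close>. The
equations are linear in the structure constants, and nineteen parameters remain. Inside the kernel of \<open>\<phi> 4\<close> the
vectors \<open>e 3\<close> and \<open>e 5\<close> commute and act on the plane \<open>e 1, e 2\<close> (modulo themselves) by commuting traceless
matrices; a rotation of that plane makes both matrices off-diagonal. If they are not nilpotent,
solvability and the Jacobi identity leave a few explicit algebras (\<open>listed_if_reeb_acts_invertibly\<close>,
\<open>listed_if_reeb_acts_trivially\<close>). If they are nilpotent, the algebra is filiform or has a
three-dimensional abelian ideal on which the two remaining directions act by traceless matrices
\<open>F\<close> and \<open>M\<close> (\<open>listed_semidirect3\<close>). There everything becomes linear algebra of a pair of matrices on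
three-space, constrained by one row and one column relation inherited from the hypo equations.

Otherwise the closed one-forms are the multiples of a single \<open>\<delta>\<close> with \<open>\<delta> (e 5) = 1\<close>, and all brackets
together span its kernel \<open>u\<close>. On \<open>u\<close> the form \<open>om1\<close> is symplectic and closed, and \<open>D = ad (e 5)\<close> is a
derivation in the symplectic algebra of \<open>om1\<close>, whose image together with the brackets of \<open>u\<close> spans
\<open>u\<close>. A case distinction on the dimension of \<open>[u, u]\<close> shows that \<open>u\<close> is abelian (\<open>kernel_abelian\<close>):
dimension 3 contradicts a trace identity, dimension 2 leads to a filiform algebra whose weights under
\<open>D\<close> are incompatible with \<open>om1\<close>, and dimension 1 leads to a Heisenberg algebra times a line,
which only the forms \<open>om2\<close> and \<open>om3\<close> exclude. Then the algebra is determined by the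
invertible element \<open>D\<close> of the symplectic Lie algebra in dimension four, up to scale, and the normal
forms of such elements are entries of the list (\<open>listed_abelian_kernel\<close>).\<close>

section \<open>Hypo structures in terms of linear functionals\<close>

lemma exhaust_5: fixes i :: 5 shows "i = 1 \<or> i = 2 \<or> i = 3 \<or> i = 4 \<or> i = 5"
proof (induct i)
  case (of_int z)
  then have "0 \<le> z" "z < 5" by simp_all
  then have "z = 0 \<or> z = 1 \<or> z = 2 \<or> z = 3 \<or> z = 4" by arith
  then show ?case by auto
qed

lemma forall_5: "(\<forall>i::5. P i) \<longleftrightarrow> P 1 \<and> P 2 \<and> P 3 \<and> P 4 \<and> P 5"
  by (metis exhaust_5)

lemma UNIV_5: "(UNIV :: 5 set) = {1, 2, 3, 4, 5}"
  using exhaust_5 by auto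

lemma sum_5: "sum f (UNIV :: 5 set) = f 1 + f 2 + f 3 + f 4 + f 5"
  unfolding UNIV_5 by (simp add: ac_simps)

text \<open>The exterior products of two one-forms, and (as \<open>wedge21\<close>) of a two-form with a one-form, evaluated on
vectors; the forms \<open>om1\<close>, \<open>om2\<close>, \<open>om3\<close> are those of a hypo structure with coframe \<open>\<phi>\<close>.\<close>

definition wedge11 :: "('a \<Rightarrow> real) \<Rightarrow> ('a \<Rightarrow> real) \<Rightarrow> 'a \<Rightarrow> 'a \<Rightarrow> real" where
  "wedge11 u v x y = u x * v y - u y * v x"

definition om1 :: "(5 \<Rightarrow> 'a \<Rightarrow> real) \<Rightarrow> 'a \<Rightarrow> 'a \<Rightarrow> real" where
  "om1 \<phi> x y = wedge11 (\<phi> 1) (\<phi> 2) x y + wedge11 (\<phi> 3) (\<phi> 4) x y"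
definition om2 :: "(5 \<Rightarrow> 'a \<Rightarrow> real) \<Rightarrow> 'a \<Rightarrow> 'a \<Rightarrow> real" where
  "om2 \<phi> x y = wedge11 (\<phi> 1) (\<phi> 3) x y + wedge11 (\<phi> 4) (\<phi> 2) x y"
definition om3 :: "(5 \<Rightarrow> 'a \<Rightarrow> real) \<Rightarrow> 'a \<Rightarrow> 'a \<Rightarrow> real" where
  "om3 \<phi> x y = wedge11 (\<phi> 1) (\<phi> 4) x y + wedge11 (\<phi> 2) (\<phi> 3) x y"

definition wedge21 :: "('a \<Rightarrow> 'a \<Rightarrow> real) \<Rightarrow> ('a \<Rightarrow> real) \<Rightarrow> 'a \<Rightarrow> 'a \<Rightarrow> 'a \<Rightarrow> real" where
  "wedge21 w u x y z = w x y * u z - w x z * u y + w y z * u x"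

text \<open>Vanishing of the Chevalley--Eilenberg differential, up to sign, for two-forms and three-forms.\<close>

definition closed2 :: "('a \<Rightarrow> 'a \<Rightarrow> 'a) \<Rightarrow> ('a \<Rightarrow> 'a \<Rightarrow> real) \<Rightarrow> bool" where
  "closed2 br w \<longleftrightarrow> (\<forall>x y z. w (br x y) z - w (br x z) y + w (br y z) x = 0)"

definition closed3 :: "('a \<Rightarrow> 'a \<Rightarrow> 'a) \<Rightarrow> ('a \<Rightarrow> 'a \<Rightarrow> 'a \<Rightarrow> real) \<Rightarrow> bool" where
  "closed3 br \<rho> \<longleftrightarrow> (\<forall>x y z w. \<rho> (br x y) z w - \<rho> (br x z) y w + \<rho> (br x w) y z
      + \<rho> (br y z) x w - \<rho> (br y w) x z + \<rho> (br z w) x y = 0)"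

definition linear_coframe :: "(5 \<Rightarrow> 'a::real_vector \<Rightarrow> real) \<Rightarrow> bool" where
  "linear_coframe \<phi> \<longleftrightarrow> (\<forall>i. linear (\<phi> i)) \<and> bij (\<lambda>x. \<chi> i. \<phi> i x)"

definition hypo_coframe :: "('a::real_vector \<Rightarrow> 'a \<Rightarrow> 'a) \<Rightarrow> (5 \<Rightarrow> 'a \<Rightarrow> real) \<Rightarrow> bool" where
  "hypo_coframe br \<phi> \<longleftrightarrow> linear_coframe \<phi> \<and> closed2 br (om1 \<phi>) \<and>
     closed3 br (wedge21 (om2 \<phi>) (\<phi> 5)) \<and> closed3 br (wedge21 (om3 \<phi>) (\<phi> 5))"

lemma ce_diff_three_form:
  "ce_diff br \<phi> [x, y, z, w] = - \<phi> [br x y, z, w] + \<phi> [br x z, y, w] - \<phi> [br x w, y, z]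
     - \<phi> [br y z, x, w] + \<phi> [br y w, x, z] - \<phi> [br z w, x, y]"
  by (simp add: ce_diff_def lessThan_Suc nths_Cons numeral_2_eq_2 numeral_3_eq_3)

text \<open>Passage from linear functionals to forms, which are functions of argument lists.\<close>

definition one_form :: "('a \<Rightarrow> real) \<Rightarrow> 'a form" where
  "one_form u = (\<lambda>xs. case xs of [x] \<Rightarrow> u x | _ \<Rightarrow> 0)"

lemma one_form_apply [simp]: "one_form u [x] = u x" by (simp add: one_form_def)

lemma one_form_in_alt_forms: "linear u \<Longrightarrow> one_form u \<in> alt_forms 1"
  by (auto simp: alt_forms_def one_form_def length_Suc_conv linear_iff split: list.splits)

lemma alt_forms_1_eq_one_form:
  assumes "f \<in> alt_forms 1" shows "f = one_form (\<lambda>x. f [x])" "linear (\<lambda>x. f [x])"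
proof -
  show "linear (\<lambda>x. f [x])"
    using assms by (auto simp: alt_forms_def dest!: spec [of _ "[undefined]"])
  show "f = one_form (\<lambda>x. f [x])"
    using assms by (auto simp: alt_forms_def one_form_def fun_eq_iff length_Suc_conv split: list.splits)
qed

lemma scale_sum_apply: "(\<Sum>i\<in>UNIV. c i *\<^sub>F f i) xs = (\<Sum>i\<in>UNIV. c i * f i xs)"
  for c :: "5 \<Rightarrow> real"
  by (simp add: sum_5 scale_form_def)

text \<open>A form of degree \<open>k\<close> is zero on lists of any other length, and so is its differential on lists of
length other than \<open>k + 1\<close>: removing two of the arguments and adding their bracket shortens the list
by one. Hence only the expected number of arguments has to be checked.\<close>

lemma ce_diff_eq_0I:
  assumes deg: "\<And>xs. length xs \<noteq> k \<Longrightarrow> \<phi> xs = 0" and "0 < k"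
    and "\<And>xs. length xs = Suc k \<Longrightarrow> ce_diff br \<phi> xs = 0"
  shows "ce_diff br \<phi> = 0"
proof
  fix xs
  show "ce_diff br \<phi> xs = 0 xs"
  proof (cases "length xs = Suc k")
    case False
    have "length (br (xs ! i) (xs ! j) # nths xs (- {i, j})) \<noteq> k" if "j < length xs" "i < j" for i j
    proof -
      have "{l. l < length xs \<and> l \<in> - {i, j}} = {..<length xs} - {i, j}" by auto
      then have "length (nths xs (- {i, j})) = card ({..<length xs} - {i, j})"
        by (simp add: length_nths)
      also have "\<dots> = length xs - 2" using that by (subst card_Diff_subset) auto
      finally show ?thesis using that False \<open>0 < k\<close> by auto
    qed
    then have "ce_diff br \<phi> xs = 0"
      unfolding ce_diff_def by (intro sum.neutral ballI) (simp add: deg)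
    then show ?thesis by simp
  qed (simp add: assms)
qed

text \<open>In every summand of the shuffle formula the two argument lists have lengths that add up to
\<open>length xs\<close>, so that one of the factors vanishes.\<close>

lemma wedge_length:
  assumes "\<phi> \<in> alt_forms k" "\<psi> \<in> alt_forms l" "length xs \<noteq> k + l"
  shows "(\<phi> \<^bold>\<and> \<psi>) xs = 0"
proof -
  have "length (nths xs S) \<noteq> k \<or> length (nths xs (- S)) \<noteq> l" for S
  proof -
    have "card {i. i < length xs \<and> i \<in> S} + card {i. i < length xs \<and> i \<in> - S}
        = card ({i. i < length xs \<and> i \<in> S} \<union> {i. i < length xs \<and> i \<in> - S})"
      by (intro card_Un_disjoint [symmetric]) auto
    also have "{i. i < length xs \<and> i \<in> S} \<union> {i. i < length xs \<and> i \<in> - S} = {..<length xs}" by auto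
    finally show ?thesis using assms(3) by (auto simp: length_nths)
  qed
  then have "\<phi> (nths xs S) * \<psi> (nths xs (- S)) = 0" for S
    using assms(1,2) by (auto simp: alt_forms_def)
  then show ?thesis unfolding wedge_def by (intro sum.neutral ballI) (simp add: mult.assoc)
qed

lemma alt_forms_add: "\<phi> \<in> alt_forms k \<Longrightarrow> \<psi> \<in> alt_forms k \<Longrightarrow> \<phi> + \<psi> \<in> alt_forms k"
  by (auto simp: alt_forms_def intro!: linear_compose_add)

lemma length_3: "length xs = 3 \<longleftrightarrow> (\<exists>x y z. xs = [x, y, z])"
  by (auto simp: numeral_3_eq_3 length_Suc_conv)
lemma length_4: "length xs = 4 \<longleftrightarrow> (\<exists>x y z w. xs = [x, y, z, w])"
  by (auto simp: eval_nat_numeral length_Suc_conv)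

lemma wedge_sum_apply:
  assumes "\<And>i. linear (\<phi> i)"
  shows "(one_form (\<phi> i) \<^bold>\<and> one_form (\<phi> j) + one_form (\<phi> k) \<^bold>\<and> one_form (\<phi> l)) [x, y]
    = wedge11 (\<phi> i) (\<phi> j) x y + wedge11 (\<phi> k) (\<phi> l) x y"
  using assms by (simp add: wedge11_def mult.commute
      wedge_one_forms[OF one_form_in_alt_forms one_form_in_alt_forms, of "\<phi> _" "\<phi> _"])

lemma wedge_sum_alt:
  assumes "\<And>i. linear (\<phi> i)"
  shows "one_form (\<phi> i) \<^bold>\<and> one_form (\<phi> j) + one_form (\<phi> k) \<^bold>\<and> one_form (\<phi> l) \<in> alt_forms 2"
  by (intro alt_forms_add wedge_one_forms_in_alt_forms one_form_in_alt_forms assms)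

lemma closed2_iff_ce_diff:
  assumes "w \<in> alt_forms 2" "\<And>x y. w [x, y] = W x y"
  shows "ce_diff br w = 0 \<longleftrightarrow> closed2 br W"
proof
  assume "ce_diff br w = 0"
  then have "ce_diff br w [x, y, z] = 0" for x y z by simp
  then have "- W (br x y) z + W (br x z) y - W (br y z) x = 0" for x y z
    unfolding ce_diff_two_form assms(2) .
  note * = this
  show "closed2 br W" unfolding closed2_def
  proof (intro allI)
    show "W (br x y) z - W (br x z) y + W (br y z) x = 0" for x y z
      using *[of x y z] by linarith
  qed
next
  assume *: "closed2 br W"
  show "ce_diff br w = 0"
  proof (rule ce_diff_eq_0I)
    show "length xs \<noteq> 2 \<Longrightarrow> w xs = 0" for xs using assms(1) by (auto simp: alt_forms_def)
    fix xs :: "'a list" assume "length xs = Suc 2"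
    then obtain x y z where "xs = [x, y, z]" using length_3[of xs] by auto
    moreover have "W (br x y) z - W (br x z) y + W (br y z) x = 0"
      using * unfolding closed2_def by blast
    ultimately show "ce_diff br w xs = 0"
      by (simp add: ce_diff_two_form assms(2))
  qed simp
qed

lemma closed3_iff_ce_diff:
  assumes "w \<in> alt_forms 2" "\<And>x y. w [x, y] = W x y" "linear u"
  shows "ce_diff br (w \<^bold>\<and> one_form u) = 0 \<longleftrightarrow> closed3 br (wedge21 W u)"
proof -
  have v: "(w \<^bold>\<and> one_form u) [x, y, z] = wedge21 W u x y z" for x y z
    using wedge_two_one_forms[OF assms(1) one_form_in_alt_forms[OF assms(3)]] by (simp add: assms wedge21_def)
  show ?thesis
  proof
    assume "ce_diff br (w \<^bold>\<and> one_form u) = 0"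
    then have "ce_diff br (w \<^bold>\<and> one_form u) [x, y, z, t] = 0" for x y z t by simp
    note * = this[unfolded ce_diff_three_form v]
    show "closed3 br (wedge21 W u)" unfolding closed3_def
    proof (intro allI)
      fix x y z t
      show "wedge21 W u (br x y) z t - wedge21 W u (br x z) y t + wedge21 W u (br x t) y z
        + wedge21 W u (br y z) x t - wedge21 W u (br y t) x z + wedge21 W u (br z t) x y = 0"
        using *[of x y z t] by linarith
    qed
  next
    assume *: "closed3 br (wedge21 W u)"
    show "ce_diff br (w \<^bold>\<and> one_form u) = 0"
    proof (rule ce_diff_eq_0I)
      show "length xs \<noteq> 3 \<Longrightarrow> (w \<^bold>\<and> one_form u) xs = 0" for xs
        using wedge_length[OF assms(1) one_form_in_alt_forms[OF assms(3)], of xs] by simp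
      fix xs :: "'a list" assume "length xs = Suc 3"
      then obtain x y z t where "xs = [x, y, z, t]" using length_4[of xs] by auto
      moreover have "wedge21 W u (br x y) z t - wedge21 W u (br x z) y t + wedge21 W u (br x t) y z
        + wedge21 W u (br y z) x t - wedge21 W u (br y t) x z + wedge21 W u (br z t) x y = 0"
        using * unfolding closed3_def by blast
      ultimately show "ce_diff br (w \<^bold>\<and> one_form u) xs = 0"
        by (simp only: ce_diff_three_form v)
    qed simp
  qed
qed

text \<open>An injective linear map into \<open>real^5\<close> from a space of dimension five is onto. The given space has no
topology, so the dimension count is made with bases.\<close>

lemma linear_coframeI:
  fixes \<phi> :: "5 \<Rightarrow> 'a::real_vector \<Rightarrow> real"
  assumes dim: "dim (UNIV :: 'a set) = 5" and lin: "\<And>i. linear (\<phi> i)"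
    and ker: "\<And>x. (\<And>i. \<phi> i x = 0) \<Longrightarrow> x = 0"
  shows "linear_coframe \<phi>"
proof -
  let ?L = "\<lambda>x. \<chi> i. \<phi> i x"
  have L: "linear ?L" using lin by (auto simp: linear_iff vec_eq_iff)
  have inj: "inj ?L"
    unfolding linear_injective_0[OF L] using ker by (auto simp: vec_eq_iff)
  have "surj ?L"
  proof -
    obtain B :: "'a set" where B: "independent B" "span B = UNIV"
      by (metis basis_exists[of UNIV] top.extremum_unique)
    have "card B = 5" using dim B by (metis dim_eq_card dim_span span_UNIV)
    moreover have "card (?L ` B) = card B"
      using inj by (intro card_image) (auto intro: inj_on_subset)
    moreover have "independent (?L ` B)"
      using linear_independent_injective_image[OF L B(1)] inj B(2) by simp
    ultimately have "5 \<le> dim (range ?L)"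
      using independent_card_le_dim[of "?L ` B" "range ?L"] by auto
    moreover have "dim (range ?L) \<le> 5"
      using dim_subset_UNIV[of "range ?L"] by simp
    ultimately have "dim (range ?L) = DIM(real^5)" by simp
    then show ?thesis using L
      by (metis dim_eq_full linear_subspace_image span_eq_iff subspace_UNIV)
  qed
  then show ?thesis using inj lin by (simp add: linear_coframe_def bij_def)
qed

lemma dual_vectors:
  fixes \<phi> :: "5 \<Rightarrow> 'a::real_vector \<Rightarrow> real"
  assumes "linear_coframe \<phi>"
  obtains e :: "5 \<Rightarrow> 'a" where "\<And>i j. \<phi> j (e i) = (if i = j then 1 else 0)"
    "\<And>x. x = (\<Sum>i\<in>UNIV. \<phi> i x *\<^sub>R e i)"
proof -
  let ?L = "\<lambda>x. \<chi> i. \<phi> i x"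
  have bij: "bij ?L" and lin: "\<And>i. linear (\<phi> i)" using assms by (simp_all add: linear_coframe_def)
  define e where "e i = inv ?L (axis i 1)" for i
  have e: "\<phi> j (e i) = (if i = j then 1 else 0)" for i j
  proof -
    have "?L (e i) = axis i 1"
      unfolding e_def using surj_f_inv_f[OF bij_is_surj[OF bij], of "axis i 1"] .
    then have "?L (e i) $ j = axis i 1 $ j" by simp
    then show ?thesis by (simp add: axis_def)
  qed
  have "x = (\<Sum>i\<in>UNIV. \<phi> i x *\<^sub>R e i)" for x
  proof -
    have "?L x = ?L (\<Sum>i\<in>UNIV. \<phi> i x *\<^sub>R e i)"
      by (simp add: vec_eq_iff linear_sum[OF lin] linear_cmul[OF lin] e if_distrib sum.delta cong: if_cong)
    then show ?thesis using bij by (meson bij_is_inj injD)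
  qed
  with e show ?thesis by (rule that)
qed

text \<open>If a vector is annihilated by all the functionals, then so is every linear functional at this vector,
which forces it to be zero; conversely the values on the dual frame are the coefficients.\<close>

lemma dual_basis_one_form_iff:
  fixes \<phi> :: "5 \<Rightarrow> 'a::real_vector \<Rightarrow> real"
  assumes lin: "\<And>i. linear (\<phi> i)" and dim: "dim (UNIV :: 'a set) = 5"
  shows "dual_basis (\<lambda>i. one_form (\<phi> i)) \<longleftrightarrow> linear_coframe \<phi>"
proof
  assume db: "dual_basis (\<lambda>i. one_form (\<phi> i))"
  show "linear_coframe \<phi>"
  proof (rule linear_coframeI[OF dim lin], rule ccontr)
    fix x :: 'a assume z: "\<And>i. \<phi> i x = 0" and "x \<noteq> 0"
    then have "independent {x}" by simp
    then obtain g :: "'a \<Rightarrow> real" where g: "linear g" "g x = 1"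
      using linear_independent_extend[of "{x}" "\<lambda>_. 1"] by auto
    obtain c where "one_form g = (\<Sum>i\<in>UNIV. c i *\<^sub>F one_form (\<phi> i))"
      using db one_form_in_alt_forms[OF g(1)] unfolding dual_basis_def by blast
    then have "one_form g [x] = (\<Sum>i\<in>UNIV. c i *\<^sub>F one_form (\<phi> i)) [x]" by simp
    then have "g x = (\<Sum>i\<in>UNIV. c i * \<phi> i x)" by (simp add: scale_sum_apply)
    then show False using z g by simp
  qed
next
  assume "linear_coframe \<phi>"
  then obtain e :: "5 \<Rightarrow> 'a" where e: "\<And>i j. \<phi> j (e i) = (if i = j then 1 else 0)"
    and dec: "\<And>x. x = (\<Sum>i\<in>UNIV. \<phi> i x *\<^sub>R e i)" by (rule dual_vectors) blast
    show "dual_basis (\<lambda>i. one_form (\<phi> i))"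
      unfolding dual_basis_def
    proof (intro conjI allI ballI)
      show "one_form (\<phi> i) \<in> alt_forms 1" for i by (rule one_form_in_alt_forms[OF lin])
      fix \<psi> :: "'a form" assume p: "\<psi> \<in> alt_forms 1"
      note q = alt_forms_1_eq_one_form[OF p]
      show "\<exists>!c::5 \<Rightarrow> real. \<psi> = (\<Sum>i\<in>UNIV. c i *\<^sub>F one_form (\<phi> i))"
      proof (rule ex1I)
        show "\<psi> = (\<Sum>i\<in>UNIV. \<psi> [e i] *\<^sub>F one_form (\<phi> i))"
        proof
          fix xs
          show "\<psi> xs = (\<Sum>i\<in>UNIV. \<psi> [e i] *\<^sub>F one_form (\<phi> i)) xs"
          proof (cases "length xs = 1")
            case True
            then obtain x where x: "xs = [x]" by (auto simp: length_Suc_conv)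
            have "\<psi> [x] = \<psi> [\<Sum>i\<in>UNIV. \<phi> i x *\<^sub>R e i]" using dec[of x] by simp
            also have "\<dots> = (\<Sum>i\<in>UNIV. \<phi> i x * \<psi> [e i])"
              by (simp add: linear_sum[OF q(2)] linear_cmul[OF q(2)])
            finally show ?thesis by (simp add: x scale_sum_apply mult.commute)
          next
            case False
            then have "\<psi> xs = 0" "one_form (\<phi> i) xs = 0" for i
              using p one_form_in_alt_forms[OF lin] by (auto simp: alt_forms_def)
            then show ?thesis by (simp add: scale_sum_apply)
          qed
        qed
        fix c assume "\<psi> = (\<Sum>i\<in>UNIV. c i *\<^sub>F one_form (\<phi> i))"
        then have "\<psi> [e j] = (\<Sum>i\<in>UNIV. c i * \<phi> i (e j))" for j by (simp add: scale_sum_apply)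
        then show "c = (\<lambda>i. \<psi> [e i])" by (simp add: e if_distrib sum.delta cong: if_cong)
      qed
    qed
qed

lemma hypo_equations_iff:
  assumes lin: "\<And>i. linear (\<phi> i)"
  shows "ce_diff br (one_form (\<phi> 1) \<^bold>\<and> one_form (\<phi> 2) + one_form (\<phi> 3) \<^bold>\<and> one_form (\<phi> 4)) = 0
      \<longleftrightarrow> closed2 br (om1 \<phi>)"
    and "ce_diff br ((one_form (\<phi> 1) \<^bold>\<and> one_form (\<phi> 3) + one_form (\<phi> 4) \<^bold>\<and> one_form (\<phi> 2)) \<^bold>\<and> one_form (\<phi> 5)) = 0
      \<longleftrightarrow> closed3 br (wedge21 (om2 \<phi>) (\<phi> 5))"
    and "ce_diff br ((one_form (\<phi> 1) \<^bold>\<and> one_form (\<phi> 4) + one_form (\<phi> 2) \<^bold>\<and> one_form (\<phi> 3)) \<^bold>\<and> one_form (\<phi> 5)) = 0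
      \<longleftrightarrow> closed3 br (wedge21 (om3 \<phi>) (\<phi> 5))"
  by (rule closed2_iff_ce_diff closed3_iff_ce_diff, rule wedge_sum_alt[of \<phi>, OF lin],
      simp only: wedge_sum_apply[of \<phi>, OF lin] om1_def om2_def om3_def, (rule lin)?)+

theorem has_hypo_structure_iff_coframe:
  fixes br :: "'a::real_vector \<Rightarrow> 'a \<Rightarrow> 'a"
  assumes dim: "dim (UNIV :: 'a set) = 5"
  shows "has_hypo_structure br \<longleftrightarrow> (\<exists>\<phi>. hypo_coframe br \<phi>)"
proof
  assume "has_hypo_structure br"
  then obtain \<alpha> \<omega>1 \<omega>2 \<omega>3 f where h: "dual_basis f" "\<alpha> = f 5" "\<omega>1 = f 1 \<^bold>\<and> f 2 + f 3 \<^bold>\<and> f 4"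
    "\<omega>2 = f 1 \<^bold>\<and> f 3 + f 4 \<^bold>\<and> f 2" "\<omega>3 = f 1 \<^bold>\<and> f 4 + f 2 \<^bold>\<and> f 3"
    "ce_diff br \<omega>1 = 0" "ce_diff br (\<omega>2 \<^bold>\<and> \<alpha>) = 0" "ce_diff br (\<omega>3 \<^bold>\<and> \<alpha>) = 0"
    unfolding has_hypo_structure_def hypo_structure_def by blast
  define \<phi> where "\<phi> i x = f i [x]" for i x
  have a1: "f i \<in> alt_forms 1" for i using h(1) unfolding dual_basis_def by blast
  have lin: "linear (\<phi> i)" for i
    unfolding \<phi>_def by (rule alt_forms_1_eq_one_form(2)[OF a1])
  have f: "f = (\<lambda>i. one_form (\<phi> i))"
    using alt_forms_1_eq_one_form(1)[OF a1] unfolding \<phi>_def by (rule ext)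
  have "hypo_coframe br \<phi>"
    unfolding hypo_coframe_def
  proof (intro conjI)
    show "linear_coframe \<phi>" using h(1) dual_basis_one_form_iff[of \<phi>, OF lin dim] unfolding f by simp
    show "closed2 br (om1 \<phi>)" "closed3 br (wedge21 (om2 \<phi>) (\<phi> 5))" "closed3 br (wedge21 (om3 \<phi>) (\<phi> 5))"
      using h(6-8) unfolding h(2-5) f hypo_equations_iff[of \<phi>, OF lin] .
  qed
  then show "\<exists>\<phi>. hypo_coframe br \<phi>" by blast
next
  assume "\<exists>\<phi>. hypo_coframe br \<phi>"
  then obtain \<phi> where h: "hypo_coframe br \<phi>" ..
  then have lin: "linear (\<phi> i)" for i by (auto simp: hypo_coframe_def linear_coframe_def)
  define f where "f i = one_form (\<phi> i)" for i
  have "dual_basis f" using h dual_basis_one_form_iff[of \<phi>, OF lin dim] unfolding f_def hypo_coframe_def by simp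
  moreover have "ce_diff br (f 1 \<^bold>\<and> f 2 + f 3 \<^bold>\<and> f 4) = 0"
    "ce_diff br ((f 1 \<^bold>\<and> f 3 + f 4 \<^bold>\<and> f 2) \<^bold>\<and> f 5) = 0"
    "ce_diff br ((f 1 \<^bold>\<and> f 4 + f 2 \<^bold>\<and> f 3) \<^bold>\<and> f 5) = 0"
    using h unfolding f_def hypo_equations_iff[of \<phi>, OF lin] hypo_coframe_def by simp_all
  moreover have "f 5 \<in> alt_forms 1" unfolding f_def by (rule one_form_in_alt_forms[OF lin])
  ultimately show "has_hypo_structure br"
    unfolding has_hypo_structure_def hypo_structure_def using wedge_sum_alt[of \<phi>, OF lin]
    unfolding f_def by blast
qed

section \<open>The listed algebras carry hypo structures\<close>

lemma lie_isomorphic_sym: "br \<simeq>\<^sub>L br' \<Longrightarrow> br' \<simeq>\<^sub>L br"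
proof -
  assume "br \<simeq>\<^sub>L br'"
  then obtain f where f: "linear f" "bij f" "\<And>x y. f (br x y) = br' (f x) (f y)"
    unfolding lie_isomorphic_def by blast
  have inv: "f (inv f y) = y" "inv f (f x) = x" for x y
    using f(2) by (simp_all add: bij_is_surj surj_f_inv_f bij_is_inj inv_f_f)
  have "linear (inv f)"
  proof (rule linearI)
    fix x y c
    have "f (inv f x + inv f y) = x + y" "f (c *\<^sub>R inv f x) = c *\<^sub>R x"
      by (simp_all add: linear_add[OF f(1)] linear_cmul[OF f(1)] inv)
    then show "inv f (x + y) = inv f x + inv f y" "inv f (c *\<^sub>R x) = c *\<^sub>R inv f x"
      by (metis inv(2))+
  qed
  moreover have "inv f (br' x y) = br (inv f x) (inv f y)" for x y
    using inv(2)[of "br (inv f x) (inv f y)"] by (simp add: f(3) inv(1))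
  ultimately show ?thesis
    unfolding lie_isomorphic_def using bij_imp_bij_inv[OF f(2)] by blast
qed

text \<open>Isomorphisms pull back all the structure; this reduces the existence question for a listed algebra
to its model on \<open>real^5\<close>.\<close>

lemma hypo_coframe_pullback:
  assumes "br \<simeq>\<^sub>L br'" and h: "hypo_coframe br' \<phi>"
  shows "\<exists>\<phi>. hypo_coframe br \<phi>"
proof -
  obtain f where f: "linear f" "bij f" "\<And>x y. f (br x y) = br' (f x) (f y)"
    using assms(1) unfolding lie_isomorphic_def by blast
  have "hypo_coframe br (\<lambda>i x. \<phi> i (f x))"
    unfolding hypo_coframe_def
  proof (intro conjI)
    have "bij ((\<lambda>x. \<chi> i. \<phi> i x) \<circ> f)"
      using h f(2) by (intro bij_comp) (auto simp: hypo_coframe_def linear_coframe_def)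
    then show "linear_coframe (\<lambda>i x. \<phi> i (f x))"
      using h linear_compose[OF f(1), of "\<phi> _"]
      by (auto simp: hypo_coframe_def linear_coframe_def comp_def)
    show "closed2 br (om1 (\<lambda>i x. \<phi> i (f x)))"
      using h by (simp add: hypo_coframe_def closed2_def om1_def wedge11_def f(3))
    show "closed3 br (wedge21 (om2 (\<lambda>i x. \<phi> i (f x))) (\<lambda>x. \<phi> 5 (f x)))"
      using h by (simp add: hypo_coframe_def closed3_def wedge21_def om2_def wedge11_def f(3))
    show "closed3 br (wedge21 (om3 (\<lambda>i x. \<phi> i (f x))) (\<lambda>x. \<phi> 5 (f x)))"
      using h by (simp add: hypo_coframe_def closed3_def wedge21_def om3_def wedge11_def f(3))
  qed
  then show ?thesis by blast
qed

text \<open>Coframes given by listing the functionals; indices are numerals of the type \<open>5\<close>, in which \<open>5 = 0\<close>.\<close>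

definition coframe_of :: "('a \<Rightarrow> real) \<Rightarrow> ('a \<Rightarrow> real) \<Rightarrow> ('a \<Rightarrow> real) \<Rightarrow> ('a \<Rightarrow> real) \<Rightarrow> ('a \<Rightarrow> real) \<Rightarrow>
    5 \<Rightarrow> 'a \<Rightarrow> real" where
  "coframe_of a b c d e = (\<lambda>i x. vector [a x, b x, c x, d x, e x] $ i)"

lemma coframe_of_simps [simp]:
  "coframe_of a b c d e 1 = a" "coframe_of a b c d e 2 = b" "coframe_of a b c d e 3 = c"
  "coframe_of a b c d e 4 = d" "coframe_of a b c d e 5 = e"
  by (auto simp: coframe_of_def vector_5)

lemma structure_bracket_component:
  "structure_bracket \<theta>1 \<theta>2 \<theta>3 \<theta>4 \<theta>5 x y $ 1 = - \<theta>1 [x, y]"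
  "structure_bracket \<theta>1 \<theta>2 \<theta>3 \<theta>4 \<theta>5 x y $ 2 = - \<theta>2 [x, y]"
  "structure_bracket \<theta>1 \<theta>2 \<theta>3 \<theta>4 \<theta>5 x y $ 3 = - \<theta>3 [x, y]"
  "structure_bracket \<theta>1 \<theta>2 \<theta>3 \<theta>4 \<theta>5 x y $ 4 = - \<theta>4 [x, y]"
  "structure_bracket \<theta>1 \<theta>2 \<theta>3 \<theta>4 \<theta>5 x y $ 5 = - \<theta>5 [x, y]"
  by (simp_all add: structure_bracket_def vector_5)

lemma scale_form_apply: "(c *\<^sub>F \<phi>) xs = c * \<phi> xs" by (simp add: scale_form_def)

text \<open>The obligations that remain when the five functionals are written down: they have no common zero,
and the closedness equations hold as polynomial identities in the coordinates. The two lists of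
functionals below are in the order \<open>\<phi> 1, \<dots>, \<phi> 5\<close>.\<close>

lemma has_hypo_structureI:
  fixes br :: "'a::real_vector \<Rightarrow> 'a \<Rightarrow> 'a" and br' :: "real^5 \<Rightarrow> real^5 \<Rightarrow> real^5"
  assumes "dim (UNIV :: 'a set) = 5" and "br \<simeq>\<^sub>L br'"
    and "linear a" "linear b" "linear c" "linear d" "linear e"
    and "\<And>x. a x = 0 \<Longrightarrow> b x = 0 \<Longrightarrow> c x = 0 \<Longrightarrow> d x = 0 \<Longrightarrow> e x = 0 \<Longrightarrow> x = 0"
    and "\<And>x y z. om1 (coframe_of a b c d e) (br' x y) z - om1 (coframe_of a b c d e) (br' x z) y
          + om1 (coframe_of a b c d e) (br' y z) x = 0"
    and "closed3 br' (wedge21 (om2 (coframe_of a b c d e)) e)"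
    and "closed3 br' (wedge21 (om3 (coframe_of a b c d e)) e)"
  shows "has_hypo_structure br"
proof -
  have "linear (coframe_of a b c d e i)" for i
    using exhaust_5[of i] assms(3-7) by auto
  moreover have "x = 0" if z: "\<And>i. coframe_of a b c d e i x = 0" for x
    using assms(8) z[of 1] z[of 2] z[of 3] z[of 4] z[of 5] by simp
  ultimately have "linear_coframe (coframe_of a b c d e)" by (intro linear_coframeI) simp_all
  then have "hypo_coframe br' (coframe_of a b c d e)"
    using assms(9-11) by (simp add: hypo_coframe_def closed2_def)
  then show ?thesis
    using hypo_coframe_pullback[OF assms(2)] has_hypo_structure_iff_coframe[OF assms(1)] by blast
qed

named_theorems hypo_eval
lemmas [hypo_eval] = closed3_def wedge21_def om1_def om2_def om3_def wedge11_def structure_bracket_component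
   scale_form_apply e2_apply

context
  fixes br :: "'a::real_vector \<Rightarrow> 'a \<Rightarrow> 'a"
  assumes dim: "dim (UNIV :: 'a set) = 5"
begin
lemma has_hypo_A1:
  assumes "br \<simeq>\<^sub>L structure_bracket (e2 2 4 + e2 3 5) 0 0 0 0"
  shows "has_hypo_structure br"
  by (rule has_hypo_structureI[OF dim assms, of
        "\<lambda>x. x $ 2" "\<lambda>x. x $ 3" "\<lambda>x. x $ 4" "\<lambda>x. x $ 5" "\<lambda>x. x $ 1"];
      ((simp add: linear_iff algebra_simps add_divide_distrib; fail) | (simp add: vec_eq_iff forall_5; fail)
       | (simp add: hypo_eval; fail) | (simp add: hypo_eval, (intro allI)?, algebra)))

lemma has_hypo_A2:
  assumes "br \<simeq>\<^sub>L structure_bracket (e2 3 4 + e2 2 5) (e2 3 5) 0 0 0"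
  shows "has_hypo_structure br"
  by (rule has_hypo_structureI[OF dim assms, of
        "\<lambda>x. -x $ 4" "\<lambda>x. x $ 2" "\<lambda>x. x $ 1" "\<lambda>x. x $ 5" "\<lambda>x. x $ 3 - x $ 1"];
      ((simp add: linear_iff algebra_simps add_divide_distrib; fail) | (simp add: vec_eq_iff forall_5; fail)
       | (simp add: hypo_eval; fail) | (simp add: hypo_eval, (intro allI)?, algebra)))

lemma has_hypo_A3:
  assumes "br \<simeq>\<^sub>L structure_bracket (- (1/2) *\<^sub>F e2 1 5 - e2 2 3) (- e2 2 5) ((1/2) *\<^sub>F e2 3 5) ((3/2) *\<^sub>F e2 4 5) 0"
  shows "has_hypo_structure br"
  by (rule has_hypo_structureI[OF dim assms, of
        "\<lambda>x. 4*x $ 1" "\<lambda>x. 2*x $ 3" "\<lambda>x. 2*x $ 2" "\<lambda>x. x $ 5" "\<lambda>x. 2*x $ 4"];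
      ((simp add: linear_iff algebra_simps add_divide_distrib; fail) | (simp add: vec_eq_iff forall_5; fail)
       | (simp add: hypo_eval; fail) | (simp add: hypo_eval field_simps)))

lemma has_hypo_A4:
  assumes "br \<simeq>\<^sub>L structure_bracket (- e2 2 3 - 2 *\<^sub>F e2 1 5) (- e2 2 5) (- e2 3 5) (3 *\<^sub>F e2 4 5) 0"
  shows "has_hypo_structure br"
  by (rule has_hypo_structureI[OF dim assms, of
        "\<lambda>x. x $ 2" "\<lambda>x. x $ 3" "\<lambda>x. -2*x $ 1" "\<lambda>x. -x $ 5" "\<lambda>x. x $ 4"];
      ((simp add: linear_iff algebra_simps add_divide_distrib; fail) | (simp add: vec_eq_iff forall_5; fail)
       | (simp add: hypo_eval; fail) | (simp add: hypo_eval, (intro allI)?, algebra)))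

lemma has_hypo_A5:
  assumes "br \<simeq>\<^sub>L structure_bracket (e2 1 5 - e2 2 3) (- e2 2 5) (2 *\<^sub>F e2 3 5) (- 3 *\<^sub>F e2 4 5) 0"
  shows "has_hypo_structure br"
  by (rule has_hypo_structureI[OF dim assms, of
        "\<lambda>x. -2*x $ 1" "\<lambda>x. x $ 2" "\<lambda>x. x $ 3" "\<lambda>x. -x $ 5" "\<lambda>x. x $ 4"];
      ((simp add: linear_iff algebra_simps add_divide_distrib; fail) | (simp add: vec_eq_iff forall_5; fail)
       | (simp add: hypo_eval; fail) | (simp add: hypo_eval, (intro allI)?, algebra)))

lemma has_hypo_A6:
  assumes "br \<simeq>\<^sub>L structure_bracket (- e2 1 5 - e2 2 4) (- e2 3 4) (e2 3 5) (- e2 4 5) 0"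
  shows "has_hypo_structure br"
  by (rule has_hypo_structureI[OF dim assms, of
        "\<lambda>x. -x $ 2" "\<lambda>x. x $ 4" "\<lambda>x. x $ 1" "\<lambda>x. -x $ 5" "\<lambda>x. x $ 1+x $ 3"];
      ((simp add: linear_iff algebra_simps add_divide_distrib; fail) | (simp add: vec_eq_iff forall_5; fail)
       | (simp add: hypo_eval; fail) | (simp add: hypo_eval, (intro allI)?, algebra)))

lemma has_hypo_A7:
  assumes "br \<simeq>\<^sub>L structure_bracket (- e2 1 4) (- e2 2 5) (e2 3 4 + e2 3 5) 0 0"
  shows "has_hypo_structure br"
  by (rule has_hypo_structureI[OF dim assms, of
        "\<lambda>x. x $ 1" "\<lambda>x. x $ 4" "\<lambda>x. x $ 2" "\<lambda>x. x $ 5" "\<lambda>x. x $ 3"];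
      ((simp add: linear_iff algebra_simps add_divide_distrib; fail) | (simp add: vec_eq_iff forall_5; fail)
       | (simp add: hypo_eval; fail) | (simp add: hypo_eval, (intro allI)?, algebra)))

lemma has_hypo_A8:
  assumes "br \<simeq>\<^sub>L structure_bracket (2 *\<^sub>F e2 1 4) (- e2 2 4 - e2 3 5) (e2 2 5 - e2 3 4) 0 0"
  shows "has_hypo_structure br"
  by (rule has_hypo_structureI[OF dim assms, of
        "\<lambda>x. -x $ 3" "\<lambda>x. x $ 5" "\<lambda>x. 2*x $ 1-x $ 2" "\<lambda>x. x $ 4" "\<lambda>x. x $ 2-x $ 1"];
      ((simp add: linear_iff algebra_simps add_divide_distrib; fail) | (simp add: vec_eq_iff forall_5; fail)
       | (simp add: hypo_eval; fail) | (simp add: hypo_eval, (intro allI)?, algebra)))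

lemma has_hypo_A9:
  assumes "br \<simeq>\<^sub>L structure_bracket (e2 2 3 + 2 *\<^sub>F e2 1 4) (e2 2 4 + e2 3 5) (e2 3 4 - e2 2 5) 0 0"
  shows "has_hypo_structure br"
  by (rule has_hypo_structureI[OF dim assms, of
        "\<lambda>x. x $ 2" "\<lambda>x. x $ 3" "\<lambda>x. 2*x $ 1" "\<lambda>x. x $ 4" "\<lambda>x. x $ 5-6*x $ 1"];
      ((simp add: linear_iff algebra_simps add_divide_distrib; fail) | (simp add: vec_eq_iff forall_5; fail)
       | (simp add: hypo_eval; fail) | (simp add: hypo_eval, (intro allI)?, algebra)))

lemma has_hypo_B1:
  assumes "br \<simeq>\<^sub>L structure_bracket (e2 3 5) (e2 4 5) 0 0 0"
  shows "has_hypo_structure br"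
  by (rule has_hypo_structureI[OF dim assms, of
        "\<lambda>x. x $ 1" "\<lambda>x. x $ 4" "\<lambda>x. x $ 2" "\<lambda>x. x $ 3" "\<lambda>x. x $ 5"];
      ((simp add: linear_iff algebra_simps add_divide_distrib; fail) | (simp add: vec_eq_iff forall_5; fail)
       | (simp add: hypo_eval; fail) | (simp add: hypo_eval, (intro allI)?, algebra)))

lemma has_hypo_B2:
  assumes "br \<simeq>\<^sub>L structure_bracket (e2 2 5) (e2 3 5) (e2 4 5) 0 0"
  shows "has_hypo_structure br"
  by (rule has_hypo_structureI[OF dim assms, of
        "\<lambda>x. x $ 1" "\<lambda>x. x $ 4" "\<lambda>x. x $ 3" "\<lambda>x. x $ 2" "\<lambda>x. x $ 5"];
      ((simp add: linear_iff algebra_simps add_divide_distrib; fail) | (simp add: vec_eq_iff forall_5; fail)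
       | (simp add: hypo_eval; fail) | (simp add: hypo_eval, (intro allI)?, algebra)))

lemma has_hypo_B3:
  assumes "br \<simeq>\<^sub>L structure_bracket (e2 1 5) (p *\<^sub>F e2 2 5) (- p *\<^sub>F e2 3 5) (- e2 4 5) 0"
  shows "has_hypo_structure br"
  by (rule has_hypo_structureI[OF dim assms, of
        "\<lambda>x. x $ 1" "\<lambda>x. x $ 4" "\<lambda>x. x $ 2" "\<lambda>x. x $ 3" "\<lambda>x. x $ 5"];
      ((simp add: linear_iff algebra_simps add_divide_distrib; fail) | (simp add: vec_eq_iff forall_5; fail)
       | (simp add: hypo_eval; fail) | (simp add: hypo_eval, (intro allI)?, algebra)))

lemma has_hypo_B4:
  assumes "br \<simeq>\<^sub>L structure_bracket (e2 2 5) 0 (e2 3 5) (- e2 4 5) 0"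
  shows "has_hypo_structure br"
  by (rule has_hypo_structureI[OF dim assms, of
        "\<lambda>x. x $ 1" "\<lambda>x. x $ 2" "\<lambda>x. x $ 3" "\<lambda>x. x $ 4" "\<lambda>x. x $ 5"];
      ((simp add: linear_iff algebra_simps add_divide_distrib; fail) | (simp add: vec_eq_iff forall_5; fail)
       | (simp add: hypo_eval; fail) | (simp add: hypo_eval, (intro allI)?, algebra)))

lemma has_hypo_B5:
  assumes "br \<simeq>\<^sub>L structure_bracket (e2 1 5) (- e2 2 5) (r *\<^sub>F e2 4 5) (- r *\<^sub>F e2 3 5) 0"
  shows "has_hypo_structure br"
  by (rule has_hypo_structureI[OF dim assms, of
        "\<lambda>x. x $ 1" "\<lambda>x. x $ 2" "\<lambda>x. x $ 3" "\<lambda>x. x $ 4" "\<lambda>x. x $ 5"];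
      ((simp add: linear_iff algebra_simps add_divide_distrib; fail) | (simp add: vec_eq_iff forall_5; fail)
       | (simp add: hypo_eval; fail) | (simp add: hypo_eval, (intro allI)?, algebra)))

lemma has_hypo_B6:
  assumes "br \<simeq>\<^sub>L structure_bracket (e2 2 5) 0 (e2 4 5) (- e2 3 5) 0"
  shows "has_hypo_structure br"
  by (rule has_hypo_structureI[OF dim assms, of
        "\<lambda>x. x $ 1" "\<lambda>x. x $ 2" "\<lambda>x. x $ 3" "\<lambda>x. x $ 4" "\<lambda>x. x $ 5"];
      ((simp add: linear_iff algebra_simps add_divide_distrib; fail) | (simp add: vec_eq_iff forall_5; fail)
       | (simp add: hypo_eval; fail) | (simp add: hypo_eval, (intro allI)?, algebra)))

lemma has_hypo_B7:
  assumes "br \<simeq>\<^sub>L structure_bracket (e2 1 5 + e2 2 5) (e2 2 5) (e2 4 5 - e2 3 5) (- e2 4 5) 0"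
  shows "has_hypo_structure br"
  by (rule has_hypo_structureI[OF dim assms, of
        "\<lambda>x. x $ 1" "\<lambda>x. x $ 4" "\<lambda>x. x $ 3" "\<lambda>x. x $ 2" "\<lambda>x. x $ 5"];
      ((simp add: linear_iff algebra_simps add_divide_distrib; fail) | (simp add: vec_eq_iff forall_5; fail)
       | (simp add: hypo_eval; fail) | (simp add: hypo_eval, (intro allI)?, algebra)))

lemma has_hypo_B8:
  assumes "br \<simeq>\<^sub>L structure_bracket (e2 2 5) (- e2 1 5) (r *\<^sub>F e2 4 5) (- r *\<^sub>F e2 3 5) 0"
  shows "has_hypo_structure br"
  by (rule has_hypo_structureI[OF dim assms, of
        "\<lambda>x. x $ 1" "\<lambda>x. x $ 2" "\<lambda>x. x $ 3" "\<lambda>x. x $ 4" "\<lambda>x. x $ 5"];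
      ((simp add: linear_iff algebra_simps add_divide_distrib; fail) | (simp add: vec_eq_iff forall_5; fail)
       | (simp add: hypo_eval; fail) | (simp add: hypo_eval, (intro allI)?, algebra)))

lemma has_hypo_B9:
  assumes "br \<simeq>\<^sub>L structure_bracket (e2 2 5 + p *\<^sub>F e2 1 5) (- e2 1 5 + p *\<^sub>F e2 2 5) (e2 4 5 - p *\<^sub>F e2 3 5) (- e2 3 5 - p *\<^sub>F e2 4 5) 0"
  shows "has_hypo_structure br"
  by (rule has_hypo_structureI[OF dim assms, of
        "\<lambda>x. x $ 1" "\<lambda>x. x $ 3" "\<lambda>x. x $ 2" "\<lambda>x. x $ 4" "\<lambda>x. x $ 5"];
      ((simp add: linear_iff algebra_simps add_divide_distrib; fail) | (simp add: vec_eq_iff forall_5; fail)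
       | (simp add: hypo_eval; fail) | (simp add: hypo_eval, (intro allI)?, algebra)))

lemma has_hypo_B10:
  assumes "br \<simeq>\<^sub>L structure_bracket (e2 2 5 + p *\<^sub>F e2 1 5) (- e2 1 5 + p *\<^sub>F e2 2 5) (- e2 4 5 - p *\<^sub>F e2 3 5) (e2 3 5 - p *\<^sub>F e2 4 5) 0"
  shows "has_hypo_structure br"
  by (rule has_hypo_structureI[OF dim assms, of
        "\<lambda>x. x $ 1" "\<lambda>x. x $ 3" "\<lambda>x. -x $ 2" "\<lambda>x. x $ 4" "\<lambda>x. x $ 5"];
      ((simp add: linear_iff algebra_simps add_divide_distrib; fail) | (simp add: vec_eq_iff forall_5; fail)
       | (simp add: hypo_eval; fail) | (simp add: hypo_eval, (intro allI)?, algebra)))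

lemma has_hypo_B11:
  assumes "br \<simeq>\<^sub>L structure_bracket (e2 3 5 + e2 2 5) (- e2 1 5 + e2 4 5) (e2 4 5) (- e2 3 5) 0"
  shows "has_hypo_structure br"
  by (rule has_hypo_structureI[OF dim assms, of
        "\<lambda>x. x $ 1" "\<lambda>x. x $ 3" "\<lambda>x. x $ 2" "\<lambda>x. x $ 4" "\<lambda>x. x $ 5"];
      ((simp add: linear_iff algebra_simps add_divide_distrib; fail) | (simp add: vec_eq_iff forall_5; fail)
       | (simp add: hypo_eval; fail) | (simp add: hypo_eval, (intro allI)?, algebra)))

lemma has_hypo_C1:
  assumes "br \<simeq>\<^sub>L structure_bracket 0 0 0 0 0"
  shows "has_hypo_structure br"
  by (rule has_hypo_structureI[OF dim assms, of
        "\<lambda>x. x $ 1" "\<lambda>x. x $ 2" "\<lambda>x. x $ 3" "\<lambda>x. x $ 4" "\<lambda>x. x $ 5"];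
      ((simp add: linear_iff algebra_simps add_divide_distrib; fail) | (simp add: vec_eq_iff forall_5; fail)
       | (simp add: hypo_eval; fail) | (simp add: hypo_eval, (intro allI)?, algebra)))

lemma has_hypo_C2:
  assumes "br \<simeq>\<^sub>L structure_bracket (e2 2 3) 0 0 0 0"
  shows "has_hypo_structure br"
  by (rule has_hypo_structureI[OF dim assms, of
        "\<lambda>x. x $ 1" "\<lambda>x. x $ 2" "\<lambda>x. x $ 4" "\<lambda>x. x $ 5" "\<lambda>x. x $ 3"];
      ((simp add: linear_iff algebra_simps add_divide_distrib; fail) | (simp add: vec_eq_iff forall_5; fail)
       | (simp add: hypo_eval; fail) | (simp add: hypo_eval, (intro allI)?, algebra)))

lemma has_hypo_C3:
  assumes "br \<simeq>\<^sub>L structure_bracket (e2 2 3) (- e2 1 3) 0 0 0"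
  shows "has_hypo_structure br"
  by (rule has_hypo_structureI[OF dim assms, of
        "\<lambda>x. x $ 1" "\<lambda>x. x $ 2" "\<lambda>x. x $ 4" "\<lambda>x. x $ 5" "\<lambda>x. x $ 3"];
      ((simp add: linear_iff algebra_simps add_divide_distrib; fail) | (simp add: vec_eq_iff forall_5; fail)
       | (simp add: hypo_eval; fail) | (simp add: hypo_eval, (intro allI)?, algebra)))

lemma has_hypo_C4:
  assumes "br \<simeq>\<^sub>L structure_bracket (e2 1 3) (- e2 2 3) 0 0 0"
  shows "has_hypo_structure br"
  by (rule has_hypo_structureI[OF dim assms, of
        "\<lambda>x. x $ 1" "\<lambda>x. x $ 2" "\<lambda>x. x $ 4" "\<lambda>x. x $ 5" "\<lambda>x. x $ 3"];
      ((simp add: linear_iff algebra_simps add_divide_distrib; fail) | (simp add: vec_eq_iff forall_5; fail)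
       | (simp add: hypo_eval; fail) | (simp add: hypo_eval, (intro allI)?, algebra)))

lemma has_hypo_C5:
  assumes "br \<simeq>\<^sub>L structure_bracket (e2 2 3) (- e2 1 3) 0 0 (e2 4 5)"
  shows "has_hypo_structure br"
  by (rule has_hypo_structureI[OF dim assms, of
        "\<lambda>x. x $ 1" "\<lambda>x. x $ 2" "\<lambda>x. x $ 3" "\<lambda>x. -x $ 4" "\<lambda>x. x $ 5"];
      ((simp add: linear_iff algebra_simps add_divide_distrib; fail) | (simp add: vec_eq_iff forall_5; fail)
       | (simp add: hypo_eval; fail) | (simp add: hypo_eval, (intro allI)?, algebra)))

end

section \<open>Recognising the listed algebras by their bracket tables\<close>

text \<open>The right-hand side of the classification, named because every branch of the converse ends in it.\<close>

definition listed :: "('a::real_vector \<Rightarrow> 'a \<Rightarrow> 'a) \<Rightarrow> bool" where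
  "listed br \<longleftrightarrow>
    br \<simeq>\<^sub>L structure_bracket (e2 2 4 + e2 3 5) 0 0 0 0 \<or>
    br \<simeq>\<^sub>L structure_bracket (e2 3 4 + e2 2 5) (e2 3 5) 0 0 0 \<or>
    br \<simeq>\<^sub>L structure_bracket (- (1/2) *\<^sub>F e2 1 5 - e2 2 3) (- e2 2 5) ((1/2) *\<^sub>F e2 3 5) ((3/2) *\<^sub>F e2 4 5) 0 \<or>
    br \<simeq>\<^sub>L structure_bracket (- e2 2 3 - 2 *\<^sub>F e2 1 5) (- e2 2 5) (- e2 3 5) (3 *\<^sub>F e2 4 5) 0 \<or>
    br \<simeq>\<^sub>L structure_bracket (e2 1 5 - e2 2 3) (- e2 2 5) (2 *\<^sub>F e2 3 5) (- 3 *\<^sub>F e2 4 5) 0 \<or>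
    br \<simeq>\<^sub>L structure_bracket (- e2 1 5 - e2 2 4) (- e2 3 4) (e2 3 5) (- e2 4 5) 0 \<or>
    br \<simeq>\<^sub>L structure_bracket (- e2 1 4) (- e2 2 5) (e2 3 4 + e2 3 5) 0 0 \<or>
    br \<simeq>\<^sub>L structure_bracket (2 *\<^sub>F e2 1 4) (- e2 2 4 - e2 3 5) (e2 2 5 - e2 3 4) 0 0 \<or>
    br \<simeq>\<^sub>L structure_bracket (e2 2 3 + 2 *\<^sub>F e2 1 4) (e2 2 4 + e2 3 5) (e2 3 4 - e2 2 5) 0 0 \<or>
    br \<simeq>\<^sub>L structure_bracket (e2 3 5) (e2 4 5) 0 0 0 \<or>
    br \<simeq>\<^sub>L structure_bracket (e2 2 5) (e2 3 5) (e2 4 5) 0 0 \<or>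
    (\<exists>p::real. p \<noteq> 0 \<and> br \<simeq>\<^sub>L structure_bracket (e2 1 5) (p *\<^sub>F e2 2 5) (- p *\<^sub>F e2 3 5) (- e2 4 5) 0) \<or>
    br \<simeq>\<^sub>L structure_bracket (e2 2 5) 0 (e2 3 5) (- e2 4 5) 0 \<or>
    (\<exists>r::real. r \<noteq> 0 \<and> br \<simeq>\<^sub>L structure_bracket (e2 1 5) (- e2 2 5) (r *\<^sub>F e2 4 5) (- r *\<^sub>F e2 3 5) 0) \<or>
    br \<simeq>\<^sub>L structure_bracket (e2 2 5) 0 (e2 4 5) (- e2 3 5) 0 \<or>
    br \<simeq>\<^sub>L structure_bracket (e2 1 5 + e2 2 5) (e2 2 5) (e2 4 5 - e2 3 5) (- e2 4 5) 0 \<or>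
    (\<exists>r::real. r \<noteq> 0 \<and> br \<simeq>\<^sub>L structure_bracket (e2 2 5) (- e2 1 5) (r *\<^sub>F e2 4 5) (- r *\<^sub>F e2 3 5) 0) \<or>
    (\<exists>p::real. br \<simeq>\<^sub>L structure_bracket (e2 2 5 + p *\<^sub>F e2 1 5) (- e2 1 5 + p *\<^sub>F e2 2 5) (e2 4 5 - p *\<^sub>F e2 3 5) (- e2 3 5 - p *\<^sub>F e2 4 5) 0) \<or>
    (\<exists>p::real. br \<simeq>\<^sub>L structure_bracket (e2 2 5 + p *\<^sub>F e2 1 5) (- e2 1 5 + p *\<^sub>F e2 2 5) (- e2 4 5 - p *\<^sub>F e2 3 5) (e2 3 5 - p *\<^sub>F e2 4 5) 0) \<or>
    br \<simeq>\<^sub>L structure_bracket (e2 3 5 + e2 2 5) (- e2 1 5 + e2 4 5) (e2 4 5) (- e2 3 5) 0 \<or>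
    br \<simeq>\<^sub>L structure_bracket 0 0 0 0 0 \<or>
    br \<simeq>\<^sub>L structure_bracket (e2 2 3) 0 0 0 0 \<or>
    br \<simeq>\<^sub>L structure_bracket (e2 2 3) (- e2 1 3) 0 0 0 \<or>
    br \<simeq>\<^sub>L structure_bracket (e2 1 3) (- e2 2 3) 0 0 0 \<or>
    br \<simeq>\<^sub>L structure_bracket (e2 2 3) (- e2 1 3) 0 0 (e2 4 5)"

lemma listed_imp_has_hypo_structure:
  fixes br :: "'a::real_vector \<Rightarrow> 'a \<Rightarrow> 'a"
  assumes "dim (UNIV :: 'a set) = 5" "listed br"
  shows "has_hypo_structure br"
  using assms(2) unfolding listed_def
  by (elim disjE exE conjE) (erule has_hypo_A1[OF assms(1)] has_hypo_A2[OF assms(1)] has_hypo_A3[OF assms(1)] has_hypo_A4[OF assms(1)] has_hypo_A5[OF assms(1)] has_hypo_A6[OF assms(1)] has_hypo_A7[OF assms(1)] has_hypo_A8[OF assms(1)] has_hypo_A9[OF assms(1)] has_hypo_B1[OF assms(1)] has_hypo_B2[OF assms(1)] has_hypo_B3[OF assms(1)] has_hypo_B4[OF assms(1)] has_hypo_B5[OF assms(1)] has_hypo_B6[OF assms(1)] has_hypo_B7[OF assms(1)] has_hypo_B8[OF assms(1)] has_hypo_B9[OF assms(1)] has_hypo_B10[OF assms(1)] has_hypo_B11[OF assms(1)] has_hypo_C1[OF assms(1)] has_hypo_C2[OF assms(1)] has_hypo_C3[OF assms(1)] has_hypo_C4[OF assms(1)] has_hypo_C5[OF assms(1)])+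

text \<open>Linear independence of five vectors, as a condition on coefficients; in dimension five such
vectors form a basis.\<close>

definition frame :: "'a::real_vector \<Rightarrow> 'a \<Rightarrow> 'a \<Rightarrow> 'a \<Rightarrow> 'a \<Rightarrow> bool" where
  "frame v1 v2 v3 v4 v5 \<longleftrightarrow> (\<forall>a b c d e. a *\<^sub>R v1 + b *\<^sub>R v2 + c *\<^sub>R v3 + d *\<^sub>R v4 + e *\<^sub>R v5 = 0 \<longrightarrow>
     a = 0 \<and> b = 0 \<and> c = 0 \<and> d = 0 \<and> e = 0)"

lemma frameI:
  "(\<And>a b c d e. a *\<^sub>R v1 + b *\<^sub>R v2 + c *\<^sub>R v3 + d *\<^sub>R v4 + e *\<^sub>R v5 = 0 \<Longrightarrow>
     a = 0 \<and> b = 0 \<and> c = 0 \<and> d = 0 \<and> e = 0) \<Longrightarrow> frame v1 v2 v3 v4 v5"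
  unfolding frame_def by blast

lemma frameD:
  "frame v1 v2 v3 v4 v5 \<Longrightarrow> a *\<^sub>R v1 + b *\<^sub>R v2 + c *\<^sub>R v3 + d *\<^sub>R v4 + e *\<^sub>R v5 = 0 \<Longrightarrow>
     a = 0 \<and> b = 0 \<and> c = 0 \<and> d = 0 \<and> e = 0"
  unfolding frame_def by blast

text \<open>Counting dimensions: the images of the standard basis are five independent vectors, hence a basis.\<close>

lemma frame_linear_bij:
  fixes v1 :: "'a::real_vector"
  assumes fr: "frame v1 v2 v3 v4 v5" and dim: "dim (UNIV :: 'a set) = 5"
  defines "g \<equiv> \<lambda>x::real^5. (x $ 1) *\<^sub>R v1 + (x $ 2) *\<^sub>R v2 + (x $ 3) *\<^sub>R v3 + (x $ 4) *\<^sub>R v4 + (x $ 5) *\<^sub>R v5"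
  shows "linear g" "bij g"
proof -
  show L: "linear g" unfolding g_def by (simp add: linear_iff algebra_simps)
  have inj: "inj g"
    unfolding linear_injective_0[OF L] using frameD[OF fr] by (auto simp: g_def vec_eq_iff forall_5)
  obtain B :: "'a set" where B: "independent B" "span B = UNIV"
    by (metis basis_exists[of UNIV] top.extremum_unique)
  have cB: "card B = 5" using dim B by (metis dim_eq_card dim_span span_UNIV)
  then have fB: "finite B" by (metis card.infinite zero_neq_numeral)
  let ?S = "g ` Basis"
  have ind: "independent ?S"
    using linear_independent_injective_image[OF L independent_Basis] inj by simp
  have cS: "card ?S = 5" using inj by (subst card_image) (auto intro: inj_on_subset)
  have "x \<in> span ?S" for x
  proof (rule ccontr)
    assume "x \<notin> span ?S"
    then have "independent (insert x ?S)" "x \<notin> ?S" using ind by (auto simp: independent_insert span_base)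
    moreover have "insert x ?S \<subseteq> span B" using B by simp
    ultimately have "card (insert x ?S) \<le> card B"
      using independent_span_bound[OF fB] by blast
    then show False using cS cB \<open>x \<notin> ?S\<close> by simp
  qed
  moreover have "span ?S = range g"
    using linear_span_image[OF L, of Basis] by simp
  ultimately have "surj g" by blast
  then show "bij g" using inj by (simp add: bij_def)
qed

locale lie5 =
  fixes br :: "'a::real_vector \<Rightarrow> 'a \<Rightarrow> 'a"
  assumes lie: "lie_algebra br" and dim5: "dim (UNIV :: 'a set) = 5"
begin

lemma bilin: "bilinear br" using lie by (simp add: lie_algebra_def)

lemma br_simps:
  "br (x + y) z = br x z + br y z" "br z (x + y) = br z x + br z y"
  "br (c *\<^sub>R x) z = c *\<^sub>R br x z" "br z (c *\<^sub>R x) = c *\<^sub>R br z x"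
  "br (x - y) z = br x z - br y z" "br z (x - y) = br z x - br z y"
  "br (- x) z = - br x z" "br z (- x) = - br z x" "br 0 z = 0" "br z 0 = 0" "br x x = 0"
  using bilin lie by (simp_all add: bilinear_ladd bilinear_radd bilinear_lmul bilinear_rmul bilinear_lsub
      bilinear_rsub bilinear_lneg bilinear_rneg bilinear_lzero bilinear_rzero lie_algebra_def)

lemma br_anti: "br y x = - br x y"
proof -
  have "br (x + y) (x + y) = br x x + br y y + (br x y + br y x)"
    by (simp only: br_simps(1,2) add_ac)
  then have "br x y + br y x = 0" by (simp add: br_simps(11))
  then show ?thesis by (simp add: add_eq_0_iff2)
qed

lemma jacobi: "br x (br y z) = br (br x y) z + br y (br x z)"
proof -
  have "br x (br y z) + br y (br z x) + br z (br x y) = 0" using lie by (simp add: lie_algebra_def)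
  then show ?thesis using br_anti[of z x] br_anti[of z "br x y"] by (simp add: br_simps algebra_simps)
qed

text \<open>A frame with prescribed brackets of its members in lexicographic order. Proofs that an algebra
occurs in the list consist in exhibiting such a table.\<close>

definition bracket_table :: "'a \<Rightarrow> 'a \<Rightarrow> 'a \<Rightarrow> 'a \<Rightarrow> 'a \<Rightarrow>
    'a \<Rightarrow> 'a \<Rightarrow> 'a \<Rightarrow> 'a \<Rightarrow> 'a \<Rightarrow> 'a \<Rightarrow> 'a \<Rightarrow> 'a \<Rightarrow> 'a \<Rightarrow> 'a \<Rightarrow> bool" where
  "bracket_table v1 v2 v3 v4 v5 b12 b13 b14 b15 b23 b24 b25 b34 b35 b45 \<longleftrightarrow> frame v1 v2 v3 v4 v5 \<and>
     br v1 v2 = b12 \<and> br v1 v3 = b13 \<and> br v1 v4 = b14 \<and> br v1 v5 = b15 \<and> br v2 v3 = b23 \<and>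
     br v2 v4 = b24 \<and> br v2 v5 = b25 \<and> br v3 v4 = b34 \<and> br v3 v5 = b35 \<and> br v4 v5 = b45"

text \<open>Two bilinear maps that agree on the pairs \<open>i < j\<close> of standard basis vectors and are alternating agree
everywhere, so the linear map sending the standard basis to the frame is an isomorphism as soon as
the ten entries of the table match.\<close>

lemma bracket_table_isomorphic:
  assumes tab: "bracket_table v1 v2 v3 v4 v5 b12 b13 b14 b15 b23 b24 b25 b34 b35 b45"
    and K: "bilinear K" "\<And>x. K x x = 0"
  defines "g \<equiv> \<lambda>x::real^5. (x $ 1) *\<^sub>R v1 + (x $ 2) *\<^sub>R v2 + (x $ 3) *\<^sub>R v3 + (x $ 4) *\<^sub>R v4 + (x $ 5) *\<^sub>R v5"
  assumes "g (K (axis 1 1) (axis 2 1)) = b12" "g (K (axis 1 1) (axis 3 1)) = b13" "g (K (axis 1 1) (axis 4 1)) = b14"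
    "g (K (axis 1 1) (axis 5 1)) = b15" "g (K (axis 2 1) (axis 3 1)) = b23" "g (K (axis 2 1) (axis 4 1)) = b24"
    "g (K (axis 2 1) (axis 5 1)) = b25" "g (K (axis 3 1) (axis 4 1)) = b34" "g (K (axis 3 1) (axis 5 1)) = b35"
    "g (K (axis 4 1) (axis 5 1)) = b45"
  shows "br \<simeq>\<^sub>L K"
proof -
  have g: "linear g" "bij g"
    using frame_linear_bij[OF _ dim5, of v1 v2 v3 v4 v5] tab unfolding bracket_table_def g_def by blast+
  have gax: "g (axis 1 1) = v1" "g (axis 2 1) = v2" "g (axis 3 1) = v3" "g (axis 4 1) = v4" "g (axis 5 1) = v5"
    by (simp_all add: g_def axis_def)
  have Kanti: "K y x = - K x y" for x y
  proof -
    have "K (x + y) (x + y) = K x x + K y y + (K x y + K y x)"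
      by (simp only: bilinear_ladd[OF K(1)] bilinear_radd[OF K(1)] add_ac)
    then have "K x y + K y x = 0" by (simp add: K(2))
    then show ?thesis by (simp add: add_eq_0_iff2)
  qed
  have anti: "g (K (axis j 1) (axis i 1)) = br (g (axis j 1)) (g (axis i 1))"
    if "g (K (axis i 1) (axis j 1)) = br (g (axis i 1)) (g (axis j 1))" for i j
    using that Kanti[of "axis j 1" "axis i 1"] br_anti[of "g (axis j 1)" "g (axis i 1)"]
    by (simp add: linear_neg[OF g(1)])
  have diag: "g (K (axis i 1) (axis i 1)) = br (g (axis i 1)) (g (axis i 1))" for i
    by (simp add: K br_simps linear_0[OF g(1)])
  have up: "g (K (axis i 1) (axis j 1)) = br (g (axis i 1)) (g (axis j 1))"
    if "(i, j) \<in> {(1,2),(1,3),(1,4),(1,5),(2,3),(2,4),(2,5),(3,4),(3,5),(4,5)}" for i j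
    using that tab assms(5-) unfolding bracket_table_def by (auto simp: gax)
  have "g (K (axis i 1) (axis j 1)) = br (g (axis i 1)) (g (axis j 1))" for i j
    using exhaust_5[of i] exhaust_5[of j]
    by (elim disjE; hypsubst) (rule diag up anti[OF up]; simp)+
  moreover have "bilinear (\<lambda>x y. g (K x y))" "bilinear (\<lambda>x y. br (g x) (g y))"
    using K bilin g(1) by (simp_all add: bilinear_def linear_iff)
  ultimately have "(\<lambda>x y. g (K x y)) = (\<lambda>x y. br (g x) (g y))"
    by (intro bilinear_eq_stdbasis) (auto simp: Basis_vec_def)
  then have "K \<simeq>\<^sub>L br" unfolding lie_isomorphic_def using g by metis
  then show ?thesis by (rule lie_isomorphic_sym)
qed

lemmas theta_eval = structure_bracket_component scale_form_apply e2_apply axis_def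

lemma listed_A1:
  assumes "bracket_table v1 v2 v3 v4 v5 0 0 0 0 0 (- v1) 0 0 (- v1) 0"
  shows "listed br"
proof -
  have "br \<simeq>\<^sub>L structure_bracket (e2 2 4 + e2 3 5) 0 0 0 0"
    by (rule bracket_table_isomorphic[OF assms];
        ((simp add: theta_eval; fail) | (simp add: bilinear_def linear_iff vec_eq_iff forall_5 theta_eval algebra_simps; fail)
         | simp add: vec_eq_iff forall_5 theta_eval algebra_simps))
  then show ?thesis unfolding listed_def by blast
qed

lemma listed_A2:
  assumes "bracket_table v1 v2 v3 v4 v5 0 0 0 0 0 0 (- v1) (- v1) (- v2) 0"
  shows "listed br"
proof -
  have "br \<simeq>\<^sub>L structure_bracket (e2 3 4 + e2 2 5) (e2 3 5) 0 0 0"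
    by (rule bracket_table_isomorphic[OF assms];
        ((simp add: theta_eval; fail) | (simp add: bilinear_def linear_iff vec_eq_iff forall_5 theta_eval algebra_simps; fail)
         | simp add: vec_eq_iff forall_5 theta_eval algebra_simps))
  then show ?thesis unfolding listed_def by blast
qed

lemma listed_A4:
  assumes "bracket_table v1 v2 v3 v4 v5 0 0 0 ((2) *\<^sub>R v1) (v1) 0 (v2) 0 (v3) (- (3) *\<^sub>R v4)"
  shows "listed br"
proof -
  have "br \<simeq>\<^sub>L structure_bracket (- e2 2 3 - 2 *\<^sub>F e2 1 5) (- e2 2 5) (- e2 3 5) (3 *\<^sub>F e2 4 5) 0"
    by (rule bracket_table_isomorphic[OF assms];
        ((simp add: theta_eval; fail) | (simp add: bilinear_def linear_iff vec_eq_iff forall_5 theta_eval algebra_simps; fail)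
         | simp add: vec_eq_iff forall_5 theta_eval algebra_simps))
  then show ?thesis unfolding listed_def by blast
qed

lemma listed_A5:
  assumes "bracket_table v1 v2 v3 v4 v5 0 0 0 (- v1) (v1) 0 (v2) 0 (- (2) *\<^sub>R v3) ((3) *\<^sub>R v4)"
  shows "listed br"
proof -
  have "br \<simeq>\<^sub>L structure_bracket (e2 1 5 - e2 2 3) (- e2 2 5) (2 *\<^sub>F e2 3 5) (- 3 *\<^sub>F e2 4 5) 0"
    by (rule bracket_table_isomorphic[OF assms];
        ((simp add: theta_eval; fail) | (simp add: bilinear_def linear_iff vec_eq_iff forall_5 theta_eval algebra_simps; fail)
         | simp add: vec_eq_iff forall_5 theta_eval algebra_simps))
  then show ?thesis unfolding listed_def by blast
qed

lemma listed_A6: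
  assumes "bracket_table v1 v2 v3 v4 v5 0 0 0 (v1) 0 (v1) 0 (v2) (- v3) (v4)"
  shows "listed br"
proof -
  have "br \<simeq>\<^sub>L structure_bracket (- e2 1 5 - e2 2 4) (- e2 3 4) (e2 3 5) (- e2 4 5) 0"
    by (rule bracket_table_isomorphic[OF assms];
        ((simp add: theta_eval; fail) | (simp add: bilinear_def linear_iff vec_eq_iff forall_5 theta_eval algebra_simps; fail)
         | simp add: vec_eq_iff forall_5 theta_eval algebra_simps))
  then show ?thesis unfolding listed_def by blast
qed

lemma listed_A7:
  assumes "bracket_table v1 v2 v3 v4 v5 0 0 (v1) 0 0 0 (v2) (- v3) (- v3) 0"
  shows "listed br"
proof -
  have "br \<simeq>\<^sub>L structure_bracket (- e2 1 4) (- e2 2 5) (e2 3 4 + e2 3 5) 0 0"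
    by (rule bracket_table_isomorphic[OF assms];
        ((simp add: theta_eval; fail) | (simp add: bilinear_def linear_iff vec_eq_iff forall_5 theta_eval algebra_simps; fail)
         | simp add: vec_eq_iff forall_5 theta_eval algebra_simps))
  then show ?thesis unfolding listed_def by blast
qed

lemma listed_A8:
  assumes "bracket_table v1 v2 v3 v4 v5 0 0 (- (2) *\<^sub>R v1) 0 0 (v2) (- v3) (v3) (v2) 0"
  shows "listed br"
proof -
  have "br \<simeq>\<^sub>L structure_bracket (2 *\<^sub>F e2 1 4) (- e2 2 4 - e2 3 5) (e2 2 5 - e2 3 4) 0 0"
    by (rule bracket_table_isomorphic[OF assms];
        ((simp add: theta_eval; fail) | (simp add: bilinear_def linear_iff vec_eq_iff forall_5 theta_eval algebra_simps; fail)
         | simp add: vec_eq_iff forall_5 theta_eval algebra_simps))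
  then show ?thesis unfolding listed_def by blast
qed

lemma listed_A9:
  assumes "bracket_table v1 v2 v3 v4 v5 0 0 (- (2) *\<^sub>R v1) 0 (- v1) (- v2) (v3) (- v3) (- v2) 0"
  shows "listed br"
proof -
  have "br \<simeq>\<^sub>L structure_bracket (e2 2 3 + 2 *\<^sub>F e2 1 4) (e2 2 4 + e2 3 5) (e2 3 4 - e2 2 5) 0 0"
    by (rule bracket_table_isomorphic[OF assms];
        ((simp add: theta_eval; fail) | (simp add: bilinear_def linear_iff vec_eq_iff forall_5 theta_eval algebra_simps; fail)
         | simp add: vec_eq_iff forall_5 theta_eval algebra_simps))
  then show ?thesis unfolding listed_def by blast
qed

lemma listed_B1:
  assumes "bracket_table v1 v2 v3 v4 v5 0 0 0 0 0 0 0 0 (- v1) (- v2)"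
  shows "listed br"
proof -
  have "br \<simeq>\<^sub>L structure_bracket (e2 3 5) (e2 4 5) 0 0 0"
    by (rule bracket_table_isomorphic[OF assms];
        ((simp add: theta_eval; fail) | (simp add: bilinear_def linear_iff vec_eq_iff forall_5 theta_eval algebra_simps; fail)
         | simp add: vec_eq_iff forall_5 theta_eval algebra_simps))
  then show ?thesis unfolding listed_def by blast
qed

lemma listed_B2:
  assumes "bracket_table v1 v2 v3 v4 v5 0 0 0 0 0 0 (- v1) 0 (- v2) (- v3)"
  shows "listed br"
proof -
  have "br \<simeq>\<^sub>L structure_bracket (e2 2 5) (e2 3 5) (e2 4 5) 0 0"
    by (rule bracket_table_isomorphic[OF assms];
        ((simp add: theta_eval; fail) | (simp add: bilinear_def linear_iff vec_eq_iff forall_5 theta_eval algebra_simps; fail)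
         | simp add: vec_eq_iff forall_5 theta_eval algebra_simps))
  then show ?thesis unfolding listed_def by blast
qed

lemma listed_B3:
  assumes "p \<noteq> 0" "bracket_table v1 v2 v3 v4 v5 0 0 0 (- v1) 0 0 (- (p) *\<^sub>R v2) 0 ((p) *\<^sub>R v3) (v4)"
  shows "listed br"
proof -
  have "br \<simeq>\<^sub>L structure_bracket (e2 1 5) (p *\<^sub>F e2 2 5) (- p *\<^sub>F e2 3 5) (- e2 4 5) 0"
    by (rule bracket_table_isomorphic[OF assms(2)];
        ((simp add: theta_eval; fail) | (simp add: bilinear_def linear_iff vec_eq_iff forall_5 theta_eval algebra_simps; fail)
         | simp add: vec_eq_iff forall_5 theta_eval algebra_simps))
  then show ?thesis unfolding listed_def using assms(1) by blast
qed

lemma listed_B4: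
  assumes "bracket_table v1 v2 v3 v4 v5 0 0 0 0 0 0 (- v1) 0 (- v3) (v4)"
  shows "listed br"
proof -
  have "br \<simeq>\<^sub>L structure_bracket (e2 2 5) 0 (e2 3 5) (- e2 4 5) 0"
    by (rule bracket_table_isomorphic[OF assms];
        ((simp add: theta_eval; fail) | (simp add: bilinear_def linear_iff vec_eq_iff forall_5 theta_eval algebra_simps; fail)
         | simp add: vec_eq_iff forall_5 theta_eval algebra_simps))
  then show ?thesis unfolding listed_def by blast
qed

lemma listed_B5:
  assumes "r \<noteq> 0" "bracket_table v1 v2 v3 v4 v5 0 0 0 (- v1) 0 0 (v2) 0 ((r) *\<^sub>R v4) (- (r) *\<^sub>R v3)"
  shows "listed br"
proof -
  have "br \<simeq>\<^sub>L structure_bracket (e2 1 5) (- e2 2 5) (r *\<^sub>F e2 4 5) (- r *\<^sub>F e2 3 5) 0"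
    by (rule bracket_table_isomorphic[OF assms(2)];
        ((simp add: theta_eval; fail) | (simp add: bilinear_def linear_iff vec_eq_iff forall_5 theta_eval algebra_simps; fail)
         | simp add: vec_eq_iff forall_5 theta_eval algebra_simps))
  then show ?thesis unfolding listed_def using assms(1) by blast
qed

lemma listed_B6:
  assumes "bracket_table v1 v2 v3 v4 v5 0 0 0 0 0 0 (- v1) 0 (v4) (- v3)"
  shows "listed br"
proof -
  have "br \<simeq>\<^sub>L structure_bracket (e2 2 5) 0 (e2 4 5) (- e2 3 5) 0"
    by (rule bracket_table_isomorphic[OF assms];
        ((simp add: theta_eval; fail) | (simp add: bilinear_def linear_iff vec_eq_iff forall_5 theta_eval algebra_simps; fail)
         | simp add: vec_eq_iff forall_5 theta_eval algebra_simps))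
  then show ?thesis unfolding listed_def by blast
qed

lemma listed_B7:
  assumes "bracket_table v1 v2 v3 v4 v5 0 0 0 (- v1) 0 0 (- v1 - v2) 0 (v3) (- v3 + v4)"
  shows "listed br"
proof -
  have "br \<simeq>\<^sub>L structure_bracket (e2 1 5 + e2 2 5) (e2 2 5) (e2 4 5 - e2 3 5) (- e2 4 5) 0"
    by (rule bracket_table_isomorphic[OF assms];
        ((simp add: theta_eval; fail) | (simp add: bilinear_def linear_iff vec_eq_iff forall_5 theta_eval algebra_simps; fail)
         | simp add: vec_eq_iff forall_5 theta_eval algebra_simps))
  then show ?thesis unfolding listed_def by blast
qed

lemma listed_B8:
  assumes "r \<noteq> 0" "bracket_table v1 v2 v3 v4 v5 0 0 0 (v2) 0 0 (- v1) 0 ((r) *\<^sub>R v4) (- (r) *\<^sub>R v3)"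
  shows "listed br"
proof -
  have "br \<simeq>\<^sub>L structure_bracket (e2 2 5) (- e2 1 5) (r *\<^sub>F e2 4 5) (- r *\<^sub>F e2 3 5) 0"
    by (rule bracket_table_isomorphic[OF assms(2)];
        ((simp add: theta_eval; fail) | (simp add: bilinear_def linear_iff vec_eq_iff forall_5 theta_eval algebra_simps; fail)
         | simp add: vec_eq_iff forall_5 theta_eval algebra_simps))
  then show ?thesis unfolding listed_def using assms(1) by blast
qed

lemma listed_B9:
  assumes "bracket_table v1 v2 v3 v4 v5 0 0 0 (- (p) *\<^sub>R v1 + v2) 0 0 (- v1 - (p) *\<^sub>R v2) 0 ((p) *\<^sub>R v3 + v4) (- v3 + (p) *\<^sub>R v4)"
  shows "listed br"
proof -
  have "br \<simeq>\<^sub>L structure_bracket (e2 2 5 + p *\<^sub>F e2 1 5) (- e2 1 5 + p *\<^sub>F e2 2 5) (e2 4 5 - p *\<^sub>F e2 3 5) (- e2 3 5 - p *\<^sub>F e2 4 5) 0"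
    by (rule bracket_table_isomorphic[OF assms];
        ((simp add: theta_eval; fail) | (simp add: bilinear_def linear_iff vec_eq_iff forall_5 theta_eval algebra_simps; fail)
         | simp add: vec_eq_iff forall_5 theta_eval algebra_simps))
  then show ?thesis unfolding listed_def by blast
qed

lemma listed_B11:
  assumes "bracket_table v1 v2 v3 v4 v5 0 0 0 (v2) 0 0 (- v1) 0 (- v1 + v4) (- v2 - v3)"
  shows "listed br"
proof -
  have "br \<simeq>\<^sub>L structure_bracket (e2 3 5 + e2 2 5) (- e2 1 5 + e2 4 5) (e2 4 5) (- e2 3 5) 0"
    by (rule bracket_table_isomorphic[OF assms];
        ((simp add: theta_eval; fail) | (simp add: bilinear_def linear_iff vec_eq_iff forall_5 theta_eval algebra_simps; fail)
         | simp add: vec_eq_iff forall_5 theta_eval algebra_simps))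
  then show ?thesis unfolding listed_def by blast
qed

lemma listed_C1:
  assumes "bracket_table v1 v2 v3 v4 v5 0 0 0 0 0 0 0 0 0 0"
  shows "listed br"
proof -
  have "br \<simeq>\<^sub>L structure_bracket 0 0 0 0 0"
    by (rule bracket_table_isomorphic[OF assms];
        ((simp add: theta_eval; fail) | (simp add: bilinear_def linear_iff vec_eq_iff forall_5 theta_eval algebra_simps; fail)
         | simp add: vec_eq_iff forall_5 theta_eval algebra_simps))
  then show ?thesis unfolding listed_def by blast
qed

lemma listed_C2:
  assumes "bracket_table v1 v2 v3 v4 v5 0 0 0 0 (- v1) 0 0 0 0 0"
  shows "listed br"
proof -
  have "br \<simeq>\<^sub>L structure_bracket (e2 2 3) 0 0 0 0"
    by (rule bracket_table_isomorphic[OF assms];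
        ((simp add: theta_eval; fail) | (simp add: bilinear_def linear_iff vec_eq_iff forall_5 theta_eval algebra_simps; fail)
         | simp add: vec_eq_iff forall_5 theta_eval algebra_simps))
  then show ?thesis unfolding listed_def by blast
qed

lemma listed_C3:
  assumes "bracket_table v1 v2 v3 v4 v5 0 (v2) 0 0 (- v1) 0 0 0 0 0"
  shows "listed br"
proof -
  have "br \<simeq>\<^sub>L structure_bracket (e2 2 3) (- e2 1 3) 0 0 0"
    by (rule bracket_table_isomorphic[OF assms];
        ((simp add: theta_eval; fail) | (simp add: bilinear_def linear_iff vec_eq_iff forall_5 theta_eval algebra_simps; fail)
         | simp add: vec_eq_iff forall_5 theta_eval algebra_simps))
  then show ?thesis unfolding listed_def by blast
qed

lemma listed_C4:
  assumes "bracket_table v1 v2 v3 v4 v5 0 (- v1) 0 0 (v2) 0 0 0 0 0"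
  shows "listed br"
proof -
  have "br \<simeq>\<^sub>L structure_bracket (e2 1 3) (- e2 2 3) 0 0 0"
    by (rule bracket_table_isomorphic[OF assms];
        ((simp add: theta_eval; fail) | (simp add: bilinear_def linear_iff vec_eq_iff forall_5 theta_eval algebra_simps; fail)
         | simp add: vec_eq_iff forall_5 theta_eval algebra_simps))
  then show ?thesis unfolding listed_def by blast
qed

lemma listed_C5:
  assumes "bracket_table v1 v2 v3 v4 v5 0 (v2) 0 0 (- v1) 0 0 0 0 (- v5)"
  shows "listed br"
proof -
  have "br \<simeq>\<^sub>L structure_bracket (e2 2 3) (- e2 1 3) 0 0 (e2 4 5)"
    by (rule bracket_table_isomorphic[OF assms];
        ((simp add: theta_eval; fail) | (simp add: bilinear_def linear_iff vec_eq_iff forall_5 theta_eval algebra_simps; fail)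
         | simp add: vec_eq_iff forall_5 theta_eval algebra_simps))
  then show ?thesis unfolding listed_def by blast
qed

end

section \<open>Closed one-forms, the trace form and rotations of hypo coframes\<close>

text \<open>A set contained in the span of its own brackets stays in every term of the derived series.
This is the only way in which solvability is exploited.\<close>

lemma solvable_no_perfect_subset:
  assumes "solvable_lie br" "S \<subseteq> span {br x y | x y. x \<in> S \<and> y \<in> S}"
  shows "S \<subseteq> {0}"
proof -
  have "S \<subseteq> derived_series br n" for n
  proof (induction n)
    case (Suc n)
    have "span {br x y | x y. x \<in> S \<and> y \<in> S}
        \<subseteq> span {br x y | x y. x \<in> derived_series br n \<and> y \<in> derived_series br n}"
      by (rule span_mono) (use Suc in blast)
    then show ?case using assms(2) by simp
  qed simp
  then show ?thesis using assms(1) unfolding solvable_lie_def by blast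
qed

lemma exists_functional_separating:
  fixes S :: "'a::real_vector set"
  assumes x: "x \<notin> span S"
  obtains g :: "'a \<Rightarrow> real" where "linear g" "\<And>y. y \<in> S \<Longrightarrow> g y = 0" "g x = 1"
proof -
  obtain B where B: "B \<subseteq> S" "independent B" "S \<subseteq> span B"
    by (metis maximal_independent_subset)
  have sp: "span B = span S" using B by (metis span_mono span_span subset_antisym)
  have "independent (insert x B)" using B(2) x sp by (simp add: independent_insert)
  then obtain g :: "'a \<Rightarrow> real" where g: "linear g" "\<forall>y\<in>insert x B. g y = (if y = x then 1 else 0)"
    using linear_independent_extend[of "insert x B" "\<lambda>y. if y = x then 1 else 0"] by blast
  have "x \<notin> B" using x sp span_base by blast
  then have "g y = 0" if "y \<in> B" for y using g(2) that by auto
  then have "g y = 0" if "y \<in> span B" for y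
    using linear_eq_0_on_span[OF g(1)] that by blast
  then have "g y = 0" if "y \<in> S" for y using that B(3) by blast
  then show ?thesis using that[OF g(1)] g(2) by simp
qed

definition closed1 :: "('a \<Rightarrow> 'a \<Rightarrow> 'a) \<Rightarrow> ('a \<Rightarrow> real) \<Rightarrow> bool" where
  "closed1 br \<delta> \<longleftrightarrow> (\<forall>x y. \<delta> (br x y) = 0)"

context lie5
begin

text \<open>The whole algebra is not perfect, and a functional vanishing on all brackets is a closed one-form.\<close>

lemma nonzero_closed_form:
  assumes "solvable_lie br"
  obtains \<delta> x where "linear \<delta>" "closed1 br \<delta>" "\<delta> x = (1::real)"
proof -
  have "span {br x y | x y. True} \<noteq> UNIV"
  proof
    assume "span {br x y | x y. True} = UNIV"
    then have "(UNIV :: 'a set) \<subseteq> {0}"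
      using solvable_no_perfect_subset[OF assms, of UNIV] by simp
    then have "dim (UNIV :: 'a set) = dim {0 :: 'a}" by (intro arg_cong[of _ _ dim]) blast
    moreover have "dim {0 :: 'a} = card ({} :: 'a set)" by (rule dim_eq_card) (simp_all add: independent_empty)
    ultimately show False using dim5 by simp
  qed
  then obtain x where "x \<notin> span {br x y | x y. True}" by blast
  then obtain g :: "'a \<Rightarrow> real" where
    "linear g" "\<And>y. y \<in> {br x y | x y. True} \<Longrightarrow> g y = 0" "g x = 1"
    by (rule exists_functional_separating) blast
  then show ?thesis using that[of g x] by (auto simp: closed1_def)
qed

end

definition trace_ad :: "('a::real_vector \<Rightarrow> 'a \<Rightarrow> 'a) \<Rightarrow> (5 \<Rightarrow> 'a \<Rightarrow> real) \<Rightarrow> (5 \<Rightarrow> 'a) \<Rightarrow> 'a \<Rightarrow> real" where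
  "trace_ad br \<phi> e x = (\<Sum>i\<in>UNIV. \<phi> i (br x (e i)))"

text \<open>A frame \<open>e\<close> and its dual coframe \<open>\<phi>\<close>, not yet related to a hypo structure.\<close>

locale coframe5 = lie5 br for br :: "'a::real_vector \<Rightarrow> 'a \<Rightarrow> 'a" +
  fixes \<phi> :: "5 \<Rightarrow> 'a \<Rightarrow> real" and e :: "5 \<Rightarrow> 'a"
  assumes lin: "\<And>i. linear (\<phi> i)"
    and dual: "\<And>i j. \<phi> j (e i) = (if i = j then 1 else 0)"
    and expand: "\<And>x. x = (\<Sum>i\<in>UNIV. \<phi> i x *\<^sub>R e i)"
begin

lemmas phi_simps = linear_add[OF lin] linear_diff[OF lin] linear_cmul[OF lin] linear_neg[OF lin] linear_0[OF lin]

lemma expand5: "x = \<phi> 1 x *\<^sub>R e 1 + \<phi> 2 x *\<^sub>R e 2 + \<phi> 3 x *\<^sub>R e 3 + \<phi> 4 x *\<^sub>R e 4 + \<phi> 5 x *\<^sub>R e 5"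
  using expand[of x] by (simp only: sum_5)

text \<open>The trace form \<open>x \<mapsto> tr (ad x)\<close> is closed because the trace of a commutator of endomorphisms vanishes.\<close>

lemma trace_ad_linear: "linear (trace_ad br \<phi> e)"
  unfolding trace_ad_def
  by (rule linearI) (simp_all add: br_simps phi_simps sum.distrib sum_distrib_left)

lemma trace_ad_closed: "closed1 br (trace_ad br \<phi> e)"
  unfolding closed1_def
proof (intro allI)
  fix x y
  have ex: "\<phi> i (br u (br v (e i))) = (\<Sum>j\<in>UNIV. \<phi> j (br v (e i)) * \<phi> i (br u (e j)))" for u v i
  proof -
    have "br u (br v (e i)) = br u (\<Sum>j\<in>UNIV. \<phi> j (br v (e i)) *\<^sub>R e j)"
      using expand[of "br v (e i)"] by simp
    then show ?thesis by (simp add: sum_5 br_simps phi_simps)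
  qed
  have "br (br x y) z = br x (br y z) - br y (br x z)" for z
    using jacobi[of x y z] by (simp add: algebra_simps)
  then have "trace_ad br \<phi> e (br x y) = (\<Sum>i\<in>UNIV. \<phi> i (br x (br y (e i)))) - (\<Sum>i\<in>UNIV. \<phi> i (br y (br x (e i))))"
    by (simp add: trace_ad_def phi_simps sum_subtractf)
  also have "(\<Sum>i\<in>UNIV. \<phi> i (br x (br y (e i)))) = (\<Sum>i\<in>UNIV. \<Sum>j\<in>UNIV. \<phi> j (br y (e i)) * \<phi> i (br x (e j)))"
    by (simp only: ex)
  also have "\<dots> = (\<Sum>j\<in>UNIV. \<Sum>i\<in>UNIV. \<phi> j (br y (e i)) * \<phi> i (br x (e j)))" by (rule sum.swap)
  also have "\<dots> = (\<Sum>j\<in>UNIV. \<phi> j (br y (br x (e j))))" by (simp only: ex mult.commute)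
  finally show "trace_ad br \<phi> e (br x y) = 0" by simp
qed

end

locale hypo5 = coframe5 br \<phi> e for br :: "'a::real_vector \<Rightarrow> 'a \<Rightarrow> 'a" and \<phi> e +
  assumes hypo: "hypo_coframe br \<phi>"

lemma (in lie5) hypo5_exists:
  assumes "hypo_coframe br \<phi>"
  obtains e where "hypo5 br \<phi> e"
proof -
  have lc: "linear_coframe \<phi>" using assms by (simp add: hypo_coframe_def)
  obtain e where "\<And>i j. \<phi> j (e i) = (if i = j then 1 else 0)" "\<And>x. x = (\<Sum>i\<in>UNIV. \<phi> i x *\<^sub>R e i)"
    using dual_vectors[OF lc] by metis
  moreover have "linear (\<phi> i)" for i using lc by (simp add: linear_coframe_def)
  ultimately have "coframe5_axioms \<phi> e" by (simp add: coframe5_axioms_def)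
  then show ?thesis
    by (intro that hypo5.intro coframe5.intro lie5_axioms hypo5_axioms.intro assms)
qed

text \<open>Rotations in the plane of \<open>\<phi> 1\<close> and \<open>\<phi> 2\<close> mix \<open>om2\<close> and \<open>om3\<close>; the hypo equations survive because they are
linear in these forms.\<close>

lemma closed3_linear_combination:
  assumes "closed3 br (wedge21 w u)" "closed3 br (wedge21 w' u)"
  shows "closed3 br (wedge21 (\<lambda>x y. c * w x y + s * w' x y) u)"
proof -
  have v: "wedge21 (\<lambda>x y. c * w x y + s * w' x y) u x y z = c * wedge21 w u x y z + s * wedge21 w' u x y z" for x y z
    by (simp add: wedge21_def algebra_simps)
  show ?thesis unfolding closed3_def
  proof (intro allI)
    fix x y z t
    let ?r = "wedge21 (\<lambda>x y. c * w x y + s * w' x y) u" and ?E = "\<lambda>r. r (br x y) z t - r (br x z) y t + r (br x t) y z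
        + r (br y z) x t - r (br y t) x z + r (br z t) x y"
    have "?E ?r = c * ?E (wedge21 w u) + s * ?E (wedge21 w' u)" unfolding v by (simp add: algebra_simps)
    moreover have "?E (wedge21 w u) = 0" "?E (wedge21 w' u) = 0" using assms unfolding closed3_def by blast+
    ultimately show "?E ?r = 0" by (simp only: mult_zero_right add_0_right)
  qed
qed

text \<open>A family indexed by the type \<open>5\<close> with prescribed members.\<close>

definition family5 :: "'b \<Rightarrow> 'b \<Rightarrow> 'b \<Rightarrow> 'b \<Rightarrow> 'b \<Rightarrow> 5 \<Rightarrow> 'b::zero" where
  "family5 a b c d f i = vector [a, b, c, d, f] $ i"

lemma family5_simps [simp]:
  "family5 a b c d f 1 = a" "family5 a b c d f 2 = b" "family5 a b c d f 3 = c"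
  "family5 a b c d f 4 = d" "family5 a b c d f 5 = f"
  by (simp_all add: family5_def vector_5)

context hypo5
begin

lemma kahler: "om1 \<phi> (br x y) z - om1 \<phi> (br x z) y + om1 \<phi> (br y z) x = 0"
  using hypo by (simp add: hypo_coframe_def closed2_def)

lemma psi_closed:
  "w = om2 \<phi> \<or> w = om3 \<phi> \<Longrightarrow> wedge21 w (\<phi> 5) (br x y) z t - wedge21 w (\<phi> 5) (br x z) y t + wedge21 w (\<phi> 5) (br x t) y z
      + wedge21 w (\<phi> 5) (br y z) x t - wedge21 w (\<phi> 5) (br y t) x z + wedge21 w (\<phi> 5) (br z t) x y = 0"
  using hypo unfolding hypo_coframe_def closed3_def by blast

text \<open>Closedness of \<open>om1\<close> on the triples \<open>e 5, e 1, e 2\<close> and \<open>e 5, e 3, e 4\<close> gives the vanishing of the traces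
of the two diagonal blocks.\<close>

lemma trace_ad_reeb: "trace_ad br \<phi> e (e 5) = 0"
proof -
  have "\<phi> 1 (br (e 5) (e 1)) + \<phi> 2 (br (e 5) (e 2)) = 0"
    using kahler[of "e 5" "e 1" "e 2"] by (simp add: om1_def wedge11_def dual)
  moreover have "\<phi> 3 (br (e 5) (e 3)) + \<phi> 4 (br (e 5) (e 4)) = 0"
    using kahler[of "e 5" "e 3" "e 4"] by (simp add: om1_def wedge11_def dual)
  ultimately show ?thesis by (simp add: trace_ad_def sum_5 br_simps phi_simps)
qed

text \<open>The unit quaternions acting on \<open>real^4\<close> from one side preserve the triple of two-forms, which
corresponds to multiplication by the imaginary units from the other side. As they act simply transitively on the
unit sphere, any unit covector \<open>w\<close> can be made the fourth member of the coframe.\<close>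

lemma rotate_hypo:
  assumes w: "w1\<^sup>2 + w2\<^sup>2 + w3\<^sup>2 + w4\<^sup>2 = 1"
  shows "hypo_coframe br (coframe_of
     (\<lambda>x. w4 * \<phi> 1 x + w3 * \<phi> 2 x - w2 * \<phi> 3 x - w1 * \<phi> 4 x)
     (\<lambda>x. - w3 * \<phi> 1 x + w4 * \<phi> 2 x + w1 * \<phi> 3 x - w2 * \<phi> 4 x)
     (\<lambda>x. w2 * \<phi> 1 x - w1 * \<phi> 2 x + w4 * \<phi> 3 x - w3 * \<phi> 4 x)
     (\<lambda>x. w1 * \<phi> 1 x + w2 * \<phi> 2 x + w3 * \<phi> 3 x + w4 * \<phi> 4 x) (\<phi> 5))" (is "hypo_coframe br ?\<psi>")
proof -
  have n: "w1*w1 + w2*w2 + w3*w3 + w4*w4 = 1" using w by (simp add: power2_eq_square)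
  have "om1 ?\<psi> = om1 \<phi>" "om2 ?\<psi> = om2 \<phi>" "om3 ?\<psi> = om3 \<phi>"
    by (intro ext; simp add: om1_def om2_def om3_def wedge11_def; use n in algebra)+
  moreover have "linear_coframe ?\<psi>"
  proof (rule linear_coframeI[OF dim5])
    show "linear (?\<psi> i)" for i
      using exhaust_5[of i] by (elim disjE) (simp_all add: linear_iff phi_simps algebra_simps)
    fix x assume z: "\<And>i. ?\<psi> i x = 0"
    have "\<phi> 1 x = 0" "\<phi> 2 x = 0" "\<phi> 3 x = 0" "\<phi> 4 x = 0" "\<phi> 5 x = 0"
      using z[of 1] z[of 2] z[of 3] z[of 4] z[of 5] n by (simp_all; algebra)+
    then show "x = 0" using expand5[of x] by simp
  qed
  ultimately show ?thesis using hypo by (simp add: hypo_coframe_def)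
qed

text \<open>This rotation preserves \<open>om1\<close> and rotates the pair \<open>om2\<close>, \<open>om3\<close>; it leaves \<open>\<phi> 3\<close>, \<open>\<phi> 4\<close> and \<open>\<phi> 5\<close> alone and is
therefore available after \<open>\<phi> 4\<close> has been made closed.\<close>

lemma rotate_hypo_plane:
  assumes w: "c\<^sup>2 + s\<^sup>2 = 1"
  shows "hypo_coframe br (coframe_of (\<lambda>x. c * \<phi> 1 x + s * \<phi> 2 x) (\<lambda>x. c * \<phi> 2 x - s * \<phi> 1 x)
     (\<phi> 3) (\<phi> 4) (\<phi> 5))" (is "hypo_coframe br ?\<psi>")
proof -
  have n: "c * c + s * s = 1" using w by (simp add: power2_eq_square)
  have "om1 ?\<psi> = om1 \<phi>"
    by (intro ext; simp add: om1_def wedge11_def; use n in algebra)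
  moreover have o2: "om2 ?\<psi> x y = c * om2 \<phi> x y + s * om3 \<phi> x y" and o3: "om3 ?\<psi> x y = c * om3 \<phi> x y - s * om2 \<phi> x y" for x y
    by (simp_all add: om2_def om3_def wedge11_def algebra_simps)
  have "om2 ?\<psi> = (\<lambda>x y. c * om2 \<phi> x y + s * om3 \<phi> x y)" "om3 ?\<psi> = (\<lambda>x y. c * om3 \<phi> x y + (- s) * om2 \<phi> x y)"
    by (intro ext; simp add: o2 o3)+
  then have "closed3 br (wedge21 (om2 ?\<psi>) (\<phi> 5))" "closed3 br (wedge21 (om3 ?\<psi>) (\<phi> 5))"
    using closed3_linear_combination[of br "om2 \<phi>" "\<phi> 5" "om3 \<phi>" c s]
      closed3_linear_combination[of br "om3 \<phi>" "\<phi> 5" "om2 \<phi>" c "- s"] hypo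
    by (simp_all only: hypo_coframe_def)
  moreover have "linear_coframe ?\<psi>"
  proof (rule linear_coframeI[OF dim5])
    show "linear (?\<psi> i)" for i
      using exhaust_5[of i] by (elim disjE) (simp_all add: lin linear_iff phi_simps algebra_simps)
    fix x assume z: "\<And>i. ?\<psi> i x = 0"
    have "c * \<phi> 1 x + s * \<phi> 2 x = 0" "c * \<phi> 2 x - s * \<phi> 1 x = 0"
      using z[of 1] z[of 2] by simp_all
    then have "\<phi> 1 x = 0" "\<phi> 2 x = 0" using n by algebra+
    moreover have "\<phi> 3 x = 0" "\<phi> 4 x = 0" "\<phi> 5 x = 0" using z[of 3] z[of 4] z[of 5] by simp_all
    ultimately show "x = 0" using expand5[of x] by simp
  qed
  ultimately show ?thesis using hypo by (simp add: hypo_coframe_def)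
qed

lemma rotate_plane:
  assumes w: "c\<^sup>2 + s\<^sup>2 = 1"
  shows "hypo5 br (coframe_of (\<lambda>x. c * \<phi> 1 x + s * \<phi> 2 x) (\<lambda>x. c * \<phi> 2 x - s * \<phi> 1 x) (\<phi> 3) (\<phi> 4) (\<phi> 5))
    (family5 (c *\<^sub>R e 1 + s *\<^sub>R e 2) (c *\<^sub>R e 2 - s *\<^sub>R e 1) (e 3) (e 4) (e 5))" (is "hypo5 br ?\<psi> ?f")
proof -
  have n: "c * c + s * s = 1" using w by (simp add: power2_eq_square)
  have h: "hypo_coframe br ?\<psi>" by (rule rotate_hypo_plane[OF w])
  have "?\<psi> j (?f i) = (if i = j then 1 else 0)" for i j
    using exhaust_5[of i] exhaust_5[of j] n
    by (elim disjE) (simp_all add: phi_simps dual algebra_simps)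
  moreover have "x = (\<Sum>i\<in>UNIV. ?\<psi> i x *\<^sub>R ?f i)" for x
  proof -
    have "(c * \<phi> 1 x + s * \<phi> 2 x) *\<^sub>R (c *\<^sub>R e 1 + s *\<^sub>R e 2) + (c * \<phi> 2 x - s * \<phi> 1 x) *\<^sub>R (c *\<^sub>R e 2 - s *\<^sub>R e 1)
      = (c * c + s * s) *\<^sub>R (\<phi> 1 x *\<^sub>R e 1 + \<phi> 2 x *\<^sub>R e 2)"
      by (simp add: algebra_simps)
    then show ?thesis using n expand5[of x] by (simp add: sum_5)
  qed
  moreover have "linear (?\<psi> i)" for i using h by (simp add: hypo_coframe_def linear_coframe_def)
  ultimately have "coframe5_axioms ?\<psi> ?f" unfolding coframe5_axioms_def by blast
  then show ?thesis by (intro hypo5.intro coframe5.intro lie5_axioms hypo5_axioms.intro h)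
qed

end

section \<open>A closed one-form transverse to the Reeb vector\<close>

text \<open>The situation reached by \<open>rotate_hypo\<close> when some closed one-form vanishes on \<open>e 5\<close>. The second
assumption holds when \<open>\<phi> 4\<close> is proportional to the trace form, and also when the trace form is zero.\<close>

locale transverse = hypo5 br \<phi> e for br :: "'a::real_vector \<Rightarrow> 'a \<Rightarrow> 'a" and \<phi> e +
  assumes closed4: "closed1 br (\<phi> 4)"
    and unimodular_kernel: "\<And>x. \<phi> 4 x = 0 \<Longrightarrow> trace_ad br \<phi> e x = 0"
begin

text \<open>The structure constants that describe the solution of the linear equations; three of them, \<open>m11\<close>, \<open>m22\<close> and
\<open>m55\<close>, depend on the others. Modulo \<open>e 3\<close> and \<open>e 5\<close> the vector \<open>e 3\<close> acts on the plane of \<open>e 1\<close>, \<open>e 2\<close> by the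
matrix with rows \<open>a3, b3\<close> and \<open>c3, - a3\<close>, and \<open>e 5\<close> by the one with rows \<open>a5, b5\<close> and \<open>c5, - a5\<close>; the letters \<open>q\<close>, \<open>Q\<close>,
\<open>r\<close>, \<open>R\<close> are the components of these brackets along \<open>e 3\<close> and \<open>e 5\<close>, \<open>p\<close> those of the bracket of \<open>e 1\<close> and \<open>e 2\<close>,
and \<open>m\<close> describes the action of \<open>e 4\<close>.\<close>

definition "a3 = \<phi> 1 (br (e 3) (e 1))"
definition "c3 = \<phi> 2 (br (e 3) (e 1))"
definition "q1 = \<phi> 3 (br (e 3) (e 1))"
definition "Q1 = \<phi> 5 (br (e 3) (e 1))"
definition "b3 = \<phi> 1 (br (e 3) (e 2))"
definition "q2 = \<phi> 3 (br (e 3) (e 2))"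
definition "Q2 = \<phi> 5 (br (e 3) (e 2))"
definition "a5 = \<phi> 1 (br (e 5) (e 1))"
definition "c5 = \<phi> 2 (br (e 5) (e 1))"
definition "r1 = \<phi> 3 (br (e 5) (e 1))"
definition "R1 = \<phi> 5 (br (e 5) (e 1))"
definition "b5 = \<phi> 1 (br (e 5) (e 2))"
definition "r2 = \<phi> 3 (br (e 5) (e 2))"
definition "R2 = \<phi> 5 (br (e 5) (e 2))"
definition "m11 = \<phi> 1 (br (e 4) (e 1))"
definition "m22 = \<phi> 2 (br (e 4) (e 2))"
definition "m33 = \<phi> 3 (br (e 4) (e 3))"
definition "m53 = \<phi> 5 (br (e 4) (e 3))"
definition "m35 = \<phi> 3 (br (e 4) (e 5))"
definition "m55 = \<phi> 5 (br (e 4) (e 5))"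
definition "p3 = - \<phi> 3 (br (e 1) (e 2))"
definition "p5 = - \<phi> 5 (br (e 1) (e 2))"
lemmas param_defs = a3_def c3_def q1_def Q1_def b3_def q2_def Q2_def a5_def c5_def r1_def R1_def b5_def r2_def R2_def m11_def m22_def m33_def m53_def m35_def m55_def p3_def p5_def

lemma anti_basis:
  "br (e 2) (e 1) = - br (e 1) (e 2)"
  "br (e 3) (e 1) = - br (e 1) (e 3)"
  "br (e 4) (e 1) = - br (e 1) (e 4)"
  "br (e 5) (e 1) = - br (e 1) (e 5)"
  "br (e 3) (e 2) = - br (e 2) (e 3)"
  "br (e 4) (e 2) = - br (e 2) (e 4)"
  "br (e 5) (e 2) = - br (e 2) (e 5)"
  "br (e 4) (e 3) = - br (e 3) (e 4)"
  "br (e 5) (e 3) = - br (e 3) (e 5)"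
  "br (e 5) (e 4) = - br (e 4) (e 5)"
  by (rule br_anti)+

text \<open>The general solution of the linear equations: ten from the closedness of \<open>om1\<close>, five from each of the
two three-forms, and three from the unimodularity of the kernel of \<open>\<phi> 4\<close>.\<close>

lemma component_relations:
  "\<phi> 1 (br (e 1) (e 2)) = - q2 - R2"
  "\<phi> 2 (br (e 1) (e 2)) = q1 + R1"
  "\<phi> 3 (br (e 1) (e 2)) = - p3"
  "\<phi> 5 (br (e 1) (e 2)) = - p5"
  "\<phi> 2 (br (e 3) (e 2)) = - a3"
  "\<phi> 2 (br (e 5) (e 2)) = - a5"
  "\<phi> 1 (br (e 3) (e 5)) = 0"
  "\<phi> 2 (br (e 3) (e 5)) = 0"
  "\<phi> 3 (br (e 3) (e 5)) = 0"
  "\<phi> 5 (br (e 3) (e 5)) = 0"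
  "\<phi> 2 (br (e 4) (e 1)) = a3"
  "\<phi> 3 (br (e 4) (e 1)) = - q2"
  "\<phi> 5 (br (e 4) (e 1)) = - Q2"
  "\<phi> 1 (br (e 4) (e 2)) = a3"
  "\<phi> 3 (br (e 4) (e 2)) = q1"
  "\<phi> 5 (br (e 4) (e 2)) = Q1"
  "\<phi> 1 (br (e 4) (e 3)) = - q2"
  "\<phi> 2 (br (e 4) (e 3)) = q1"
  "\<phi> 1 (br (e 4) (e 5)) = - r2"
  "\<phi> 2 (br (e 4) (e 5)) = r1"
  "2 * m11 = p3 - b3 - c3"
  "2 * m22 = p3 + b3 + c3"
  "2 * m55 = b3 - c3 - p3 - 2 * m33"
proof -
  note ev = om1_def om2_def om3_def wedge21_def wedge11_def dual closed4[unfolded closed1_def, rule_format]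
  note K123 = kahler[of "e 1" "e 2" "e 3", simplified ev, simplified]
  note K124 = kahler[of "e 1" "e 2" "e 4", simplified ev, simplified]
  note K125 = kahler[of "e 1" "e 2" "e 5", simplified ev, simplified]
  note K134 = kahler[of "e 1" "e 3" "e 4", simplified ev, simplified]
  note K135 = kahler[of "e 1" "e 3" "e 5", simplified ev, simplified]
  note K145 = kahler[of "e 1" "e 4" "e 5", simplified ev, simplified]
  note K234 = kahler[of "e 2" "e 3" "e 4", simplified ev, simplified]
  note K235 = kahler[of "e 2" "e 3" "e 5", simplified ev, simplified]
  note K245 = kahler[of "e 2" "e 4" "e 5", simplified ev, simplified]
  note K345 = kahler[of "e 3" "e 4" "e 5", simplified ev, simplified]
  note L21234 = psi_closed[of "om2 \<phi>" "e 1" "e 2" "e 3" "e 4", simplified ev, simplified]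
  note L21235 = psi_closed[of "om2 \<phi>" "e 1" "e 2" "e 3" "e 5", simplified ev, simplified]
  note L21245 = psi_closed[of "om2 \<phi>" "e 1" "e 2" "e 4" "e 5", simplified ev, simplified]
  note L21345 = psi_closed[of "om2 \<phi>" "e 1" "e 3" "e 4" "e 5", simplified ev, simplified]
  note L22345 = psi_closed[of "om2 \<phi>" "e 2" "e 3" "e 4" "e 5", simplified ev, simplified]
  note L31234 = psi_closed[of "om3 \<phi>" "e 1" "e 2" "e 3" "e 4", simplified ev, simplified]
  note L31235 = psi_closed[of "om3 \<phi>" "e 1" "e 2" "e 3" "e 5", simplified ev, simplified]
  note L31245 = psi_closed[of "om3 \<phi>" "e 1" "e 2" "e 4" "e 5", simplified ev, simplified]
  note L31345 = psi_closed[of "om3 \<phi>" "e 1" "e 3" "e 4" "e 5", simplified ev, simplified]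
  note L32345 = psi_closed[of "om3 \<phi>" "e 2" "e 3" "e 4" "e 5", simplified ev, simplified]
  have tr: "trace_ad br \<phi> e (e 1) = 0" "trace_ad br \<phi> e (e 2) = 0" "trace_ad br \<phi> e (e 3) = 0"
    by (rule unimodular_kernel; simp add: dual)+
  note tr' = tr[unfolded trace_ad_def sum_5 anti_basis br_simps phi_simps closed4[unfolded closed1_def, rule_format]]
  show "\<phi> 1 (br (e 1) (e 2)) = - q2 - R2"
    "\<phi> 2 (br (e 1) (e 2)) = q1 + R1"
    "\<phi> 3 (br (e 1) (e 2)) = - p3"
    "\<phi> 5 (br (e 1) (e 2)) = - p5"
    "\<phi> 2 (br (e 3) (e 2)) = - a3"
    "\<phi> 2 (br (e 5) (e 2)) = - a5"
    "\<phi> 1 (br (e 3) (e 5)) = 0"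
    "\<phi> 2 (br (e 3) (e 5)) = 0"
    "\<phi> 3 (br (e 3) (e 5)) = 0"
    "\<phi> 5 (br (e 3) (e 5)) = 0"
    "\<phi> 2 (br (e 4) (e 1)) = a3"
    "\<phi> 3 (br (e 4) (e 1)) = - q2"
    "\<phi> 5 (br (e 4) (e 1)) = - Q2"
    "\<phi> 1 (br (e 4) (e 2)) = a3"
    "\<phi> 3 (br (e 4) (e 2)) = q1"
    "\<phi> 5 (br (e 4) (e 2)) = Q1"
    "\<phi> 1 (br (e 4) (e 3)) = - q2"
    "\<phi> 2 (br (e 4) (e 3)) = q1"
    "\<phi> 1 (br (e 4) (e 5)) = - r2"
    "\<phi> 2 (br (e 4) (e 5)) = r1"
    "2 * m11 = p3 - b3 - c3"
    "2 * m22 = p3 + b3 + c3"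
    "2 * m55 = b3 - c3 - p3 - 2 * m33"
    unfolding param_defs anti_basis phi_simps
    using K123 K124 K125 K134 K135 K145 K234 K235 K245 K345 L21234 L21235 L21245 L21345 L22345 L31234 L31235 L31245 L31345 L32345 tr'
    by linarith+
qed

lemma table:
  "br (e 1) (e 2) = (- q2 - R2) *\<^sub>R e 1 + (q1 + R1) *\<^sub>R e 2 + (- p3) *\<^sub>R e 3 + (- p5) *\<^sub>R e 5"
  "br (e 3) (e 1) = (a3) *\<^sub>R e 1 + (c3) *\<^sub>R e 2 + (q1) *\<^sub>R e 3 + (Q1) *\<^sub>R e 5"
  "br (e 3) (e 2) = (b3) *\<^sub>R e 1 + (- a3) *\<^sub>R e 2 + (q2) *\<^sub>R e 3 + (Q2) *\<^sub>R e 5"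
  "br (e 5) (e 1) = (a5) *\<^sub>R e 1 + (c5) *\<^sub>R e 2 + (r1) *\<^sub>R e 3 + (R1) *\<^sub>R e 5"
  "br (e 5) (e 2) = (b5) *\<^sub>R e 1 + (- a5) *\<^sub>R e 2 + (r2) *\<^sub>R e 3 + (R2) *\<^sub>R e 5"
  "br (e 3) (e 5) = 0"
  "br (e 4) (e 1) = (m11) *\<^sub>R e 1 + (a3) *\<^sub>R e 2 + (- q2) *\<^sub>R e 3 + (- Q2) *\<^sub>R e 5"
  "br (e 4) (e 2) = (a3) *\<^sub>R e 1 + (m22) *\<^sub>R e 2 + (q1) *\<^sub>R e 3 + (Q1) *\<^sub>R e 5"
  "br (e 4) (e 3) = (- q2) *\<^sub>R e 1 + (q1) *\<^sub>R e 2 + (m33) *\<^sub>R e 3 + (m53) *\<^sub>R e 5"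
  "br (e 4) (e 5) = (- r2) *\<^sub>R e 1 + (r1) *\<^sub>R e 2 + (m35) *\<^sub>R e 3 + (m55) *\<^sub>R e 5"
  by (rule trans[OF expand5], simp add: component_relations closed4[unfolded closed1_def, rule_format] param_defs[symmetric])+

lemma anti_table:
  "br (e 2) (e 1) = - br (e 1) (e 2)"
  "br (e 1) (e 3) = - br (e 3) (e 1)"
  "br (e 2) (e 3) = - br (e 3) (e 2)"
  "br (e 1) (e 5) = - br (e 5) (e 1)"
  "br (e 2) (e 5) = - br (e 5) (e 2)"
  "br (e 5) (e 3) = - br (e 3) (e 5)"
  "br (e 1) (e 4) = - br (e 4) (e 1)"
  "br (e 2) (e 4) = - br (e 4) (e 2)"
  "br (e 3) (e 4) = - br (e 4) (e 3)"
  "br (e 5) (e 4) = - br (e 4) (e 5)"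
  by (rule br_anti)+

lemmas jacobi_eval = br_simps anti_table table phi_simps dual

text \<open>Since \<open>e 3\<close> and \<open>e 5\<close> commute, the two traceless matrices by which they act commute, that is, they
are linearly dependent.\<close>

lemma kernel_action_commutes: "b3 * c5 = b5 * c3" "a3 * c5 = a5 * c3" "a3 * b5 = a5 * b3"
proof -
  show "b3 * c5 = b5 * c3"
    using arg_cong[OF jacobi[of "e 1" "e 3" "e 5"], of "\<phi> 1"]
    by (simp add: jacobi_eval algebra_simps)
  show "a3 * c5 = a5 * c3"
    using arg_cong[OF jacobi[of "e 1" "e 3" "e 5"], of "\<phi> 2"]
    by (simp add: jacobi_eval algebra_simps)
  show "a3 * b5 = a5 * b3"
    using arg_cong[OF jacobi[of "e 2" "e 3" "e 5"], of "\<phi> 1"]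
    by (simp add: jacobi_eval algebra_simps)
qed

end

text \<open>The normalisation achieved by a rotation of the plane of \<open>e 1\<close> and \<open>e 2\<close>.\<close>

locale offdiagonal = transverse br \<phi> e for br :: "'a::real_vector \<Rightarrow> 'a \<Rightarrow> 'a" and \<phi> e +
  assumes offdiag: "a3 = 0" "a5 = 0"
begin

text \<open>The components of the Jacobi identity that are used later, in terms of the parameters.\<close>

lemma jacobi_relations:
  "- Q1 * b5 + R1 * b3 = 0"
  "Q2 * c5 - R2 * c3 = 0"
  "- 2 * Q1 * R2 + 2 * Q2 * R1 = 0"
  "- b3 * r1 + b5 * q1 = 0"
  "c3 * r2 - c5 * q2 = 0"
  "2 * q1 * r2 - 2 * q2 * r1 = 0"
  "2 * p5 * r2 + 2 * Q2 * b5 + R2 * b3 + R2 * c3 + R2 * p3 + 3 * b3 * q2 + c3 * q2 + 3 * p3 * q2 = 0"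
  "- 2 * p5 * r1 + 2 * Q1 * c5 + R1 * b3 + R1 * c3 - R1 * p3 + b3 * q1 + 3 * c3 * q1 - 3 * p3 * q1 = 0"
  "- p5 * m35 + Q1 * r1 + Q2 * r2 + R1 * q1 + R2 * q2 - m33 * p3 + p3 * p3 + 2 * q1 * q1 + 2 * q2 * q2 = 0"
  "- p5 * m55 + p5 * p3 + 2 * Q1 * R1 + 2 * Q1 * q1 + 2 * Q2 * R2 + 2 * Q2 * q2 - m53 * p3 = 0"
  "b3 * c5 - b5 * c3 = 0"
  "Q1 * r2 + R2 * q1 + 2 * q1 * q2 = 0"
  "- Q1 * r1 - R1 * q1 - b3 * c3 - c3 * c3 + c3 * m33 + c5 * m53 - 2 * q1 * q1 = 0"
  "- 2 * Q1 * m35 - b3 * q1 - 3 * c3 * q1 + 2 * m53 * r1 + 3 * p3 * q1 = 0"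
  "2 * p5 * q1 - Q1 * b3 - 3 * Q1 * c3 + 2 * Q1 * m33 - 2 * Q1 * m55 + Q1 * p3 + 2 * R1 * m53 - 2 * m53 * q1 = 0"
  "R1 * r2 + R2 * r1 + 2 * q2 * r1 = 0"
  "- 2 * R1 * r1 - b3 * c5 - c3 * c5 + c3 * m35 + c5 * m55 - 2 * q1 * r1 = 0"
  "- 2 * R1 * m35 - b3 * r1 - c3 * r1 - 2 * c5 * q1 - 2 * m33 * r1 + 2 * m35 * q1 + 2 * m55 * r1 + 3 * p3 * r1 = 0"
  "2 * p5 * r1 - 2 * Q1 * c5 + 2 * Q1 * m35 - R1 * b3 - R1 * c3 + R1 * p3 - 2 * m53 * r1 = 0"
  "Q2 * r2 + R2 * q2 + b3 * b3 + b3 * c3 + b3 * m33 + b5 * m53 + 2 * q2 * q2 = 0"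
  "- Q2 * r1 - R1 * q2 - 2 * q1 * q2 = 0"
  "- 2 * Q2 * m35 + 3 * b3 * q2 + c3 * q2 + 2 * m53 * r2 + 3 * p3 * q2 = 0"
  "2 * R2 * r2 + b3 * b5 + b3 * m35 + b5 * c3 + b5 * m55 + 2 * q2 * r2 = 0"
  "- 2 * R2 * m35 + b3 * r2 + 2 * b5 * q2 + c3 * r2 - 2 * m33 * r2 + 2 * m35 * q2 + 2 * m55 * r2 + 3 * p3 * r2 = 0"
proof -
  note ex = offdiag
  note hv = component_relations(21-23)
  show "- Q1 * b5 + R1 * b3 = 0"
    using arg_cong[OF jacobi[of "e 1" "e 2" "e 3"], of "\<phi> 1"] hv
    by (simp add: jacobi_eval ex, (algebra | (simp add: algebra_simps; fail) | (simp add: algebra_simps, algebra)))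
  show "Q2 * c5 - R2 * c3 = 0"
    using arg_cong[OF jacobi[of "e 1" "e 2" "e 3"], of "\<phi> 2"] hv
    by (simp add: jacobi_eval ex, (algebra | (simp add: algebra_simps; fail) | (simp add: algebra_simps, algebra)))
  show "- 2 * Q1 * R2 + 2 * Q2 * R1 = 0"
    using arg_cong[OF jacobi[of "e 1" "e 2" "e 3"], of "\<phi> 5"] hv
    by (simp add: jacobi_eval ex, (algebra | (simp add: algebra_simps; fail) | (simp add: algebra_simps, algebra)))
  show "- b3 * r1 + b5 * q1 = 0"
    using arg_cong[OF jacobi[of "e 1" "e 2" "e 5"], of "\<phi> 1"] hv
    by (simp add: jacobi_eval ex, (algebra | (simp add: algebra_simps; fail) | (simp add: algebra_simps, algebra)))
  show "c3 * r2 - c5 * q2 = 0"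
    using arg_cong[OF jacobi[of "e 1" "e 2" "e 5"], of "\<phi> 2"] hv
    by (simp add: jacobi_eval ex, (algebra | (simp add: algebra_simps; fail) | (simp add: algebra_simps, algebra)))
  show "2 * q1 * r2 - 2 * q2 * r1 = 0"
    using arg_cong[OF jacobi[of "e 1" "e 2" "e 5"], of "\<phi> 3"] hv
    by (simp add: jacobi_eval ex, (algebra | (simp add: algebra_simps; fail) | (simp add: algebra_simps, algebra)))
  show "2 * p5 * r2 + 2 * Q2 * b5 + R2 * b3 + R2 * c3 + R2 * p3 + 3 * b3 * q2 + c3 * q2 + 3 * p3 * q2 = 0"
    using arg_cong[OF jacobi[of "e 1" "e 2" "e 4"], of "\<phi> 1"] hv
    by (simp add: jacobi_eval ex, (algebra | (simp add: algebra_simps; fail) | (simp add: algebra_simps, algebra)))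
  show "- 2 * p5 * r1 + 2 * Q1 * c5 + R1 * b3 + R1 * c3 - R1 * p3 + b3 * q1 + 3 * c3 * q1 - 3 * p3 * q1 = 0"
    using arg_cong[OF jacobi[of "e 1" "e 2" "e 4"], of "\<phi> 2"] hv
    by (simp add: jacobi_eval ex, (algebra | (simp add: algebra_simps; fail) | (simp add: algebra_simps, algebra)))
  show "- p5 * m35 + Q1 * r1 + Q2 * r2 + R1 * q1 + R2 * q2 - m33 * p3 + p3 * p3 + 2 * q1 * q1 + 2 * q2 * q2 = 0"
    using arg_cong[OF jacobi[of "e 1" "e 2" "e 4"], of "\<phi> 3"] hv
    by (simp add: jacobi_eval ex, (algebra | (simp add: algebra_simps; fail) | (simp add: algebra_simps, algebra)))
  show "- p5 * m55 + p5 * p3 + 2 * Q1 * R1 + 2 * Q1 * q1 + 2 * Q2 * R2 + 2 * Q2 * q2 - m53 * p3 = 0"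
    using arg_cong[OF jacobi[of "e 1" "e 2" "e 4"], of "\<phi> 5"] hv
    by (simp add: jacobi_eval ex, (algebra | (simp add: algebra_simps; fail) | (simp add: algebra_simps, algebra)))
  show "b3 * c5 - b5 * c3 = 0"
    using arg_cong[OF jacobi[of "e 1" "e 3" "e 5"], of "\<phi> 1"] hv
    by (simp add: jacobi_eval ex, (algebra | (simp add: algebra_simps; fail) | (simp add: algebra_simps, algebra)))
  show "Q1 * r2 + R2 * q1 + 2 * q1 * q2 = 0"
    using arg_cong[OF jacobi[of "e 1" "e 3" "e 4"], of "\<phi> 1"] hv
    by (simp add: jacobi_eval ex, (algebra | (simp add: algebra_simps; fail) | (simp add: algebra_simps, algebra)))
  show "- Q1 * r1 - R1 * q1 - b3 * c3 - c3 * c3 + c3 * m33 + c5 * m53 - 2 * q1 * q1 = 0"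
    using arg_cong[OF jacobi[of "e 1" "e 3" "e 4"], of "\<phi> 2"] hv
    by (simp add: jacobi_eval ex, (algebra | (simp add: algebra_simps; fail) | (simp add: algebra_simps, algebra)))
  show "- 2 * Q1 * m35 - b3 * q1 - 3 * c3 * q1 + 2 * m53 * r1 + 3 * p3 * q1 = 0"
    using arg_cong[OF jacobi[of "e 1" "e 3" "e 4"], of "\<phi> 3"] hv
    by (simp add: jacobi_eval ex, (algebra | (simp add: algebra_simps; fail) | (simp add: algebra_simps, algebra)))
  show "2 * p5 * q1 - Q1 * b3 - 3 * Q1 * c3 + 2 * Q1 * m33 - 2 * Q1 * m55 + Q1 * p3 + 2 * R1 * m53 - 2 * m53 * q1 = 0"
    using arg_cong[OF jacobi[of "e 1" "e 3" "e 4"], of "\<phi> 5"] hv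
    by (simp add: jacobi_eval ex, (algebra | (simp add: algebra_simps; fail) | (simp add: algebra_simps, algebra)))
  show "R1 * r2 + R2 * r1 + 2 * q2 * r1 = 0"
    using arg_cong[OF jacobi[of "e 1" "e 5" "e 4"], of "\<phi> 1"] hv
    by (simp add: jacobi_eval ex, (algebra | (simp add: algebra_simps; fail) | (simp add: algebra_simps, algebra)))
  show "- 2 * R1 * r1 - b3 * c5 - c3 * c5 + c3 * m35 + c5 * m55 - 2 * q1 * r1 = 0"
    using arg_cong[OF jacobi[of "e 1" "e 5" "e 4"], of "\<phi> 2"] hv
    by (simp add: jacobi_eval ex, (algebra | (simp add: algebra_simps; fail) | (simp add: algebra_simps, algebra)))
  show "- 2 * R1 * m35 - b3 * r1 - c3 * r1 - 2 * c5 * q1 - 2 * m33 * r1 + 2 * m35 * q1 + 2 * m55 * r1 + 3 * p3 * r1 = 0"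
    using arg_cong[OF jacobi[of "e 1" "e 5" "e 4"], of "\<phi> 3"] hv
    by (simp add: jacobi_eval ex, (algebra | (simp add: algebra_simps; fail) | (simp add: algebra_simps, algebra)))
  show "2 * p5 * r1 - 2 * Q1 * c5 + 2 * Q1 * m35 - R1 * b3 - R1 * c3 + R1 * p3 - 2 * m53 * r1 = 0"
    using arg_cong[OF jacobi[of "e 1" "e 5" "e 4"], of "\<phi> 5"] hv
    by (simp add: jacobi_eval ex, (algebra | (simp add: algebra_simps; fail) | (simp add: algebra_simps, algebra)))
  show "Q2 * r2 + R2 * q2 + b3 * b3 + b3 * c3 + b3 * m33 + b5 * m53 + 2 * q2 * q2 = 0"
    using arg_cong[OF jacobi[of "e 2" "e 3" "e 4"], of "\<phi> 1"] hv
    by (simp add: jacobi_eval ex, (algebra | (simp add: algebra_simps; fail) | (simp add: algebra_simps, algebra)))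
  show "- Q2 * r1 - R1 * q2 - 2 * q1 * q2 = 0"
    using arg_cong[OF jacobi[of "e 2" "e 3" "e 4"], of "\<phi> 2"] hv
    by (simp add: jacobi_eval ex, (algebra | (simp add: algebra_simps; fail) | (simp add: algebra_simps, algebra)))
  show "- 2 * Q2 * m35 + 3 * b3 * q2 + c3 * q2 + 2 * m53 * r2 + 3 * p3 * q2 = 0"
    using arg_cong[OF jacobi[of "e 2" "e 3" "e 4"], of "\<phi> 3"] hv
    by (simp add: jacobi_eval ex, (algebra | (simp add: algebra_simps; fail) | (simp add: algebra_simps, algebra)))
  show "2 * R2 * r2 + b3 * b5 + b3 * m35 + b5 * c3 + b5 * m55 + 2 * q2 * r2 = 0"
    using arg_cong[OF jacobi[of "e 2" "e 5" "e 4"], of "\<phi> 1"] hv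
    by (simp add: jacobi_eval ex, (algebra | (simp add: algebra_simps; fail) | (simp add: algebra_simps, algebra)))
  show "- 2 * R2 * m35 + b3 * r2 + 2 * b5 * q2 + c3 * r2 - 2 * m33 * r2 + 2 * m35 * q2 + 2 * m55 * r2 + 3 * p3 * r2 = 0"
    using arg_cong[OF jacobi[of "e 2" "e 5" "e 4"], of "\<phi> 3"] hv
    by (simp add: jacobi_eval ex, (algebra | (simp add: algebra_simps; fail) | (simp add: algebra_simps, algebra)))
qed

end

section \<open>Non-nilpotent action on the plane\<close>

context coframe5
begin

lemma frame_via_components:
  assumes "\<And>a b c d f. a * \<phi> 1 w1 + b * \<phi> 1 w2 + c * \<phi> 1 w3 + d * \<phi> 1 w4 + f * \<phi> 1 w5 = 0 \<Longrightarrow>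
    a * \<phi> 2 w1 + b * \<phi> 2 w2 + c * \<phi> 2 w3 + d * \<phi> 2 w4 + f * \<phi> 2 w5 = 0 \<Longrightarrow>
    a * \<phi> 3 w1 + b * \<phi> 3 w2 + c * \<phi> 3 w3 + d * \<phi> 3 w4 + f * \<phi> 3 w5 = 0 \<Longrightarrow>
    a * \<phi> 4 w1 + b * \<phi> 4 w2 + c * \<phi> 4 w3 + d * \<phi> 4 w4 + f * \<phi> 4 w5 = 0 \<Longrightarrow>
    a * \<phi> 5 w1 + b * \<phi> 5 w2 + c * \<phi> 5 w3 + d * \<phi> 5 w4 + f * \<phi> 5 w5 = 0 \<Longrightarrow>
    a = 0 \<and> b = 0 \<and> c = 0 \<and> d = 0 \<and> f = 0"
  shows "frame w1 w2 w3 w4 w5"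
proof (rule frameI)
  fix a b c d f assume E: "a *\<^sub>R w1 + b *\<^sub>R w2 + c *\<^sub>R w3 + d *\<^sub>R w4 + f *\<^sub>R w5 = 0"
  have "a * \<phi> i w1 + b * \<phi> i w2 + c * \<phi> i w3 + d * \<phi> i w4 + f * \<phi> i w5 = 0" for i
    using arg_cong[OF E, of "\<phi> i"] by (simp add: phi_simps)
  then show "a = 0 \<and> b = 0 \<and> c = 0 \<and> d = 0 \<and> f = 0" by (intro assms)
qed

end

context lie5
begin

lemma frame_coframe5:
  fixes v1 :: 'a
  assumes "frame v1 v2 v3 v4 v5"
  obtains \<psi> where "coframe5 br \<psi> (family5 v1 v2 v3 v4 v5)"
proof -
  define g where "g = (\<lambda>x::real^5. (x $ 1) *\<^sub>R v1 + (x $ 2) *\<^sub>R v2 + (x $ 3) *\<^sub>R v3 + (x $ 4) *\<^sub>R v4 + (x $ 5) *\<^sub>R v5)"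
  have g: "linear g" "bij g" using frame_linear_bij[OF assms dim5] by (simp_all add: g_def)
  have inv: "g (inv g y) = y" "inv g (g x) = x" for x y
    using g(2) by (simp_all add: bij_is_surj surj_f_inv_f bij_is_inj inv_f_f)
  have li: "linear (inv g)"
  proof (rule linearI)
    fix x y c
    have "g (inv g x + inv g y) = x + y" "g (c *\<^sub>R inv g x) = c *\<^sub>R x"
      by (simp_all add: linear_add[OF g(1)] linear_cmul[OF g(1)] inv)
    then show "inv g (x + y) = inv g x + inv g y" "inv g (c *\<^sub>R x) = c *\<^sub>R inv g x"
      by (metis inv(2))+
  qed
  have ax: "inv g v1 = axis 1 1" "inv g v2 = axis 2 1" "inv g v3 = axis 3 1" "inv g v4 = axis 4 1" "inv g v5 = axis 5 1"
    using inv(2)[of "axis 1 1"] inv(2)[of "axis 2 1"] inv(2)[of "axis 3 1"] inv(2)[of "axis 4 1"] inv(2)[of "axis 5 1"]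
    by (simp_all add: g_def axis_def)
  have "coframe5_axioms (\<lambda>i x. inv g x $ i) (family5 v1 v2 v3 v4 v5)"
    unfolding coframe5_axioms_def
  proof (intro conjI allI)
    show "linear (\<lambda>x. inv g x $ i)" for i using li by (simp add: linear_iff)
    show "inv g (family5 v1 v2 v3 v4 v5 i) $ j = (if i = j then 1 else 0)" for i j
      using exhaust_5[of i] by (elim disjE) (auto simp: ax axis_def)
    show "x = (\<Sum>i\<in>UNIV. (inv g x $ i) *\<^sub>R family5 v1 v2 v3 v4 v5 i)" for x
      using inv(1)[of x] by (simp add: sum_5 g_def)
  qed
  then show ?thesis by (intro that coframe5.intro lie5_axioms)
qed

text \<open>Here \<open>z\<close> acts on the plane of \<open>x1\<close> and \<open>x2\<close> by an invertible traceless matrix, and the remaining bracket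
\<open>[z, t]\<close> is a central element that may vanish. The sign of \<open>b * c\<close> decides between real and imaginary
eigenvalues.\<close>

lemma listed_semidirect_plane:
  assumes tab: "bracket_table x1 x2 z t w 0 (- c *\<^sub>R x2) 0 0 (- b *\<^sub>R x1) 0 0 (- \<mu> *\<^sub>R w) 0 0" and nz: "b * c \<noteq> 0"
  shows "listed br"
proof -
  note T = tab[unfolded bracket_table_def]
  obtain \<psi> where "coframe5 br \<psi> (family5 x1 x2 z t w)" using frame_coframe5 T by blast
  then interpret c: coframe5 br \<psi> "family5 x1 x2 z t w" .
  have d [simp]: "\<psi> j x1 = (if 1 = j then 1 else 0)" "\<psi> j x2 = (if 2 = j then 1 else 0)" "\<psi> j z = (if 3 = j then 1 else 0)"
     "\<psi> j t = (if 4 = j then 1 else 0)" "\<psi> j w = (if 5 = j then 1 else 0)" for j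
    using c.dual[of j 1] c.dual[of j 2] c.dual[of j 3] c.dual[of j 4] c.dual[of j 5] by simp_all
  have T2: "br x1 x2 = 0" "br x1 z = - c *\<^sub>R x2" "br x1 t = 0" "br x1 w = 0" "br x2 z = - b *\<^sub>R x1" "br x2 t = 0"
    "br x2 w = 0" "br z t = - \<mu> *\<^sub>R w" "br z w = 0" "br t w = 0" using T by blast+
  note anti = br_anti[of z x1] br_anti[of x2 x1] br_anti[of t x1] br_anti[of w x1] br_anti[of z x2] br_anti[of t x2]
    br_anti[of w x2] br_anti[of t z] br_anti[of w z] br_anti[of w t]
  note ev = br_simps T2 br_anti[of t z] br_anti[of w z] br_anti[of w t] br_anti[of x2 x1] br_anti[of w x1] br_anti[of w x2]
  show ?thesis
  proof (cases "b * c > 0")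
    case True
    define k where "k = sqrt (b * c)"
    have k: "k > 0" "k * k = b * c" using True by (simp_all add: k_def)
    have b: "b \<noteq> 0" using nz by auto
    let ?u = "b *\<^sub>R x1 + k *\<^sub>R x2" and ?v = "b *\<^sub>R x1 - k *\<^sub>R x2" and ?z = "(1 / k) *\<^sub>R z"
    have u: "br ?u ?z = - ?u" "br ?v ?z = ?v"
      using k by (simp_all add: ev field_simps scaleR_right_distrib)
    show ?thesis
    proof (cases "\<mu> = 0")
      case True
      have "bracket_table ?u ?v ?z t w 0 (- ?u) 0 0 ?v 0 0 0 0 0"
        unfolding bracket_table_def
        using k b True by (intro conjI c.frame_via_components u) (auto simp: ev c.phi_simps)
      then show ?thesis by (rule listed_C4)
    next
      case False
      have "bracket_table (- (\<mu> / k) *\<^sub>R w) t ?u ?v ?z 0 0 0 0 0 0 (- (- (\<mu> / k) *\<^sub>R w)) 0 (- ?u) ?v"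
        unfolding bracket_table_def
        using k b False by (intro conjI c.frame_via_components u) (auto simp: ev c.phi_simps br_anti[of t x1] br_anti[of t x2])
      then show ?thesis by (rule listed_B4)
    qed
  next
    case False
    then have neg: "b * c < 0" using nz by linarith
    define k where "k = sqrt (- (b * c))"
    have k: "k > 0" "k * k = - (b * c)" using neg by (simp_all add: k_def)
    have c: "c \<noteq> 0" using nz by auto
    let ?v = "- (c / k) *\<^sub>R x2" and ?z = "(1 / k) *\<^sub>R z"
    have u: "br x1 ?z = ?v" "br ?v ?z = - x1"
      using k nz by (simp_all add: ev field_simps)
    show ?thesis
    proof (cases "\<mu> = 0")
      case True
      have "bracket_table x1 ?v ?z t w 0 ?v 0 0 (- x1) 0 0 0 0 0"
        unfolding bracket_table_def
        using k c True by (intro conjI c.frame_via_components u) (auto simp: ev c.phi_simps)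
      then show ?thesis by (rule listed_C3)
    next
      case False
      have "bracket_table (- (\<mu> / k) *\<^sub>R w) t x1 ?v ?z 0 0 0 0 0 0 (- (- (\<mu> / k) *\<^sub>R w)) 0 ?v (- x1)"
        unfolding bracket_table_def
        using k c False by (intro conjI c.frame_via_components u) (auto simp: ev c.phi_simps br_anti[of t x1] br_anti[of t x2])
      then show ?thesis by (rule listed_B6)
    qed
  qed
qed

text \<open>The direct sum of the Euclidean motion algebra of the plane and the affine algebra of the line.\<close>

lemma listed_rotation_affine:
  assumes tab: "bracket_table x1 x2 z t w 0 (- c *\<^sub>R x2) 0 0 (c *\<^sub>R x1) 0 0 0 0 (l *\<^sub>R w)" and nz: "c \<noteq> 0" "l \<noteq> 0"
  shows "listed br"
proof -
  note T = tab[unfolded bracket_table_def]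
  obtain \<psi> where "coframe5 br \<psi> (family5 x1 x2 z t w)" using frame_coframe5 T by blast
  then interpret c: coframe5 br \<psi> "family5 x1 x2 z t w" .
  have d [simp]: "\<psi> j x1 = (if 1 = j then 1 else 0)" "\<psi> j x2 = (if 2 = j then 1 else 0)" "\<psi> j z = (if 3 = j then 1 else 0)"
     "\<psi> j t = (if 4 = j then 1 else 0)" "\<psi> j w = (if 5 = j then 1 else 0)" for j
    using c.dual[of j 1] c.dual[of j 2] c.dual[of j 3] c.dual[of j 4] c.dual[of j 5] by simp_all
  have "bracket_table x1 x2 (- (1 / c) *\<^sub>R z) (- (1 / l) *\<^sub>R t) w 0 x2 0 0 (- x1) 0 0 0 0 (- w)"
    unfolding bracket_table_def
    using nz by (intro conjI c.frame_via_components) (auto simp: T br_simps c.phi_simps)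
  then show ?thesis by (rule listed_C5)
qed

text \<open>A Heisenberg ideal spanned by \<open>x1\<close>, \<open>x2\<close>, \<open>w\<close> on which \<open>z\<close> acts as a rotation and \<open>t\<close> as a dilation.\<close>

lemma listed_rotation_heisenberg:
  assumes tab: "bracket_table x1 x2 z t w (- p *\<^sub>R w) (- c *\<^sub>R x2) (- (p / 2) *\<^sub>R x1) 0 (c *\<^sub>R x1) (- (p / 2) *\<^sub>R x2) 0 0 0 (p *\<^sub>R w)"
    and nz: "c \<noteq> 0" "p \<noteq> 0"
  shows "listed br"
proof -
  note T = tab[unfolded bracket_table_def]
  obtain \<psi> where "coframe5 br \<psi> (family5 x1 x2 z t w)" using frame_coframe5 T by blast
  then interpret c: coframe5 br \<psi> "family5 x1 x2 z t w" .
  have d [simp]: "\<psi> j x1 = (if 1 = j then 1 else 0)" "\<psi> j x2 = (if 2 = j then 1 else 0)" "\<psi> j z = (if 3 = j then 1 else 0)"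
     "\<psi> j t = (if 4 = j then 1 else 0)" "\<psi> j w = (if 5 = j then 1 else 0)" for j
    using c.dual[of j 1] c.dual[of j 2] c.dual[of j 3] c.dual[of j 4] c.dual[of j 5] by simp_all
  have wt: "br w t = - p *\<^sub>R w" "br w x1 = 0" "br w x2 = 0" "br w z = 0" "br t z = 0"
    using T br_anti[of w t] br_anti[of w x1] br_anti[of w x2] br_anti[of w z] br_anti[of t z] by simp_all
  have "bracket_table (p *\<^sub>R w) x1 x2 ((2 / p) *\<^sub>R t) (- (1 / c) *\<^sub>R z)
      0 0 (- 2 *\<^sub>R (p *\<^sub>R w)) 0 (- (p *\<^sub>R w)) (- x1) x2 (- x2) (- x1) 0"
    unfolding bracket_table_def
    using nz by (intro conjI c.frame_via_components) (auto simp: T wt br_simps c.phi_simps)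
  then show ?thesis by (rule listed_A9)
qed

end

context coframe5
begin

lemma vec_eqI: "(\<And>k. \<phi> k x = \<phi> k y) \<Longrightarrow> x = y"
  using expand[of x] expand[of y] by simp

lemma vec_eqI5: "\<phi> 1 x = \<phi> 1 y \<Longrightarrow> \<phi> 2 x = \<phi> 2 y \<Longrightarrow> \<phi> 3 x = \<phi> 3 y \<Longrightarrow> \<phi> 4 x = \<phi> 4 y \<Longrightarrow> \<phi> 5 x = \<phi> 5 y \<Longrightarrow> x = y"
  by (rule vec_eqI) (metis exhaust_5)

end

context lie5
begin

text \<open>The three vectors span a perfect subalgebra, a real form of the simple algebra of dimension three.\<close>

lemma solvable_no_simple_triple:
  assumes solv: "solvable_lie br" and "br g x = \<beta> *\<^sub>R y" "br g y = \<gamma> *\<^sub>R x" "br x y = \<delta> *\<^sub>R g"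
    and nz: "\<beta> \<noteq> 0" "\<gamma> \<noteq> 0" "\<delta> \<noteq> 0"
  shows "x = 0"
proof -
  let ?S = "{x, y, g}" and ?B = "{br u v |u v. u \<in> {x, y, g} \<and> v \<in> {x, y, g}}"
  have "y \<in> span ?B"
  proof -
    have "(1 / \<beta>) *\<^sub>R br g x \<in> span ?B" by (intro span_scale span_base) blast
    then show ?thesis using assms by simp
  qed
  moreover have "x \<in> span ?B"
  proof -
    have "(1 / \<gamma>) *\<^sub>R br g y \<in> span ?B" by (intro span_scale span_base) blast
    then show ?thesis using assms by simp
  qed
  moreover have "g \<in> span ?B"
  proof -
    have "(1 / \<delta>) *\<^sub>R br x y \<in> span ?B" by (intro span_scale span_base) blast
    then show ?thesis using assms by simp
  qed
  ultimately have "?S \<subseteq> {0}" by (intro solvable_no_perfect_subset[OF solv]) blast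
  then show ?thesis by blast
qed

end

context offdiagonal
begin

text \<open>Here \<open>e 5\<close> acts trivially and \<open>e 3\<close> invertibly on the plane. Bracketing with \<open>e 3\<close> twice produces \<open>x1\<close>, \<open>x2\<close> and
\<open>g\<close>, proportional up to a factor \<open>k\<close> to a simple triple, so \<open>k = 0\<close>; the remaining Jacobi relations
then kill \<open>q1\<close> and \<open>q2\<close> and force the action of \<open>e 3\<close> to be a rotation.\<close>

lemma listed_if_reeb_acts_trivially:
  assumes solv: "solvable_lie br" and b5: "b5 = 0" and c5: "c5 = 0" and nz: "b3 * c3 \<noteq> 0"
  shows "listed br"
proof -
  have b: "b3 \<noteq> 0" and c: "c3 \<noteq> 0" using nz by auto
  note J = jacobi_relations
  have R: "R1 = 0" "R2 = 0" using J(1,2) b5 c5 b c by simp_all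
  have r: "r1 = 0" "r2 = 0" using J(4,5) b5 c5 b c by simp_all
  define x1 x2 where "x1 = br (e 3) (e 1)" and "x2 = br (e 3) (e 2)"
  define g where "g = br (e 1) (e 2) - (q1 / c3) *\<^sub>R x1 + (q2 / b3) *\<^sub>R x2"
  define k where "k = - p3 - q1 * q1 / c3 + q2 * q2 / b3"
  \<comment> \<open>\<open>g\<close> is \<open>[e 1, e 2]\<close> corrected so that bracketing with it preserves the span of \<open>x1\<close> and \<open>x2\<close>.\<close>
  have gx: "br g x1 = (k * c3) *\<^sub>R x2" "br g x2 = (k * b3) *\<^sub>R x1"
    by (rule vec_eqI5; simp add: g_def x1_def x2_def k_def jacobi_eval R r b5 c5 offdiag, (simp add: field_simps b c)?)+
  have xx: "br x1 x2 = (- (b3 * c3)) *\<^sub>R g"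
    by (rule vec_eqI5; simp add: g_def x1_def x2_def jacobi_eval R r b5 c5 offdiag, (simp add: field_simps b c)?)
  have "x1 \<noteq> 0"
  proof
    assume "x1 = 0"
    then have "\<phi> 2 x1 = 0" by (simp add: phi_simps)
    then show False using c by (simp add: x1_def jacobi_eval)
  qed
  then have "k = 0"
    using solvable_no_simple_triple[OF solv gx xx] b c nz by force
  then have p3: "b3 * c3 * p3 = c3 * q2 * q2 - b3 * q1 * q1" using b c by (simp add: k_def field_simps)
  have m35: "m35 = 0" using J(17) R r b5 c5 c by simp
  have qq: "q1 * q2 = 0" using J(12) R r by simp
  have J14: "- b3 * c3 - c3 * c3 + c3 * m33 - 2 * q1 * q1 = 0" using J(13) R r c5 by simp
  have J21: "b3 * b3 + b3 * c3 + b3 * m33 + 2 * q2 * q2 = 0" using J(20) R r b5 by simp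
  have J15: "- b3 * q1 - 3 * c3 * q1 + 3 * p3 * q1 = 0" using J(14) m35 r by simp
  have J23: "3 * b3 * q2 + c3 * q2 + 3 * p3 * q2 = 0" using J(22) m35 r by simp
  have q1: "q1 = 0"
  proof (rule ccontr)
    assume n: "q1 \<noteq> 0"
    then have "q2 = 0" using qq by simp
    then have "b3 * (b3 + c3 + m33) = 0" using J21 by algebra
    then have m: "m33 = - b3 - c3" using b by simp
    have "3 * p3 = b3 + 3 * c3"
    proof -
      have "q1 * (3 * p3 - b3 - 3 * c3) = 0" using J15 by algebra
      then show ?thesis using n by simp
    qed
    moreover have "b3 * (c3 * p3 + q1 * q1) = 0" using p3 \<open>q2 = 0\<close> by algebra
    then have "c3 * p3 + q1 * q1 = 0" using b by simp
    ultimately have "c3 * b3 = 0" using J14 m by algebra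
    then show False using b c by simp
  qed
  have q2: "q2 = 0"
  proof (rule ccontr)
    assume n: "q2 \<noteq> 0"
    have "c3 * (- b3 - c3 + m33) = 0" using J14 q1 by algebra
    then have m: "m33 = b3 + c3" using c by simp
    have "3 * p3 = - 3 * b3 - c3"
    proof -
      have "q2 * (3 * p3 + 3 * b3 + c3) = 0" using J23 by algebra
      then have "3 * p3 + 3 * b3 + c3 = 0" using n by simp
      then show ?thesis by simp
    qed
    moreover have "c3 * (b3 * p3 - q2 * q2) = 0" using p3 q1 by algebra
    then have "b3 * p3 - q2 * q2 = 0" using c by simp
    ultimately have "c3 * b3 = 0" using J21 m by algebra
    then show False using b c by simp
  qed
  have "c3 * (m33 - b3 - c3) = 0" "b3 * (m33 + b3 + c3) = 0" using J14 J21 q1 q2 by algebra+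
  then have m33: "m33 = 0" and bc: "b3 = - c3" using b c by auto
  have p3': "p3 = 0" using p3 q1 q2 b c by simp
  have m55: "m55 = - c3" using component_relations m33 p3' bc by simp
  have m: "m11 = 0" "m22 = 0" using component_relations m33 p3' bc by simp_all
  have p5: "p5 = 0" using J(10) R q1 q2 p3' m55 c by simp
  let ?x1 = "e 1 - (Q2 / c3) *\<^sub>R e 5" and ?x2 = "e 2 + (Q1 / c3) *\<^sub>R e 5" and ?z = "e 3 + (m53 / c3) *\<^sub>R e 5"
  have "bracket_table ?x1 ?x2 ?z (e 4) (e 5) 0 (- c3 *\<^sub>R ?x2) 0 0 (c3 *\<^sub>R ?x1) 0 0 0 0 ((- c3) *\<^sub>R e 5)"
    unfolding bracket_table_def
  proof (intro conjI)
    show "frame ?x1 ?x2 ?z (e 4) (e 5)"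
      by (rule frame_via_components) (simp add: phi_simps dual)
  qed (rule vec_eqI5; simp add: jacobi_eval R r b5 c5 offdiag q1 q2 m m33 m35 m55 p3' p5 bc c)+
  then show ?thesis by (rule listed_rotation_affine) (use c in simp_all)
qed

end

context offdiagonal
begin

text \<open>Commutation makes the action of \<open>e 3\<close> a multiple \<open>s\<close> of that of \<open>e 5\<close>, and the Jacobi identity extends
this proportionality to all the components of the brackets. Again a factor \<open>k\<close> vanishes by solvability.
With \<open>y1\<close>, \<open>y2\<close> standing for the components of \<open>[e 1, e 2]\<close> in the plane, divided by \<open>- b5\<close> and \<open>c5\<close>, the relations
reduce to the alternative called \<open>key\<close>, after which the algebra can be written down.\<close>

lemma listed_if_reeb_acts_invertibly:
  assumes solv: "solvable_lie br" and nz: "b5 * c5 \<noteq> 0"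
  shows "listed br"
proof -
  have b: "b5 \<noteq> 0" and c: "c5 \<noteq> 0" using nz by auto
  note J = jacobi_relations
  define s where "s = b3 / b5"
  have b3: "b3 = s * b5" using b by (simp add: s_def)
  have c3: "c3 = s * c5" using J(11) b c by (simp add: s_def field_simps)
  have "b5 * (q1 - s * r1) = 0" using J(4) b3 by algebra
  then have q1: "q1 = s * r1" using b by simp
  have "c5 * (q2 - s * r2) = 0" using J(5) c3 by algebra
  then have q2: "q2 = s * r2" using c by simp
  have "b5 * (Q1 - s * R1) = 0" using J(1) b3 by algebra
  then have Q1: "Q1 = s * R1" using b by simp
  have "c5 * (Q2 - s * R2) = 0" using J(2) c3 by algebra
  then have Q2: "Q2 = s * R2" using c by simp
  define y1 y2 where "y1 = (s * r2 + R2) / b5" and "y2 = (s * r1 + R1) / c5"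
  have R1: "R1 = c5 * y2 - s * r1" and R2: "R2 = b5 * y1 - s * r2" using b c by (simp_all add: y1_def y2_def)
  note S = b3 c3 q1 q2 Q1 Q2 R1 R2
  define x1 x2 where "x1 = br (e 5) (e 1)" and "x2 = br (e 5) (e 2)"
  define g where "g = br (e 1) (e 2) - y2 *\<^sub>R x1 + y1 *\<^sub>R x2"
  define k where "k = - s * p3 - p5 - c5 * y2 * y2 + b5 * y1 * y1"
  have gx: "br g x1 = (k * c5) *\<^sub>R x2" "br g x2 = (k * b5) *\<^sub>R x1"
    by (rule vec_eqI5; simp add: g_def x1_def x2_def k_def jacobi_eval S offdiag, (simp add: algebra_simps)?)+
  have xx: "br x1 x2 = (- (b5 * c5)) *\<^sub>R g"
    by (rule vec_eqI5; simp add: g_def x1_def x2_def jacobi_eval S offdiag, (simp add: algebra_simps)?)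
  have "x1 \<noteq> 0"
  proof
    assume "x1 = 0"
    then have "\<phi> 2 x1 = 0" by (simp add: phi_simps)
    then show False using c by (simp add: x1_def jacobi_eval)
  qed
  then have "k = 0"
    using solvable_no_simple_triple[OF solv gx xx] b c by force
  then have p5: "p5 = b5 * y1 * y1 - c5 * y2 * y2 - s * p3" by (simp add: k_def)
  note hv = component_relations(21-23)
  have m11: "2 * m11 = p3 - s * (b5 + c5)" and m22: "2 * m22 = p3 + s * (b5 + c5)"
    and m55: "2 * m55 = s * (b5 - c5) - p3 - 2 * m33" using hv unfolding S by algebra+
  have E1: "b5 * r1 * y1 + c5 * r2 * y2 = 0" using J(16) unfolding S by algebra
  define ll where "ll = m33 - m35 * s"
  have "c5 * (- 2 * ll - p3 - b5 * s - 3 * c5 * s - 4 * r1 * y2) = 0"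
    using J(17) m55 unfolding S ll_def by algebra
  then have D1: "- 2 * ll - p3 - b5 * s - 3 * c5 * s - 4 * r1 * y2 = 0" using c by simp
  have "b5 * (- 2 * ll - p3 + 3 * b5 * s + c5 * s + 4 * r2 * y1) = 0"
    using J(23) m55 unfolding S ll_def by algebra
  then have D2: "- 2 * ll - p3 + 3 * b5 * s + c5 * s + 4 * r2 * y1 = 0" using b by simp
  have D3: "r2 * y1 + r1 * y2 = - (b5 + c5) * s" using D1 D2 by algebra
  have m53: "m53 + m33 * s = s * (m35 * s + m55)"
  proof -
    have "c5 * (m53 + m33 * s - s * (m35 * s + m55)) = 0"
      using J(13) J(17) unfolding S by algebra
    then show ?thesis using c by simp
  qed
  have Y1: "y1 * (p3 + (b5 - c5) * s) = 0"
  proof -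
    have "b5 * (y1 * (p3 + (b5 - c5) * s)) = 0"
      using J(7) E1 D3 p5 unfolding S by algebra
    then show ?thesis using b by simp
  qed
  have Y2: "y2 * (p3 + (b5 - c5) * s) = 0"
  proof -
    have "c5 * (y2 * (p3 + (b5 - c5) * s)) = 0"
      using J(8) E1 D3 p5 unfolding S by algebra
    then show ?thesis using c by simp
  qed
  have J10: "p3 * (p3 - ll) - m35 * (b5 * y1 * y1 - c5 * y2 * y2) + 2 * s * (b5 * r2 * y1 + c5 * r1 * y2) = 0"
    using J(9) p5 unfolding S ll_def by algebra
  have J19: "r1 * (- 2 * ll + p3 - 2 * c5 * s) = c5 * m35 * y2"
    using J(18) m55 unfolding S ll_def by algebra
  have J27: "r2 * (- 2 * ll + p3 + 2 * b5 * s) = b5 * m35 * y1"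
    using J(24) m55 unfolding S ll_def by algebra
  \<comment> \<open>If \<open>y1\<close> or \<open>y2\<close> is nonzero, the quadratic relation becomes a perfect square in \<open>p3 - \<alpha>\<close>.\<close>
  have key: "(y1 = 0 \<and> y2 = 0) \<or> (s = 0 \<and> r1 = 0 \<and> r2 = 0)"
  proof (rule disjCI)
    assume ny: "\<not> (s = 0 \<and> r1 = 0 \<and> r2 = 0)"
    show "y1 = 0 \<and> y2 = 0"
    proof (rule ccontr)
      assume y: "\<not> (y1 = 0 \<and> y2 = 0)"
      then have p: "p3 = s * (c5 - b5)" using Y1 Y2 by algebra
      define \<alpha> where "\<alpha> = r2 * y1 - r1 * y2"
      have l: "ll = - p3 + \<alpha>" using D1 D2 p unfolding \<alpha>_def by algebra
      have "(p3 - \<alpha>) * (p3 - \<alpha>) = 0"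
        using J10 J19 J27 l unfolding \<alpha>_def by algebra
      then have a: "\<alpha> = p3" by simp
      have ry: "r1 * y2 = - s * c5" "r2 * y1 = - s * b5"
        using a D3 p unfolding \<alpha>_def by algebra+
      have "s * b5 * c5 * (y1 * y1 + y2 * y2) = 0"
        using ry E1 by algebra
      then have s: "s = 0" using b c y by auto
      then have "r1 * y2 = 0" "r2 * y1 = 0" using ry by simp_all
      then have "r1 = 0 \<and> r2 = 0" using E1 y b c by auto
      then show False using s ny by simp
    qed
  qed
  show ?thesis
  proof (cases "s = 0")
    case True
    have Ryz: "R1 = c5 * y2" "R2 = b5 * y1" using R1 R2 True by simp_all
    have ry: "r1 * y1 = 0" "r1 * y2 = 0" "r2 * y1 = 0" "r2 * y2 = 0" using key by auto
    have l: "ll = m33" by (simp add: ll_def True)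
    have m33: "2 * m33 = - p3" using D1 ry(2) True l by algebra
    have my: "m35 * y1 = 0" "m35 * y2 = 0" using J19 J27 key b c by auto
    have "p3 * (p3 - m33) = 0" using J10 l True my by algebra
    then have p3: "p3 = 0" using m33 by (auto simp: algebra_simps)
    then have m33: "m33 = 0" using m33 by simp
    have m: "m11 = 0" "m22 = 0" "m55 = 0" "m53 = 0" using m11 m22 m55 m53 True p3 m33 by simp_all
    let ?t = "e 4 - (r2 / (b5 * c5)) *\<^sub>R x1 + (r1 / (b5 * c5)) *\<^sub>R x2"
    define \<mu> where "\<mu> = m35 + r2 * r2 / b5 - r1 * r1 / c5"
    note simps = jacobi_eval S True offdiag p3 p5 m33 m
    have yr: "y1 = 0 \<or> r1 = 0" "y2 = 0 \<or> r1 = 0" "y1 = 0 \<or> r2 = 0" "y2 = 0 \<or> r2 = 0" "y1 = 0 \<or> m35 = 0" "y2 = 0 \<or> m35 = 0"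
      using ry my by auto
    have "bracket_table x1 x2 (e 5) ?t (e 3) 0 (- c5 *\<^sub>R x2) 0 0 (- b5 *\<^sub>R x1) 0 0 (- \<mu> *\<^sub>R e 3) 0 0"
      unfolding bracket_table_def
    proof (intro conjI)
      show "frame x1 x2 (e 5) ?t (e 3)"
        by (rule frame_via_components) (use b c in \<open>simp add: x1_def x2_def simps\<close>)
    qed (rule vec_eqI5; use b c yr in \<open>simp add: x1_def x2_def \<mu>_def simps, (auto simp: field_simps)?\<close>)+
    then show ?thesis by (rule listed_semidirect_plane) (rule nz)
  next
    case False
    then have y: "y1 = 0" "y2 = 0" using key by auto
    have "(b5 + c5) * s = 0" using D3 y by algebra
    then have "b5 + c5 = 0" using False by simp
    then have bc: "b5 = - c5" by simp
    have l: "2 * ll = - p3 - 2 * c5 * s" using D1 y bc by algebra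
    have J10': "p3 * (p3 - ll) = 0" using J10 y by algebra
    define z where "z = e 3 - s *\<^sub>R e 5"
    have m: "m33 = ll + m35 * s" "m55 = - m35 * s" "m53 = - m33 * s" "2 * m11 = p3" "2 * m22 = p3"
    proof -
      show "m33 = ll + m35 * s" by (simp add: ll_def)
      show 5: "m55 = - m35 * s" using m55 l bc unfolding ll_def by algebra
      show "m53 = - m33 * s" using m53 5 by algebra
      show "2 * m11 = p3" "2 * m22 = p3" using m11 m22 bc by algebra+
    qed
    have m': "m11 = p3 / 2" "m22 = p3 / 2" using m(4,5) by simp_all
    note simps = jacobi_eval S bc y offdiag p5 m(3) m(2) m(1) m'
    show ?thesis
    proof (cases "p3 = 0")
      case True
      then have l': "ll = - c5 * s" using l by linarith
      define \<tau> where "\<tau> = (m35 - r2 * r2 / c5 - r1 * r1 / c5) / (c5 * s)"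
      let ?x1 = "e 1 - (r2 / c5) *\<^sub>R z" and ?x2 = "e 2 + (r1 / c5) *\<^sub>R z"
      let ?t = "e 4 + (r1 / c5) *\<^sub>R ?x1 + (r2 / c5) *\<^sub>R ?x2"
      let ?z = "e 5 + \<tau> *\<^sub>R z"
      have "bracket_table ?x1 ?x2 ?z ?t z 0 (- c5 *\<^sub>R ?x2) 0 0 (c5 *\<^sub>R ?x1) 0 0 0 0 (ll *\<^sub>R z)"
        unfolding bracket_table_def
      proof (intro conjI)
        show "frame ?x1 ?x2 ?z ?t z"
          by (rule frame_via_components) (use c False in \<open>simp add: z_def phi_simps dual, algebra?\<close>)
      qed (rule vec_eqI5; use c False in \<open>simp add: z_def \<tau>_def simps True l', (simp add: field_simps)?\<close>)+
      then show ?thesis by (rule listed_rotation_affine) (use c l' False in simp_all)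
    next
      case nzp: False
      then have lp: "ll = p3" using J10' by simp
      have sc: "c5 * s = - (3 / 2) * p3" using l lp by linarith
      have r: "r1 = 0" "r2 = 0"
      proof -
        have "r1 * (2 * p3) = 0" "r2 * (2 * p3) = 0" using J19 J27 y lp l bc by algebra+
        then show "r1 = 0" "r2 = 0" using nzp by simp_all
      qed
      let ?z = "e 5 - (m35 / p3) *\<^sub>R z"
      have "bracket_table (e 1) (e 2) ?z (e 4) z (- p3 *\<^sub>R z) (- c5 *\<^sub>R e 2) (- (p3 / 2) *\<^sub>R e 1) 0
          (c5 *\<^sub>R e 1) (- (p3 / 2) *\<^sub>R e 2) 0 0 0 (p3 *\<^sub>R z)"
        unfolding bracket_table_def
      proof (intro conjI)
        show "frame (e 1) (e 2) ?z (e 4) z"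
          by (rule frame_via_components) (use c False nzp in \<open>simp add: z_def phi_simps dual, (simp add: field_simps)?\<close>)
      qed (rule vec_eqI5; use c False nzp in \<open>simp add: z_def simps lp r, (simp add: field_simps)?\<close>)+
      then show ?thesis by (rule listed_rotation_heisenberg) (use c nzp in simp_all)
    qed
  qed
qed

end

section \<open>Nilpotent action on the plane\<close>

context offdiagonal
begin

text \<open>With \<open>c3 = c5 = 0\<close> the vectors \<open>e 1\<close>, \<open>e 3\<close>, \<open>e 5\<close> commute exactly when \<open>q1\<close>, \<open>r1\<close>, \<open>Q1\<close>, \<open>R1\<close> vanish. A nonzero \<open>r1\<close> determines
almost all other parameters and leads to the filiform algebra with an abelian ideal of dimension
four; any other failure either contradicts the Jacobi relations or produces a perfect subalgebra
spanned by \<open>e 5\<close>, \<open>[e 5, e 2]\<close> and \<open>[e 1, e 2]\<close>. When the whole action on the plane is zero, the statement is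
assumed as \<open>deg\<close>: it is then achieved by a rotation.\<close>

lemma listed_filiform_or_abelian_ideal:
  assumes solv: "solvable_lie br" and c: "c3 = 0" "c5 = 0"
    and deg: "b3 = 0 \<Longrightarrow> b5 = 0 \<Longrightarrow> q1 = 0 \<and> r1 = 0 \<and> Q1 = 0 \<and> R1 = 0"
  shows "listed br \<or> (q1 = 0 \<and> r1 = 0 \<and> Q1 = 0 \<and> R1 = 0)"
proof -
  note J = jacobi_relations[unfolded c mult_zero_left mult_zero_right add_0_right diff_0_right]
  note hv = component_relations(21-23)[unfolded c]
  consider "b3 = 0" "b5 = 0" | "b3 \<noteq> 0" "b5 = 0" | "b5 \<noteq> 0" by blast
  then show ?thesis
  proof cases
    case 1
    then show ?thesis using deg by blast
  next
    case 2
    have r1: "r1 = 0" using J(4) 2 by simp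
    have R1: "R1 = 0" using J(1) 2 by simp
    have q1: "q1 = 0" using J(13) 2 r1 R1 c by (simp add: c)
    have "Q1 = 0"
    proof (rule ccontr)
      assume n: "Q1 \<noteq> 0"
      have r2: "r2 = 0" using J(12) q1 n by simp
      have R2: "R2 = 0" using J(3) R1 n by simp
      have m35: "m35 = 0" using J(14) q1 r1 n by simp
      have "Q1 * (- b3 + 2 * m33 - 2 * m55 + p3) = 0" using J(15) q1 R1 c by algebra
      then have m: "2 * m33 = b3 - p3" using n hv by simp
      have a: "q2 * (b3 + p3) = 0" using J(7) r2 2 R2 c by algebra
      have b: "b3 * b3 + b3 * m33 + 2 * q2 * q2 = 0" using J(20) r2 R2 2 c by simp
      have d: "- m33 * p3 + p3 * p3 + 2 * q2 * q2 = 0" using J(9) m35 r1 r2 R1 R2 q1 by simp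
      show False
      proof (cases "q2 = 0")
        case True
        then have "b3 * (b3 + m33) = 0" using b by algebra
        then have "m33 = - b3" using 2 by auto
        then have "p3 = 3 * b3" using m by simp
        then show False using d True \<open>m33 = - b3\<close> 2 by simp
      next
        case False
        then have p: "p3 = - b3" using a by auto
        then have "m33 = b3" using m by simp
        then have "b3 * b3 + b3 * b3 + 2 * (q2 * q2) = 0" using b by (simp add: algebra_simps)
        then have "q2 * q2 \<le> 0" using zero_le_square[of b3] by linarith
        then show False using False by (auto simp: mult_le_0_iff)
      qed
    qed
    then show ?thesis using q1 r1 R1 by simp
  next
    case 3
    define s where "s = b3 / b5"
    have b3: "b3 = s * b5" using 3 by (simp add: s_def)
    have "b5 * (q1 - s * r1) = 0" using J(4) b3 by algebra
    then have q1: "q1 = s * r1" using 3 by simp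
    have "b5 * (Q1 - s * R1) = 0" using J(1) b3 by algebra
    then have Q1: "Q1 = s * R1" using 3 by simp
    show ?thesis
    proof (cases "r1 = 0")
      case True
      then have q10: "q1 = 0" using q1 by simp
      have "R1 = 0"
      proof (rule ccontr)
        assume n: "R1 \<noteq> 0"
        have r2: "r2 = 0" using J(16) True n by simp
        have q2: "q2 = 0" using J(21) True q10 n by simp
        let ?x = "br (e 5) (e 2)" and ?y = "br (e 1) (e 2)"
        let ?S = "{e 5, ?x, ?y}" and ?B = "{br u v |u v. u \<in> {e 5, br (e 5) (e 2), br (e 1) (e 2)} \<and> v \<in> {e 5, br (e 5) (e 2), br (e 1) (e 2)}}"
        have 1: "br ?x (e 5) = (- (b5 * R1)) *\<^sub>R e 5"
          by (rule vec_eqI5; simp add: jacobi_eval offdiag c True q10 r2 q2)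
        have 2: "br (e 5) ?y = R1 *\<^sub>R ?x - (R1 * R2) *\<^sub>R e 5"
          by (rule vec_eqI5; simp add: jacobi_eval offdiag c True q10 r2 q2, (simp add: algebra_simps)?)
        have 4: "br ?x ?y = (b5 * R1) *\<^sub>R ?y + (b5 * (p3 * Q1 + p5 * R1)) *\<^sub>R e 5 + R2 *\<^sub>R br (e 5) ?y"
          by (rule vec_eqI5; simp add: jacobi_eval offdiag c True q10 r2 q2, (simp add: algebra_simps)?)
        have e5: "e 5 \<in> span ?B"
        proof -
          have "(- 1 / (b5 * R1)) *\<^sub>R br ?x (e 5) \<in> span ?B" by (intro span_scale span_base) blast
          then show ?thesis using 3 n by (simp add: 1)
        qed
        moreover have "?x \<in> span ?B"
        proof -
          have "br (e 5) ?y \<in> span ?B" by (intro span_base) blast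
          then have "(1 / R1) *\<^sub>R (br (e 5) ?y + (R1 * R2) *\<^sub>R e 5) \<in> span ?B"
            using e5 by (intro span_scale span_add)
          moreover have "br (e 5) ?y + (R1 * R2) *\<^sub>R e 5 = R1 *\<^sub>R ?x" using 2 by simp
          ultimately show ?thesis using n by simp
        qed
        moreover have "?y \<in> span ?B"
        proof -
          have "br ?x ?y \<in> span ?B" "br (e 5) ?y \<in> span ?B" by (intro span_base; blast)+
          then have "(1 / (b5 * R1)) *\<^sub>R (br ?x ?y - (b5 * (p3 * Q1 + p5 * R1)) *\<^sub>R e 5 - R2 *\<^sub>R br (e 5) ?y) \<in> span ?B"
            using e5 by (intro span_scale span_diff)
          moreover have "br ?x ?y - (b5 * (p3 * Q1 + p5 * R1)) *\<^sub>R e 5 - R2 *\<^sub>R br (e 5) ?y = (b5 * R1) *\<^sub>R ?y"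
            using 4 by simp
          ultimately show ?thesis using n 3 by simp
        qed
        ultimately have "?S \<subseteq> {0}" by (intro solvable_no_perfect_subset[OF solv]) blast
        then have "\<phi> 5 (e 5) = 0" by (simp add: phi_simps)
        then show False by (simp add: dual)
      qed
      then show ?thesis using True q10 Q1 by simp
    next
      case False
      have "r1 * (R1 + q1) = 0" using J(17) c by algebra
      then have R1: "R1 = - s * r1" using False q1 by simp
      have "r1 * (q2 - s * r2) = 0" using J(6) q1 by algebra
      then have q2: "q2 = s * r2" using False by simp
      have "r1 * (R2 + s * r2) = 0" using J(16) R1 q2 by algebra
      then have R2: "R2 = - s * r2" using False by simp
      have "r1 * (Q2 + s * s * r2) = 0" using J(21) R1 q2 q1 by algebra
      then have Q2: "Q2 = - s * s * r2" using False by simp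
      have "r1 * (p5 + s * p3) = 0" using J(8) R1 q1 b3 c by algebra
      then have p5: "p5 = - s * p3" using False by simp
      have "b5 * (m55 + s * b5 + s * m35) = 0" using J(23) R2 q2 b3 c by algebra
      then have m55: "m55 = - s * b5 - s * m35" using 3 by simp
      have l1: "2 * (m33 - s * m35) = 3 * s * b5 - p3" using hv m55 b3 by algebra
      have "r1 * (3 * p3 - 3 * s * b5 - 2 * (m33 - s * m35)) = 0" using J(18) R1 q1 b3 m55 c by algebra
      then have l2: "2 * (m33 - s * m35) = 3 * p3 - 3 * s * b5" using False by simp
      have "p3 * (p3 - (m33 - s * m35)) = 0" using J(9) p5 Q1 R1 Q2 R2 q1 q2 by algebra
      then have "p3 * p3 = 0" using l1 l2 by algebra
      then have p3: "p3 = 0" by simp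
      then have "s * b5 = 0" using l1 l2 by simp
      then have s: "s = 0" using 3 by simp
      have z: "b3 = 0" "q1 = 0" "q2 = 0" "Q1 = 0" "Q2 = 0" "R1 = 0" "R2 = 0" "p5 = 0" "m55 = 0" "m33 = 0" "m11 = 0" "m22 = 0"
        using b3 q1 q2 Q1 Q2 R1 R2 p5 m55 l1 hv s p3 by simp_all
      have m53: "m53 = 0" using J(19) z False p3 by simp
      note simps = jacobi_eval offdiag c z m53 p3
      \<comment> \<open>the successive brackets of \<open>e 5\<close> with \<open>e 4\<close>\<close>
      let ?v3 = "r2 *\<^sub>R e 1 - r1 *\<^sub>R e 2 - m35 *\<^sub>R e 3" and ?v2 = "(r1 * r2) *\<^sub>R e 3 - r1 *\<^sub>R (b5 *\<^sub>R e 1 + r2 *\<^sub>R e 3)"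
        and ?v1 = "(- (r1 * r1 * b5)) *\<^sub>R e 3"
      have "bracket_table ?v1 ?v2 ?v3 (e 4) (e 5) 0 0 0 0 0 0 (- ?v1) 0 (- ?v2) (- ?v3)"
        unfolding bracket_table_def
      proof (intro conjI)
        show "frame ?v1 ?v2 ?v3 (e 4) (e 5)"
          by (rule frame_via_components) (use 3 False in \<open>simp add: phi_simps dual\<close>)
      qed (rule vec_eqI5; simp add: simps, (simp add: algebra_simps)?)+
      then show ?thesis using listed_B2 by blast
    qed
  qed
qed

end

section \<open>Linear algebra of three-space\<close>

definition ind3 :: "real^3 \<Rightarrow> real^3 \<Rightarrow> real^3 \<Rightarrow> bool" where
  "ind3 u v w \<longleftrightarrow> (\<forall>a b c. a *\<^sub>R u + b *\<^sub>R v + c *\<^sub>R w = 0 \<longrightarrow> a = 0 \<and> b = 0 \<and> c = 0)"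

lemma ind3I: "(\<And>a b c. a *\<^sub>R u + b *\<^sub>R v + c *\<^sub>R w = 0 \<Longrightarrow> a = 0 \<and> b = 0 \<and> c = 0) \<Longrightarrow> ind3 u v w"
  unfolding ind3_def by blast

lemma ind3D: "ind3 u v w \<Longrightarrow> a *\<^sub>R u + b *\<^sub>R v + c *\<^sub>R w = 0 \<Longrightarrow> a = 0 \<and> b = 0 \<and> c = 0"
  unfolding ind3_def by blast

lemma ind3_eqD:
  assumes "ind3 u v w" "a *\<^sub>R u + b *\<^sub>R v + c *\<^sub>R w = a' *\<^sub>R u + b' *\<^sub>R v + c' *\<^sub>R w"
  shows "a = a' \<and> b = b' \<and> c = c'"
proof -
  have "(a - a') *\<^sub>R u + (b - b') *\<^sub>R v + (c - c') *\<^sub>R w = 0"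
    using assms(2) by (simp add: algebra_simps)
  from ind3D[OF assms(1) this] show ?thesis by simp
qed

definition columns3 :: "real^3 \<Rightarrow> real^3 \<Rightarrow> real^3 \<Rightarrow> real^3^3" where
  "columns3 u v w = transpose (vector [u, v, w])"

lemma columns3_mult: "columns3 u v w *v x = x $ 1 *\<^sub>R u + x $ 2 *\<^sub>R v + x $ 3 *\<^sub>R w"
  by (simp add: columns3_def vec_eq_iff forall_3 matrix_vector_mult_def transpose_def sum_3 vector_3 mult.commute)

lemma columns3_invertible:
  assumes "ind3 u v w" shows "invertible (columns3 u v w)"
proof -
  have "x = 0" if "columns3 u v w *v x = 0" for x
    using ind3D[OF assms, of "x $ 1" "x $ 2" "x $ 3"] that by (simp add: columns3_mult vec_eq_iff forall_3)
  then show ?thesis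
    using matrix_left_invertible_ker invertible_left_inverse by blast
qed

lemma ind3_expand:
  assumes "ind3 u v w"
  obtains a b c where "x = a *\<^sub>R u + b *\<^sub>R v + c *\<^sub>R w"
proof -
  obtain Q where "columns3 u v w ** Q = mat 1" using columns3_invertible[OF assms] unfolding invertible_def by blast
  then have "columns3 u v w *v (Q *v x) = x" by (simp add: matrix_vector_mul_assoc)
  then show ?thesis using that unfolding columns3_mult by metis
qed

text \<open>The trace may be computed in any basis: conjugate by the matrix whose columns are the basis vectors.\<close>

lemma trace_ind3:
  fixes A :: "real^3^3"
  assumes i: "ind3 u v w" and A: "A *v u = a1 *\<^sub>R u + a2 *\<^sub>R v + a3 *\<^sub>R w"
    "A *v v = b1 *\<^sub>R u + b2 *\<^sub>R v + b3 *\<^sub>R w" "A *v w = c1 *\<^sub>R u + c2 *\<^sub>R v + c3 *\<^sub>R w"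
  shows "trace A = a1 + b2 + c3"
proof -
  define P where "P = columns3 u v w"
  define B :: "real^3^3" where "B = transpose (vector [vector [a1, a2, a3], vector [b1, b2, b3], vector [c1, c2, c3]])"
  obtain Q where Q: "P ** Q = mat 1" "Q ** P = mat 1"
    using columns3_invertible[OF i] unfolding invertible_def P_def by blast
  have "A ** P = P ** B"
  proof -
    have "A *v (P *v x) = P *v (B *v x)" for x
    proof -
      have B: "(B *v x) $ 1 = a1 * x $ 1 + b1 * x $ 2 + c1 * x $ 3" "(B *v x) $ 2 = a2 * x $ 1 + b2 * x $ 2 + c2 * x $ 3"
        "(B *v x) $ 3 = a3 * x $ 1 + b3 * x $ 2 + c3 * x $ 3"
        by (simp_all add: B_def matrix_vector_mult_def transpose_def sum_3 vector_3)
      show ?thesis unfolding P_def columns3_mult B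
        by (simp add: matrix_vector_right_distrib matrix_vector_mult_scaleR A algebra_simps)
    qed
    then show ?thesis by (simp add: matrix_eq matrix_vector_mul_assoc[symmetric])
  qed
  then have "trace A = trace ((P ** B) ** Q)" using Q by (metis matrix_mul_assoc matrix_mul_rid)
  also have "\<dots> = trace (Q ** (P ** B))" by (rule trace_mul_sym)
  also have "\<dots> = trace B" using Q by (simp add: matrix_mul_assoc)
  also have "\<dots> = a1 + b2 + c3" by (simp add: B_def trace_def transpose_def sum_3 vector_3)
  finally show ?thesis .
qed

lemma ind3_complete2:
  fixes u v :: "real^3"
  assumes "\<And>a b. a *\<^sub>R u + b *\<^sub>R v = 0 \<Longrightarrow> a = 0 \<and> b = 0"
  obtains w where "ind3 u v w"
proof -
  have "dim {u, v} \<le> 2" using dim_le_card'[of "{u, v}"] by (simp add: card_insert_if split: if_splits)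
  then have "span {u, v} \<noteq> UNIV"
  proof (intro notI)
    assume "span {u, v} = UNIV"
    then have "dim (span {u, v}) = dim (UNIV :: (real^3) set)" by simp
    then have "dim {u, v} = 3" unfolding dim_span by simp
    with \<open>dim {u, v} \<le> 2\<close> show False by simp
  qed
  then obtain w where w: "w \<notin> span {u, v}" by blast
  have "ind3 u v w"
  proof (rule ind3I)
    fix a b c assume e: "a *\<^sub>R u + b *\<^sub>R v + c *\<^sub>R w = 0"
    have "c = 0"
    proof (rule ccontr)
      assume "c \<noteq> 0"
      have "c *\<^sub>R w = (- a) *\<^sub>R u + (- b) *\<^sub>R v" using e by (simp add: eq_neg_iff_add_eq_0 algebra_simps)
      then have "c *\<^sub>R w \<in> span {u, v}" by (simp add: span_add span_scale span_base span_neg span_diff)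
      then have "(1 / c) *\<^sub>R (c *\<^sub>R w) \<in> span {u, v}" by (rule span_scale)
      then show False using w \<open>c \<noteq> 0\<close> by simp
    qed
    then show "a = 0 \<and> b = 0 \<and> c = 0" using e assms[of a b] by simp
  qed
  then show ?thesis by (rule that)
qed

lemma ind3_complete1:
  fixes u :: "real^3"
  assumes "u \<noteq> 0"
  obtains v w where "ind3 u v w"
proof -
  have "\<exists>v. v \<notin> span {u}"
  proof (rule ccontr)
    assume "\<not> ?thesis"
    then have "span {u} = UNIV" by blast
    then have "dim (span {u}) = dim (UNIV :: (real^3) set)" by simp
    then have "dim {u} = 3" unfolding dim_span by simp
    then show False using dim_le_card'[of "{u}"] by simp
  qed
  then obtain v where v: "v \<notin> span {u}" by blast
  have "a = 0 \<and> b = 0" if e: "a *\<^sub>R u + b *\<^sub>R v = 0" for a b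
  proof -
    have "b = 0"
    proof (rule ccontr)
      assume "b \<noteq> 0"
      have "b *\<^sub>R v = (- a) *\<^sub>R u" using e by (simp add: eq_neg_iff_add_eq_0 algebra_simps)
      then have "b *\<^sub>R v \<in> span {u}" by (simp add: span_scale span_base span_neg)
      then have "(1 / b) *\<^sub>R (b *\<^sub>R v) \<in> span {u}" by (rule span_scale)
      then show False using v \<open>b \<noteq> 0\<close> by simp
    qed
    then show ?thesis using e assms by simp
  qed
  then show ?thesis using that ind3_complete2[of u v] by metis
qed

text \<open>For traceless matrices the characteristic polynomial is the depressed cubic with these coefficients.\<close>

lemma cayley_hamilton_3:
  fixes A :: "real^3^3"
  assumes "trace A = 0"
  shows "A *v (A *v (A *v x)) = (trace (A ** A) / 2) *\<^sub>R (A *v x) + det A *\<^sub>R x"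
proof -
  have A33: "A $ 3 $ 3 = - A $ 1 $ 1 - A $ 2 $ 2" using assms by (simp add: trace_def sum_3)
  show ?thesis
    by (simp add: vec_eq_iff forall_3 matrix_vector_mult_def matrix_matrix_mult_def trace_def sum_3 det_3 A33)
      (simp add: field_simps)
qed

lemma trace_cube:
  fixes A :: "real^3^3"
  assumes "trace A = 0"
  shows "trace (A ** (A ** A)) = 3 * det A"
proof -
  have A33: "A $ 3 $ 3 = - A $ 1 $ 1 - A $ 2 $ 2" using assms by (simp add: trace_def sum_3)
  show ?thesis
    by (simp add: matrix_matrix_mult_def trace_def sum_3 det_3 A33) (simp add: field_simps)
qed

lemma singular_kernel:
  fixes A :: "real^'n^'n"
  assumes "det A = 0"
  obtains x where "x \<noteq> 0" "A *v x = 0"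
proof -
  have "\<not> invertible A" using assms invertible_det_nz by blast
  then show ?thesis using that matrix_left_invertible_ker invertible_left_inverse by blast
qed

text \<open>A cubic has a real root, and a multiple root \<open>f\<close> of a depressed cubic leaves \<open>- 2 * f\<close> as a simple one
unless \<open>f = 0\<close>, when the polynomial is a pure cube.\<close>

lemma simple_root_depressed_cubic:
  fixes a b :: real
  assumes "a \<noteq> 0 \<or> b \<noteq> 0"
  obtains f where "f ^ 3 + a * f + b = 0" "3 * f ^ 2 + a \<noteq> 0"
proof -
  let ?p = "\<lambda>t::real. t ^ 3 + a * t + b"
  define R where "R = 1 + \<bar>a\<bar> + \<bar>b\<bar>"
  have R1: "R \<ge> 1" by (simp add: R_def)
  have R2: "R ^ 2 \<ge> R" using R1 by (simp add: power2_eq_square)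
  have "R ^ 3 = R * R ^ 2" by (simp add: power3_eq_cube power2_eq_square)
  have R3: "R ^ 3 \<ge> (1 + \<bar>a\<bar> + \<bar>b\<bar>) * R"
    using R1 R2 unfolding R_def[symmetric] by (simp add: power3_eq_cube power2_eq_square mult_left_mono)
  have ab: "\<bar>a * R\<bar> + \<bar>b\<bar> \<le> (\<bar>a\<bar> + \<bar>b\<bar>) * R"
    using R1 mult_right_mono[of 1 R "\<bar>b\<bar>"] by (simp add: abs_mult algebra_simps)
  have e: "(1 + \<bar>a\<bar> + \<bar>b\<bar>) * R = R + (\<bar>a\<bar> + \<bar>b\<bar>) * R" "(- R) ^ 3 = - (R ^ 3)" "a * - R = - (a * R)"
    by (simp_all add: algebra_simps)
  have "?p R \<ge> 0" "?p (- R) \<le> 0"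
    using R3 ab R1 unfolding e by linarith+
  then obtain f where f: "?p f = 0"
    using IVT'[of ?p "- R" 0 R] R1 by (force intro!: continuous_intros)
  show ?thesis
  proof (cases "3 * f ^ 2 + a = 0")
    case False then show ?thesis using f that by blast
  next
    case True
    then have a: "a = - 3 * f ^ 2" by simp
    then have b: "b = 2 * f ^ 3" using f by (simp add: power3_eq_cube power2_eq_square)
    then have "f \<noteq> 0" using a assms by auto
    have "?p (- 2 * f) = 0" "3 * (- 2 * f) ^ 2 + a \<noteq> 0"
      using a b \<open>f \<noteq> 0\<close> by (simp_all add: power3_eq_cube power2_eq_square)
    then show ?thesis by (rule that)
  qed
qed

section \<open>An abelian ideal of dimension three: nonabelian complement\<close>

lemma frame_perm:
  assumes "frame a b c d e"
  shows "frame a d b c e" "frame a b d e c" "frame a d b e c"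
proof -
  show "frame a d b c e"
  proof (rule frameI)
    fix x y z s t assume "x *\<^sub>R a + y *\<^sub>R d + z *\<^sub>R b + s *\<^sub>R c + t *\<^sub>R e = 0"
    then have "x *\<^sub>R a + z *\<^sub>R b + s *\<^sub>R c + y *\<^sub>R d + t *\<^sub>R e = 0" by (simp add: ac_simps)
    from frameD[OF assms this] show "x = 0 \<and> y = 0 \<and> z = 0 \<and> s = 0 \<and> t = 0" by simp
  qed
  show "frame a b d e c"
  proof (rule frameI)
    fix x y z s t assume "x *\<^sub>R a + y *\<^sub>R b + z *\<^sub>R d + s *\<^sub>R e + t *\<^sub>R c = 0"
    then have "x *\<^sub>R a + y *\<^sub>R b + t *\<^sub>R c + z *\<^sub>R d + s *\<^sub>R e = 0" by (simp add: ac_simps)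
    from frameD[OF assms this] show "x = 0 \<and> y = 0 \<and> z = 0 \<and> s = 0 \<and> t = 0" by simp
  qed
  show "frame a d b e c"
  proof (rule frameI)
    fix x y z s t assume "x *\<^sub>R a + y *\<^sub>R d + z *\<^sub>R b + s *\<^sub>R e + t *\<^sub>R c = 0"
    then have "x *\<^sub>R a + z *\<^sub>R b + t *\<^sub>R c + y *\<^sub>R d + s *\<^sub>R e = 0" by (simp add: ac_simps)
    from frameD[OF assms this] show "x = 0 \<and> y = 0 \<and> z = 0 \<and> s = 0 \<and> t = 0" by simp
  qed
qed

text \<open>An abelian ideal \<open>\<iota> x\<close>, acted on by \<open>S\<close> and \<open>T\<close> through traceless matrices, with \<open>[T, S]\<close> a multiple of \<open>S\<close>. In the
application \<open>\<iota>\<close> has the basis \<open>e 1, e 3, e 5\<close>, and \<open>S\<close>, \<open>T\<close> are \<open>e 2\<close> and \<open>e 4\<close>. The last two assumptions are all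
that is left of the hypo equations: they say that the first column of \<open>M\<close> and the second of \<open>F\<close>, and
likewise the first row of \<open>M\<close> and the second of \<open>F\<close>, agree up to terms in \<open>h\<close>.\<close>

locale semidirect3 = lie5 br for br :: "'a::real_vector \<Rightarrow> 'a \<Rightarrow> 'a" +
  fixes \<iota> :: "real^3 \<Rightarrow> 'a" and S T :: 'a and F M :: "real^3^3" and h :: real
  assumes lin_iota: "linear \<iota>"
    and direct: "\<And>x s t. \<iota> x + s *\<^sub>R S + t *\<^sub>R T = 0 \<Longrightarrow> x = 0 \<and> s = 0 \<and> t = 0"
    and br_S: "\<And>x. br S (\<iota> x) = \<iota> (F *v x)" and br_T: "\<And>x. br T (\<iota> x) = \<iota> (M *v x)"
    and abelian: "\<And>x y. br (\<iota> x) (\<iota> y) = 0" and br_TS: "br T S = h *\<^sub>R S"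
    and trF: "trace F = 0" and trM: "trace M = 0"
    and hypo_col: "M *v axis 1 1 = F *v axis 2 1 + h *\<^sub>R axis 1 1"
    and hypo_row: "\<And>x. (M *v x) $ 1 + h * x $ 1 = (F *v x) $ 2"
begin

lemmas iota_simps = linear_add[OF lin_iota] linear_diff[OF lin_iota] linear_cmul[OF lin_iota] linear_neg[OF lin_iota] linear_0[OF lin_iota]

lemma inj_iota: "\<iota> x = \<iota> y \<Longrightarrow> x = y"
  using direct[of "x - y" 0 0] by (simp add: iota_simps)

lemma mv_simps: "A *v (x + y) = A *v x + A *v y" "A *v (x - y) = A *v x - A *v y" "A *v (c *\<^sub>R x) = c *\<^sub>R (A *v x)" "A *v (- x) = - (A *v x)"
  "(A + B) *v x = A *v x + B *v x" "(c *\<^sub>R A) *v x = c *\<^sub>R (A *v x)" "(A - B) *v x = A *v x - B *v x" "A *v 0 = 0"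
  for A B :: "real^3^3"
  by (simp_all add: vec_eq_iff matrix_vector_mult_def sum_3 algebra_simps)

text \<open>The Jacobi identity for \<open>S\<close>, \<open>T\<close> and the ideal.\<close>

lemma commutator: "M *v (F *v x) = F *v (M *v x) + h *\<^sub>R (F *v x)"
proof (rule inj_iota)
  show "\<iota> (M *v (F *v x)) = \<iota> (F *v (M *v x) + h *\<^sub>R (F *v x))"
    using jacobi[of T S "\<iota> x"] by (simp add: br_S br_T br_TS br_simps iota_simps algebra_simps)
qed

lemma br_rev: "br (\<iota> x) S = - \<iota> (F *v x)" "br (\<iota> x) T = - \<iota> (M *v x)" "br S T = - h *\<^sub>R S"
  using br_anti[of "\<iota> x" S] br_anti[of "\<iota> x" T] br_anti[of S T] by (simp_all add: br_S br_T br_TS)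

lemmas br_all = br_simps br_S br_T br_TS abelian br_rev iota_simps

lemma frame_iota:
  assumes i: "ind3 u v w" and d: "\<alpha> * \<delta> - \<beta> * \<gamma> \<noteq> 0"
  shows "frame (\<iota> u) (\<iota> v) (\<iota> w) (\<alpha> *\<^sub>R S + \<beta> *\<^sub>R T) (\<gamma> *\<^sub>R S + \<delta> *\<^sub>R T)"
proof (rule frameI)
  fix a b c s t assume "a *\<^sub>R \<iota> u + b *\<^sub>R \<iota> v + c *\<^sub>R \<iota> w + s *\<^sub>R (\<alpha> *\<^sub>R S + \<beta> *\<^sub>R T) + t *\<^sub>R (\<gamma> *\<^sub>R S + \<delta> *\<^sub>R T) = 0"
  then have "\<iota> (a *\<^sub>R u + b *\<^sub>R v + c *\<^sub>R w) + (s * \<alpha> + t * \<gamma>) *\<^sub>R S + (s * \<beta> + t * \<delta>) *\<^sub>R T = 0"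
    by (simp add: iota_simps algebra_simps)
  note z = direct[OF this]
  have "s * \<alpha> + t * \<gamma> = 0" "s * \<beta> + t * \<delta> = 0" using z by blast+
  then have "s * (\<alpha> * \<delta> - \<beta> * \<gamma>) = 0" "t * (\<alpha> * \<delta> - \<beta> * \<gamma>) = 0" by algebra+
  then show "a = 0 \<and> b = 0 \<and> c = 0 \<and> s = 0 \<and> t = 0" using d ind3D[OF i] z by simp
qed

text \<open>From \<open>M ** F - F ** M = h *\<^sub>R F\<close> and \<open>h \<noteq> 0\<close> the powers of \<open>F\<close> are traceless, so \<open>F\<close> is nilpotent, here a single
Jordan block. The chain \<open>z, F z, F (F z)\<close> consists of generalised eigenvectors of \<open>M\<close> with eigenvalues
in arithmetic progression, \<open>- h, 0, h\<close> by tracelessness, and \<open>M\<close> can be diagonalised along with it.\<close>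

lemma listed_nilradical_filiform:
  assumes h: "h \<noteq> 0" and z: "F *v (F *v z) \<noteq> 0"
  shows "listed br"
proof -
  have MF: "M ** F = F ** M + h *\<^sub>R F"
    by (simp add: matrix_eq matrix_vector_mul_assoc[symmetric] mv_simps commutator)
  have "h * trace (F ** F) = 0"
  proof -
    have "M ** F ** F = (F ** M) ** F + h *\<^sub>R (F ** F)"
      by (simp add: matrix_eq matrix_vector_mul_assoc[symmetric] mv_simps commutator)
    then have "trace (M ** F ** F) = trace ((F ** M) ** F) + trace (h *\<^sub>R (F ** F))"
      by (simp add: trace_add)
    moreover have "trace (M ** F ** F) = trace (F ** M ** F)"
      using trace_mul_sym[of "M ** F" F] by (simp add: matrix_mul_assoc)
    ultimately show ?thesis by (simp add: trace_def sum_3 algebra_simps)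
  qed
  then have t2: "trace (F ** F) = 0" using h by simp
  have "h * trace (F ** (F ** F)) = 0"
  proof -
    have "M ** (F ** F ** F) = (F ** M) ** (F ** F) + h *\<^sub>R (F ** (F ** F))"
      by (simp add: matrix_eq matrix_vector_mul_assoc[symmetric] mv_simps commutator)
    then have "trace (M ** (F ** F ** F)) = trace ((F ** M) ** (F ** F)) + trace (h *\<^sub>R (F ** (F ** F)))"
      by (simp add: trace_add)
    moreover have "trace (M ** (F ** F ** F)) = trace ((F ** M) ** (F ** F))"
      using trace_mul_sym[of "M ** (F ** F)" F] by (simp add: matrix_mul_assoc)
    ultimately show ?thesis by (simp add: trace_def sum_3 algebra_simps)
  qed
  then have "det F = 0" using h trace_cube[OF trF] by simp
  then have cube: "F *v (F *v (F *v x)) = 0" for x using cayley_hamilton_3[OF trF, of x] t2 by simp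
  let ?a = "F *v (F *v z)" and ?b = "F *v z"
  have ind: "ind3 ?a ?b z"
  proof (rule ind3I)
    fix a b c assume e: "a *\<^sub>R ?a + b *\<^sub>R ?b + c *\<^sub>R z = 0"
    from arg_cong[OF e, of "\<lambda>x. F *v (F *v x)"] have c: "c = 0" using z by (simp add: mv_simps cube)
    from arg_cong[OF e, of "\<lambda>x. F *v x"] have b: "b = 0" using z c by (simp add: mv_simps cube)
    show "a = 0 \<and> b = 0 \<and> c = 0" using e b c z by simp
  qed
  obtain b a l where Mz: "M *v z = b *\<^sub>R ?a + a *\<^sub>R ?b + l *\<^sub>R z" using ind3_expand[OF ind] by blast
  have Mb: "M *v ?b = a *\<^sub>R ?a + (l + h) *\<^sub>R ?b" using commutator[of z] by (simp add: Mz mv_simps cube algebra_simps)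
  have Ma: "M *v ?a = (l + 2 * h) *\<^sub>R ?a" using commutator[of ?b] by (simp add: Mb mv_simps cube vec_eq_iff algebra_simps)
  have "trace M = (l + 2 * h) + (l + h) + l"
    by (rule trace_ind3[OF ind, of M "l + 2 * h" 0 0 a "l + h" 0 b a l]) (simp_all add: Ma Mb Mz)
  then have l: "l = - h" using trM by simp
  \<comment> \<open>\<open>p\<close> and \<open>q\<close> turn \<open>z\<close> into a genuine eigenvector of \<open>M\<close>.\<close>
  define p q where "p = - a / h" and "q = - (b + p * a) / (2 * h)"
  define y where "y = z + p *\<^sub>R ?b + q *\<^sub>R ?a"
  have Fy: "F *v (F *v y) = ?a" by (simp add: y_def mv_simps cube)
  have My: "M *v y = - h *\<^sub>R y"
  proof -
    have e: "M *v y = (b + p * a + q * h) *\<^sub>R ?a + a *\<^sub>R ?b - h *\<^sub>R z"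
      by (simp add: y_def mv_simps Mz Ma Mb l vec_eq_iff algebra_simps)
    have c: "b + p * a + q * h = - h * q" and a: "a = - h * p" using h by (simp_all add: p_def q_def field_simps)
    show ?thesis unfolding e c by (subst a, simp add: y_def algebra_simps)
  qed
  have MFy: "M *v (F *v y) = 0" using commutator[of y] by (simp add: My mv_simps)
  have MFFy: "M *v (F *v (F *v y)) = h *\<^sub>R (F *v (F *v y))" using commutator[of "F *v y"] by (simp add: MFy mv_simps)
  have ind': "ind3 (F *v (F *v y)) (- (F *v y)) y"
  proof (rule ind3I)
    fix a b c assume e: "a *\<^sub>R (F *v (F *v y)) + b *\<^sub>R - (F *v y) + c *\<^sub>R y = 0"
    have ny: "F *v (F *v y) \<noteq> 0" using z Fy by simp
    from arg_cong[OF e, of "\<lambda>x. F *v (F *v x)"] have c: "c = 0" using ny by (simp add: mv_simps cube)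
    from arg_cong[OF e, of "\<lambda>x. F *v x"] have b: "b = 0" using ny c by (simp add: mv_simps cube)
    show "a = 0 \<and> b = 0 \<and> c = 0" using e b c ny by simp
  qed
  have "frame (\<iota> (F *v (F *v y))) (\<iota> (- (F *v y))) (\<iota> y) (1 *\<^sub>R S + 0 *\<^sub>R T) (0 *\<^sub>R S + (- 1 / h) *\<^sub>R T)"
    by (rule frame_iota[OF ind']) (use h in simp)
  then have "bracket_table (\<iota> (F *v (F *v y))) (\<iota> (- (F *v y))) (\<iota> y) S ((- 1 / h) *\<^sub>R T)
     0 0 0 (\<iota> (F *v (F *v y))) 0 (\<iota> (F *v (F *v y))) 0 (\<iota> (- (F *v y))) (- \<iota> y) S"
    unfolding bracket_table_def using h by (simp add: br_all mv_simps cube My MFy MFFy)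
  then show ?thesis by (rule listed_A6)
qed

text \<open>Here \<open>F\<close> has square zero and is nonzero by the row and column relations. On \<open>y0\<close>, \<open>v = F y0\<close> and a second
kernel vector \<open>u\<close> the matrix \<open>M\<close> has eigenvalues \<open>l\<close>, \<open>l + h\<close> and \<open>- 2 * l - h\<close>. Only the relations coming from
the hypo equations restrict \<open>l\<close>, to the two values \<open>h\<close> and \<open>- 2 * h\<close>.\<close>

lemma listed_nilradical_heisenberg:
  assumes h: "h \<noteq> 0" and sq: "\<And>x. F *v (F *v x) = 0"
  shows "listed br"
proof -
  have F0: "\<exists>y. F *v y \<noteq> 0"
  proof (rule ccontr)
    assume "\<not> ?thesis"
    then have z: "F *v x = 0" for x by blast
    have "(M *v axis 1 1) $ 1 = h" "(M *v axis 1 1) $ 1 + h = 0"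
      using hypo_col hypo_row[of "axis 1 1"] by (simp_all add: z axis_def)
    then show False using h by simp
  qed
  then obtain y0 where y0: "F *v y0 \<noteq> 0" by blast
  define v where "v = F *v y0"
  have v: "v \<noteq> 0" "F *v v = 0" using y0 sq by (simp_all add: v_def)
  obtain u0 where i0: "ind3 y0 v u0"
  proof (rule ind3_complete2[of y0 v])
    fix a b assume e: "a *\<^sub>R y0 + b *\<^sub>R v = 0"
    from arg_cong[OF e, of "\<lambda>x. F *v x"] have "a = 0" using v by (simp add: mv_simps v_def[symmetric])
    then show "a = 0 \<and> b = 0" using e v by simp
  qed
  obtain \<alpha> \<beta> \<gamma> where Fu0: "F *v u0 = \<alpha> *\<^sub>R y0 + \<beta> *\<^sub>R v + \<gamma> *\<^sub>R u0" using ind3_expand[OF i0] by blast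
  have "F *v (F *v u0) = (\<gamma> * \<alpha>) *\<^sub>R y0 + (\<alpha> + \<gamma> * \<beta>) *\<^sub>R v + (\<gamma> * \<gamma>) *\<^sub>R u0"
    by (simp add: Fu0 mv_simps v v_def[symmetric] algebra_simps)
  then have "(\<gamma> * \<alpha>) *\<^sub>R y0 + (\<alpha> + \<gamma> * \<beta>) *\<^sub>R v + (\<gamma> * \<gamma>) *\<^sub>R u0 = 0" by (simp add: sq)
  from ind3D[OF i0 this] have ag: "\<gamma> = 0" "\<alpha> = 0" by auto
  define u where "u = u0 - \<beta> *\<^sub>R y0"
  have Fu: "F *v u = 0" by (simp add: u_def mv_simps Fu0 ag v_def[symmetric])
  have i: "ind3 y0 v u"
  proof (rule ind3I)
    fix a b c assume "a *\<^sub>R y0 + b *\<^sub>R v + c *\<^sub>R u = 0"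
    then have "(a - c * \<beta>) *\<^sub>R y0 + b *\<^sub>R v + c *\<^sub>R u0 = 0" by (simp add: u_def algebra_simps)
    from ind3D[OF i0 this] show "a = 0 \<and> b = 0 \<and> c = 0" by auto
  qed
  obtain l a b where My0: "M *v y0 = l *\<^sub>R y0 + a *\<^sub>R v + b *\<^sub>R u" using ind3_expand[OF i] by blast
  have Mv: "M *v v = (l + h) *\<^sub>R v"
    using commutator[of y0] by (simp add: My0 mv_simps v Fu v_def[symmetric] algebra_simps)
  obtain c d g where Mu: "M *v u = c *\<^sub>R y0 + d *\<^sub>R v + g *\<^sub>R u" using ind3_expand[OF i] by blast
  have "c *\<^sub>R v = 0" using commutator[of u] by (simp add: Mu mv_simps v Fu v_def[symmetric])
  then have c: "c = 0" using v by simp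
  have "trace M = l + (l + h) + g"
    by (rule trace_ind3[OF i, of M l a b 0 "l + h" 0 c d g]) (simp_all add: My0 Mv Mu)
  then have g: "g = - 2 * l - h" using trM by simp
  \<comment> \<open>Unless \<open>l\<close> is one of the two values, \<open>axis 1 1\<close> has no component along \<open>y0\<close>, and \<open>v\<close> none along it.\<close>
  have lh: "l = h \<or> l = - 2 * h"
  proof (rule ccontr)
    assume n: "\<not> ?thesis"
    obtain p q r where e1: "axis 1 1 = p *\<^sub>R y0 + q *\<^sub>R v + r *\<^sub>R u" using ind3_expand[OF i] by blast
    obtain p' q' r' where e2: "axis 2 1 = p' *\<^sub>R y0 + q' *\<^sub>R v + r' *\<^sub>R u" using ind3_expand[OF i] by blast
    have Fe1: "F *v axis 1 1 = p *\<^sub>R v" and Fe2: "F *v axis 2 1 = p' *\<^sub>R v"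
      by (simp_all add: e1 e2 mv_simps v Fu v_def[symmetric])
    have "(p * l) *\<^sub>R y0 + (p * a + q * (l + h) + r * d) *\<^sub>R v + (p * b + r * g) *\<^sub>R u
        = (h * p) *\<^sub>R y0 + (p' + h * q) *\<^sub>R v + (h * r) *\<^sub>R u"
      using hypo_col unfolding Fe2 unfolding e1 by (simp add: mv_simps My0 Mv Mu c algebra_simps)
    from ind3_eqD[OF i this] have "p * (l - h) = 0" by (simp add: algebra_simps)
    then have p: "p = 0" using n by simp
    have "v $ 1 * (l + 2 * h) = 0" using hypo_row[of v] by (simp add: Mv v algebra_simps)
    then have v1: "v $ 1 = 0" using n by auto
    have "(F *v axis 1 1) $ 2 = 0" "(F *v axis 2 1) $ 1 = 0" by (simp_all add: Fe1 Fe2 p v1)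
    then have "(M *v axis 1 1) $ 1 = h" "(M *v axis 1 1) $ 1 + h = 0"
      using hypo_col hypo_row[of "axis 1 1"] by (simp_all add: axis_def)
    then show False using h by simp
  qed
  have nz: "3 * l + h \<noteq> 0" "3 * l + 2 * h \<noteq> 0" using lh h by auto
  define k where "k = d / (g - l - h)"
  have gk: "g - l - h \<noteq> 0" using nz g by simp
  define u' where "u' = u + k *\<^sub>R v"
  have Mu': "M *v u' = g *\<^sub>R u'"
  proof -
    have "d + k * (l + h) = g * k" using gk by (simp add: k_def field_simps)
    then have "(d + k * (l + h)) *\<^sub>R v = (g * k) *\<^sub>R v" by simp
    then show ?thesis by (simp add: u'_def mv_simps Mu c Mv algebra_simps)
  qed
  \<comment> \<open>The denominators are differences of eigenvalues of \<open>M\<close>, nonzero by the restriction on \<open>l\<close>.\<close>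
  define p q where "p = - (a - b * k) / h" and "q = b / (3 * l + h)"
  define y where "y = y0 + p *\<^sub>R v + q *\<^sub>R u'"
  have My: "M *v y = l *\<^sub>R y"
  proof -
    have "M *v y0 = l *\<^sub>R y0 + (a - b * k) *\<^sub>R v + b *\<^sub>R u'" by (simp add: My0 u'_def algebra_simps)
    then have e: "M *v y = l *\<^sub>R y0 + ((a - b * k) + p * (l + h)) *\<^sub>R v + (b + q * g) *\<^sub>R u'"
      by (simp add: y_def mv_simps Mv Mu' algebra_simps)
    have c: "(a - b * k) + p * (l + h) = l * p" using h by (simp add: p_def field_simps)
    have d: "b + q * g = l * q" using nz unfolding g q_def by (simp add: field_simps)
    show ?thesis unfolding e c d by (simp add: y_def algebra_simps)
  qed
  have Fu': "F *v u' = 0" by (simp add: u'_def mv_simps Fu v)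
  have Fy: "F *v y = v" by (simp add: y_def mv_simps Fu' v v_def[symmetric])
  have ind: "ind3 v y u'"
  proof (rule ind3I)
    fix p q r assume e: "p *\<^sub>R v + q *\<^sub>R y + r *\<^sub>R u' = 0"
    from arg_cong[OF e, of "\<lambda>x. F *v x"] have q: "q = 0" using v by (simp add: mv_simps Fy Fu')
    then have "0 *\<^sub>R y0 + (p + r * k) *\<^sub>R v + r *\<^sub>R u = 0" using e by (simp add: u'_def algebra_simps)
    from ind3D[OF i this] show "p = 0 \<and> q = 0 \<and> r = 0" using q by auto
  qed
  have "frame (\<iota> v) (\<iota> y) (\<iota> u') (1 *\<^sub>R S + 0 *\<^sub>R T) (0 *\<^sub>R S + (- 1 / h) *\<^sub>R T)"
    by (rule frame_iota[OF ind]) (use h in simp)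
  then have fr: "frame (\<iota> v) S (\<iota> y) (\<iota> u') ((- 1 / h) *\<^sub>R T)" using frame_perm(1) by simp
  from lh show ?thesis
  proof
    assume l: "l = h"
    have "bracket_table (\<iota> v) S (\<iota> y) (\<iota> u') ((- 1 / h) *\<^sub>R T)
      0 0 0 (2 *\<^sub>R \<iota> v) (\<iota> v) 0 S 0 (\<iota> y) (- 3 *\<^sub>R \<iota> u')"
      unfolding bracket_table_def using h fr by (simp add: br_all mv_simps My Mv Mu' Fy Fu' v l g)
    then show ?thesis using listed_A4[of "\<iota> v" S "\<iota> y" "\<iota> u'"] by simp
  next
    assume l: "l = - 2 * h"
    have "bracket_table (\<iota> v) S (\<iota> y) (\<iota> u') ((- 1 / h) *\<^sub>R T)
      0 0 0 (- \<iota> v) (\<iota> v) 0 S 0 (- 2 *\<^sub>R \<iota> y) (3 *\<^sub>R \<iota> u')"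
      unfolding bracket_table_def using h fr by (simp add: br_all mv_simps My Mv Mu' Fy Fu' v l g)
    then show ?thesis using listed_A5[of "\<iota> v" S "\<iota> y" "\<iota> u'"] by simp
  qed
qed

end

section \<open>An abelian ideal of dimension three: abelian complement\<close>

lemma char_poly_3:
  fixes A :: "real^3^3"
  assumes "trace A = 0"
  shows "det (A - f *\<^sub>R mat 1) = - (f ^ 3 + (- (trace (A ** A) / 2)) * f + (- det A))"
proof -
  have A33: "A $ 3 $ 3 = - A $ 1 $ 1 - A $ 2 $ 2" using assms by (simp add: trace_def sum_3)
  show ?thesis
    by (simp add: matrix_matrix_mult_def trace_def sum_3 det_3 A33 mat_def power3_eq_cube) (simp add: field_simps)
qed

locale split_semidirect3 = semidirect3 br \<iota> S T F M h for br :: "'a::real_vector \<Rightarrow> 'a \<Rightarrow> 'a" and \<iota> S T F M h +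
  assumes h0: "h = 0"
begin

lemma commute: "M *v (F *v x) = F *v (M *v x)" using commutator h0 by simp

lemma row: "(M *v x) $ 1 = (F *v x) $ 2" and col: "M *v axis 1 1 = F *v axis 2 1"
  using hypo_row[of x] hypo_col h0 by simp_all

lemma br_ST: "br S T = 0" "br T S = 0" using br_TS br_rev h0 by simp_all

text \<open>In the commuting pencil of \<open>F\<close> and \<open>M\<close>, the column relation turns the vector \<open>a *\<^sub>R axis 1 1 + b *\<^sub>R axis 2 1\<close> into the
image under the invertible \<open>X\<close> of some \<open>w\<close> with \<open>N w = 0\<close>, while the row relation evaluates the functional
with coefficients \<open>a\<close>, \<open>b\<close> on it; this gives \<open>a * a + b * b = 0\<close>.\<close>

lemma invertible_excludes_square_zero:
  assumes N: "\<And>x. N *v (N *v x) = 0" "N = a *\<^sub>R F + b *\<^sub>R M" and X: "X = c *\<^sub>R F + d *\<^sub>R M" "\<And>x. X *v x = 0 \<Longrightarrow> x = 0"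
  shows "a = 0 \<and> b = 0"
proof -
  let ?e = "a *\<^sub>R axis 1 1 + b *\<^sub>R axis 2 1 :: real^3" and ?d = "c *\<^sub>R axis 1 1 + d *\<^sub>R axis 2 1 :: real^3"
  have rel: "a * (X *v x) $ 1 + b * (X *v x) $ 2 = c * (N *v x) $ 1 + d * (N *v x) $ 2" for x
    using row[of x] by (simp add: N X(1) mv_simps algebra_simps)
  have Xe: "X *v ?e = N *v ?d"
    using col by (simp add: N X(1) mv_simps algebra_simps)
  have "inj ((*v) X)" using X(2) by (metis matrix_left_invertible_injective matrix_left_invertible_ker)
  then have "surj ((*v) X)" by (simp add: linear_injective_imp_surjective)
  then obtain w where w: "?e = X *v w" by blast
  have comm: "X *v (N *v x) = N *v (X *v x)" for x
    using commute by (simp add: N X(1) mv_simps algebra_simps)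
  have "X *v (X *v (N *v w)) = N *v (N *v ?d)" using comm Xe w by simp
  then have "X *v (X *v (N *v w)) = 0" by (simp only: N(1))
  then have Nw: "N *v w = 0" using X(2) by blast
  have "a * ?e $ 1 + b * ?e $ 2 = 0" using rel[of w] unfolding w Nw by simp
  then have "a * a + b * b = 0" by (simp add: axis_def)
  then show ?thesis by simp
qed

text \<open>The semisimple situation: \<open>Y\<close> kills a vector \<open>v\<close> and is invertible and traceless on a complementary
plane, while \<open>Z\<close> is scalar there. Real and imaginary eigenvalues of \<open>Y\<close> give the two algebras.\<close>

lemma listed_torus:
  assumes Y: "Y = \<alpha> *\<^sub>R F + \<beta> *\<^sub>R M" and Z: "Z = \<gamma> *\<^sub>R F + \<delta> *\<^sub>R M" and d: "\<alpha> * \<delta> - \<beta> * \<gamma> \<noteq> 0"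
    and i: "ind3 v p q" and Yv: "Y *v v = 0" "Y *v p = q" "Y *v q = \<kappa> *\<^sub>R p"
    and Zv: "Z *v v = (- 2 * g) *\<^sub>R v" "Z *v p = g *\<^sub>R p" "Z *v q = g *\<^sub>R q" and nz: "\<kappa> \<noteq> 0" "g \<noteq> 0"
  shows "listed br"
proof -
  let ?S = "\<alpha> *\<^sub>R S + \<beta> *\<^sub>R T" and ?T = "\<gamma> *\<^sub>R S + \<delta> *\<^sub>R T"
  have bS: "br (\<iota> x) ?S = - \<iota> (Y *v x)" and bT: "br (\<iota> x) ?T = - \<iota> (Z *v x)" for x
    by (simp_all add: Y Z br_all mv_simps)
  have ST: "br ?S ?T = 0" "br ?T ?S = 0" by (simp_all add: br_simps br_ST)
  show ?thesis
  proof (cases "\<kappa> < 0")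
    case True
    define k where "k = sqrt (- \<kappa>)"
    have k: "k > 0" "k * k = - \<kappa>" using True by (simp_all add: k_def)
    have "ind3 v p ((1 / k) *\<^sub>R q)"
      using ind3D[OF i] k by (intro ind3I) (fastforce simp: )
    then have "frame (\<iota> v) (\<iota> p) (\<iota> ((1 / k) *\<^sub>R q)) ((- \<gamma> / g) *\<^sub>R S + (- \<delta> / g) *\<^sub>R T) ((\<alpha> / k) *\<^sub>R S + (\<beta> / k) *\<^sub>R T)"
      by (rule frame_iota) (use d k nz in \<open>simp add: field_simps\<close>)
    moreover have "(- \<gamma> / g) *\<^sub>R S + (- \<delta> / g) *\<^sub>R T = (- 1 / g) *\<^sub>R ?T" "(\<alpha> / k) *\<^sub>R S + (\<beta> / k) *\<^sub>R T = (1 / k) *\<^sub>R ?S"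
      by (simp_all add: scaleR_right_distrib)
    ultimately have fr: "frame (\<iota> v) (\<iota> p) (\<iota> ((1 / k) *\<^sub>R q)) ((- 1 / g) *\<^sub>R ?T) ((1 / k) *\<^sub>R ?S)" by simp
    have kk: "\<kappa> / (k * k) = - 1" using k nz by simp
    have "bracket_table (\<iota> v) (\<iota> p) (\<iota> ((1 / k) *\<^sub>R q)) ((- 1 / g) *\<^sub>R ?T) ((1 / k) *\<^sub>R ?S)
       0 0 (- 2 *\<^sub>R \<iota> v) 0 0 (\<iota> p) (- \<iota> ((1 / k) *\<^sub>R q)) (\<iota> ((1 / k) *\<^sub>R q)) (\<iota> p) 0"
      unfolding bracket_table_def
    proof (intro conjI fr)
      show "br (\<iota> ((1 / k) *\<^sub>R q)) ((1 / k) *\<^sub>R ?S) = \<iota> p"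
        using kk by (simp only: br_simps(3,4) bS mv_simps Yv iota_simps) (simp add: iota_simps)
    qed (use nz in \<open>simp_all only: br_simps(3,4) bS bT ST abelian mv_simps Yv Zv iota_simps\<close>, simp_all add: iota_simps)
    then show ?thesis using listed_A8 by simp
  next
    case False
    define k where "k = sqrt \<kappa>"
    have k: "k > 0" "k * k = \<kappa>" using False nz by (simp_all add: k_def)
    let ?p = "k *\<^sub>R p + q" and ?q = "k *\<^sub>R p - q"
    have Y2: "Y *v ?p = k *\<^sub>R ?p" "Y *v ?q = (- k) *\<^sub>R ?q" by (simp_all add: mv_simps Yv k(2)[symmetric] algebra_simps)
    have Z2: "Z *v ?p = g *\<^sub>R ?p" "Z *v ?q = g *\<^sub>R ?q" by (simp_all add: mv_simps Zv algebra_simps)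
    have "ind3 ?p v ?q"
    proof (rule ind3I)
      fix a b c assume "a *\<^sub>R ?p + b *\<^sub>R v + c *\<^sub>R ?q = 0"
      then have "b *\<^sub>R v + (k * (a + c)) *\<^sub>R p + (a - c) *\<^sub>R q = 0" by (simp add: algebra_simps)
      from ind3D[OF i this] show "a = 0 \<and> b = 0 \<and> c = 0" using k by auto
    qed
    then have "frame (\<iota> ?p) (\<iota> v) (\<iota> ?q) ((- \<alpha> / k) *\<^sub>R S + (- \<beta> / k) *\<^sub>R T)
        ((\<gamma> / (2 * g) - \<alpha> / (2 * k)) *\<^sub>R S + (\<delta> / (2 * g) - \<beta> / (2 * k)) *\<^sub>R T)"
      by (rule frame_iota) (use d k nz in \<open>simp add: field_simps\<close>)
    moreover have "(- \<alpha> / k) *\<^sub>R S + (- \<beta> / k) *\<^sub>R T = (- 1 / k) *\<^sub>R ?S"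
      "(\<gamma> / (2 * g) - \<alpha> / (2 * k)) *\<^sub>R S + (\<delta> / (2 * g) - \<beta> / (2 * k)) *\<^sub>R T = (1 / (2 * g)) *\<^sub>R ?T - (1 / (2 * k)) *\<^sub>R ?S"
      by (simp_all add: algebra_simps)
    ultimately have fr: "frame (\<iota> ?p) (\<iota> v) (\<iota> ?q) ((- 1 / k) *\<^sub>R ?S) ((1 / (2 * g)) *\<^sub>R ?T - (1 / (2 * k)) *\<^sub>R ?S)" by simp
    have "bracket_table (\<iota> ?p) (\<iota> v) (\<iota> ?q) ((- 1 / k) *\<^sub>R ?S) ((1 / (2 * g)) *\<^sub>R ?T - (1 / (2 * k)) *\<^sub>R ?S)
       0 0 (\<iota> ?p) 0 0 0 (\<iota> v) (- \<iota> ?q) (- \<iota> ?q) 0"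
      unfolding bracket_table_def
    proof (intro conjI fr)
      show "br (\<iota> ?q) ((1 / (2 * g)) *\<^sub>R ?T - (1 / (2 * k)) *\<^sub>R ?S) = - \<iota> ?q"
      proof -
        have "br (\<iota> ?q) ((1 / (2 * g)) *\<^sub>R ?T - (1 / (2 * k)) *\<^sub>R ?S) = (- 1 / 2 - 1 / 2) *\<^sub>R \<iota> ?q"
          unfolding br_simps(4,6) bS bT Y2 Z2 linear_cmul[OF lin_iota] scaleR_left_diff_distrib using nz k by simp
        then show ?thesis by simp
      qed
    qed (use nz k in \<open>simp_all only: br_simps(3,4,5,6) bS bT br_simps(11) ST abelian Y2 Z2 Yv Zv linear_cmul[OF lin_iota] linear_0[OF lin_iota]\<close>, simp_all)
    then show ?thesis by (rule listed_A7)
  qed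
qed

end

lemma trace_linear: "trace (a *\<^sub>R A + b *\<^sub>R B) = a * trace A + b * trace B" for A B :: "real^'n^'n"
  by (simp add: trace_def sum.distrib sum_distrib_left)

context split_semidirect3
begin

lemma br_iota_combination: "br (\<iota> x) ((a / p) *\<^sub>R S + (b / p) *\<^sub>R T) = - (1 / p) *\<^sub>R \<iota> ((a *\<^sub>R F + b *\<^sub>R M) *v x)"
  by (simp add: br_all mv_simps scaleR_right_distrib)

text \<open>If \<open>F\<close> and \<open>M\<close> are proportional, then a combination \<open>?T\<close> of \<open>S\<close> and \<open>T\<close> is central, and the action is that of
a single matrix \<open>X\<close>. By the row and column relations \<open>X\<close> kills \<open>?e\<close> and maps into the plane orthogonal to it,
so that only a traceless endomorphism of that plane remains: invertible, nilpotent or zero.\<close>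

lemma listed_dependent:
  assumes dep: "a *\<^sub>R F + b *\<^sub>R M = 0" and nz: "a \<noteq> 0 \<or> b \<noteq> 0"
  shows "listed br"
proof -
  define n where "n = a * a + b * b"
  have n: "n \<noteq> 0" using nz by (simp add: n_def)
  define X where "X = (b / n) *\<^sub>R F + (- a / n) *\<^sub>R M"
  let ?S = "(b / n) *\<^sub>R S + (- a / n) *\<^sub>R T" and ?T = "a *\<^sub>R S + b *\<^sub>R T"
  have dep': "a *\<^sub>R (F *v x) + b *\<^sub>R (M *v x) = 0" for x using arg_cong[OF dep, of "\<lambda>A. A *v x"] by (simp add: mv_simps)
  have bS: "br (\<iota> x) ?S = - \<iota> (X *v x)" "br ?S (\<iota> x) = \<iota> (X *v x)" for x by (simp_all add: X_def br_all mv_simps)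
  have bT: "br (\<iota> x) ?T = 0" "br ?T (\<iota> x) = 0" for x
  proof -
    have "br (\<iota> x) ?T = - \<iota> (a *\<^sub>R (F *v x) + b *\<^sub>R (M *v x))" by (simp add: br_all)
    then show "br (\<iota> x) ?T = 0" by (simp add: dep' iota_simps)
    then show "br ?T (\<iota> x) = 0" using br_anti[of ?T "\<iota> x"] by simp
  qed
  have ST: "br ?S ?T = 0" "br ?T ?S = 0" by (simp_all add: br_simps br_ST)
  have dt: "(b / n) * b - (- a / n) * a \<noteq> 0"
  proof -
    have "(b / n) * b - (- a / n) * a = (a * a + b * b) / n" by (simp add: add_divide_distrib)
    then show ?thesis using n unfolding n_def[symmetric] by simp
  qed
  let ?e = "a *\<^sub>R axis 1 1 + b *\<^sub>R axis 2 1 :: real^3"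
  have rowX: "a * (X *v x) $ 1 + b * (X *v x) $ 2 = 0" for x
  proof -
    have 1: "a * (F *v x) $ 1 + b * (F *v x) $ 2 = 0" "a * (F *v x) $ 2 + b * (M *v x) $ 2 = 0"
      using arg_cong[OF dep'[of x], of "\<lambda>v. v $ 1"] arg_cong[OF dep'[of x], of "\<lambda>v. v $ 2"] row[of x] by simp_all
    have "n * (a * (X *v x) $ 1 + b * (X *v x) $ 2) = b * (a * (F *v x) $ 1 + b * (F *v x) $ 2) - a * (a * (F *v x) $ 2 + b * (M *v x) $ 2)"
      using n row[of x] by (simp add: X_def mv_simps field_simps)
    then show ?thesis using 1 n by simp
  qed
  have colX: "X *v ?e = 0"
  proof -
    have 1: "a *\<^sub>R (F *v axis 1 1) + b *\<^sub>R (F *v axis 2 1) = 0" "a *\<^sub>R (F *v axis 2 1) + b *\<^sub>R (M *v axis 2 1) = 0"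
      using dep'[of "axis 1 1"] dep'[of "axis 2 1"] col by simp_all
    have "X *v ?e = (b / n) *\<^sub>R (a *\<^sub>R (F *v axis 1 1) + b *\<^sub>R (F *v axis 2 1)) - (a / n) *\<^sub>R (a *\<^sub>R (F *v axis 2 1) + b *\<^sub>R (M *v axis 2 1))"
      using col by (simp add: X_def mv_simps algebra_simps)
    then show ?thesis using 1 by simp
  qed
  have e: "?e $ 1 = a" "?e $ 2 = b" by (simp_all add: axis_def)
  have trX: "trace X = 0" unfolding X_def trace_linear using trF trM by simp
  show ?thesis
  proof (cases "\<exists>q. a * q $ 1 + b * q $ 2 = 0 \<and> (\<forall>s t. s *\<^sub>R q + t *\<^sub>R (X *v q) = 0 \<longrightarrow> s = 0 \<and> t = 0)")
    case True
    then obtain q where q: "a * q $ 1 + b * q $ 2 = 0" "\<And>s t. s *\<^sub>R q + t *\<^sub>R (X *v q) = 0 \<Longrightarrow> s = 0 \<and> t = 0" by blast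
    have i: "ind3 q (X *v q) ?e"
    proof (rule ind3I)
      fix s t r assume z: "s *\<^sub>R q + t *\<^sub>R (X *v q) + r *\<^sub>R ?e = 0"
      have "a * (s *\<^sub>R q + t *\<^sub>R (X *v q) + r *\<^sub>R ?e) $ 1 + b * (s *\<^sub>R q + t *\<^sub>R (X *v q) + r *\<^sub>R ?e) $ 2
          = s * (a * q $ 1 + b * q $ 2) + t * (a * (X *v q) $ 1 + b * (X *v q) $ 2) + r * n"
        by (simp add: e n_def algebra_simps axis_def)
      then have "r * n = 0" unfolding z using q(1) rowX by simp
      then have "r = 0" using n by simp
      then show "s = 0 \<and> t = 0 \<and> r = 0" using z q(2)[of s t] by simp
    qed
    obtain \<alpha> \<beta> c where X2: "X *v (X *v q) = \<alpha> *\<^sub>R q + \<beta> *\<^sub>R (X *v q) + c *\<^sub>R ?e" using ind3_expand[OF i] by blast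
    have "a * (X *v (X *v q)) $ 1 + b * (X *v (X *v q)) $ 2 = \<alpha> * (a * q $ 1 + b * q $ 2) + \<beta> * (a * (X *v q) $ 1 + b * (X *v q) $ 2) + c * n"
      unfolding X2 by (simp add: e n_def algebra_simps axis_def)
    then have c: "c = 0" using q(1) rowX n by simp
    have "trace X = 0 + \<beta> + 0"
      by (rule trace_ind3[OF i, of X 0 1 0 \<alpha> \<beta> c 0 0 0]) (simp_all add: X2 colX)
    then have \<beta>: "\<beta> = 0" using trX by simp
    have X2': "X *v (X *v q) = \<alpha> *\<^sub>R q" using X2 c \<beta> by simp
    have f: "frame (\<iota> q) (\<iota> (X *v q)) (\<iota> ?e) ?S ?T" by (rule frame_iota[OF i dt])
    show ?thesis
    proof (cases "\<alpha> = 0")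
      case False
      have "bracket_table (\<iota> q) (\<iota> (X *v q)) ?S ?T (\<iota> ?e) 0 (- 1 *\<^sub>R \<iota> (X *v q)) 0 0 (- \<alpha> *\<^sub>R \<iota> q) 0 0 (- 0 *\<^sub>R \<iota> ?e) 0 0"
        unfolding bracket_table_def using frame_perm(2)[OF f]
        by (simp only: bS bT ST abelian X2' colX linear_cmul[OF lin_iota] linear_0[OF lin_iota]) simp
      then show ?thesis by (rule listed_semidirect_plane) (use False in simp)
    next
      case True
      have f': "frame (- \<iota> (X *v q)) ?S (\<iota> q) ?T (\<iota> ?e)"
      proof -
        have "ind3 (- (X *v q)) q ?e"
        proof (rule ind3I)
          fix s t r assume "s *\<^sub>R - (X *v q) + t *\<^sub>R q + r *\<^sub>R ?e = 0"
          then have "t *\<^sub>R q + (- s) *\<^sub>R (X *v q) + r *\<^sub>R ?e = 0" by simp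
          from ind3D[OF i this] show "s = 0 \<and> t = 0 \<and> r = 0" by simp
        qed
        from frame_perm(3)[OF frame_iota[OF this dt]] show ?thesis by (simp add: iota_simps)
      qed
      have n1: "br (- \<iota> x) y = - br (\<iota> x) y" for x y by (rule br_simps)
      have "bracket_table (- \<iota> (X *v q)) ?S (\<iota> q) ?T (\<iota> ?e) 0 0 0 0 (- (- \<iota> (X *v q))) 0 0 0 0 0"
        unfolding bracket_table_def using f' True
        by (simp only: n1 bS bT ST abelian X2' colX linear_cmul[OF lin_iota] linear_0[OF lin_iota]) simp
      then show ?thesis by (rule listed_C2)
    qed
  next
    case False
    have dep2: "\<exists>m. X *v q = m *\<^sub>R q" if qe: "a * q $ 1 + b * q $ 2 = 0" and qn: "q \<noteq> 0" for q
    proof -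
      obtain s t where st: "s *\<^sub>R q + t *\<^sub>R (X *v q) = 0" "\<not> (s = 0 \<and> t = 0)" using False qe by blast
      have t: "t \<noteq> 0" using st qn by auto
      have "X *v q = (1 / t) *\<^sub>R (t *\<^sub>R (X *v q))" using t by simp
      also have "t *\<^sub>R (X *v q) = - (s *\<^sub>R q)" using st(1) by (simp add: eq_neg_iff_add_eq_0 add.commute)
      finally show ?thesis by (intro exI[of _ "- s / t"]) simp
    qed
    have "?e \<noteq> 0" using nz e by (metis zero_index)
    then obtain p0 q0 where i0: "ind3 ?e p0 q0" by (rule ind3_complete1)
    define p where "p = p0 - ((a * p0 $ 1 + b * p0 $ 2) / n) *\<^sub>R ?e"
    define q where "q = q0 - ((a * q0 $ 1 + b * q0 $ 2) / n) *\<^sub>R ?e"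
    have pq: "a * p $ 1 + b * p $ 2 = 0" "a * q $ 1 + b * q $ 2 = 0"
    proof -
      have "a * (x - k *\<^sub>R ?e) $ 1 + b * (x - k *\<^sub>R ?e) $ 2 = (a * x $ 1 + b * x $ 2) - k * n" for x k
        unfolding vector_minus_component vector_scaleR_component e by (simp add: n_def algebra_simps)
      then show "a * p $ 1 + b * p $ 2 = 0" "a * q $ 1 + b * q $ 2 = 0" using n by (simp_all only: p_def q_def) simp_all
    qed
    have i: "ind3 ?e p q"
    proof (rule ind3I)
      fix s t r assume z: "s *\<^sub>R ?e + t *\<^sub>R p + r *\<^sub>R q = 0"
      have "(s - t * ((a * p0 $ 1 + b * p0 $ 2) / n) - r * ((a * q0 $ 1 + b * q0 $ 2) / n)) *\<^sub>R ?e + t *\<^sub>R p0 + r *\<^sub>R q0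
         = s *\<^sub>R ?e + t *\<^sub>R p + r *\<^sub>R q"
        unfolding p_def q_def by (simp only: scaleR_left_diff_distrib scaleR_right_diff_distrib scaleR_scaleR) (simp add: algebra_simps)
      then have "(s - t * ((a * p0 $ 1 + b * p0 $ 2) / n) - r * ((a * q0 $ 1 + b * q0 $ 2) / n)) *\<^sub>R ?e + t *\<^sub>R p0 + r *\<^sub>R q0 = 0"
        using z by simp
      from ind3D[OF i0 this] show "s = 0 \<and> t = 0 \<and> r = 0" by auto
    qed
    have p0: "p \<noteq> 0" and q0: "q \<noteq> 0" and pq0: "p + q \<noteq> 0"
      using ind3D[OF i, of 0 1 0] ind3D[OF i, of 0 0 1] ind3D[OF i, of 0 1 1] by auto
    obtain m1 where m1: "X *v p = m1 *\<^sub>R p" using dep2[OF pq(1) p0] by blast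
    obtain m2 where m2: "X *v q = m2 *\<^sub>R q" using dep2[OF pq(2) q0] by blast
    have "a * (p + q) $ 1 + b * (p + q) $ 2 = 0" using pq by (simp add: algebra_simps)
    then obtain m3 where m3: "X *v (p + q) = m3 *\<^sub>R (p + q)" using dep2 pq0 by blast
    have "0 *\<^sub>R ?e + m1 *\<^sub>R p + m2 *\<^sub>R q = 0 *\<^sub>R ?e + m3 *\<^sub>R p + m3 *\<^sub>R q"
      using m3 by (simp add: mv_simps m1 m2 scaleR_right_distrib)
    from ind3_eqD[OF i this] have mm: "m1 = m2" by simp
    have "trace X = 0 + m1 + m2"
      by (rule trace_ind3[OF i, of X 0 0 0 0 m1 0 0 0 m2]) (simp_all add: m1 m2 colX)
    then have m0: "m1 = 0" "m2 = 0" using trX mm by simp_all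
    have X0: "X *v x = 0" for x
    proof -
      obtain s t r where x: "x = s *\<^sub>R ?e + t *\<^sub>R p + r *\<^sub>R q" using ind3_expand[OF i] by blast
      have "X *v x = s *\<^sub>R (X *v ?e) + t *\<^sub>R (X *v p) + r *\<^sub>R (X *v q)" by (simp only: x mv_simps(1,3))
      then show ?thesis by (simp only: colX m1 m2 m0) simp
    qed
    have "frame (\<iota> ?e) (\<iota> p) (\<iota> q) ?S ?T" by (rule frame_iota[OF i dt])
    then have "bracket_table (\<iota> ?e) (\<iota> p) (\<iota> q) ?S ?T 0 0 0 0 0 0 0 0 0 0"
      unfolding bracket_table_def by (simp only: bS bT ST abelian X0 linear_0[OF lin_iota]) simp
    then show ?thesis by (rule listed_C1)
  qed
qed

text \<open>A two-dimensional commuting space of nilpotent matrices. If it contains a single Jordan block \<open>X\<close>, it is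
spanned by \<open>X\<close> and \<open>X ** X\<close>. Otherwise all products vanish, and the two matrices have either a common kernel
plane or a common image line.\<close>

lemma listed_all_nilpotent:
  assumes ind: "\<And>a b. a *\<^sub>R F + b *\<^sub>R M = 0 \<Longrightarrow> a = 0 \<and> b = 0"
    and nil: "\<And>a b x. (a *\<^sub>R F + b *\<^sub>R M) *v ((a *\<^sub>R F + b *\<^sub>R M) *v ((a *\<^sub>R F + b *\<^sub>R M) *v x)) = 0"
  shows "listed br"
proof (cases "\<exists>c d z. (c *\<^sub>R F + d *\<^sub>R M) *v ((c *\<^sub>R F + d *\<^sub>R M) *v z) \<noteq> 0")
  case True
  then obtain c d z where z: "(c *\<^sub>R F + d *\<^sub>R M) *v ((c *\<^sub>R F + d *\<^sub>R M) *v z) \<noteq> 0" by blast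
  define X where "X = c *\<^sub>R F + d *\<^sub>R M"
  have X3: "X *v (X *v (X *v x)) = 0" for x using nil[of c d] by (simp add: X_def)
  let ?a = "X *v (X *v z)" and ?b = "X *v z"
  have a0: "?a \<noteq> 0" using z by (simp add: X_def)
  have i: "ind3 ?a ?b z"
  proof (rule ind3I)
    fix a b c assume e: "a *\<^sub>R ?a + b *\<^sub>R ?b + c *\<^sub>R z = 0"
    from arg_cong[OF e, of "\<lambda>x. X *v (X *v x)"] have c: "c = 0" using a0 by (simp add: mv_simps X3)
    from arg_cong[OF e, of "\<lambda>x. X *v x"] have b: "b = 0" using a0 c by (simp add: mv_simps X3)
    show "a = 0 \<and> b = 0 \<and> c = 0" using e b c a0 by simp
  qed
  have cd: "\<not> (c = 0 \<and> d = 0)" using z by (auto simp: mv_simps)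
  define Y where "Y = (- d) *\<^sub>R F + c *\<^sub>R M"
  have XY: "X *v (Y *v x) = Y *v (X *v x)" for x by (simp add: X_def Y_def mv_simps commute algebra_simps)
  obtain p q r where Yz: "Y *v z = p *\<^sub>R ?a + q *\<^sub>R ?b + r *\<^sub>R z" using ind3_expand[OF i] by blast
  have Yb: "Y *v ?b = q *\<^sub>R ?a + r *\<^sub>R ?b" using XY[of z, symmetric] by (simp add: Yz mv_simps X3)
  have Ya: "Y *v ?a = r *\<^sub>R ?a" using XY[of ?b, symmetric] by (simp add: Yb mv_simps X3)
  have trY: "trace Y = 0" unfolding Y_def trace_linear using trF trM by simp
  have "trace Y = r + r + r"
    by (rule trace_ind3[OF i, of Y r 0 0 q r 0 p q r]) (simp_all add: Ya Yb Yz)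
  then have r: "r = 0" using trY by simp
  define Z where "Z = (- d - q * c) *\<^sub>R F + (c - q * d) *\<^sub>R M"
  have ZY: "Z *v x = Y *v x - q *\<^sub>R (X *v x)" for x by (simp add: X_def Y_def Z_def mv_simps algebra_simps)
  have Z: "Z *v z = p *\<^sub>R ?a" "Z *v ?b = 0" "Z *v ?a = 0" by (simp_all add: ZY Yz Yb Ya r X3)
  have cd2: "c * c + d * d \<noteq> 0" using cd by auto
  have p: "p \<noteq> 0"
  proof
    assume "p = 0"
    have "Z *v x = 0" for x
    proof -
      obtain s t u where x: "x = s *\<^sub>R ?a + t *\<^sub>R ?b + u *\<^sub>R z" using ind3_expand[OF i] by blast
      show ?thesis unfolding x mv_simps Z \<open>p = 0\<close> by simp
    qed
    then have "Z = 0" by (simp add: matrix_eq)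
    then have "- d - q * c = 0" "c - q * d = 0" using ind unfolding Z_def by blast+
    then have "c * c + d * d = 0" by algebra
    then show False using cd2 by simp
  qed
  let ?S = "c *\<^sub>R S + d *\<^sub>R T" and ?T = "((- d - q * c) / p) *\<^sub>R S + ((c - q * d) / p) *\<^sub>R T"
  have bS: "br (\<iota> x) ?S = - \<iota> (X *v x)" for x by (simp add: X_def br_all mv_simps)
  have bT: "br (\<iota> x) ?T = - (1 / p) *\<^sub>R \<iota> (Z *v x)" for x unfolding Z_def by (rule br_iota_combination)
  have ST: "br ?T ?S = 0" by (simp add: br_simps br_ST)
  have "((- d - q * c) / p) * d - ((c - q * d) / p) * c = - ((c * c + d * d) / p)" using p by (simp add: field_simps)
  then have dt: "((- d - q * c) / p) * d - ((c - q * d) / p) * c \<noteq> 0"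
    using p cd2 by (metis divide_eq_0_iff neg_equal_0_iff_equal)
  have fr: "frame (\<iota> ?a) (\<iota> ?b) (\<iota> z) ?T ?S" by (rule frame_iota[OF i dt])
  have "bracket_table (\<iota> ?a) (\<iota> ?b) (\<iota> z) ?T ?S 0 0 0 0 0 0 (- \<iota> ?a) (- \<iota> ?a) (- \<iota> ?b) 0"
    unfolding bracket_table_def using fr p
    by (simp only: bS bT ST abelian Z X3 linear_cmul[OF lin_iota] linear_0[OF lin_iota]) simp
  then show ?thesis by (rule listed_A2)
next
  case False
  then have sq: "(c *\<^sub>R F + d *\<^sub>R M) *v ((c *\<^sub>R F + d *\<^sub>R M) *v x) = 0" for c d x by blast
  have FF: "F *v (F *v x) = 0" and MM: "M *v (M *v x) = 0" for x
    using sq[of 1 0 x] sq[of 0 1 x] by (simp_all add: mv_simps)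
  have "2 *\<^sub>R (F *v (M *v x)) = 0" for x
    using sq[of 1 1 x] by (simp add: mv_simps FF MM commute scaleR_2)
  then have FM: "F *v (M *v x) = 0" and MF: "M *v (F *v x) = 0" for x using commute by simp_all
  note prods = FF MM FM MF
  have B1: "listed br" if y: "\<And>s t. s *\<^sub>R (F *v y) + t *\<^sub>R (M *v y) = 0 \<Longrightarrow> s = 0 \<and> t = 0" for y
  proof -
    have "ind3 (- (F *v y)) (- (M *v y)) y"
    proof (rule ind3I)
      fix s t r assume e: "s *\<^sub>R - (F *v y) + t *\<^sub>R - (M *v y) + r *\<^sub>R y = 0"
      have "F *v y \<noteq> 0" using y[of 1 0] by auto
      moreover from arg_cong[OF e, of "\<lambda>x. F *v x"] have "r *\<^sub>R (F *v y) = 0" by (simp add: mv_simps prods)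
      ultimately have r: "r = 0" by simp
      then have "(- s) *\<^sub>R (F *v y) + (- t) *\<^sub>R (M *v y) = 0" using e by simp
      from y[OF this] r show "s = 0 \<and> t = 0 \<and> r = 0" by simp
    qed
    from frame_perm(2)[OF frame_iota[OF this, of 1 1 0 0]]
    have "frame (\<iota> (- (F *v y))) (\<iota> (- (M *v y))) S T (\<iota> y)" by simp
    then have "bracket_table (\<iota> (- (F *v y))) (\<iota> (- (M *v y))) S T (\<iota> y) 0 0 0 0 0 0 0 0 (- \<iota> (- (F *v y))) (- \<iota> (- (M *v y)))"
      unfolding bracket_table_def by (simp add: br_all mv_simps prods br_ST h0)
    then show ?thesis by (rule listed_B1)
  qed
  have "\<exists>y. F *v y \<noteq> 0"
  proof (rule ccontr)
    assume "\<not> ?thesis"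
    then have "1 *\<^sub>R F + 0 *\<^sub>R M = 0" by (simp add: matrix_eq)
    from ind[OF this] show False by simp
  qed
  then obtain y1 where y1: "F *v y1 \<noteq> 0" by blast
  show ?thesis
  proof (cases "\<exists>y. \<forall>s t. s *\<^sub>R (F *v y) + t *\<^sub>R (M *v y) = 0 \<longrightarrow> s = 0 \<and> t = 0")
    case True then show ?thesis using B1 by blast
  next
    case False
    then have dep: "\<exists>s t. s *\<^sub>R (F *v y) + t *\<^sub>R (M *v y) = 0 \<and> \<not> (s = 0 \<and> t = 0)" for y by blast
    define v where "v = F *v y1"
    obtain s t where st: "s *\<^sub>R v + t *\<^sub>R (M *v y1) = 0" "\<not> (s = 0 \<and> t = 0)" using dep[of y1] unfolding v_def by blast
    have v0: "v \<noteq> 0" using y1 v_def by simp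
    have t: "t \<noteq> 0" using st v0 by auto
    define c where "c = - s / t"
    have My1: "M *v y1 = c *\<^sub>R v"
    proof -
      have "M *v y1 = (1 / t) *\<^sub>R (t *\<^sub>R (M *v y1))" using t by simp
      also have "t *\<^sub>R (M *v y1) = - (s *\<^sub>R v)" using st(1) by (simp add: eq_neg_iff_add_eq_0 add.commute)
      finally show ?thesis by (simp add: c_def)
    qed
    define N where "N = (- c) *\<^sub>R F + 1 *\<^sub>R M"
    have Nx: "N *v x = M *v x - c *\<^sub>R (F *v x)" for x by (simp add: N_def mv_simps)
    have Ny1: "N *v y1 = 0" by (simp add: Nx My1 v_def)
    have "\<exists>y. N *v y \<noteq> 0"
    proof (rule ccontr)
      assume "\<not> ?thesis"
      then have "N = 0" by (simp add: matrix_eq)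
      from ind[OF this[unfolded N_def]] show False by simp
    qed
    then obtain y2 where y2: "N *v y2 \<noteq> 0" by blast
    define w where "w = N *v y2"
    have depN: "\<exists>s t. s *\<^sub>R (F *v y) + t *\<^sub>R (N *v y) = 0 \<and> \<not> (s = 0 \<and> t = 0)" for y
    proof -
      obtain s t where "s *\<^sub>R (F *v y) + t *\<^sub>R (M *v y) = 0" "\<not> (s = 0 \<and> t = 0)" using dep by blast
      then have "(s + t * c) *\<^sub>R (F *v y) + t *\<^sub>R (N *v y) = 0 \<and> \<not> (s + t * c = 0 \<and> t = 0)"
        by (auto simp: Nx algebra_simps)
      then show ?thesis by blast
    qed
    obtain l where l: "F *v y2 = l *\<^sub>R w"
    proof -
      obtain s t where e: "s *\<^sub>R (F *v y2) + t *\<^sub>R w = 0" "\<not> (s = 0 \<and> t = 0)" using depN[of y2] unfolding w_def by blast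
      have "s \<noteq> 0" using e y2 unfolding w_def by auto
      then have "F *v y2 = (1 / s) *\<^sub>R (s *\<^sub>R (F *v y2))" by simp
      also have "s *\<^sub>R (F *v y2) = - (t *\<^sub>R w)" using e(1) by (simp add: eq_neg_iff_add_eq_0)
      finally have "F *v y2 = (- t / s) *\<^sub>R w" by simp
      then show ?thesis by (rule that)
    qed
    obtain k where k: "w = k *\<^sub>R v" "k \<noteq> 0"
    proof -
      obtain s t where e: "s *\<^sub>R (F *v (y1 + y2)) + t *\<^sub>R (N *v (y1 + y2)) = 0" "\<not> (s = 0 \<and> t = 0)" using depN by blast
      then have e1: "s *\<^sub>R v + (s * l + t) *\<^sub>R w = 0" by (simp add: mv_simps Ny1 l v_def[symmetric] w_def[symmetric] algebra_simps)
      have "s * l + t \<noteq> 0" using e1 e(2) v0 by auto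
      then have "w = (1 / (s * l + t)) *\<^sub>R ((s * l + t) *\<^sub>R w)" by simp
      also have "(s * l + t) *\<^sub>R w = - (s *\<^sub>R v)" using e1 by (simp add: eq_neg_iff_add_eq_0 add.commute)
      finally have "w = (- s / (s * l + t)) *\<^sub>R v" by simp
      moreover from this have "- s / (s * l + t) \<noteq> 0" using y2 unfolding w_def[symmetric] by (metis scaleR_zero_left)
      ultimately show ?thesis by (rule that)
    qed
    define y3 where "y3 = y2 - (l * k) *\<^sub>R y1"
    have Fy3: "F *v y3 = 0" by (simp add: y3_def mv_simps l k(1) v_def[symmetric])
    have Ny3: "N *v y3 = k *\<^sub>R v" by (simp add: y3_def mv_simps Ny1 w_def[symmetric] k(1))
    have Fv: "F *v v = 0" "N *v v = 0" by (simp_all add: v_def Nx prods)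
    have "ind3 v y1 y3"
    proof (rule ind3I)
      fix a b c' assume e: "a *\<^sub>R v + b *\<^sub>R y1 + c' *\<^sub>R y3 = 0"
      from arg_cong[OF e, of "\<lambda>x. F *v x"] have b: "b = 0" using v0 by (simp add: mv_simps Fv Fy3 v_def[symmetric])
      from arg_cong[OF e, of "\<lambda>x. N *v x"] have c: "c' = 0" using v0 k by (simp add: mv_simps Fv Ny1 Ny3 b)
      show "a = 0 \<and> b = 0 \<and> c' = 0" using e b c v0 by simp
    qed
    then have fr: "frame (\<iota> v) (\<iota> y1) (\<iota> y3) (1 *\<^sub>R S + 0 *\<^sub>R T) ((- c / k) *\<^sub>R S + (1 / k) *\<^sub>R T)"
      by (rule frame_iota) (use k in simp)
    let ?T = "(- c / k) *\<^sub>R S + (1 / k) *\<^sub>R T"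
    have bT: "br (\<iota> x) ?T = - (1 / k) *\<^sub>R \<iota> (N *v x)" for x by (simp add: N_def br_all mv_simps algebra_simps)
    have "bracket_table (\<iota> v) (\<iota> y1) (\<iota> y3) S ?T 0 0 0 0 0 (- \<iota> v) 0 0 (- \<iota> v) 0"
      unfolding bracket_table_def
    proof (intro conjI)
      show "frame (\<iota> v) (\<iota> y1) (\<iota> y3) S ?T" using fr by simp
      show "br S ?T = 0" by (simp add: br_simps br_ST)
    qed (simp_all only: abelian bT br_rev Fv Fy3 Ny1 Ny3 v_def[symmetric] linear_cmul[OF lin_iota] linear_0[OF lin_iota], simp_all add: k)
    then show ?thesis by (rule listed_A1)
  qed
qed

end

context split_semidirect3
begin

text \<open>If \<open>f\<close> is a simple eigenvalue of \<open>X\<close>, then whatever commutes with \<open>X\<close> preserves both the eigenline and the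
invariant complement; the determinant \<open>D\<close> being nonzero says that \<open>f\<close> is not an eigenvalue on the complement.\<close>

lemma commuting_block:
  assumes i: "ind3 v p q" and X: "X *v v = f *\<^sub>R v" "X *v p = b11 *\<^sub>R p + b21 *\<^sub>R q" "X *v q = b12 *\<^sub>R p + b22 *\<^sub>R q"
    and D: "(b11 - f) * (b22 - f) - b12 * b21 \<noteq> 0" and Z: "\<And>x. X *v (Z *v x) = Z *v (X *v x)"
  obtains z c11 c12 c21 c22 where "Z *v v = z *\<^sub>R v" "Z *v p = c11 *\<^sub>R p + c21 *\<^sub>R q" "Z *v q = c12 *\<^sub>R p + c22 *\<^sub>R q"
proof -
  obtain z a b where Zv: "Z *v v = z *\<^sub>R v + a *\<^sub>R p + b *\<^sub>R q" using ind3_expand[OF i] by blast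
  obtain e1 c11 c21 where Zp: "Z *v p = e1 *\<^sub>R v + c11 *\<^sub>R p + c21 *\<^sub>R q" using ind3_expand[OF i] by blast
  obtain e2 c12 c22 where Zq: "Z *v q = e2 *\<^sub>R v + c12 *\<^sub>R p + c22 *\<^sub>R q" using ind3_expand[OF i] by blast
  have "(f * z) *\<^sub>R v + (a * b11 + b * b12) *\<^sub>R p + (a * b21 + b * b22) *\<^sub>R q = (f * z) *\<^sub>R v + (f * a) *\<^sub>R p + (f * b) *\<^sub>R q"
    using Z[of v] by (simp add: X Zv mv_simps algebra_simps)
  from ind3_eqD[OF i this] have "a * b11 + b * b12 = f * a" "a * b21 + b * b22 = f * b" by blast+
  then have "a * ((b11 - f) * (b22 - f) - b12 * b21) = 0" "b * ((b11 - f) * (b22 - f) - b12 * b21) = 0" by algebra+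
  then have ab: "a = 0" "b = 0" using D by simp_all
  have "(f * e1) *\<^sub>R v + (c11 * b11 + c21 * b12) *\<^sub>R p + (c11 * b21 + c21 * b22) *\<^sub>R q
      = (b11 * e1 + b21 * e2) *\<^sub>R v + (b11 * c11 + b21 * c12) *\<^sub>R p + (b11 * c21 + b21 * c22) *\<^sub>R q"
    using Z[of p] by (simp add: X Zp Zq mv_simps algebra_simps)
  from ind3_eqD[OF i this] have 1: "f * e1 = b11 * e1 + b21 * e2" by blast
  have "(f * e2) *\<^sub>R v + (c12 * b11 + c22 * b12) *\<^sub>R p + (c12 * b21 + c22 * b22) *\<^sub>R q
      = (b12 * e1 + b22 * e2) *\<^sub>R v + (b12 * c11 + b22 * c12) *\<^sub>R p + (b12 * c21 + b22 * c22) *\<^sub>R q"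
    using Z[of q] by (simp add: X Zp Zq mv_simps algebra_simps)
  from ind3_eqD[OF i this] have 2: "f * e2 = b12 * e1 + b22 * e2" by blast
  have "e1 * ((b11 - f) * (b22 - f) - b12 * b21) = 0" "e2 * ((b11 - f) * (b22 - f) - b12 * b21) = 0" using 1 2 by algebra+
  then have "e1 = 0" "e2 = 0" using D by simp_all
  then show ?thesis using that[of z c11 c21 c12 c22] Zv Zp Zq ab by simp
qed

text \<open>A matrix \<open>X\<close> of the pencil that is not nilpotent has a simple real eigenvalue, hence the pencil
preserves a line \<open>v\<close> and a complementary plane. A combination \<open>Y\<close> kills \<open>v\<close> and is traceless on the plane, with
square \<open>\<kappa>\<close>; \<open>invertible_excludes_square_zero\<close> rules out \<open>\<kappa> = 0\<close>. The matrices commuting with \<open>Y\<close> on the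
plane are combinations of \<open>Y\<close> and the identity, which yields the second generator \<open>Z\<close> of a torus.\<close>

lemma listed_not_nilpotent:
  assumes ind: "\<And>a b. a *\<^sub>R F + b *\<^sub>R M = 0 \<Longrightarrow> a = 0 \<and> b = 0"
    and X: "X = c *\<^sub>R F + d *\<^sub>R M" and nn: "trace (X ** X) \<noteq> 0 \<or> det X \<noteq> 0"
  shows "listed br"
proof -
  define a where "a = - (trace (X ** X) / 2)"
  define b where "b = - det X"
  have trX: "trace X = 0" unfolding X trace_linear using trF trM by simp
  obtain f where f: "f ^ 3 + a * f + b = 0" "3 * f ^ 2 + a \<noteq> 0"
    using simple_root_depressed_cubic[of a b] nn by (auto simp: a_def b_def)
  have "det (X - f *\<^sub>R mat 1) = 0" using char_poly_3[OF trX, of f] f(1) by (simp add: a_def b_def)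
  then obtain v where v: "v \<noteq> 0" "(X - f *\<^sub>R mat 1) *v v = 0" by (rule singular_kernel)
  have Xv: "X *v v = f *\<^sub>R v" using v(2) by (simp add: mv_simps)
  obtain p0 q0 where i0: "ind3 v p0 q0" using ind3_complete1[OF v(1)] .
  obtain x1 b11 b21 where Xp0: "X *v p0 = x1 *\<^sub>R v + b11 *\<^sub>R p0 + b21 *\<^sub>R q0" using ind3_expand[OF i0] by blast
  obtain x2 b12 b22 where Xq0: "X *v q0 = x2 *\<^sub>R v + b12 *\<^sub>R p0 + b22 *\<^sub>R q0" using ind3_expand[OF i0] by blast
  have "trace X = f + b11 + b22"
    by (rule trace_ind3[OF i0, of X f 0 0 x1 b11 b21 x2 b12 b22]) (simp_all add: Xv Xp0 Xq0)
  then have tr: "f + b11 + b22 = 0" using trX by simp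
  have "trace (X ** X) = f * f + (b11 * b11 + b21 * b12) + (b12 * b21 + b22 * b22)"
  proof (rule trace_ind3[OF i0])
    show "(X ** X) *v v = (f * f) *\<^sub>R v + 0 *\<^sub>R p0 + 0 *\<^sub>R q0" by (simp add: matrix_vector_mul_assoc[symmetric] Xv mv_simps)
    show "(X ** X) *v p0 = (x1 * f + b11 * x1 + b21 * x2) *\<^sub>R v + (b11 * b11 + b21 * b12) *\<^sub>R p0 + (b11 * b21 + b21 * b22) *\<^sub>R q0"
      by (simp add: matrix_vector_mul_assoc[symmetric] Xv Xp0 Xq0 mv_simps algebra_simps)
    show "(X ** X) *v q0 = (x2 * f + b12 * x1 + b22 * x2) *\<^sub>R v + (b12 * b11 + b22 * b12) *\<^sub>R p0 + (b12 * b21 + b22 * b22) *\<^sub>R q0"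
      by (simp add: matrix_vector_mul_assoc[symmetric] Xv Xp0 Xq0 mv_simps algebra_simps)
  qed
  moreover have "2 * a = - trace (X ** X)" by (simp add: a_def)
  ultimately have a2: "2 * a = - (f * f + b11 * b11 + 2 * b12 * b21 + b22 * b22)" by (simp add: algebra_simps)
  define D where "D = (b11 - f) * (b22 - f) - b12 * b21"
  have "2 * D = 2 * (3 * f ^ 2 + a)"
  proof -
    have b22: "b22 = - f - b11" using tr by simp
    have "2 * (3 * f ^ 2 + a) = 6 * f * f + 2 * a" by (simp add: power2_eq_square)
    then show ?thesis unfolding D_def a2 b22 by (simp add: algebra_simps)
  qed
  then have D: "D = 3 * f ^ 2 + a" "D \<noteq> 0" using f(2) by simp_all
  \<comment> \<open>Cramer: \<open>e1\<close> and \<open>e2\<close> move \<open>p0\<close> and \<open>q0\<close> into the \<open>X\<close>-invariant complement of \<open>v\<close>.\<close>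
  define e1 e2 where "e1 = (x1 * (b22 - f) - b21 * x2) / D" and "e2 = ((b11 - f) * x2 - b12 * x1) / D"
  have "D * e1 = x1 * (b22 - f) - b21 * x2" "D * e2 = (b11 - f) * x2 - b12 * x1" using D by (simp_all add: e1_def e2_def)
  then have "D * (x1 + e1 * f) = D * (b11 * e1 + b21 * e2)" "D * (x2 + e2 * f) = D * (b12 * e1 + b22 * e2)"
    unfolding D_def by algebra+
  then have e: "x1 + e1 * f = b11 * e1 + b21 * e2" "x2 + e2 * f = b12 * e1 + b22 * e2" using D by simp_all
  define p q where "p = p0 + e1 *\<^sub>R v" and "q = q0 + e2 *\<^sub>R v"
  have "X *v p = (x1 + e1 * f) *\<^sub>R v + b11 *\<^sub>R p0 + b21 *\<^sub>R q0" by (simp add: p_def mv_simps Xp0 Xv algebra_simps)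
  then have Xp: "X *v p = b11 *\<^sub>R p + b21 *\<^sub>R q" unfolding e by (simp add: p_def q_def algebra_simps)
  have "X *v q = (x2 + e2 * f) *\<^sub>R v + b12 *\<^sub>R p0 + b22 *\<^sub>R q0" by (simp add: q_def mv_simps Xq0 Xv algebra_simps)
  then have Xq: "X *v q = b12 *\<^sub>R p + b22 *\<^sub>R q" unfolding e by (simp add: p_def q_def algebra_simps)
  have i: "ind3 v p q"
  proof (rule ind3I)
    fix r s t assume "r *\<^sub>R v + s *\<^sub>R p + t *\<^sub>R q = 0"
    then have "(r + s * e1 + t * e2) *\<^sub>R v + s *\<^sub>R p0 + t *\<^sub>R q0 = 0" by (simp add: p_def q_def algebra_simps)
    from ind3D[OF i0 this] show "r = 0 \<and> s = 0 \<and> t = 0" by auto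
  qed
  have XF: "X *v (F *v x) = F *v (X *v x)" and XM: "X *v (M *v x) = M *v (X *v x)" for x
    by (simp_all add: X mv_simps commute)
  obtain fF f11 f12 f21 f22 where Fb: "F *v v = fF *\<^sub>R v" "F *v p = f11 *\<^sub>R p + f21 *\<^sub>R q" "F *v q = f12 *\<^sub>R p + f22 *\<^sub>R q"
    by (rule commuting_block[OF i Xv Xp Xq D(2)[unfolded D_def] XF])
  obtain fM m11 m12 m21 m22 where Mb: "M *v v = fM *\<^sub>R v" "M *v p = m11 *\<^sub>R p + m21 *\<^sub>R q" "M *v q = m12 *\<^sub>R p + m22 *\<^sub>R q"
    by (rule commuting_block[OF i Xv Xp Xq D(2)[unfolded D_def] XM])
  have v0: "s *\<^sub>R v = t *\<^sub>R v \<Longrightarrow> s = t" for s t using v(1) by simp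
  have fX: "f = c * fF + d * fM" using Xv unfolding X by (intro v0) (simp add: mv_simps Fb Mb algebra_simps)
  \<comment> \<open>\<open>Y = \<alpha> F + \<beta> M\<close> is to kill \<open>v\<close>; if \<open>X\<close> does so already, take \<open>Y = X\<close>.\<close>
  have cd: "\<not> (c = 0 \<and> d = 0)"
  proof
    assume "c = 0 \<and> d = 0"
    then have "X = 0" by (simp add: X)
    then show False using nn by (simp add: trace_def matrix_matrix_mult_def det_3)
  qed
  obtain \<alpha> \<beta> where \<alpha>\<beta>: "\<not> (\<alpha> = 0 \<and> \<beta> = 0)" "\<alpha> * fF + \<beta> * fM = 0" "f = 0 \<Longrightarrow> \<alpha> = c \<and> \<beta> = d"
  proof (cases "f = 0")
    case True then show ?thesis using that[of c d] cd fX by simp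
  next
    case False
    have "\<not> (fM = 0 \<and> - fF = 0)" using False fX by auto
    then show ?thesis by (rule that) (use False in simp_all)
  qed
  define Y where "Y = \<alpha> *\<^sub>R F + \<beta> *\<^sub>R M"
  have Yv: "Y *v v = 0"
  proof -
    have "Y *v v = (\<alpha> * fF + \<beta> * fM) *\<^sub>R v" by (simp add: Y_def mv_simps Fb Mb algebra_simps)
    then show ?thesis by (simp add: \<alpha>\<beta>)
  qed
  define y11 y12 y21 y22 where "y11 = \<alpha> * f11 + \<beta> * m11" and "y12 = \<alpha> * f12 + \<beta> * m12" and "y21 = \<alpha> * f21 + \<beta> * m21" and "y22 = \<alpha> * f22 + \<beta> * m22"
  have Yp: "Y *v p = y11 *\<^sub>R p + y21 *\<^sub>R q" and Yq: "Y *v q = y12 *\<^sub>R p + y22 *\<^sub>R q"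
    by (simp_all add: Y_def mv_simps Fb Mb y11_def y12_def y21_def y22_def algebra_simps)
  have trY: "trace Y = 0" unfolding Y_def trace_linear using trF trM by simp
  have "trace Y = 0 + y11 + y22"
    by (rule trace_ind3[OF i, of Y 0 0 0 0 y11 y21 0 y12 y22]) (simp_all add: Yv Yp Yq)
  then have y22: "y22 = - y11" using trY by simp
  define \<kappa> where "\<kappa> = y11 * y11 + y12 * y21"
  have Y2: "Y *v (Y *v p) = \<kappa> *\<^sub>R p" "Y *v (Y *v q) = \<kappa> *\<^sub>R q"
    by (simp_all add: Yp Yq mv_simps y22 \<kappa>_def algebra_simps)
  have Yn: "y11 \<noteq> 0 \<or> y12 \<noteq> 0 \<or> y21 \<noteq> 0"
  proof (rule ccontr)
    assume z: "\<not> ?thesis"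
    have "Y *v x = 0" for x
    proof -
      obtain r s t where x: "x = r *\<^sub>R v + s *\<^sub>R p + t *\<^sub>R q" using ind3_expand[OF i] by blast
      show ?thesis using z by (simp add: x mv_simps Yv Yp Yq y22)
    qed
    then have "Y = 0" by (simp add: matrix_eq)
    then show False using ind \<alpha>\<beta>(1) unfolding Y_def by blast
  qed
  \<comment> \<open>a vector of the plane that is not an eigenvector of \<open>Y\<close>\<close>
  obtain s t where st: "(s * y11 + t * y12) * t \<noteq> (s * y21 + t * y22) * s"
  proof -
    consider "y21 \<noteq> 0" | "y12 \<noteq> 0" | "y21 = 0" "y12 = 0" "y11 \<noteq> 0" using Yn by blast
    then show ?thesis
    proof cases
      case 1 then show ?thesis by (intro that[of 1 0]) simp
    next
      case 2 then show ?thesis by (intro that[of 0 1]) simp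
    next
      case 3 then show ?thesis by (intro that[of 1 1]) (simp add: y22)
    qed
  qed
  define p1 q1 where "p1 = s *\<^sub>R p + t *\<^sub>R q" and "q1 = Y *v p1"
  have Yp1: "Y *v p1 = q1" "Y *v q1 = \<kappa> *\<^sub>R p1" by (simp_all add: q1_def p1_def mv_simps Y2 algebra_simps)
  have q1e: "q1 = (s * y11 + t * y12) *\<^sub>R p + (s * y21 + t * y22) *\<^sub>R q" by (simp add: q1_def p1_def mv_simps Yp Yq algebra_simps)
  have det1: "s * (s * y21 + t * y22) - t * (s * y11 + t * y12) \<noteq> 0" using st by (simp add: algebra_simps)
  have i1: "ind3 v p1 q1"
  proof (rule ind3I)
    fix r x y assume "r *\<^sub>R v + x *\<^sub>R p1 + y *\<^sub>R q1 = 0"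
    then have "r *\<^sub>R v + (x * s + y * (s * y11 + t * y12)) *\<^sub>R p + (x * t + y * (s * y21 + t * y22)) *\<^sub>R q = 0"
      by (simp add: p1_def q1e algebra_simps)
    from ind3D[OF i this] have z: "r = 0" "x * s + y * (s * y11 + t * y12) = 0" "x * t + y * (s * y21 + t * y22) = 0" by blast+
    have "x * (s * (s * y21 + t * y22) - t * (s * y11 + t * y12)) = 0" "y * (s * (s * y21 + t * y22) - t * (s * y11 + t * y12)) = 0"
      using z(2,3) by algebra+
    then show "r = 0 \<and> x = 0 \<and> y = 0" using z(1) det1 by simp
  qed
  have Pinv: "\<exists>g c'. Z *v p1 = g *\<^sub>R p1 + c' *\<^sub>R q1 \<and> Z *v q1 = g *\<^sub>R q1 + (c' * \<kappa>) *\<^sub>R p1" if Z: "Z = \<gamma> *\<^sub>R F + \<delta> *\<^sub>R M" for Z \<gamma> \<delta>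
  proof -
    obtain z g c' where g: "Z *v p1 = z *\<^sub>R v + g *\<^sub>R p1 + c' *\<^sub>R q1" using ind3_expand[OF i1] by blast
    have "\<exists>u w. Z *v p1 = u *\<^sub>R p + w *\<^sub>R q"
      by (intro exI[of _ "\<gamma> * (s * f11 + t * f12) + \<delta> * (s * m11 + t * m12)"] exI[of _ "\<gamma> * (s * f21 + t * f22) + \<delta> * (s * m21 + t * m22)"])
        (simp add: Z p1_def mv_simps Fb Mb algebra_simps)
    then obtain u w where "Z *v p1 = u *\<^sub>R p + w *\<^sub>R q" by blast
    then have "z *\<^sub>R v + (g * s + c' * (s * y11 + t * y12)) *\<^sub>R p + (g * t + c' * (s * y21 + t * y22)) *\<^sub>R q = 0 *\<^sub>R v + u *\<^sub>R p + w *\<^sub>R q"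
      using g by (simp add: p1_def q1e algebra_simps)
    from ind3_eqD[OF i this] have "z = 0" by blast
    then have 1: "Z *v p1 = g *\<^sub>R p1 + c' *\<^sub>R q1" using g by simp
    have "Z *v q1 = Y *v (Z *v p1)" by (simp add: q1_def Y_def Z mv_simps commute algebra_simps)
    then have "Z *v q1 = g *\<^sub>R q1 + (c' * \<kappa>) *\<^sub>R p1" by (simp add: 1 mv_simps Yp1)
    then show ?thesis using 1 by blast
  qed
  have \<kappa>: "\<kappa> \<noteq> 0"
  proof
    assume k0: "\<kappa> = 0"
    show False
    proof (cases "f = 0")
      case True
      then have "Y = X" using \<alpha>\<beta>(3) by (simp add: X Y_def)
      then have "y11 *\<^sub>R p + y21 *\<^sub>R q = b11 *\<^sub>R p + b21 *\<^sub>R q" "y12 *\<^sub>R p + y22 *\<^sub>R q = b12 *\<^sub>R p + b22 *\<^sub>R q" using Xp Xq Yp Yq by auto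
      then have "0 *\<^sub>R v + y11 *\<^sub>R p + y21 *\<^sub>R q = 0 *\<^sub>R v + b11 *\<^sub>R p + b21 *\<^sub>R q" "0 *\<^sub>R v + y12 *\<^sub>R p + y22 *\<^sub>R q = 0 *\<^sub>R v + b12 *\<^sub>R p + b22 *\<^sub>R q" by simp_all
      then have "y11 = b11" "y21 = b21" "y12 = b12" "y22 = b22" using ind3_eqD[OF i] by blast+
      then have "b11 = y11" "b21 = y21" "b12 = y12" "b22 = - y11" using y22 by simp_all
      then have "D = - \<kappa>" by (simp add: D_def \<kappa>_def True)
      then show False using D(2) k0 by simp
    next
      case False
      have NN: "Y *v (Y *v x) = 0" for x
      proof -
        obtain r x' y where x: "x = r *\<^sub>R v + x' *\<^sub>R p1 + y *\<^sub>R q1" using ind3_expand[OF i1] by blast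
        show ?thesis by (simp add: x mv_simps Yv Yp1 k0)
      qed
      obtain g c' where g: "X *v p1 = g *\<^sub>R p1 + c' *\<^sub>R q1" "X *v q1 = g *\<^sub>R q1 + (c' * \<kappa>) *\<^sub>R p1" using Pinv[OF X] by blast
      have "trace X = f + g + g"
        by (rule trace_ind3[OF i1, of X f 0 0 0 g c' 0 "c' * \<kappa>" g]) (simp_all add: Xv g)
      then have g0: "g \<noteq> 0" using trX False by auto
      have "x = 0" if "X *v x = 0" for x
      proof -
        obtain r x' y where x: "x = r *\<^sub>R v + x' *\<^sub>R p1 + y *\<^sub>R q1" using ind3_expand[OF i1] by blast
        have "(r * f) *\<^sub>R v + (x' * g) *\<^sub>R p1 + (x' * c' + y * g) *\<^sub>R q1 = 0"
          using that by (simp add: x mv_simps Xv g k0 algebra_simps)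
        from ind3D[OF i1 this] have "r * f = 0" "x' * g = 0" "x' * c' + y * g = 0" by blast+
        then show ?thesis using False g0 by (simp add: x)
      qed
      then have "\<alpha> = 0 \<and> \<beta> = 0"
        using invertible_excludes_square_zero[OF NN Y_def X] by blast
      then show False using \<alpha>\<beta>(1) by blast
    qed
  qed
  define W where "W = (- \<beta>) *\<^sub>R F + \<alpha> *\<^sub>R M"
  obtain g c' where W: "W *v p1 = g *\<^sub>R p1 + c' *\<^sub>R q1" "W *v q1 = g *\<^sub>R q1 + (c' * \<kappa>) *\<^sub>R p1" using Pinv[OF W_def] by blast
  define Z where "Z = (- \<beta> - c' * \<alpha>) *\<^sub>R F + (\<alpha> - c' * \<beta>) *\<^sub>R M"
  have ZW: "Z *v x = W *v x - c' *\<^sub>R (Y *v x)" for x by (simp add: Z_def W_def Y_def mv_simps algebra_simps)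
  have Zp: "Z *v p1 = g *\<^sub>R p1" "Z *v q1 = g *\<^sub>R q1" by (simp_all add: ZW W Yp1)
  have Zv': "Z *v v = (- \<beta> * fF + \<alpha> * fM) *\<^sub>R v" by (simp add: ZW W_def mv_simps Yv Fb Mb algebra_simps)
  have "trace Z = 0" unfolding Z_def trace_linear using trF trM by simp
  moreover have "trace Z = (- \<beta> * fF + \<alpha> * fM) + g + g"
    by (rule trace_ind3[OF i1, of Z "- \<beta> * fF + \<alpha> * fM" 0 0 0 g 0 0 0 g]) (simp_all add: Zv' Zp)
  ultimately have "- \<beta> * fF + \<alpha> * fM = - 2 * g" by simp
  then have Zv: "Z *v v = (- 2 * g) *\<^sub>R v" using Zv' by (simp only:)
  have nz: "\<alpha> * \<alpha> + \<beta> * \<beta> \<noteq> 0" using \<alpha>\<beta>(1) by auto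
  have "g \<noteq> 0"
  proof
    assume g: "g = 0"
    have "Z *v x = 0" for x
    proof -
      obtain r x' y where x: "x = r *\<^sub>R v + x' *\<^sub>R p1 + y *\<^sub>R q1" using ind3_expand[OF i1] by blast
      show ?thesis by (simp add: x mv_simps Zv Zp g)
    qed
    then have "Z = 0" by (simp add: matrix_eq)
    then have "- \<beta> - c' * \<alpha> = 0" "\<alpha> - c' * \<beta> = 0" using ind unfolding Z_def by blast+
    then have "\<alpha> * \<alpha> + \<beta> * \<beta> = 0" by algebra
    then show False using nz by simp
  qed
  moreover have "\<alpha> * (\<alpha> - c' * \<beta>) - \<beta> * (- \<beta> - c' * \<alpha>) \<noteq> 0" using nz by (simp add: algebra_simps)
  ultimately show ?thesis using listed_torus[OF Y_def Z_def _ i1 Yv Yp1 Zv Zp \<kappa>] by blast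
qed

lemma listed_split: "listed br"
proof (cases "\<exists>a b. a *\<^sub>R F + b *\<^sub>R M = 0 \<and> \<not> (a = 0 \<and> b = 0)")
  case True then show ?thesis using listed_dependent by blast
next
  case False
  then have ind: "\<And>a b. a *\<^sub>R F + b *\<^sub>R M = 0 \<Longrightarrow> a = 0 \<and> b = 0" by blast
  show ?thesis
  proof (cases "\<exists>a b. trace ((a *\<^sub>R F + b *\<^sub>R M) ** (a *\<^sub>R F + b *\<^sub>R M)) \<noteq> 0 \<or> det (a *\<^sub>R F + b *\<^sub>R M) \<noteq> 0")
    case True then show ?thesis using listed_not_nilpotent[OF ind refl] by blast
  next
    case False
    have nil: "(a *\<^sub>R F + b *\<^sub>R M) *v ((a *\<^sub>R F + b *\<^sub>R M) *v ((a *\<^sub>R F + b *\<^sub>R M) *v x)) = 0" for a b x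
    proof -
      have "trace (a *\<^sub>R F + b *\<^sub>R M) = 0" unfolding trace_linear using trF trM by simp
      from cayley_hamilton_3[OF this, of x] show ?thesis using False by simp
    qed
    show ?thesis by (rule listed_all_nilpotent) (erule ind, rule nil)
  qed
qed

end

lemma (in semidirect3) listed_semidirect3: "listed br"
proof (cases "h = 0")
  case True
  then have "split_semidirect3 br \<iota> S T F M h" by unfold_locales
  then show ?thesis by (rule split_semidirect3.listed_split)
next
  case False
  then show ?thesis using listed_nilradical_filiform listed_nilradical_heisenberg by blast
qed

section \<open>The transverse case assembled\<close>

context offdiagonal
begin

text \<open>The parameters translate into the matrices of \<open>e 2\<close> and \<open>e 4\<close> on the span of \<open>e 1\<close>, \<open>e 3\<close>, \<open>e 5\<close>.\<close>

lemma listed_abelian_ideal: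
  assumes z: "c3 = 0" "c5 = 0" "q1 = 0" "r1 = 0" "Q1 = 0" "R1 = 0"
  shows "listed br"
proof -
  define \<iota> where "\<iota> = (\<lambda>x::real^3. x $ 1 *\<^sub>R e 1 + x $ 2 *\<^sub>R e 3 + x $ 3 *\<^sub>R e 5)"
  define F :: "real^3^3" where "F = vector [vector [q2 + R2, - b3, - b5], vector [p3, - q2, - r2], vector [p5, - Q2, - R2]]"
  define M :: "real^3^3" where "M = vector [vector [m11, - q2, - r2], vector [- q2, m33, m35], vector [- Q2, m53, m55]]"
  have Fx: "(F *v x) $ 1 = (q2 + R2) * x $ 1 - b3 * x $ 2 - b5 * x $ 3" "(F *v x) $ 2 = p3 * x $ 1 - q2 * x $ 2 - r2 * x $ 3"
    "(F *v x) $ 3 = p5 * x $ 1 - Q2 * x $ 2 - R2 * x $ 3" for x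
    by (simp_all add: F_def matrix_vector_mult_def sum_3 vector_3)
  have Mx: "(M *v x) $ 1 = m11 * x $ 1 - q2 * x $ 2 - r2 * x $ 3" "(M *v x) $ 2 = - q2 * x $ 1 + m33 * x $ 2 + m35 * x $ 3"
    "(M *v x) $ 3 = - Q2 * x $ 1 + m53 * x $ 2 + m55 * x $ 3" for x
    by (simp_all add: M_def matrix_vector_mult_def sum_3 vector_3)
  note hv = component_relations(21-23)[unfolded z]
  have "semidirect3 br \<iota> (e 2) (e 4) F M m22"
  proof
    fix x y :: "real^3" and s t :: real
    show "\<iota> (x + y) = \<iota> x + \<iota> y" "\<iota> (s *\<^sub>R x) = s *\<^sub>R \<iota> x" by (simp_all add: \<iota>_def algebra_simps)
    show "x = 0 \<and> s = 0 \<and> t = 0" if E: "\<iota> x + s *\<^sub>R e 2 + t *\<^sub>R e 4 = 0"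
    proof -
      have "\<phi> i (\<iota> x + s *\<^sub>R e 2 + t *\<^sub>R e 4) = 0" for i by (simp add: E phi_simps)
      from this[of 1] this[of 2] this[of 3] this[of 4] this[of 5] show ?thesis
        by (simp add: \<iota>_def phi_simps dual vec_eq_iff forall_3)
    qed
    show "br (e 2) (\<iota> x) = \<iota> (F *v x)"
      by (rule vec_eqI5; simp add: \<iota>_def Fx jacobi_eval z offdiag algebra_simps)
    show "br (e 4) (\<iota> x) = \<iota> (M *v x)"
      by (rule vec_eqI5; simp add: \<iota>_def Mx jacobi_eval z offdiag algebra_simps)
    show "br (\<iota> x) (\<iota> y) = 0"
      by (rule vec_eqI5; simp add: \<iota>_def jacobi_eval z offdiag)
    show "br (e 4) (e 2) = m22 *\<^sub>R e 2" by (simp add: table z offdiag)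
    show "trace F = 0" by (simp add: F_def trace_def sum_3 vector_3)
    show "trace M = 0" using hv by (simp add: M_def trace_def sum_3 vector_3)
    show "M *v axis 1 1 = F *v axis 2 1 + m22 *\<^sub>R axis 1 1"
      using hv by (simp add: vec_eq_iff forall_3 Fx Mx) (simp add: axis_def)
    show "(M *v x) $ 1 + m22 * x $ 1 = (F *v x) $ 2"
    proof -
      have "m11 + m22 = p3" using hv by simp
      then have "m11 * x $ 1 + m22 * x $ 1 = p3 * x $ 1" by (simp add: distrib_right[symmetric])
      then show ?thesis by (simp add: Fx Mx)
    qed
  qed
  then show ?thesis by (rule semidirect3.listed_semidirect3)
qed

lemma listed_degenerate:
  assumes solv: "solvable_lie br" and c: "c3 = 0" "c5 = 0"
    and deg: "b3 = 0 \<Longrightarrow> b5 = 0 \<Longrightarrow> q1 = 0 \<and> r1 = 0 \<and> Q1 = 0 \<and> R1 = 0"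
  shows "listed br"
  using listed_filiform_or_abelian_ideal[OF assms] listed_abelian_ideal c by blast

end

text \<open>The tangent of the angle solves \<open>u * t * t - w * t - u = 0\<close>, whose discriminant \<open>w\<^sup>2 + 4 * u\<^sup>2\<close> is nonnegative.\<close>

lemma exists_diagonalising_angle:
  fixes u w :: real
  obtains c s where "c\<^sup>2 + s\<^sup>2 = 1" "u * (c\<^sup>2 - s\<^sup>2) + w * (c * s) = 0"
proof (cases "u = 0")
  case True then show ?thesis using that[of 1 0] by simp
next
  case False
  define r where "r = sqrt (w\<^sup>2 + 4 * u\<^sup>2)"
  have r: "r * r = w\<^sup>2 + 4 * u\<^sup>2" by (simp add: r_def)
  define t where "t = (w + r) / (2 * u)"
  have "2 * u * t = w + r" using False by (simp add: t_def)
  then have "(2 * u * t - w) * (2 * u * t - w) = w\<^sup>2 + 4 * u\<^sup>2" using r by simp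
  then have "4 * u * (u * t * t - w * t - u) = 0" by (simp add: power2_eq_square algebra_simps)
  then have t: "u * t * t - w * t - u = 0" using False by simp
  define n where "n = sqrt (1 + t\<^sup>2)"
  have n: "n\<^sup>2 = 1 + t\<^sup>2" "n \<noteq> 0" by (simp_all add: n_def add_nonneg_eq_0_iff)
  show ?thesis
  proof (rule that[of "1 / n" "t / n"])
    have "(1 / n)\<^sup>2 + (t / n)\<^sup>2 = (1 + t\<^sup>2) / n\<^sup>2" by (simp add: power_divide add_divide_distrib)
    then show "(1 / n)\<^sup>2 + (t / n)\<^sup>2 = 1" using n(2) unfolding n(1)[symmetric] by simp
    have "u * ((1 / n)\<^sup>2 - (t / n)\<^sup>2) + w * (1 / n * (t / n)) = - (u * t * t - w * t - u) / n\<^sup>2"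
      by (simp add: power_divide power2_eq_square algebra_simps diff_divide_distrib add_divide_distrib)
    then show "u * ((1 / n)\<^sup>2 - (t / n)\<^sup>2) + w * (1 / n * (t / n)) = 0" using t by simp
  qed
qed

context transverse
begin

abbreviation (input) "rot_coframe c s \<equiv> coframe_of (\<lambda>x. c * \<phi> 1 x + s * \<phi> 2 x) (\<lambda>x. c * \<phi> 2 x - s * \<phi> 1 x) (\<phi> 3) (\<phi> 4) (\<phi> 5)"
abbreviation (input) "rot_frame c s \<equiv> family5 (c *\<^sub>R e 1 + s *\<^sub>R e 2) (c *\<^sub>R e 2 - s *\<^sub>R e 1) (e 3) (e 4) (e 5)"

lemma rotate_transverse:
  assumes w: "c\<^sup>2 + s\<^sup>2 = 1"
  shows "transverse br (rot_coframe c s) (rot_frame c s)"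
proof -
  have n: "c * c + s * s = 1" using w by (simp add: power2_eq_square)
  have h: "hypo5 br (rot_coframe c s) (rot_frame c s)" by (rule rotate_plane[OF w])
  have tr: "trace_ad br (rot_coframe c s) (rot_frame c s) x = trace_ad br \<phi> e x" for x
  proof -
    have "trace_ad br (rot_coframe c s) (rot_frame c s) x = (c * c + s * s) * (\<phi> 1 (br x (e 1)) + \<phi> 2 (br x (e 2)))
       + \<phi> 3 (br x (e 3)) + \<phi> 4 (br x (e 4)) + \<phi> 5 (br x (e 5))"
      by (simp add: trace_ad_def sum_5 br_simps phi_simps algebra_simps)
    then show ?thesis by (simp add: n trace_ad_def sum_5)
  qed
  show ?thesis
    by (intro transverse.intro h transverse_axioms.intro) (simp_all add: closed4 tr unimodular_kernel)
qed

text \<open>Under a rotation the two matrices of the action on the plane are conjugated, and the pairs such as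
\<open>q1, q2\<close> rotate like vectors.\<close>

lemma rotated_parameters:
  assumes w: "c\<^sup>2 + s\<^sup>2 = 1"
  shows "transverse.a3 br (rot_coframe c s) (rot_frame c s) = a3 * (c\<^sup>2 - s\<^sup>2) + (b3 + c3) * (c * s)"
    "transverse.a5 br (rot_coframe c s) (rot_frame c s) = a5 * (c\<^sup>2 - s\<^sup>2) + (b5 + c5) * (c * s)"
    "transverse.b3 br (rot_coframe c s) (rot_frame c s) = b3 * c\<^sup>2 - c3 * s\<^sup>2 - 2 * a3 * c * s"
    "transverse.b5 br (rot_coframe c s) (rot_frame c s) = b5 * c\<^sup>2 - c5 * s\<^sup>2 - 2 * a5 * c * s"
    "transverse.c3 br (rot_coframe c s) (rot_frame c s) = c3 * c\<^sup>2 - b3 * s\<^sup>2 - 2 * a3 * c * s"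
    "transverse.c5 br (rot_coframe c s) (rot_frame c s) = c5 * c\<^sup>2 - b5 * s\<^sup>2 - 2 * a5 * c * s"
    "transverse.q1 br (rot_coframe c s) (rot_frame c s) = c * q1 + s * q2"
    "transverse.r1 br (rot_coframe c s) (rot_frame c s) = c * r1 + s * r2"
    "transverse.Q1 br (rot_coframe c s) (rot_frame c s) = c * Q1 + s * Q2"
    "transverse.R1 br (rot_coframe c s) (rot_frame c s) = c * R1 + s * R2"
proof -
  interpret r: transverse br "rot_coframe c s" "rot_frame c s" by (rule rotate_transverse[OF w])
  show "r.a3 = a3 * (c\<^sup>2 - s\<^sup>2) + (b3 + c3) * (c * s)" "r.a5 = a5 * (c\<^sup>2 - s\<^sup>2) + (b5 + c5) * (c * s)"
    "r.b3 = b3 * c\<^sup>2 - c3 * s\<^sup>2 - 2 * a3 * c * s" "r.b5 = b5 * c\<^sup>2 - c5 * s\<^sup>2 - 2 * a5 * c * s"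
    "r.c3 = c3 * c\<^sup>2 - b3 * s\<^sup>2 - 2 * a3 * c * s" "r.c5 = c5 * c\<^sup>2 - b5 * s\<^sup>2 - 2 * a5 * c * s"
    "r.q1 = c * q1 + s * q2" "r.r1 = c * r1 + s * r2" "r.Q1 = c * Q1 + s * Q2" "r.R1 = c * R1 + s * R2"
    unfolding r.param_defs by (simp_all add: jacobi_eval power2_eq_square algebra_simps)
qed

end

context offdiagonal
begin

text \<open>When \<open>e 3\<close> and \<open>e 5\<close> act trivially on the plane, the Jacobi relations make the four pairs \<open>q1, q2\<close>, \<open>r1, r2\<close>, \<open>Q1, Q2\<close>
and \<open>R1, R2\<close> parallel, so that one rotation annihilates their first members.\<close>

lemma listed_offdiagonal_zero:
  assumes solv: "solvable_lie br" and z: "b3 = 0" "b5 = 0" "c3 = 0" "c5 = 0"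
  shows "listed br"
proof -
  note J = jacobi_relations
  have "\<exists>x y. \<not> (x = 0 \<and> y = 0) \<and> x * q1 + y * q2 = 0 \<and> x * r1 + y * r2 = 0 \<and> x * Q1 + y * Q2 = 0 \<and> x * R1 + y * R2 = 0"
  proof -
    consider "r1 \<noteq> 0 \<or> r2 \<noteq> 0" | "r1 = 0" "r2 = 0" "q1 \<noteq> 0 \<or> q2 \<noteq> 0" | "r1 = 0" "r2 = 0" "q1 = 0" "q2 = 0" by blast
    then show ?thesis
    proof cases
      case 1
      have q: "q1 * r2 = q2 * r1" using J(6) by simp
      have J17: "R1 * r2 + R2 * r1 + 2 * q2 * r1 = 0" and J18: "r1 * (R1 + q1) = 0" and J25: "r2 * (R2 + q2) = 0"
        using J(16) J(17) J(23) z by algebra+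
      have R: "R1 = - q1 \<and> R2 = - q2"
      proof (cases "r1 = 0")
        case True
        then have "r2 \<noteq> 0" "q1 = 0" using 1 q by auto
        moreover from this have "R2 = - q2" using J25 by (simp add: eq_neg_iff_add_eq_0)
        moreover have "R1 = 0" using J17 True \<open>r2 \<noteq> 0\<close> by simp
        ultimately show ?thesis by simp
      next
        case False
        then have R1: "R1 = - q1" using J18 by (simp add: eq_neg_iff_add_eq_0)
        then have "r1 * (R2 + q2) = 0" using J17 q by algebra
        then show ?thesis using R1 False by (simp add: eq_neg_iff_add_eq_0)
      qed
      have "Q1 * r2 = - q1 * q2" "Q2 * r1 = - q1 * q2" using J(12) J(21) R by (algebra, algebra)
      then have "(- r2) * Q1 + r1 * Q2 = 0" by (simp add: mult.commute)
      moreover have "(- r2) * q1 + r1 * q2 = 0" "(- r2) * r1 + r1 * r2 = 0" using q by (simp_all add: mult.commute)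
      moreover have "(- r2) * R1 + r1 * R2 = 0" using q R by (simp add: mult.commute)
      moreover have "\<not> (- r2 = 0 \<and> r1 = 0)" using 1 by auto
      ultimately show ?thesis by blast
    next
      case 2
      have "q1 * (R1 + 2 * q1) = 0" "q1 * (R2 + 2 * q2) = 0" "q2 * (R2 + 2 * q2) = 0" "q2 * (R1 + 2 * q1) = 0"
        using J(13) J(12) J(20) J(21) z 2(1,2) by algebra+
      then have "R1 + 2 * q1 = 0" "R2 + 2 * q2 = 0" using 2(3) by auto
      then have R: "R1 = - 2 * q1" "R2 = - 2 * q2" by simp_all
      have "Q2 * q1 = Q1 * q2" using J(3) R by simp
      then have "(- q2) * Q1 + q1 * Q2 = 0" "(- q2) * q1 + q1 * q2 = 0" "(- q2) * r1 + q1 * r2 = 0" "(- q2) * R1 + q1 * R2 = 0"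
        using 2 R by (simp_all add: mult.commute)
      moreover have "\<not> (- q2 = 0 \<and> q1 = 0)" using 2 by auto
      ultimately show ?thesis by blast
    next
      case 3
      have QR: "Q1 * R2 = Q2 * R1" using J(3) by simp
      show ?thesis
      proof (cases "R1 = 0 \<and> R2 = 0")
        case True
        show ?thesis
        proof (cases "Q1 = 0 \<and> Q2 = 0")
          case q: True
          show ?thesis using 3 True q by (intro exI[of _ 1] exI[of _ 0]) simp
        next
          case False
          then show ?thesis using 3 True by (intro exI[of _ "- Q2"] exI[of _ Q1]) (auto simp: mult.commute)
        qed
      next
        case False
        then show ?thesis using 3 QR by (intro exI[of _ "- R2"] exI[of _ R1]) (auto simp: mult.commute)
      qed
    qed
  qed
  then obtain x y where xy: "\<not> (x = 0 \<and> y = 0)" "x * q1 + y * q2 = 0" "x * r1 + y * r2 = 0" "x * Q1 + y * Q2 = 0" "x * R1 + y * R2 = 0"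
    by blast
  define n where "n = sqrt (x\<^sup>2 + y\<^sup>2)"
  have n: "n \<noteq> 0" "n\<^sup>2 = x\<^sup>2 + y\<^sup>2" using xy(1) by (auto simp: n_def sum_power2_eq_zero_iff)
  have w: "(x / n)\<^sup>2 + (y / n)\<^sup>2 = 1"
  proof -
    have "(x / n)\<^sup>2 + (y / n)\<^sup>2 = (x\<^sup>2 + y\<^sup>2) / n\<^sup>2" by (simp add: power_divide add_divide_distrib)
    then show ?thesis using n(1) unfolding n(2)[symmetric] by simp
  qed
  have "x / n * u + y / n * v = (x * u + y * v) / n" for u v by (simp add: add_divide_distrib)
  then have "x / n * q1 + y / n * q2 = 0" "x / n * r1 + y / n * r2 = 0" "x / n * Q1 + y / n * Q2 = 0" "x / n * R1 + y / n * R2 = 0"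
    using xy by simp_all
  with w obtain c s where w: "c\<^sup>2 + s\<^sup>2 = 1"
    and cs: "c * q1 + s * q2 = 0" "c * r1 + s * r2 = 0" "c * Q1 + s * Q2 = 0" "c * R1 + s * R2 = 0" by blast
  interpret r: transverse br "rot_coframe c s" "rot_frame c s" by (rule rotate_transverse[OF w])
  note par = rotated_parameters[OF w, unfolded z offdiag cs]
  interpret o: offdiagonal br "rot_coframe c s" "rot_frame c s"
    by unfold_locales (simp_all add: par)
  show ?thesis
    by (rule o.listed_abelian_ideal) (simp_all add: par)
qed

text \<open>A quarter turn exchanges the roles of \<open>b\<close> and \<open>c\<close> and reduces the case \<open>b3 = b5 = 0\<close> to \<open>c3 = c5 = 0\<close>.\<close>

lemma listed_degenerate_rotated:
  assumes w: "c\<^sup>2 + s\<^sup>2 = 1"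
    and par: "b3 * c\<^sup>2 - c3 * s\<^sup>2 \<noteq> 0 \<or> b5 * c\<^sup>2 - c5 * s\<^sup>2 \<noteq> 0"
      "c3 * c\<^sup>2 - b3 * s\<^sup>2 = 0" "c5 * c\<^sup>2 - b5 * s\<^sup>2 = 0" "c * s = 0"
    and solv: "solvable_lie br"
  shows "listed br"
proof -
  interpret r: transverse br "rot_coframe c s" "rot_frame c s" by (rule rotate_transverse[OF w])
  note rp = rotated_parameters[OF w]
  have a: "r.a3 = 0" "r.a5 = 0" using rp(1,2) offdiag par(4) by (simp_all add: mult.assoc)
  interpret o: offdiagonal br "rot_coframe c s" "rot_frame c s" by unfold_locales (rule a)+
  have "r.c3 = 0" "r.c5 = 0" "r.b3 \<noteq> 0 \<or> r.b5 \<noteq> 0"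
    using rp(3-6) offdiag par(1-3) by auto
  then show ?thesis using o.listed_degenerate[OF solv] by blast
qed

lemma listed_offdiagonal:
  assumes solv: "solvable_lie br"
  shows "listed br"
proof -
  consider "b5 * c5 \<noteq> 0" | "b5 = 0" "c5 = 0" "b3 * c3 \<noteq> 0" | "c3 = 0" "c5 = 0" | "b3 = 0" "b5 = 0"
  proof -
    have J12: "b3 * c5 = b5 * c3" using jacobi_relations(11) by simp
    show ?thesis
      using that J12 by (cases "b5 = 0"; cases "c5 = 0"; cases "b3 = 0"; cases "c3 = 0") auto
  qed
  then show ?thesis
  proof cases
    case 1 then show ?thesis by (rule listed_if_reeb_acts_invertibly[OF solv])
  next
    case 2 then show ?thesis by (rule listed_if_reeb_acts_trivially[OF solv])
  next
    case 3
    show ?thesis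
    proof (cases "b3 = 0 \<and> b5 = 0")
      case True then show ?thesis using listed_offdiagonal_zero[OF solv] 3 by blast
    next
      case False then show ?thesis using listed_degenerate[OF solv 3] by blast
    qed
  next
    case 4
    show ?thesis
    proof (cases "c3 = 0 \<and> c5 = 0")
      case True then show ?thesis using listed_offdiagonal_zero[OF solv] 4 by blast
    next
      case False
      have w: "(0::real)\<^sup>2 + 1\<^sup>2 = 1" by simp
      show ?thesis by (rule listed_degenerate_rotated[OF w _ _ _ _ solv]) (use 4 offdiag False in simp_all)
    qed
  qed
qed

end

text \<open>Both matrices of the action become off-diagonal under the same rotation, because they are proportional.\<close>

lemma (in transverse) listed_transverse:
  assumes solv: "solvable_lie br"
  shows "listed br"
proof -
  have "\<exists>c s. c\<^sup>2 + s\<^sup>2 = 1 \<and> a3 * (c\<^sup>2 - s\<^sup>2) + (b3 + c3) * (c * s) = 0 \<and> a5 * (c\<^sup>2 - s\<^sup>2) + (b5 + c5) * (c * s) = 0"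
  proof (cases "a5 = 0 \<and> b5 + c5 = 0")
    case True
    obtain c s where "c\<^sup>2 + s\<^sup>2 = 1" "a3 * (c\<^sup>2 - s\<^sup>2) + (b3 + c3) * (c * s) = 0"
      using exists_diagonalising_angle by blast
    then show ?thesis using True by (intro exI[of _ c] exI[of _ s]) simp
  next
    case False
    obtain c s where cs: "c\<^sup>2 + s\<^sup>2 = 1" "a5 * (c\<^sup>2 - s\<^sup>2) + (b5 + c5) * (c * s) = 0"
      using exists_diagonalising_angle by blast
    have "a5 * (a3 * (c\<^sup>2 - s\<^sup>2) + (b3 + c3) * (c * s)) = 0" "(b5 + c5) * (a3 * (c\<^sup>2 - s\<^sup>2) + (b3 + c3) * (c * s)) = 0"
      using cs(2) kernel_action_commutes by algebra+
    then show ?thesis using cs False by auto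
  qed
  then obtain c s where w: "c\<^sup>2 + s\<^sup>2 = 1" and d: "a3 * (c\<^sup>2 - s\<^sup>2) + (b3 + c3) * (c * s) = 0" "a5 * (c\<^sup>2 - s\<^sup>2) + (b5 + c5) * (c * s) = 0"
    by blast
  interpret r: transverse br "rot_coframe c s" "rot_frame c s" by (rule rotate_transverse[OF w])
  interpret o: offdiagonal br "rot_coframe c s" "rot_frame c s"
    by unfold_locales (simp_all add: rotated_parameters[OF w] d)
  show ?thesis by (rule o.listed_offdiagonal[OF solv])
qed

section \<open>All closed one-forms nonzero on the Reeb vector: abelian kernel\<close>

text \<open>The trace does not depend on the frame in which it is computed.\<close>

lemma (in lie5) trace_ad_frame_independent:
  assumes "coframe5 br \<phi> e" "coframe5 br \<psi> f"
  shows "trace_ad br \<phi> e x = trace_ad br \<psi> f x"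
proof -
  interpret p: coframe5 br \<phi> e by fact
  interpret q: coframe5 br \<psi> f by fact
  have "\<phi> i (br x (e i)) = (\<Sum>j\<in>UNIV. \<psi> j (br x (e i)) * \<phi> i (f j))" for i
    using arg_cong[OF q.expand[of "br x (e i)"], of "\<phi> i"] by (simp add: sum_5 p.phi_simps)
  then have "trace_ad br \<phi> e x = (\<Sum>i\<in>UNIV. \<Sum>j\<in>UNIV. \<psi> j (br x (e i)) * \<phi> i (f j))" by (simp add: trace_ad_def)
  also have "\<dots> = (\<Sum>j\<in>UNIV. \<Sum>i\<in>UNIV. \<psi> j (br x (e i)) * \<phi> i (f j))" by (rule sum.swap)
  also have "\<dots> = (\<Sum>j\<in>UNIV. \<psi> j (br x (f j)))"
  proof (rule sum.cong)
    fix j :: 5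
    show "(\<Sum>i\<in>UNIV. \<psi> j (br x (e i)) * \<phi> i (f j)) = \<psi> j (br x (f j))"
      using arg_cong[OF p.expand[of "f j"], of "\<lambda>y. \<psi> j (br x y)"] by (simp add: sum_5 br_simps q.phi_simps mult.commute)
  qed simp
  finally show ?thesis by (simp add: trace_ad_def)
qed

text \<open>Every closed one-form is a multiple of \<open>\<delta>\<close>. Equivalently the brackets span the kernel of \<open>\<delta>\<close>; the dual
formulation in terms of functionals, \<open>functional_zero\<close> below, is the one that gets used.\<close>

locale reeb5 = hypo5 br \<phi> e for br :: "'a::real_vector \<Rightarrow> 'a \<Rightarrow> 'a" and \<phi> e +
  fixes \<delta> :: "'a \<Rightarrow> real"
  assumes lin_delta: "linear \<delta>" and closed_delta: "closed1 br \<delta>" and delta_reeb: "\<delta> (e 5) = 1"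
    and no_closed: "\<And>\<epsilon> x. linear \<epsilon> \<Longrightarrow> closed1 br \<epsilon> \<Longrightarrow> \<epsilon> (e 5) = 0 \<Longrightarrow> \<epsilon> x = 0"
begin

abbreviation "D \<equiv> br (e 5)"

lemmas delta_simps = linear_add[OF lin_delta] linear_diff[OF lin_delta] linear_cmul[OF lin_delta]
  linear_neg[OF lin_delta] linear_0[OF lin_delta]

lemma delta_br [simp]: "\<delta> (br x y) = 0" using closed_delta by (simp add: closed1_def)

lemma delta_eqI: "\<delta> x = 0 \<Longrightarrow> \<phi> 1 x = 0 \<Longrightarrow> \<phi> 2 x = 0 \<Longrightarrow> \<phi> 3 x = 0 \<Longrightarrow> \<phi> 4 x = 0 \<Longrightarrow> x = 0"
  using arg_cong[OF expand5[of x], of \<delta>] expand5[of x] by (simp add: delta_simps delta_reeb)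

text \<open>Such a functional vanishes on all brackets, since any vector is the sum of a member of the kernel of \<open>\<delta>\<close> and a
multiple of \<open>e 5\<close>; being closed and zero on \<open>e 5\<close>, it is zero.\<close>

lemma functional_zero:
  assumes f: "linear f" "f (e 5) = (0::real)"
    and b: "\<And>x y. \<delta> x = 0 \<Longrightarrow> \<delta> y = 0 \<Longrightarrow> f (br x y) = 0" "\<And>x. \<delta> x = 0 \<Longrightarrow> f (D x) = 0"
  shows "f x = 0"
proof (rule no_closed[OF f(1) _ f(2)])
  note fs = linear_add[OF f(1)] linear_diff[OF f(1)] linear_cmul[OF f(1)] linear_neg[OF f(1)] linear_0[OF f(1)]
  have "f (br x y) = 0" for x y
  proof -
    define x' y' where "x' = x - \<delta> x *\<^sub>R e 5" and "y' = y - \<delta> y *\<^sub>R e 5"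
    have "\<delta> x' = 0" "\<delta> y' = 0" by (simp_all add: x'_def y'_def delta_simps delta_reeb)
    moreover have "br x y = br x' y' + \<delta> x *\<^sub>R D y' - \<delta> y *\<^sub>R D x'"
      using br_anti[of x "e 5"] by (simp add: x'_def y'_def br_simps algebra_simps)
    ultimately show ?thesis using b by (simp add: fs)
  qed
  then show "closed1 br f" by (simp add: closed1_def)
qed

lemma trace_zero: "trace_ad br \<phi> e x = 0"
  by (rule no_closed[OF trace_ad_linear trace_ad_closed trace_ad_reeb])

lemma om1_simps: "om1 \<phi> (x + y) z = om1 \<phi> x z + om1 \<phi> y z" "om1 \<phi> z (x + y) = om1 \<phi> z x + om1 \<phi> z y"
  "om1 \<phi> (x - y) z = om1 \<phi> x z - om1 \<phi> y z" "om1 \<phi> z (x - y) = om1 \<phi> z x - om1 \<phi> z y"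
  "om1 \<phi> (c *\<^sub>R x) z = c * om1 \<phi> x z" "om1 \<phi> z (c *\<^sub>R x) = c * om1 \<phi> z x"
  "om1 \<phi> (- x) z = - om1 \<phi> x z" "om1 \<phi> z (- x) = - om1 \<phi> z x"
  "om1 \<phi> 0 z = 0" "om1 \<phi> z 0 = 0" "om1 \<phi> x x = 0" "om1 \<phi> (e 5) z = 0" "om1 \<phi> z (e 5) = 0"
  by (simp_all add: om1_def wedge11_def phi_simps dual algebra_simps)

lemma om1_anti: "om1 \<phi> y x = - om1 \<phi> x y" by (simp add: om1_def wedge11_def)

text \<open>Infinitesimal invariance: the two-form \<open>om1\<close> is closed and contraction with \<open>e 5\<close> annihilates it.\<close>

lemma om1_D: "om1 \<phi> (D x) y = - om1 \<phi> x (D y)"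
  using kahler[of "e 5" x y] om1_anti[of x "D y"] by (simp add: om1_simps)

lemma om1_nondegenerate:
  assumes "\<delta> x = 0" "\<And>y. \<delta> y = 0 \<Longrightarrow> om1 \<phi> x y = 0"
  shows "x = 0"
proof -
  have "om1 \<phi> x (e j) = 0" for j
    using assms(2)[of "e j - \<delta> (e j) *\<^sub>R e 5"] by (simp add: om1_simps delta_simps delta_reeb)
  from this[of 1] this[of 2] this[of 3] this[of 4] show ?thesis
    by (intro delta_eqI assms(1)) (simp_all add: om1_def wedge11_def dual)
qed

text \<open>The square of an element of the symplectic algebra is selfadjoint for \<open>om1\<close>. In a symplectic basis a
selfadjoint matrix has scalar diagonal blocks of size two and mutually adjugate off-diagonal blocks, and
therefore satisfies a quadratic equation.\<close>

lemma square_quadratic: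
  obtains t d where "\<And>x. \<delta> x = 0 \<Longrightarrow> D (D (D (D x))) = t *\<^sub>R D (D x) - d *\<^sub>R x"
proof -
  define \<sigma> where "\<sigma> k j = \<phi> k (D (D (e j)))" for k j
  have adj: "om1 \<phi> (D (D x)) y = om1 \<phi> x (D (D y))" for x y by (simp add: om1_D)
  note a = adj[of "e 1" "e 1"] adj[of "e 2" "e 2"] adj[of "e 3" "e 3"] adj[of "e 4" "e 4"] adj[of "e 1" "e 2"]
    adj[of "e 1" "e 3"] adj[of "e 1" "e 4"] adj[of "e 2" "e 3"] adj[of "e 2" "e 4"] adj[of "e 3" "e 4"]
  have r: "\<sigma> 2 1 = 0" "\<sigma> 1 2 = 0" "\<sigma> 4 3 = 0" "\<sigma> 3 4 = 0" "\<sigma> 2 2 = \<sigma> 1 1" "\<sigma> 2 3 = - \<sigma> 4 1" "\<sigma> 2 4 = \<sigma> 3 1"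
    "\<sigma> 4 2 = \<sigma> 1 3" "\<sigma> 3 2 = - \<sigma> 1 4" "\<sigma> 4 4 = \<sigma> 3 3"
    using a by (simp_all add: om1_def wedge11_def dual \<sigma>_def)
  have S: "\<phi> k (D (D x)) = \<phi> 1 x * \<sigma> k 1 + \<phi> 2 x * \<sigma> k 2 + \<phi> 3 x * \<sigma> k 3 + \<phi> 4 x * \<sigma> k 4" for k x
    using arg_cong[OF expand5[of x], of "\<lambda>y. \<phi> k (D (D y))"] by (simp add: br_simps phi_simps \<sigma>_def)
  show ?thesis
  proof (rule that)
    fix x assume x: "\<delta> x = 0"
    let ?t = "\<sigma> 1 1 + \<sigma> 3 3" and ?d = "\<sigma> 1 1 * \<sigma> 3 3 - \<sigma> 1 3 * \<sigma> 3 1 - \<sigma> 1 4 * \<sigma> 4 1"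
    have "D (D (D (D x))) - ?t *\<^sub>R D (D x) + ?d *\<^sub>R x = 0"
      by (rule delta_eqI) (simp_all add: delta_simps x phi_simps S r algebra_simps)
    then show "D (D (D (D x))) = ?t *\<^sub>R D (D x) - ?d *\<^sub>R x" by (simp add: algebra_simps add_eq_0_iff)
  qed
qed

end

locale reeb5_abelian = reeb5 +
  assumes abelian: "\<And>x y. \<delta> x = 0 \<Longrightarrow> \<delta> y = 0 \<Longrightarrow> br x y = 0"
begin

text \<open>If \<open>D x = 0\<close>, then the functional \<open>om1 \<phi> x\<close> vanishes on the image of \<open>D\<close>, which is the whole kernel of \<open>\<delta>\<close>.\<close>

lemma D_injective:
  assumes x: "\<delta> x = 0" "D x = 0"
  shows "x = 0"
proof (rule om1_nondegenerate[OF x(1)])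
  fix y
  have "linear (om1 \<phi> x)" by (rule linearI) (simp_all add: om1_simps)
  then show "om1 \<phi> x y = 0"
  proof (rule functional_zero)
    show "om1 \<phi> x (D y) = 0" for y using om1_D[of x y] x(2) by (simp add: om1_simps)
  qed (simp_all add: om1_simps abelian)
qed

lemma bracket_table_D:
  assumes u: "\<delta> v1 = 0" "\<delta> v2 = 0" "\<delta> v3 = 0" "\<delta> v4 = 0" and c: "c \<noteq> 0"
    and ind: "\<And>a b f g. a *\<^sub>R v1 + b *\<^sub>R v2 + f *\<^sub>R v3 + g *\<^sub>R v4 = 0 \<Longrightarrow> a = 0 \<and> b = 0 \<and> f = 0 \<and> g = 0"
    and b: "b1 = - (c *\<^sub>R D v1)" "b2 = - (c *\<^sub>R D v2)" "b3 = - (c *\<^sub>R D v3)" "b4 = - (c *\<^sub>R D v4)"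
  shows "bracket_table v1 v2 v3 v4 (c *\<^sub>R e 5) 0 0 0 b1 0 0 b2 0 b3 b4"
proof -
  have "frame v1 v2 v3 v4 (c *\<^sub>R e 5)"
  proof (rule frameI)
    fix p q r s t assume E: "p *\<^sub>R v1 + q *\<^sub>R v2 + r *\<^sub>R v3 + s *\<^sub>R v4 + t *\<^sub>R c *\<^sub>R e 5 = 0"
    then have "\<delta> (p *\<^sub>R v1 + q *\<^sub>R v2 + r *\<^sub>R v3 + s *\<^sub>R v4 + t *\<^sub>R c *\<^sub>R e 5) = 0" by (simp add: delta_simps)
    then have "t = 0" using c by (simp add: delta_simps u delta_reeb)
    then show "p = 0 \<and> q = 0 \<and> r = 0 \<and> s = 0 \<and> t = 0" using E ind by simp
  qed
  moreover have "br v (c *\<^sub>R e 5) = - (c *\<^sub>R D v)" for v using br_anti[of v "e 5"] by (simp add: br_simps)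
  ultimately show ?thesis unfolding bracket_table_def using u b by (simp add: abelian)
qed

text \<open>Eigenvectors of \<open>D \<circ> D\<close> for different eigenvalues are independent.\<close>

lemma indep_pairs:
  fixes v1 :: 'a
  assumes S: "D (D v1) = s *\<^sub>R v1" "D (D v2) = s *\<^sub>R v2" "D (D v3) = s' *\<^sub>R v3" "D (D v4) = s' *\<^sub>R v4" "s \<noteq> s'"
    and i: "\<And>a b. a *\<^sub>R v1 + b *\<^sub>R v2 = 0 \<Longrightarrow> a = 0 \<and> b = 0" "\<And>a b. a *\<^sub>R v3 + b *\<^sub>R v4 = 0 \<Longrightarrow> a = 0 \<and> b = 0"
    and E: "a *\<^sub>R v1 + b *\<^sub>R v2 + f *\<^sub>R v3 + g *\<^sub>R v4 = 0"
  shows "a = 0 \<and> b = 0 \<and> f = 0 \<and> g = 0"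
proof -
  let ?x = "a *\<^sub>R v1 + b *\<^sub>R v2" and ?y = "f *\<^sub>R v3 + g *\<^sub>R v4"
  have y: "?y = - ?x" using E by (simp add: algebra_simps add_eq_0_iff)
  have "D (D ?y) = s' *\<^sub>R ?y" "D (D ?x) = s *\<^sub>R ?x" using S by (simp_all add: br_simps algebra_simps)
  then have "s' *\<^sub>R ?x = s *\<^sub>R ?x" unfolding y by (simp only: br_simps scaleR_minus_right neg_equal_iff_equal)
  then have "?x = 0" using S(5) by (metis scaleR_right_imp_eq)
  then show ?thesis using i y by simp
qed

text \<open>Invariant planes on which \<open>D\<close> is diagonal with opposite eigenvalues, or a rotation. A real pair is required to be
symplectic, so that it splits off; for a rotation pair this can fail.\<close>

definition real_pair where
  "real_pair \<mu> v w \<longleftrightarrow> \<mu> > 0 \<and> \<delta> v = 0 \<and> \<delta> w = 0 \<and> D v = \<mu> *\<^sub>R v \<and> D w = - \<mu> *\<^sub>R w \<and> om1 \<phi> v w \<noteq> 0"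

definition rotation_pair where
  "rotation_pair r v w \<longleftrightarrow> r > 0 \<and> \<delta> v = 0 \<and> \<delta> w = 0 \<and> D v = - r *\<^sub>R w \<and> D w = r *\<^sub>R v \<and> v \<noteq> 0"

lemma pair_independent:
  assumes "real_pair \<mu> v w \<or> rotation_pair \<mu> v w" "a *\<^sub>R v + b *\<^sub>R w = 0"
  shows "a = 0 \<and> b = 0"
  using assms(1)
proof
  assume p: "real_pair \<mu> v w"
  have "om1 \<phi> (a *\<^sub>R v + b *\<^sub>R w) w = 0" "om1 \<phi> v (a *\<^sub>R v + b *\<^sub>R w) = 0" using assms(2) by (simp_all add: om1_simps)
  then show ?thesis using p by (simp add: real_pair_def om1_simps)
next
  assume p: "rotation_pair \<mu> v w"
  have D: "D (a *\<^sub>R v + b *\<^sub>R w) = 0" using assms(2) by (simp add: br_simps)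
  then have "\<mu> *\<^sub>R (b *\<^sub>R v - a *\<^sub>R w) = 0" using p by (simp add: rotation_pair_def br_simps algebra_simps)
  then have d: "b *\<^sub>R v = a *\<^sub>R w" using p by (simp add: rotation_pair_def)
  have "(a * a + b * b) *\<^sub>R v = a *\<^sub>R (a *\<^sub>R v) + b *\<^sub>R (b *\<^sub>R v)" by (simp add: algebra_simps)
  also have "\<dots> = a *\<^sub>R (a *\<^sub>R v + b *\<^sub>R w)" unfolding d by (simp add: algebra_simps)
  also have "\<dots> = 0" using assms(2) by simp
  finally have "a * a + b * b = 0" using p by (simp add: rotation_pair_def)
  then show ?thesis by (simp add: sum_squares_eq_zero_iff)
qed

lemma listed_two_pairs:
  assumes "real_pair \<mu> v1 v2 \<or> rotation_pair \<mu> v1 v2" "real_pair \<nu> v3 v4 \<or> rotation_pair \<nu> v3 v4"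
    and ind: "\<And>a b f g. a *\<^sub>R v1 + b *\<^sub>R v2 + f *\<^sub>R v3 + g *\<^sub>R v4 = 0 \<Longrightarrow> a = 0 \<and> b = 0 \<and> f = 0 \<and> g = 0"
  shows "listed br"
proof -
  have "\<mu> > 0" "\<nu> > 0" using assms(1,2) by (auto simp: real_pair_def rotation_pair_def)
  then have nz: "\<mu> \<noteq> 0" "\<nu> \<noteq> 0" "\<nu> / \<mu> \<noteq> 0" "\<mu> / \<nu> \<noteq> 0" "1 / \<mu> \<noteq> 0" "1 / \<nu> \<noteq> 0" by simp_all
  have ind': "a = 0 \<and> b = 0 \<and> f = 0 \<and> g = 0" if "a *\<^sub>R v1 + b *\<^sub>R v3 + f *\<^sub>R v4 + g *\<^sub>R v2 = 0" for a b f g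
    using ind[of a g b f] that by (simp add: ac_simps)
  have ind'': "a = 0 \<and> b = 0 \<and> f = 0 \<and> g = 0" if "a *\<^sub>R v3 + b *\<^sub>R v4 + f *\<^sub>R v1 + g *\<^sub>R v2 = 0" for a b f g
    using ind[of f g a b] that by (simp add: ac_simps)
  consider "real_pair \<mu> v1 v2" "real_pair \<nu> v3 v4" | "real_pair \<mu> v1 v2" "rotation_pair \<nu> v3 v4"
    | "rotation_pair \<mu> v1 v2" "real_pair \<nu> v3 v4" | "rotation_pair \<mu> v1 v2" "rotation_pair \<nu> v3 v4" using assms by blast
  then show ?thesis
  proof cases
    case 1
    show ?thesis
      by (intro listed_B3[OF nz(3)], rule bracket_table_D[where c = "1 / \<mu>", OF _ _ _ _ nz(5) ind'])
         (use 1 nz in \<open>auto simp: real_pair_def\<close>)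
  next
    case 2
    show ?thesis
      by (intro listed_B5[OF nz(3)], rule bracket_table_D[where c = "1 / \<mu>", OF _ _ _ _ nz(5) ind])
         (use 2 nz in \<open>auto simp: real_pair_def rotation_pair_def\<close>)
  next
    case 3
    show ?thesis
      by (intro listed_B5[OF nz(4)], rule bracket_table_D[where c = "1 / \<nu>", OF _ _ _ _ nz(6) ind''])
         (use 3 nz in \<open>auto simp: real_pair_def rotation_pair_def\<close>)
  next
    case 4
    show ?thesis
      by (rule listed_B8[OF nz(3), of v1 v2 v3 v4 "(1 / \<mu>) *\<^sub>R e 5"], rule bracket_table_D[where c = "1 / \<mu>", OF _ _ _ _ nz(5) ind])
         (use 4 nz in \<open>auto simp: rotation_pair_def\<close>)
  qed
qed

lemma rotation_pairI:
  assumes "\<delta> x = 0" "x \<noteq> 0" "D (D x) = s *\<^sub>R x" "s < 0"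
  shows "rotation_pair (sqrt (- s)) x (- (1 / sqrt (- s)) *\<^sub>R D x)"
proof -
  have "- s / sqrt (- s) = sqrt (- s)" using assms by (intro real_div_sqrt) simp
  then have "(- s / sqrt (- s)) *\<^sub>R x = sqrt (- s) *\<^sub>R x" by (simp only:)
  then show ?thesis unfolding rotation_pair_def using assms by (simp add: br_simps delta_simps)
qed

text \<open>The projections onto the two eigenspaces of \<open>D\<close>, up to factors \<open>P\<close> and \<open>M\<close>, have isotropic images, because \<open>om1\<close> can only pair
opposite eigenvalues. So an eigenvector pairs nontrivially with one for the opposite eigenvalue.\<close>

lemma real_pair_exists:
  assumes E: "\<And>x. x \<in> E \<Longrightarrow> \<delta> x = 0" "\<And>x. x \<in> E \<Longrightarrow> D x \<in> E" "\<And>x. x \<in> E \<Longrightarrow> D (D x) = \<mu>\<^sup>2 *\<^sub>R x"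
      "\<And>x c. x \<in> E \<Longrightarrow> c *\<^sub>R x \<in> E" "\<And>x y. x \<in> E \<Longrightarrow> y \<in> E \<Longrightarrow> x + y \<in> E"
    and nondeg: "\<And>x. x \<in> E \<Longrightarrow> (\<And>y. y \<in> E \<Longrightarrow> om1 \<phi> x y = 0) \<Longrightarrow> x = 0"
    and x: "x \<in> E" "x \<noteq> 0" and m: "\<mu> > 0"
  obtains v w where "v \<in> E" "w \<in> E" "real_pair \<mu> v w"
proof -
  define P where "P y = D y + \<mu> *\<^sub>R y" for y
  define M where "M y = D y + (- \<mu>) *\<^sub>R y" for y
  have in_E: "P y \<in> E" "M y \<in> E" if "y \<in> E" for y using E that by (simp_all only: P_def M_def)
  have eig: "D (P y) = \<mu> *\<^sub>R P y" "D (M y) = - \<mu> *\<^sub>R M y" if "y \<in> E" for y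
    using E(3)[OF that] by (simp_all add: P_def M_def br_simps power2_eq_square algebra_simps)
  have split: "P y - M y = (2 * \<mu>) *\<^sub>R y" for y by (simp add: P_def M_def algebra_simps flip: scaleR_2)
  have iso: "om1 \<phi> a b = 0" if "D a = k *\<^sub>R a" "D b = k *\<^sub>R b" "k \<noteq> 0" for a b k
    using om1_D[of a b] that by (simp add: om1_simps)
  have "P x \<noteq> 0 \<or> M x \<noteq> 0" using split[of x] x m by auto
  then show ?thesis
  proof
    assume nz: "P x \<noteq> 0"
    then obtain y where y: "y \<in> E" "om1 \<phi> (P x) y \<noteq> 0" using nondeg in_E x by blast
    have "om1 \<phi> (P x) (P y) = 0" by (rule iso[OF eig(1)[OF x(1)] eig(1)[OF y(1)]]) (use m in simp)
    moreover have "om1 \<phi> (P x) (P y) - om1 \<phi> (P x) (M y) = 2 * \<mu> * om1 \<phi> (P x) y"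
      using arg_cong[OF split[of y], of "om1 \<phi> (P x)"] by (simp add: om1_simps)
    ultimately have "om1 \<phi> (P x) (M y) \<noteq> 0" using y m by (auto simp: minus_equation_iff)
    then show ?thesis using that[of "P x" "M y"] in_E eig E(1) x y m by (simp add: real_pair_def)
  next
    assume nz: "M x \<noteq> 0"
    then obtain y where y: "y \<in> E" "om1 \<phi> (M x) y \<noteq> 0" using nondeg in_E x by blast
    have "om1 \<phi> (M x) (M y) = 0" by (rule iso[OF eig(2)[OF x(1)] eig(2)[OF y(1)]]) (use m in simp)
    moreover have "om1 \<phi> (M x) (P y) - om1 \<phi> (M x) (M y) = 2 * \<mu> * om1 \<phi> (M x) y"
      using arg_cong[OF split[of y], of "om1 \<phi> (M x)"] by (simp add: om1_simps)
    ultimately have "om1 \<phi> (P y) (M x) \<noteq> 0" using y m om1_anti[of "M x" "P y"] by (auto simp: minus_equation_iff)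
    then show ?thesis using that[of "P y" "M x"] in_E eig E(1) x y m by (simp add: real_pair_def)
  qed
qed

lemma not_spanned_by_two:
  obtains y where "\<delta> y = 0" "y \<notin> span {v, w}"
proof -
  have "\<exists>y. \<delta> y = 0 \<and> y \<notin> span {v, w}"
  proof (rule ccontr)
    assume "\<not> ?thesis"
    then have u: "y \<in> span {v, w}" if "\<delta> y = 0" for y using that by blast
    have "y \<in> span {v, w, e 5}" for y
    proof -
      have "y - \<delta> y *\<^sub>R e 5 \<in> span {v, w}" by (rule u) (simp add: delta_simps delta_reeb)
      moreover have "span {v, w} \<subseteq> span {v, w, e 5}" by (rule span_mono) auto
      ultimately have "y - \<delta> y *\<^sub>R e 5 \<in> span {v, w, e 5}" by blast
      moreover have "\<delta> y *\<^sub>R e 5 \<in> span {v, w, e 5}" by (simp add: span_base span_scale)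
      ultimately have "(y - \<delta> y *\<^sub>R e 5) + \<delta> y *\<^sub>R e 5 \<in> span {v, w, e 5}" by (rule span_add)
      then show ?thesis by simp
    qed
    then have "dim (UNIV :: 'a set) \<le> card {v, w, e 5}" by (intro dim_le_card) auto
    also have "\<dots> \<le> 3" by (simp add: card_insert_if)
    finally show False using dim5 by simp
  qed
  then show ?thesis using that by blast
qed

text \<open>For \<open>s < 0\<close> the endomorphism \<open>D\<close> is a multiple of a complex structure, and any two vectors that are
independent over the complex numbers give the frame. For \<open>s > 0\<close> a real pair is split off and its orthogonal
complement with respect to \<open>om1\<close> supplies the second one.\<close>

lemma listed_scalar_square:
  assumes S: "\<And>x. \<delta> x = 0 \<Longrightarrow> D (D x) = s *\<^sub>R x"
  shows "listed br"
proof -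
  obtain x where x: "\<delta> x = 0" "x \<noteq> 0" using not_spanned_by_two[of 0 0] span_zero by metis
  have "s \<noteq> 0"
  proof
    assume "s = 0"
    then have "D (D x) = 0" using S x by simp
    then show False using D_injective[of "D x"] D_injective[of x] x by simp
  qed
  then consider "s < 0" | "s > 0" by linarith
  then show ?thesis
  proof cases
    case 1
    define r where "r = sqrt (- s)"
    define v2 where "v2 = - (1 / r) *\<^sub>R D x"
    obtain y where y: "\<delta> y = 0" "y \<notin> span {x, v2}" by (rule not_spanned_by_two)
    define v4 where "v4 = - (1 / r) *\<^sub>R D y"
    have "y \<noteq> 0" using y span_zero by metis
    then have p: "rotation_pair r x v2" "rotation_pair r y v4"
      unfolding v2_def v4_def r_def using rotation_pairI x y S 1 by blast+
    then have r: "r > 0" by (simp add: rotation_pair_def)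
    have "a = 0 \<and> b = 0 \<and> f = 0 \<and> g = 0" if E: "a *\<^sub>R x + b *\<^sub>R v2 + f *\<^sub>R y + g *\<^sub>R v4 = 0" for a b f g
    proof -
      have "D (a *\<^sub>R x + b *\<^sub>R v2 + f *\<^sub>R y + g *\<^sub>R v4) = 0" using E by (simp add: br_simps)
      then have "r *\<^sub>R (b *\<^sub>R x - a *\<^sub>R v2 + g *\<^sub>R y - f *\<^sub>R v4) = 0"
        using p by (simp add: rotation_pair_def br_simps algebra_simps)
      then have E2: "b *\<^sub>R x - a *\<^sub>R v2 + g *\<^sub>R y - f *\<^sub>R v4 = 0" using r by simp
      have "(f * f + g * g) *\<^sub>R y = f *\<^sub>R (a *\<^sub>R x + b *\<^sub>R v2 + f *\<^sub>R y + g *\<^sub>R v4) + g *\<^sub>R (b *\<^sub>R x - a *\<^sub>R v2 + g *\<^sub>R y - f *\<^sub>R v4)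
         + ((- (f * a) - g * b) *\<^sub>R x + (g * a - f * b) *\<^sub>R v2)" by (simp add: algebra_simps)
      also have "\<dots> = (- (f * a) - g * b) *\<^sub>R x + (g * a - f * b) *\<^sub>R v2" by (simp only: E E2) simp
      also have "\<dots> \<in> span {x, v2}" by (intro span_add span_scale span_base) auto
      finally have sp: "(f * f + g * g) *\<^sub>R y \<in> span {x, v2}" .
      have "f * f + g * g = 0"
      proof (rule ccontr)
        assume n: "f * f + g * g \<noteq> 0"
        have "(1 / (f * f + g * g)) *\<^sub>R (f * f + g * g) *\<^sub>R y \<in> span {x, v2}" by (rule span_scale[OF sp])
        then show False using n y by (simp del: sum_squares_eq_zero_iff)
      qed
      then have "f = 0" "g = 0" by (simp_all add: sum_squares_eq_zero_iff)
      then show ?thesis using E pair_independent[of r x v2 a b] p by simp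
    qed
    then show ?thesis using listed_two_pairs p by blast
  next
    case 2
    define \<mu> where "\<mu> = sqrt s"
    have m: "\<mu> > 0" "s = \<mu>\<^sup>2" using 2 by (simp_all add: \<mu>_def)
    obtain v w where "v \<in> {x. \<delta> x = 0}" "w \<in> {x. \<delta> x = 0}" and p: "real_pair \<mu> v w"
      by (rule real_pair_exists[of "{x. \<delta> x = 0}" \<mu> x]) (use om1_nondegenerate x m S in \<open>auto simp: delta_simps\<close>)
    define k where "k = om1 \<phi> v w"
    have k: "k \<noteq> 0" "om1 \<phi> w v = - k" using p om1_anti[of v w] by (simp_all add: real_pair_def k_def)
    define E where "E = {y. \<delta> y = 0 \<and> om1 \<phi> v y = 0 \<and> om1 \<phi> w y = 0}"
    define Q where "Q y = y - (om1 \<phi> v y / k) *\<^sub>R w + (om1 \<phi> w y / k) *\<^sub>R v" for y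
    have Q: "Q y \<in> E" if "\<delta> y = 0" for y
      using that p k by (simp add: E_def Q_def om1_simps real_pair_def delta_simps flip: k_def)
    have "D y \<in> E" if "y \<in> E" for y
      using that p om1_D[of v y] om1_D[of w y] by (simp add: E_def real_pair_def om1_simps)
    moreover have "z = 0" if z: "z \<in> E" "\<And>y. y \<in> E \<Longrightarrow> om1 \<phi> z y = 0" for z
    proof (rule om1_nondegenerate)
      show "\<delta> z = 0" using z by (simp add: E_def)
      fix y assume "\<delta> y = 0"
      then have "om1 \<phi> z (Q y) = 0" using z Q by blast
      then show "om1 \<phi> z y = 0" using z(1) om1_anti[of v z] om1_anti[of w z] by (simp add: Q_def om1_simps E_def)
    qed
    moreover obtain y where y: "\<delta> y = 0" "y \<notin> span {v, w}" by (rule not_spanned_by_two)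
    moreover have "Q y \<noteq> 0"
    proof
      assume "Q y = 0"
      then have "y = (om1 \<phi> v y / k) *\<^sub>R w + (- (om1 \<phi> w y / k)) *\<^sub>R v" by (simp add: Q_def algebra_simps)
      also have "\<dots> \<in> span {v, w}" by (intro span_add span_scale span_base) auto
      finally show False using y by simp
    qed
    ultimately obtain v' w' where E': "v' \<in> E" "w' \<in> E" and p': "real_pair \<mu> v' w'"
      by (rule_tac real_pair_exists[of E \<mu> "Q y"]) (use Q S m in \<open>auto simp: E_def delta_simps om1_simps\<close>)
    have "a = 0 \<and> b = 0 \<and> f = 0 \<and> g = 0" if z: "a *\<^sub>R v + b *\<^sub>R w + f *\<^sub>R v' + g *\<^sub>R w' = 0" for a b f g
    proof -
      have "om1 \<phi> v (a *\<^sub>R v + b *\<^sub>R w + f *\<^sub>R v' + g *\<^sub>R w') = 0" "om1 \<phi> w (a *\<^sub>R v + b *\<^sub>R w + f *\<^sub>R v' + g *\<^sub>R w') = 0"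
        by (simp_all add: z om1_simps)
      then have "a = 0" "b = 0" using k E' by (simp_all add: om1_simps E_def flip: k_def)
      then show ?thesis using z pair_independent[of \<mu> v' w' f g] p' by simp
    qed
    then show ?thesis using listed_two_pairs p p' by blast
  qed
qed

lemma pair_in_eigenspace:
  assumes E: "\<And>x. x \<in> E \<Longrightarrow> \<delta> x = 0" "\<And>x. x \<in> E \<Longrightarrow> D x \<in> E" "\<And>x. x \<in> E \<Longrightarrow> D (D x) = s *\<^sub>R x"
      "\<And>x c. x \<in> E \<Longrightarrow> c *\<^sub>R x \<in> E" "\<And>x y. x \<in> E \<Longrightarrow> y \<in> E \<Longrightarrow> x + y \<in> E"
    and nondeg: "\<And>x. x \<in> E \<Longrightarrow> (\<And>y. y \<in> E \<Longrightarrow> om1 \<phi> x y = 0) \<Longrightarrow> x = 0"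
    and x: "x \<in> E" "x \<noteq> 0"
  obtains \<mu> v w where "v \<in> E" "w \<in> E" "real_pair \<mu> v w \<or> rotation_pair \<mu> v w"
proof -
  have "s \<noteq> 0"
  proof
    assume "s = 0"
    then have "D (D x) = 0" using E(3) x by simp
    then show False using D_injective[of "D x"] D_injective[of x] x E(1,2) by simp
  qed
  then consider "s < 0" | "s > 0" by linarith
  then show ?thesis
  proof cases
    case 1
    then have p: "rotation_pair (sqrt (- s)) x (- (1 / sqrt (- s)) *\<^sub>R D x)" using rotation_pairI E x by blast
    have "- (1 / sqrt (- s)) *\<^sub>R D x \<in> E" by (intro E x)
    then show ?thesis using that x p by blast
  next
    case 2
    then have m: "sqrt s > 0" "s = (sqrt s)\<^sup>2" by simp_all
    have sq: "D (D y) = (sqrt s)\<^sup>2 *\<^sub>R y" if "y \<in> E" for y using E(3)[OF that] 2 by simp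
    show ?thesis by (rule real_pair_exists[OF E(1,2) sq E(4,5) nondeg x m(1)]) (auto intro: that)
  qed
qed

text \<open>The eigenspaces of the selfadjoint square are orthogonal for \<open>om1\<close>, hence symplectic planes, and each of them
contributes a real pair or a rotation pair.\<close>

lemma listed_distinct_roots:
  assumes S: "\<And>x. \<delta> x = 0 \<Longrightarrow> D (D (D (D x))) = (s1 + s2) *\<^sub>R D (D x) - (s1 * s2) *\<^sub>R x" and s: "s1 \<noteq> s2"
    and x1: "\<delta> x1 = 0" "D (D x1) \<noteq> s2 *\<^sub>R x1" and x2: "\<delta> x2 = 0" "D (D x2) \<noteq> s1 *\<^sub>R x2"
  shows "listed br"
proof -
  define E where "E s = {x. \<delta> x = 0 \<and> D (D x) = s *\<^sub>R x}" for s
  have orth: "om1 \<phi> x y = 0" if "x \<in> E a" "y \<in> E b" "a \<noteq> b" for x y a b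
  proof -
    have "om1 \<phi> (D (D x)) y = om1 \<phi> x (D (D y))" by (simp add: om1_D)
    then show ?thesis using that by (simp add: E_def om1_simps)
  qed
  have proj: "D (D y) - b *\<^sub>R y \<in> E a" if "\<delta> y = 0" "(a, b) = (s1, s2) \<or> (a, b) = (s2, s1)" for y a b
    using that S by (auto simp: E_def delta_simps br_simps algebra_simps)
  have pair: "\<exists>\<mu> v w. v \<in> E a \<and> w \<in> E a \<and> (real_pair \<mu> v w \<or> rotation_pair \<mu> v w)"
    if ab: "(a, b) = (s1, s2) \<or> (a, b) = (s2, s1)" and x: "\<delta> x = 0" "D (D x) \<noteq> b *\<^sub>R x" for a b x
  proof -
    have ne: "a \<noteq> b" using ab s by auto
    have nd: "z = 0" if z: "z \<in> E a" "\<And>y. y \<in> E a \<Longrightarrow> om1 \<phi> z y = 0" for z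
    proof (rule om1_nondegenerate)
      show "\<delta> z = 0" using z by (simp add: E_def)
      fix y assume y: "\<delta> y = 0"
      have "om1 \<phi> z (D (D y) - b *\<^sub>R y) = 0" using z(2) proj[OF y ab] by blast
      moreover have "(b, a) = (s1, s2) \<or> (b, a) = (s2, s1)" using ab by auto
      from this have "om1 \<phi> z (D (D y) - a *\<^sub>R y) = 0" using orth[OF z(1) proj[OF y]] ne by blast
      ultimately have "(a - b) * om1 \<phi> z y = 0" by (auto simp: om1_simps left_diff_distrib)
      then show "om1 \<phi> z y = 0" using ne by simp
    qed
    show ?thesis
      by (rule pair_in_eigenspace[of "E a" a "D (D x) - b *\<^sub>R x"])
         (use proj[OF x(1) ab] x(2) nd in \<open>auto simp: E_def delta_simps br_simps algebra_simps\<close>)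
  qed
  obtain \<mu> v w where a: "v \<in> E s1" "w \<in> E s1" "real_pair \<mu> v w \<or> rotation_pair \<mu> v w" using pair[of s1 s2 x1] x1 by blast
  obtain \<nu> v' w' where b: "v' \<in> E s2" "w' \<in> E s2" "real_pair \<nu> v' w' \<or> rotation_pair \<nu> v' w'" using pair[of s2 s1 x2] x2 by blast
  show ?thesis
  proof (rule listed_two_pairs[OF a(3) b(3)])
    fix p q r t assume z: "p *\<^sub>R v + q *\<^sub>R w + r *\<^sub>R v' + t *\<^sub>R w' = 0"
    show "p = 0 \<and> q = 0 \<and> r = 0 \<and> t = 0"
      by (rule indep_pairs[OF _ _ _ _ s _ _ z]) (use a b pair_independent in \<open>auto simp: E_def\<close>)
  qed
qed

text \<open>The adjoint of \<open>D\<close> is \<open>- D\<close>, so an annihilating polynomial remains one when the signs of its odd coefficients are changed.\<close>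

lemma adjoint_factor:
  assumes "\<And>x. \<delta> x = 0 \<Longrightarrow> a *\<^sub>R D (D (D x)) + b *\<^sub>R D (D x) + c *\<^sub>R D x + d *\<^sub>R x = 0" and x: "\<delta> x = 0"
  shows "- a *\<^sub>R D (D (D x)) + b *\<^sub>R D (D x) - c *\<^sub>R D x + d *\<^sub>R x = 0"
proof (rule om1_nondegenerate)
  fix y assume y: "\<delta> y = 0"
  have "om1 \<phi> (- a *\<^sub>R D (D (D x)) + b *\<^sub>R D (D x) - c *\<^sub>R D x + d *\<^sub>R x) y
     = om1 \<phi> x (a *\<^sub>R D (D (D y)) + b *\<^sub>R D (D y) + c *\<^sub>R D y + d *\<^sub>R y)"
    by (simp add: om1_simps om1_D)
  then show "om1 \<phi> (- a *\<^sub>R D (D (D x)) + b *\<^sub>R D (D x) - c *\<^sub>R D x + d *\<^sub>R x) y = 0" by (simp only: assms(1)[OF y] om1_simps)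
qed (simp add: delta_simps x)

text \<open>The biquadratic polynomial of \<open>D\<close> factors over the reals as \<open>D\<^sup>2 - 2 a D + m\<close> times \<open>D\<^sup>2 + 2 a D + m\<close>, where \<open>m = sqrt d\<close>
and \<open>m = a\<^sup>2 + q\<^sup>2\<close>. By \<open>adjoint_factor\<close> and the injectivity of \<open>D\<close> neither factor annihilates the kernel of \<open>\<delta>\<close>, so
each contributes an invariant plane with eigenvalues \<open>\<plusminus> a \<plusminus> q i\<close>.\<close>

lemma listed_complex_roots:
  assumes S: "\<And>x. \<delta> x = 0 \<Longrightarrow> D (D (D (D x))) = t *\<^sub>R D (D x) - d *\<^sub>R x" and td: "t\<^sup>2 < 4 * d"
  shows "listed br"
proof -
  define m where "m = sqrt d"
  have "d > 0" using td zero_le_power2[of t] by linarith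
  then have m: "m > 0" "m * m = d" by (simp_all add: m_def)
  have "t\<^sup>2 < (2 * m)\<^sup>2" using td m(2) by (simp add: power2_eq_square)
  then have "\<bar>t\<bar> < 2 * m" using m(1) abs_le_square_iff[of "2 * m" t] by fastforce
  then have p: "2 * m + t > 0" "2 * m - t > 0" by auto
  define a q where "a = sqrt ((2 * m + t) / 4)" and "q = sqrt ((2 * m - t) / 4)"
  have a: "a > 0" "4 * (a * a) = 2 * m + t" and q: "q > 0" "4 * (q * q) = 2 * m - t" using p by (simp_all add: a_def q_def)
  have aq: "a * a + q * q = m" using a q by simp
  have t: "t = 2 * (a * a) - 2 * (q * q)" using a q by simp
  define T where "T k x = D (D x) - (2 * k) *\<^sub>R D x + (a * a + q * q) *\<^sub>R x" for k x
  have Tker: "T k (T (- k) x) = 0" if "\<delta> x = 0" "k = a \<or> k = - a" for k x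
  proof -
    have "k * k = a * a" using that by auto
    moreover have "T k (T (- k) x) = D (D (D (D x))) + (2 * m - 4 * (k * k)) *\<^sub>R D (D x) + (m * m) *\<^sub>R x"
      by (simp add: T_def br_simps aq algebra_simps flip: scaleR_2)
    ultimately show ?thesis using S[OF that(1)] m a by (simp add: algebra_simps)
  qed
  have "\<exists>x. \<delta> x = 0 \<and> T k x \<noteq> 0" if k: "k \<noteq> 0" for k
  proof (rule ccontr)
    assume "\<not> ?thesis"
    then have z: "T k x = 0" if "\<delta> x = 0" for x using that by blast
    obtain x where x: "\<delta> x = 0" "x \<noteq> 0" using not_spanned_by_two[of 0 0] span_zero by metis
    have "- 0 *\<^sub>R D (D (D x)) + 1 *\<^sub>R D (D x) - (- 2 * k) *\<^sub>R D x + (a * a + q * q) *\<^sub>R x = 0"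
      by (rule adjoint_factor[OF _ x(1)]) (use z in \<open>simp add: T_def\<close>)
    then have "T k x + (2 * k) *\<^sub>R D x + (2 * k) *\<^sub>R D x = 0" by (simp add: T_def algebra_simps)
    then have "(2 * k + 2 * k) *\<^sub>R D x = 0" using z x by (simp only: scaleR_add_left add_0_left)
    then have "D x = 0" using k by simp
    then show False using D_injective x by blast
  qed
  from this[of a] this[of "- a"] a obtain x y where x: "\<delta> x = 0" "T (- a) x \<noteq> 0" and y: "\<delta> y = 0" "T a y \<noteq> 0" by auto
  define v1 v2 v3 v4 where "v1 = T (- a) x" and "v2 = (1 / q) *\<^sub>R (a *\<^sub>R v1 - D v1)"
    and "v3 = T a y" and "v4 = (1 / q) *\<^sub>R (- a *\<^sub>R v3 - D v3)"
  have nz: "v1 \<noteq> 0" "v3 \<noteq> 0" using x y by (simp_all add: v1_def v3_def)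
  have u: "\<delta> v1 = 0" "\<delta> v2 = 0" "\<delta> v3 = 0" "\<delta> v4 = 0"
    using x y by (simp_all add: v1_def v2_def v3_def v4_def T_def delta_simps)
  have Tv1: "T a v1 = 0" using Tker[of x a] x by (simp add: v1_def)
  moreover have "D (D v1) - ((2 * a) *\<^sub>R D v1 - (a * a + q * q) *\<^sub>R v1) = T a v1" by (simp add: T_def)
  ultimately have D2v1: "D (D v1) = (2 * a) *\<^sub>R D v1 - (a * a + q * q) *\<^sub>R v1" by simp
  have Tv3: "T (- a) v3 = 0" using Tker[of y "- a"] y by (simp add: v3_def)
  moreover have "D (D v3) - (- (2 * a) *\<^sub>R D v3 - (a * a + q * q) *\<^sub>R v3) = T (- a) v3" by (simp add: T_def)
  ultimately have D2v3: "D (D v3) = - (2 * a) *\<^sub>R D v3 - (a * a + q * q) *\<^sub>R v3" by simp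
  have Dv: "D v1 = a *\<^sub>R v1 - q *\<^sub>R v2" "D v3 = - a *\<^sub>R v3 - q *\<^sub>R v4" using q by (simp_all add: v2_def v4_def)
  have qD: "q *\<^sub>R D v2 = a *\<^sub>R D v1 - D (D v1)" "q *\<^sub>R D v4 = - a *\<^sub>R D v3 - D (D v3)"
    using q by (simp_all add: v2_def v4_def br_simps)
  have "q *\<^sub>R D v2 = (a * a + q * q) *\<^sub>R v1 - a *\<^sub>R D v1"
    unfolding qD D2v1 by (simp add: algebra_simps flip: scaleR_2)
  also have "\<dots> = q *\<^sub>R (q *\<^sub>R v1 + a *\<^sub>R v2)" unfolding Dv by (simp add: algebra_simps)
  finally have "q *\<^sub>R D v2 = q *\<^sub>R (q *\<^sub>R v1 + a *\<^sub>R v2)" .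
  then have Dv2: "D v2 = q *\<^sub>R v1 + a *\<^sub>R v2" using q by simp
  have "q *\<^sub>R D v4 = (a * a + q * q) *\<^sub>R v3 + a *\<^sub>R D v3"
    unfolding qD D2v3 by (simp add: algebra_simps flip: scaleR_2)
  also have "\<dots> = q *\<^sub>R (q *\<^sub>R v3 - a *\<^sub>R v4)" unfolding Dv by (simp add: algebra_simps)
  finally have "q *\<^sub>R D v4 = q *\<^sub>R (q *\<^sub>R v3 - a *\<^sub>R v4)" .
  then have Dv4: "D v4 = q *\<^sub>R v3 - a *\<^sub>R v4" using q by simp
  have plane: "b = 0 \<and> c = 0" if E: "b *\<^sub>R v + c *\<^sub>R w = 0" and v: "D v = k *\<^sub>R v - q *\<^sub>R w" "D w = q *\<^sub>R v + k *\<^sub>R w" "v \<noteq> 0" for b c k v w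
  proof -
    have "D (b *\<^sub>R v + c *\<^sub>R w) = 0" by (simp add: E br_simps)
    then have "k *\<^sub>R (b *\<^sub>R v + c *\<^sub>R w) + q *\<^sub>R (c *\<^sub>R v - b *\<^sub>R w) = 0" by (simp add: br_simps v(1,2) algebra_simps)
    then have E2: "c *\<^sub>R v - b *\<^sub>R w = 0" using E q by simp
    have "(b * b + c * c) *\<^sub>R v = b *\<^sub>R (b *\<^sub>R v + c *\<^sub>R w) + c *\<^sub>R (c *\<^sub>R v - b *\<^sub>R w)" by (simp add: algebra_simps)
    then have "b * b + c * c = 0" using E E2 v(3) by (simp del: sum_squares_eq_zero_iff)
    then show ?thesis by (simp add: sum_squares_eq_zero_iff)
  qed
  have ind: "b = 0 \<and> c = 0 \<and> f = 0 \<and> g = 0" if E: "b *\<^sub>R v1 + c *\<^sub>R v2 + f *\<^sub>R v3 + g *\<^sub>R v4 = 0" for b c f g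
  proof -
    let ?z = "b *\<^sub>R v1 + c *\<^sub>R v2"
    have fac: "T k x = D (D x - k *\<^sub>R x) - k *\<^sub>R (D x - k *\<^sub>R x) + (q * q) *\<^sub>R x" if "k * k = a * a" for k x
      using that by (simp add: T_def br_simps algebra_simps flip: scaleR_2)
    have "D v2 - a *\<^sub>R v2 = q *\<^sub>R v1" "D v4 - (- a) *\<^sub>R v4 = q *\<^sub>R v3" by (simp_all add: Dv2 Dv4)
    then have "T a v2 = D (q *\<^sub>R v1) - a *\<^sub>R (q *\<^sub>R v1) + (q * q) *\<^sub>R v2"
      "T (- a) v4 = D (q *\<^sub>R v3) - (- a) *\<^sub>R (q *\<^sub>R v3) + (q * q) *\<^sub>R v4" by (simp_all only: fac minus_mult_minus)
    then have T0: "T a v2 = 0" "T (- a) v4 = 0" by (simp_all add: br_simps Dv algebra_simps)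
    have lin: "T k (r *\<^sub>R v + s *\<^sub>R w) = r *\<^sub>R T k v + s *\<^sub>R T k w" for k r s v w by (simp add: T_def br_simps algebra_simps)
    have "?z - ((- f) *\<^sub>R v3 + (- g) *\<^sub>R v4) = 0" using E by (simp add: algebra_simps)
    then have z: "?z = (- f) *\<^sub>R v3 + (- g) *\<^sub>R v4" by simp
    have "T a ?z = 0" using T0 Tv1 by (simp only: lin) simp
    moreover have "T (- a) ?z = 0" using T0 Tv3 by (simp only: z lin) simp
    moreover have "T (- a) ?z - T a ?z = (4 * a) *\<^sub>R D ?z" by (simp add: T_def br_simps algebra_simps flip: scaleR_2)
    ultimately have "D ?z = 0" using a by simp
    then have z0: "?z = 0" by (rule D_injective[rotated]) (simp add: delta_simps u)
    then have "b = 0 \<and> c = 0" by (rule plane[OF _ Dv(1) Dv2 nz(1)])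
    moreover have "(- f) *\<^sub>R v3 + (- g) *\<^sub>R v4 = 0" using z0 z by (simp only:)
    then have "- f = 0 \<and> - g = 0" by (rule plane[OF _ Dv(2) _ nz(2)]) (simp add: Dv4)
    ultimately show ?thesis by simp
  qed
  show ?thesis
    by (rule listed_B9[of v1 v2 v3 v4 "(1 / q) *\<^sub>R e 5" "a / q"], rule bracket_table_D[OF u _ ind])
       (use q in \<open>simp_all add: Dv Dv2 Dv4 algebra_simps\<close>)
qed

text \<open>Here \<open>N = D\<^sup>2 - s\<close> is nonzero with square zero. If \<open>s = \<mu>\<^sup>2\<close>, there is a Jordan block of size two for each of
\<open>\<mu>\<close> and \<open>- \<mu>\<close>, again by \<open>adjoint_factor\<close>; the generalised eigenvectors are obtained by applying \<open>(D + \<mu>)\<^sup>2\<close> and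
\<open>(D - \<mu>)\<^sup>2\<close>. If \<open>s = - r\<^sup>2\<close>, a single vector \<open>x\<close> outside the kernel of \<open>N\<close> generates a Jordan block over the complex
numbers.\<close>

lemma listed_jordan:
  assumes S: "\<And>x. \<delta> x = 0 \<Longrightarrow> D (D (D (D x))) = (2 * s) *\<^sub>R D (D x) - (s * s) *\<^sub>R x"
    and x: "\<delta> x = 0" "D (D x) \<noteq> s *\<^sub>R x"
  shows "listed br"
proof -
  define N where "N x = D (D x) - s *\<^sub>R x" for x
  have N2: "N (N x) = 0" if "\<delta> x = 0" for x
    using S[OF that] by (simp add: N_def br_simps algebra_simps flip: scaleR_2)
  have Nx: "N x \<noteq> 0" "\<delta> (N x) = 0" using x by (simp_all add: N_def delta_simps)
  have "s \<noteq> 0"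
  proof
    assume "s = 0"
    then have "D (D (N x)) = 0" using N2[OF x(1)] by (simp add: N_def)
    then show False using D_injective[of "D (N x)"] D_injective[of "N x"] Nx by simp
  qed
  then consider "s > 0" | "s < 0" by linarith
  then show ?thesis
  proof cases
    case 1
    define \<mu> where "\<mu> = sqrt s"
    have m: "\<mu> > 0" "s = \<mu> * \<mu>" using 1 by (simp_all add: \<mu>_def)
    define F where "F k x = D (D (D x)) + k *\<^sub>R D (D x) - (\<mu> * \<mu>) *\<^sub>R D x - (k * (\<mu> * \<mu>)) *\<^sub>R x" for k x
    have "\<exists>x. \<delta> x = 0 \<and> F k x \<noteq> 0" if k: "k = \<mu> \<or> k = - \<mu>" for k
    proof (rule ccontr)
      assume "\<not> ?thesis"
      then have z: "F k x = 0" if "\<delta> x = 0" for x using that by blast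
      have "- 1 *\<^sub>R D (D (D x)) + k *\<^sub>R D (D x) - (- (\<mu> * \<mu>)) *\<^sub>R D x + (- (k * (\<mu> * \<mu>))) *\<^sub>R x = 0"
        by (rule adjoint_factor[OF _ x(1)]) (use z in \<open>simp add: F_def\<close>)
      then have "F k x + (- 1 *\<^sub>R D (D (D x)) + k *\<^sub>R D (D x) - (- (\<mu> * \<mu>)) *\<^sub>R D x + (- (k * (\<mu> * \<mu>))) *\<^sub>R x) = 0"
        using z x by simp
      then have "(2 * k) *\<^sub>R N x = 0" by (simp add: F_def N_def m algebra_simps flip: scaleR_2)
      then show False using Nx m k by auto
    qed
    from this[of \<mu>] this[of "- \<mu>"] obtain y z where y: "\<delta> y = 0" "F \<mu> y \<noteq> 0" and z: "\<delta> z = 0" "F (- \<mu>) z \<noteq> 0" by blast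
    have S4: "D (D (D (D x))) = (2 * (\<mu> * \<mu>)) *\<^sub>R D (D x) - (\<mu> * \<mu> * (\<mu> * \<mu>)) *\<^sub>R x" if "\<delta> x = 0" for x
      using S[OF that] m by simp
    define w1 v2 w3 v4 where "w1 = F \<mu> y" and "v2 = D (D y) + \<mu> *\<^sub>R D y + \<mu> *\<^sub>R D y + (\<mu> * \<mu>) *\<^sub>R y"
      and "w3 = F (- \<mu>) z" and "v4 = D (D z) - \<mu> *\<^sub>R D z - \<mu> *\<^sub>R D z + (\<mu> * \<mu>) *\<^sub>R z"
    have u: "\<delta> w1 = 0" "\<delta> v2 = 0" "\<delta> w3 = 0" "\<delta> v4 = 0"
      using y z by (simp_all add: w1_def v2_def w3_def v4_def F_def delta_simps)
    have Dv: "D v2 = w1 + \<mu> *\<^sub>R v2" "D v4 = w3 - \<mu> *\<^sub>R v4"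
      by (simp_all add: w1_def v2_def w3_def v4_def F_def br_simps algebra_simps)
    have Dw: "D w1 = \<mu> *\<^sub>R w1" "D w3 = - \<mu> *\<^sub>R w3"
      using S4[OF y(1)] S4[OF z(1)] by (simp_all add: w1_def w3_def F_def br_simps algebra_simps flip: scaleR_2)
    have ind: "a = 0 \<and> b = 0 \<and> f = 0 \<and> g = 0"
      if E: "a *\<^sub>R w1 + b *\<^sub>R v2 + f *\<^sub>R w3 + g *\<^sub>R v4 = 0" for a b f g
    proof -
      define A where "A x = D x + \<mu> *\<^sub>R x" for x
      define B where "B x = D x - \<mu> *\<^sub>R x" for x
      let ?E = "a *\<^sub>R w1 + b *\<^sub>R v2 + f *\<^sub>R w3 + g *\<^sub>R v4"
      have AB0: "A w1 = (2 * \<mu>) *\<^sub>R w1" "A v2 = w1 + (2 * \<mu>) *\<^sub>R v2" "A w3 = 0" "A v4 = w3"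
        "B w1 = 0" "B v2 = w1" "B w3 = - (2 * \<mu>) *\<^sub>R w3" "B v4 = w3 - (2 * \<mu>) *\<^sub>R v4"
        by (simp_all add: A_def B_def Dv Dw algebra_simps flip: scaleR_2)
      have lin: "A (p *\<^sub>R w1 + q *\<^sub>R v2 + r *\<^sub>R w3 + s *\<^sub>R v4) = p *\<^sub>R A w1 + q *\<^sub>R A v2 + r *\<^sub>R A w3 + s *\<^sub>R A v4"
        "B (p *\<^sub>R w1 + q *\<^sub>R v2 + r *\<^sub>R w3 + s *\<^sub>R v4) = p *\<^sub>R B w1 + q *\<^sub>R B v2 + r *\<^sub>R B w3 + s *\<^sub>R B v4" for p q r s
        by (simp_all add: A_def B_def br_simps algebra_simps)
      have AB: "A (p *\<^sub>R w1 + q *\<^sub>R v2 + r *\<^sub>R w3 + s *\<^sub>R v4) = (2 * \<mu> * p + q) *\<^sub>R w1 + (2 * \<mu> * q) *\<^sub>R v2 + s *\<^sub>R w3 + 0 *\<^sub>R v4"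
        "B (p *\<^sub>R w1 + q *\<^sub>R v2 + r *\<^sub>R w3 + s *\<^sub>R v4) = q *\<^sub>R w1 + 0 *\<^sub>R v2 + (s - 2 * \<mu> * r) *\<^sub>R w3 + (- 2 * \<mu> * s) *\<^sub>R v4" for p q r s
        unfolding lin AB0 by (simp_all add: algebra_simps)
      have "B (A (A ?E)) = (4 * \<mu> * \<mu> * b) *\<^sub>R w1" "A (B (B ?E)) = (4 * \<mu> * \<mu> * g) *\<^sub>R w3"
        unfolding AB by simp_all
      moreover have "A (A ?E) = (2 * \<mu> * (2 * \<mu> * a + b) + 2 * \<mu> * b) *\<^sub>R w1 + (4 * \<mu> * \<mu> * b) *\<^sub>R v2"
        "B (B ?E) = (- 2 * \<mu> * g - 2 * \<mu> * (g - 2 * \<mu> * f)) *\<^sub>R w3 + (4 * \<mu> * \<mu> * g) *\<^sub>R v4"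
        unfolding AB by simp_all
      moreover have "A 0 = 0" "B 0 = 0" by (simp_all add: A_def B_def br_simps)
      moreover have "w1 \<noteq> 0" "w3 \<noteq> 0" using y z by (simp_all add: w1_def w3_def)
      ultimately show ?thesis using E m by simp
    qed
    have ind': "a = 0 \<and> b = 0 \<and> f = 0 \<and> g = 0"
      if "a *\<^sub>R (1 / \<mu>) *\<^sub>R w1 + b *\<^sub>R v2 + f *\<^sub>R (1 / \<mu>) *\<^sub>R w3 + g *\<^sub>R v4 = 0" for a b f g
      using ind[of "a / \<mu>" b "f / \<mu>" g] that m by simp
    show ?thesis
      by (rule listed_B7[of "(1 / \<mu>) *\<^sub>R w1" v2 "(1 / \<mu>) *\<^sub>R w3" v4 "(1 / \<mu>) *\<^sub>R e 5"], rule bracket_table_D[OF _ _ _ _ _ ind'])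
         (use m in \<open>simp_all add: u delta_simps br_simps Dv Dw algebra_simps\<close>)
  next
    case 2
    define r where "r = sqrt (- s)"
    have r: "r > 0" "s = - (r * r)" using 2 by (simp_all add: r_def)
    \<comment> \<open>Solving \<open>D x = r (v1 - v4)\<close> and \<open>D v4 = r (v2 + x)\<close>, the table of the Jordan block, for \<open>v1\<close>, \<open>v2\<close>, \<open>v4\<close>.\<close>
    define v2 v1 v4 where "v2 = - (1 / (2 * (r * r))) *\<^sub>R N x" and "v1 = (1 / r) *\<^sub>R D v2" and "v4 = v1 - (1 / r) *\<^sub>R D x"
    have u: "\<delta> v1 = 0" "\<delta> v2 = 0" "\<delta> v4 = 0" using x Nx by (simp_all add: v1_def v2_def v4_def delta_simps)
    have DN: "D (D (N x)) = - (r * r) *\<^sub>R N x" using N2[OF x(1)] unfolding N_def[of "N x"] r(2) by (simp only: right_minus_eq)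
    have Dv2: "D v2 = r *\<^sub>R v1" using r by (simp add: v1_def)
    have "r *\<^sub>R D v1 = r *\<^sub>R (- r *\<^sub>R v2)" using r DN by (simp add: v1_def v2_def br_simps)
    then have Dv1: "D v1 = - r *\<^sub>R v2" using r(1) by (simp only: scaleR_cancel_left) simp
    have Dx: "D x = r *\<^sub>R (v1 - v4)" using r by (simp add: v4_def)
    have "N x = - (2 * (r * r)) *\<^sub>R v2" using r by (simp add: v2_def)
    then have DDx: "D (D x) = - (2 * (r * r)) *\<^sub>R v2 - (r * r) *\<^sub>R x" using r by (simp add: N_def algebra_simps)
    have "r *\<^sub>R D v4 = r *\<^sub>R D v1 - D (D x)" using r by (simp add: v4_def br_simps algebra_simps)
    also have "\<dots> = r *\<^sub>R (r *\<^sub>R (v2 + x))" unfolding Dv1 DDx by (simp add: algebra_simps flip: scaleR_2)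
    finally have "r *\<^sub>R D v4 = r *\<^sub>R (r *\<^sub>R (v2 + x))" .
    then have Dv4: "D v4 = r *\<^sub>R (v2 + x)" using r(1) by (simp only: scaleR_cancel_left) simp
    have v2: "v2 \<noteq> 0" using Nx r by (simp add: v2_def)
    have ind: "a = 0 \<and> b = 0 \<and> f = 0 \<and> g = 0" if E: "a *\<^sub>R v1 + b *\<^sub>R v2 + f *\<^sub>R x + g *\<^sub>R v4 = 0" for a b f g
    proof -
      have p: "rotation_pair r v1 v2" using r u Dv1 Dv2 v2 by (auto simp: rotation_pair_def br_simps)
      let ?E = "a *\<^sub>R v1 + b *\<^sub>R v2 + f *\<^sub>R x + g *\<^sub>R v4"
      have "D (D ?E) + (r * r) *\<^sub>R ?E = (2 * (r * r)) *\<^sub>R (g *\<^sub>R v1 + (- f) *\<^sub>R v2)"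
        by (simp add: br_simps Dv1 Dv2 Dv4 Dx algebra_simps flip: scaleR_2)
      then have "(2 * (r * r)) *\<^sub>R (g *\<^sub>R v1 + (- f) *\<^sub>R v2) = 0" using E by (simp add: br_simps)
      then have "g *\<^sub>R v1 + (- f) *\<^sub>R v2 = 0" using r by simp
      then have "g = 0" "f = 0" using pair_independent[of r v1 v2 g "- f"] p by simp_all
      then show ?thesis using E pair_independent[of r v1 v2 a b] p by simp
    qed
    show ?thesis
      by (rule listed_B11[of v1 v2 x v4 "(1 / r) *\<^sub>R e 5"], rule bracket_table_D[OF u(1,2) x(1) u(3) _ ind])
         (use r in \<open>simp_all add: Dv1 Dv2 Dx Dv4\<close>)
  qed
qed

lemma listed_abelian_kernel: "listed br"
proof -
  obtain t d where S: "\<And>x. \<delta> x = 0 \<Longrightarrow> D (D (D (D x))) = t *\<^sub>R D (D x) - d *\<^sub>R x" by (rule square_quadratic) blast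
  consider "t\<^sup>2 < 4 * d" | "4 * d \<le> t\<^sup>2" by linarith
  then show ?thesis
  proof cases
    case 1 then show ?thesis using listed_complex_roots S by blast
  next
    case 2
    define h where "h = sqrt (t\<^sup>2 - 4 * d)"
    have h: "h * h = t\<^sup>2 - 4 * d" using 2 by (simp add: h_def)
    define s1 s2 where "s1 = (t + h) / 2" and "s2 = (t - h) / 2"
    have "s1 * s2 = (t * t - h * h) / 4" by (simp add: s1_def s2_def algebra_simps)
    then have s: "s1 + s2 = t" "s1 * s2 = d" using h by (simp_all add: s1_def s2_def power2_eq_square field_simps)
    show ?thesis
    proof (cases "(\<forall>x. \<delta> x = 0 \<longrightarrow> D (D x) = s1 *\<^sub>R x) \<or> (\<forall>x. \<delta> x = 0 \<longrightarrow> D (D x) = s2 *\<^sub>R x)")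
      case True then show ?thesis using listed_scalar_square by blast
    next
      case False
      show ?thesis
      proof (cases "s1 = s2")
        case True
        have "D (D (D (D x))) = (2 * s1) *\<^sub>R D (D x) - (s1 * s1) *\<^sub>R x" if "\<delta> x = 0" for x
          using S[OF that] s True by simp
        then show ?thesis using listed_jordan False by blast
      next
        case ne: False
        have "D (D (D (D x))) = (s1 + s2) *\<^sub>R D (D x) - (s1 * s2) *\<^sub>R x" if "\<delta> x = 0" for x
          using S[OF that] s by simp
        then show ?thesis using listed_distinct_roots ne False by blast
      qed
    qed
  qed
qed

end

section \<open>The kernel is neither filiform nor Heisenberg\<close>

text \<open>Write \<open>z\<close> for a vector of \<open>real^4\<close>, \<open>l\<close> for a covector and \<open>L = l z\<close>. The two groups of hypotheses are the
components of \<open>om2(z) \<and> l + L om2 = 0\<close> and \<open>om3(z) \<and> l + L om3 = 0\<close>, where \<open>om2(z)\<close> and \<open>om3(z)\<close> denote contractions. Contracting the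
first with the quaternionic rotation of \<open>z\<close> belonging to \<open>om3\<close> gives the equations \<open>C\<close>, which isolate \<open>g\<close> and \<open>L\<close>.\<close>

lemma wedge_contractions_vanish:
  fixes z1 z2 z3 z4 l1 l2 l3 l4 L :: real
  assumes L: "L = z1 * l1 + z2 * l2 + z3 * l3 + z4 * l4"
    and b: "- z3 * l2 - z4 * l1 = 0" "- z3 * l3 - z1 * l1 + L = 0" "- z3 * l4 + z2 * l1 = 0"
      "z4 * l3 - z1 * l2 = 0" "z4 * l4 + z2 * l2 - L = 0" "z1 * l4 + z2 * l3 = 0"
    and c: "- z4 * l2 + z3 * l1 = 0" "- z4 * l3 - z2 * l1 = 0" "- z4 * l4 - z1 * l1 + L = 0"
      "- z3 * l3 - z2 * l2 + L = 0" "- z3 * l4 - z1 * l2 = 0" "z2 * l4 - z1 * l3 = 0"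
    and n: "z1 * z1 + z2 * z2 + z3 * z3 + z4 * z4 \<noteq> 0"
  shows "l1 = 0 \<and> l2 = 0 \<and> l3 = 0 \<and> l4 = 0"
proof -
  let ?n = "z1 * z1 + z2 * z2 + z3 * z3 + z4 * z4"
  define g where "g = - z4 * l1 - z3 * l2 + z2 * l3 + z1 * l4"
  have C: "z3 * g - z2 * L = 0" "- z4 * g + z1 * L = 0" "- z1 * g - z4 * L = 0" "z2 * g + z3 * L = 0"
    using b g_def L by algebra+
  have "?n * g = 0" "?n * L = 0" using C by algebra+
  then have 0: "g = 0" "L = 0" using n by simp_all
  have "?n * l1 = - z4 * g + z1 * L" "?n * l2 = - z3 * g + z2 * L" "?n * l3 = z2 * g + z3 * L" "?n * l4 = z1 * g + z4 * L"
    using c g_def L by algebra+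
  then have "?n * l1 = 0" "?n * l2 = 0" "?n * l3 = 0" "?n * l4 = 0" unfolding 0 by simp_all
  then show ?thesis using n by simp
qed

context hypo5
begin

lemma psi_multilinear:
  assumes "w = om2 \<phi> \<or> w = om3 \<phi>"
  shows "wedge21 w (\<phi> 5) (x + x') y z = wedge21 w (\<phi> 5) x y z + wedge21 w (\<phi> 5) x' y z"
    "wedge21 w (\<phi> 5) (c *\<^sub>R x) y z = c * wedge21 w (\<phi> 5) x y z"
    "wedge21 w (\<phi> 5) 0 y z = 0"
    "wedge21 w (\<phi> 5) x x y = 0" "wedge21 w (\<phi> 5) x y x = 0" "wedge21 w (\<phi> 5) x y y = 0"
  using assms by (auto simp: wedge21_def om2_def om3_def wedge11_def phi_simps algebra_simps)

lemma psi_rotate: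
  assumes "w = om2 \<phi> \<or> w = om3 \<phi>"
  shows "wedge21 w (\<phi> 5) y x z = - wedge21 w (\<phi> 5) x y z" "wedge21 w (\<phi> 5) z x y = wedge21 w (\<phi> 5) x y z"
  using assms by (auto simp: wedge21_def om2_def om3_def wedge11_def phi_simps algebra_simps)

end

context reeb5
begin

text \<open>Closedness of the three-forms on quadruples containing \<open>e 5\<close>: the Lie derivative along \<open>e 5\<close> plus a term
with the brackets of the kernel.\<close>

lemma psi_D:
  assumes "w = om2 \<phi> \<or> w = om3 \<phi>"
  shows "wedge21 w (\<phi> 5) (D x) y z - wedge21 w (\<phi> 5) (D y) x z + wedge21 w (\<phi> 5) (D z) x y
    + wedge21 w (\<phi> 5) (br x y) (e 5) z - wedge21 w (\<phi> 5) (br x z) (e 5) y + wedge21 w (\<phi> 5) (br y z) (e 5) x = 0"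
  using psi_closed[OF assms, of "e 5" x y z] by simp

text \<open>If contraction with \<open>z\<close> annihilates both three-forms on the kernel of \<open>\<delta>\<close>, then \<open>\<phi> 5\<close> vanishes on this kernel by
\<open>wedge_contractions_vanish\<close>, and with it the three-forms. By the last hypothesis all three two-forms
then vanish on the pair \<open>z\<close>, \<open>t\<close>, which makes the vectors parallel, like orthogonality to \<open>i z\<close>, \<open>j z\<close> and \<open>k z\<close> for
quaternions.\<close>

lemma contraction_degenerate:
  assumes z: "\<delta> z = 0" "z \<noteq> 0" and t: "\<delta> t = 0"
    and iz: "\<And>w a b. w = om2 \<phi> \<or> w = om3 \<phi> \<Longrightarrow> \<delta> a = 0 \<Longrightarrow> \<delta> b = 0 \<Longrightarrow> wedge21 w (\<phi> 5) z a b = 0"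
    and zt: "om1 \<phi> z t = 0" "\<And>w. w = om2 \<phi> \<or> w = om3 \<phi> \<Longrightarrow> \<exists>k a b. \<delta> a = 0 \<and> \<delta> b = 0 \<and> w z t = k * wedge21 w (\<phi> 5) a b t"
  obtains c d where "c \<noteq> 0" "c *\<^sub>R t = d *\<^sub>R z"
proof -
  define g where "g j = e j - \<delta> (e j) *\<^sub>R e 5" for j
  have dg: "\<delta> (g j) = 0" for j by (simp add: g_def delta_simps delta_reeb)
  define l where "l j = - \<delta> (e j)" for j
  have pg: "\<phi> 5 (g j) = l j" if "j \<noteq> 5" for j using that by (simp add: g_def l_def phi_simps dual)
  have pg': "\<phi> i (g j) = (if i = j then 1 else 0)" if "i \<noteq> 5" "j \<noteq> 5" for i j using that by (simp add: g_def phi_simps dual)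
  have p5: "\<phi> 5 x = \<phi> 1 x * l 1 + \<phi> 2 x * l 2 + \<phi> 3 x * l 3 + \<phi> 4 x * l 4" if "\<delta> x = 0" for x
    using arg_cong[OF expand5[of x], of \<delta>] that by (simp add: delta_simps delta_reeb l_def algebra_simps)
  note i2 = iz[of "om2 \<phi>" "g i" "g j" for i j, OF disjI1[OF refl] dg dg]
  note i3 = iz[of "om3 \<phi>" "g i" "g j" for i j, OF disjI2[OF refl] dg dg]
  let ?n = "\<phi> 1 z * \<phi> 1 z + \<phi> 2 z * \<phi> 2 z + \<phi> 3 z * \<phi> 3 z + \<phi> 4 z * \<phi> 4 z"
  have n: "?n \<noteq> 0"
  proof
    assume "?n = 0"
    then have "\<phi> 1 z = 0 \<and> \<phi> 2 z = 0 \<and> \<phi> 3 z = 0 \<and> \<phi> 4 z = 0"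
      by (simp add: add_nonneg_eq_0_iff)
    then show False using z delta_eqI by blast
  qed
  have "l 1 = 0 \<and> l 2 = 0 \<and> l 3 = 0 \<and> l 4 = 0"
    by (rule wedge_contractions_vanish[OF p5[OF z(1)] _ _ _ _ _ _ _ _ _ _ _ _ n])
       (use i2[of 1 2] i2[of 1 3] i2[of 1 4] i2[of 2 3] i2[of 2 4] i2[of 3 4]
          i3[of 1 2] i3[of 1 3] i3[of 1 4] i3[of 2 3] i3[of 2 4] i3[of 3 4] in
        \<open>simp_all add: wedge21_def om2_def om3_def wedge11_def pg pg' algebra_simps\<close>)
  then have p50: "\<phi> 5 x = 0" if "\<delta> x = 0" for x using p5[OF that] by simp
  have w0: "w z t = 0" if "w = om2 \<phi> \<or> w = om3 \<phi>" for w
    using zt(2)[OF that] p50 t by (auto simp: wedge21_def)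
  from w0[of "om2 \<phi>"] w0[of "om3 \<phi>"] zt(1)
  have o: "\<phi> 1 z * \<phi> 2 t - \<phi> 2 z * \<phi> 1 t + (\<phi> 3 z * \<phi> 4 t - \<phi> 4 z * \<phi> 3 t) = 0"
    "\<phi> 1 z * \<phi> 3 t - \<phi> 3 z * \<phi> 1 t + (\<phi> 4 z * \<phi> 2 t - \<phi> 2 z * \<phi> 4 t) = 0"
    "\<phi> 1 z * \<phi> 4 t - \<phi> 4 z * \<phi> 1 t + (\<phi> 2 z * \<phi> 3 t - \<phi> 3 z * \<phi> 2 t) = 0"
    by (simp_all add: om1_def om2_def om3_def wedge11_def algebra_simps)
  let ?m = "\<phi> 1 z * \<phi> 1 t + \<phi> 2 z * \<phi> 2 t + \<phi> 3 z * \<phi> 3 t + \<phi> 4 z * \<phi> 4 t"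
  have "?n *\<^sub>R t - ?m *\<^sub>R z = 0"
  proof (rule delta_eqI)
    show "\<delta> (?n *\<^sub>R t - ?m *\<^sub>R z) = 0" by (simp add: delta_simps z t)
    show "\<phi> 1 (?n *\<^sub>R t - ?m *\<^sub>R z) = 0" "\<phi> 2 (?n *\<^sub>R t - ?m *\<^sub>R z) = 0"
      "\<phi> 3 (?n *\<^sub>R t - ?m *\<^sub>R z) = 0" "\<phi> 4 (?n *\<^sub>R t - ?m *\<^sub>R z) = 0"
      unfolding phi_simps real_scaleR_def using o by algebra+
  qed
  then show ?thesis using that[of ?n ?m] n by simp
qed

end

text \<open>A basis \<open>v1, \<dots>, v4\<close> of the kernel of \<open>\<delta>\<close>, to be adapted to its derived algebra.\<close>

locale kernel_frame = reeb5 br \<phi> e \<delta> for br :: "'a::real_vector \<Rightarrow> 'a \<Rightarrow> 'a" and \<phi> e \<delta> +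
  fixes v1 v2 v3 v4 :: 'a
  assumes kernel_vectors: "\<delta> v1 = 0" "\<delta> v2 = 0" "\<delta> v3 = 0" "\<delta> v4 = 0"
    and fr: "frame v1 v2 v3 v4 (e 5)"
begin

definition "\<psi> = (SOME \<psi>. coframe5 br \<psi> (family5 v1 v2 v3 v4 (e 5)))"

lemma psi: "coframe5 br \<psi> (family5 v1 v2 v3 v4 (e 5))"
  unfolding \<psi>_def using frame_coframe5[OF fr] by (metis someI_ex)

interpretation k: coframe5 br \<psi> "family5 v1 v2 v3 v4 (e 5)" by (rule psi)

lemmas psi_simps = k.phi_simps

lemma psi_linear: "linear (\<psi> i)" by (rule k.lin)

lemma psi_dual: "\<psi> j v1 = (if 1 = j then 1 else 0)" "\<psi> j v2 = (if 2 = j then 1 else 0)" "\<psi> j v3 = (if 3 = j then 1 else 0)"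
  "\<psi> j v4 = (if 4 = j then 1 else 0)" "\<psi> j (e 5) = (if 5 = j then 1 else 0)"
  using k.dual[of j 1] k.dual[of j 2] k.dual[of j 3] k.dual[of j 4] k.dual[of j 5] by simp_all

lemma psi_5: "\<psi> 5 x = \<delta> x"
  using arg_cong[OF k.expand5[of x], of \<delta>] by (simp add: delta_simps delta_reeb kernel_vectors)

lemma kernel_expand: "\<delta> x = 0 \<Longrightarrow> x = \<psi> 1 x *\<^sub>R v1 + \<psi> 2 x *\<^sub>R v2 + \<psi> 3 x *\<^sub>R v3 + \<psi> 4 x *\<^sub>R v4"
  using k.expand5[of x] by (simp add: psi_5)

text \<open>The trace form is closed and vanishes on \<open>e 5\<close>, hence it is zero: the algebra is unimodular.\<close>

lemma kernel_trace: "\<psi> 1 (br x v1) + \<psi> 2 (br x v2) + \<psi> 3 (br x v3) + \<psi> 4 (br x v4) = 0"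
proof -
  have "trace_ad br \<psi> (family5 v1 v2 v3 v4 (e 5)) x = 0"
    using trace_ad_frame_independent[OF coframe5_axioms psi, of x] trace_zero[of x] by simp
  then show ?thesis by (simp add: trace_ad_def sum_5 psi_5)
qed

text \<open>Here \<open>v1 = [v2, v3]\<close> spans the derived algebra of the kernel and \<open>v4\<close> is a further central vector. If \<open>D v1 = \<kappa> v1\<close>,
then invariance of \<open>om1\<close> forces the weight \<open>\<tau> = - 2 \<kappa>\<close> on \<open>v4\<close> modulo \<open>v1\<close> and fixes the characteristic
polynomial of \<open>D\<close> on the plane of \<open>v2\<close> and \<open>v3\<close>. These weights are compatible with \<open>om1\<close>, but in the three-forms
they annihilate all components except one, which is tied to the value of \<open>om2\<close> and \<open>om3\<close> on \<open>v1\<close> and \<open>v4\<close>; this is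
the situation excluded by \<open>contraction_degenerate\<close>.\<close>

lemma kernel_not_heisenberg:
  assumes b: "br v2 v3 = v1" "br v1 v2 = 0" "br v1 v3 = 0" "br v1 v4 = 0" "br v2 v4 = 0" "br v3 v4 = 0"
  shows False
proof -
  note b' = br_anti[of v3 v2] br_anti[of v2 v1] br_anti[of v3 v1] br_anti[of v4 v1] br_anti[of v4 v2] br_anti[of v4 v3]
  obtain r a b p where Dx: "D v2 = r *\<^sub>R v1 + a *\<^sub>R v2 + b *\<^sub>R v3 + p *\<^sub>R v4" using kernel_expand[OF delta_br] by blast
  obtain s c d q where Dy: "D v3 = s *\<^sub>R v1 + c *\<^sub>R v2 + d *\<^sub>R v3 + q *\<^sub>R v4" using kernel_expand[OF delta_br] by blast
  obtain \<sigma> h1 h2 \<tau> where Dt0: "D v4 = \<sigma> *\<^sub>R v1 + h1 *\<^sub>R v2 + h2 *\<^sub>R v3 + \<tau> *\<^sub>R v4" using kernel_expand[OF delta_br] by blast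
  have v1: "v1 \<noteq> 0" using frameD[OF fr, of 1 0 0 0 0] by auto
  have "D (br v2 v4) = br (D v2) v4 + br v2 (D v4)" "D (br v3 v4) = br (D v3) v4 + br v3 (D v4)"
    by (rule jacobi)+
  then have "h1 = 0" "h2 = 0" using v1 by (simp_all add: Dx Dy Dt0 br_simps b b')
  then have Dt: "D v4 = \<sigma> *\<^sub>R v1 + \<tau> *\<^sub>R v4" using Dt0 by simp
  have Dz: "D v1 = (a + d) *\<^sub>R v1" using jacobi[of "e 5" v2 v3] by (simp add: Dx Dy br_simps b b' algebra_simps)
  have zt: "om1 \<phi> v1 v4 = 0" using kahler[of v2 v3 v4] by (simp add: b om1_simps)
  let ?X = "om1 \<phi> v2 v1" and ?Y = "om1 \<phi> v3 v1" and ?X' = "om1 \<phi> v2 v4" and ?Y' = "om1 \<phi> v3 v4"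
  have tz: "om1 \<phi> v4 v1 = 0" using zt om1_anti[of v1 v4] by simp
  have M: "a * ?X + b * ?Y + (a + d) * ?X = 0" "c * ?X + d * ?Y + (a + d) * ?Y = 0"
    "a * ?X' + b * ?Y' + \<sigma> * ?X + \<tau> * ?X' = 0" "c * ?X' + d * ?Y' + \<sigma> * ?Y + \<tau> * ?Y' = 0"
    using om1_D[of v2 v1] om1_D[of v3 v1] om1_D[of v2 v4] om1_D[of v3 v4]
    by (simp_all add: Dx Dy Dz Dt om1_simps zt tz)
  \<comment> \<open>Otherwise the functional \<open>om1 \<phi> v1\<close> would vanish on all brackets.\<close>
  have kappa: "a + d \<noteq> 0"
  proof
    assume 0: "a + d = 0"
    have "linear (om1 \<phi> v1)" by (rule linearI) (simp_all add: om1_simps)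
    then have "om1 \<phi> v1 x = 0" for x
    proof (rule functional_zero)
      show "om1 \<phi> v1 (D y) = 0" for y using om1_D[of v1 y] Dz 0 by (simp add: om1_simps)
      fix x y assume "\<delta> x = 0" "\<delta> y = 0"
      then have "br x y = (\<psi> 2 x * \<psi> 3 y - \<psi> 3 x * \<psi> 2 y) *\<^sub>R v1"
        using arg_cong2[OF kernel_expand[of x] kernel_expand[of y], of br] by (simp add: br_simps b b' algebra_simps)
      then show "om1 \<phi> v1 (br x y) = 0" by (simp add: om1_simps)
    qed (simp add: om1_simps)
    then show False using om1_nondegenerate[of v1] v1 kernel_vectors by blast
  qed
  have deg: "w = 0" if "\<delta> w = 0" "om1 \<phi> v1 w = 0" "om1 \<phi> v2 w = 0" "om1 \<phi> v3 w = 0" "om1 \<phi> v4 w = 0" for w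
  proof (rule om1_nondegenerate[OF that(1)])
    fix y assume "\<delta> y = 0"
    then have "om1 \<phi> y w = 0" using arg_cong[OF kernel_expand[of y], of "\<lambda>y. om1 \<phi> y w"] that by (simp add: om1_simps)
    then show "om1 \<phi> w y = 0" using om1_anti[of y w] by simp
  qed
  have det: "?X * ?Y' - ?X' * ?Y \<noteq> 0"
  proof
    assume D0: "?X * ?Y' - ?X' * ?Y = 0"
    have "?X' *\<^sub>R v1 - ?X *\<^sub>R v4 = 0" by (rule deg) (use D0 zt tz in \<open>simp_all add: delta_simps kernel_vectors om1_simps algebra_simps\<close>)
    then have "\<psi> 4 (?X' *\<^sub>R v1 - ?X *\<^sub>R v4) = 0" by (simp add: psi_simps)
    then have "?X = 0" by (simp add: psi_simps psi_dual)
    moreover have "?Y' *\<^sub>R v1 - ?Y *\<^sub>R v4 = 0" by (rule deg) (use D0 zt tz in \<open>simp_all add: delta_simps kernel_vectors om1_simps algebra_simps\<close>)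
    then have "\<psi> 4 (?Y' *\<^sub>R v1 - ?Y *\<^sub>R v4) = 0" by (simp add: psi_simps)
    then have "?Y = 0" by (simp add: psi_simps psi_dual)
    ultimately show False using deg[of v1] v1 kernel_vectors tz by (simp add: om1_simps)
  qed
  have "(\<tau> + 2 * (a + d)) * (?X * ?Y' - ?X' * ?Y) = 0" using M by algebra
  then have tau: "\<tau> = - 2 * (a + d)" using det by simp
  have "(a * d - b * c + 2 * (a + d) * (a + d)) * (?X * ?Y' - ?X' * ?Y) = 0" using M tau by algebra
  then have dt: "a * d - b * c + 2 * (a + d) * (a + d) = 0" using det by (simp only: mult_eq_0_iff simp_thms)
  have van: "wedge21 w (\<phi> 5) v1 v4 v2 = 0" "wedge21 w (\<phi> 5) v1 v4 v3 = 0" "wedge21 w (\<phi> 5) v1 v2 v3 = 0"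
    "w v1 v4 = (- (a + d)) * wedge21 w (\<phi> 5) v2 v3 v4" if w: "w = om2 \<phi> \<or> w = om3 \<phi>" for w
  proof -
    note pm = psi_multilinear[OF w]
    let ?P = "wedge21 w (\<phi> 5)"
    note rot = psi_rotate(1)[OF w, of v1 v4] psi_rotate(1)[OF w, of v1 v2] psi_rotate(1)[OF w, of v2 v3]
       psi_rotate(2)[OF w, of v1 v4] psi_rotate(2)[OF w, of v1 v2] psi_rotate(2)[OF w, of v1 v3]
    have ap: "?P v2 v1 v4 = ?P v1 v4 v2" "?P v3 v1 v4 = ?P v1 v4 v3" "?P v4 v1 v2 = - ?P v1 v4 v2" "?P v4 v1 v3 = - ?P v1 v4 v3"
      "?P v3 v1 v2 = ?P v1 v2 v3" "?P v2 v1 v3 = - ?P v1 v2 v3" "?P v4 v1 v3 = - ?P v1 v4 v3" "?P v3 v2 v4 = - ?P v2 v3 v4" "?P v4 v2 v3 = ?P v2 v3 v4"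
      "?P v1 v2 v4 = - ?P v1 v4 v2" "?P v1 v3 v4 = - ?P v1 v4 v3"
      using psi_rotate[OF w] by metis+
    note ev = Dx Dy Dz Dt pm ap b b' br_simps
    let ?hx = "?P v1 v4 v2" and ?hy = "?P v1 v4 v3"
    have "(a + d) * ?hx + \<tau> * ?hx + (a * ?hx + b * ?hy) = 0" "(a + d) * ?hy + \<tau> * ?hy + (c * ?hx + d * ?hy) = 0"
      using psi_D[OF w, of v1 v4 v2] psi_D[OF w, of v1 v4 v3]
      by (simp_all add: ev b' algebra_simps)
    then have "(2 * (a + d) * (a + d)) * ?hx = 0" "(2 * (a + d) * (a + d)) * ?hy = 0" using tau dt by algebra+
    then show h: "?hx = 0" "?hy = 0" using kappa by simp_all
    have "2 * (a + d) * ?P v1 v2 v3 = 0"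
      using psi_D[OF w, of v1 v2 v3] by (simp add: ev h algebra_simps)
    then show g: "?P v1 v2 v3 = 0" using kappa by simp
    have "?P v1 (e 5) v4 = - w v1 v4" using w by (auto simp: wedge21_def om2_def om3_def wedge11_def dual)
    moreover have "(a + d + \<tau>) * ?P v2 v3 v4 + ?P v1 (e 5) v4 = 0"
      using psi_D[OF w, of v2 v3 v4] by (simp add: ev h g algebra_simps)
    ultimately show "w v1 v4 = (- (a + d)) * ?P v2 v3 v4" using tau by algebra
  qed
  obtain c d where "c \<noteq> 0" "c *\<^sub>R v4 = d *\<^sub>R v1"
  proof (rule contraction_degenerate[of v1 v4])
    fix w x y assume w: "w = om2 \<phi> \<or> w = om3 \<phi>" and u: "\<delta> x = 0" "\<delta> y = 0"
    note pm = psi_multilinear[OF w]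
    have r: "wedge21 w (\<phi> 5) v1 x y = wedge21 w (\<phi> 5) x y v1" for x y by (rule psi_rotate(2)[OF w])
    have r2: "wedge21 w (\<phi> 5) v1 x y = wedge21 w (\<phi> 5) y v1 x" for x y by (rule psi_rotate(2)[OF w, symmetric])
    have "wedge21 w (\<phi> 5) v1 v v' = 0" if "v \<in> {v1, v2, v3, v4}" "v' \<in> {v1, v2, v3, v4}" for v v'
    proof -
      have "wedge21 w (\<phi> 5) v1 v2 v4 = 0" "wedge21 w (\<phi> 5) v1 v3 v4 = 0" "wedge21 w (\<phi> 5) v1 v3 v2 = 0"
        using van[OF w] psi_rotate[OF w] by (metis neg_0_equal_iff_equal)+
      then show ?thesis using that van[OF w] by (auto simp: pm)
    qed
    then have base: "wedge21 w (\<phi> 5) v' v1 v = 0" if "v \<in> {v1, v2, v3, v4}" "v' \<in> {v1, v2, v3, v4}" for v v'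
      using that r2[of v v'] by simp
    have "wedge21 w (\<phi> 5) v1 v y = 0" if "v \<in> {v1, v2, v3, v4}" for v
    proof -
      have "wedge21 w (\<phi> 5) y v1 v = 0"
        by (subst kernel_expand[OF u(2)]) (simp add: pm base[OF that])
      then show ?thesis using r2[of v y] by simp
    qed
    then have "wedge21 w (\<phi> 5) v y v1 = 0" if "v \<in> {v1, v2, v3, v4}" for v using that r[of v y] by simp
    then have "wedge21 w (\<phi> 5) x y v1 = 0" by (subst kernel_expand[OF u(1)]) (simp add: pm)
    then show "wedge21 w (\<phi> 5) v1 x y = 0" using r[of x y] by simp
  next
    fix w assume w: "w = om2 \<phi> \<or> w = om3 \<phi>"
    show "\<exists>k a b. \<delta> a = 0 \<and> \<delta> b = 0 \<and> w v1 v4 = k * wedge21 w (\<phi> 5) a b v4"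
      using van(4)[OF w] kernel_vectors by blast
  qed (use kernel_vectors v1 zt in auto)
  then have "\<psi> 4 (c *\<^sub>R v4) = \<psi> 4 (d *\<^sub>R v1)" by simp
  then show False using \<open>c \<noteq> 0\<close> by (simp add: psi_simps psi_dual)
qed

text \<open>If \<open>D\<close> has the weights \<open>a\<close> on \<open>v3\<close> and \<open>d\<close> on \<open>v4\<close>, then it has the weights \<open>a + d\<close> on \<open>v2\<close> and \<open>2 a + d\<close> on \<open>v1\<close>. Closedness of
\<open>om1\<close> leaves only the pairings of \<open>v1\<close> with \<open>v3\<close> and of \<open>v2\<close> with \<open>v4\<close>, which have to be of weight zero: \<open>3 a + d = 0\<close> and
\<open>a + 2 d = 0\<close>. So \<open>a = d = 0\<close>, and the functional dual to \<open>v3\<close> vanishes on all brackets.\<close>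

lemma kernel_not_filiform:
  assumes b: "br v3 v4 = v2" "br v3 v2 = v1" "br v3 v1 = 0" "br v4 v1 = 0" "br v4 v2 = 0" "br v2 v1 = 0"
  shows False
proof -
  note b' = br_anti[of v4 v3] br_anti[of v2 v3] br_anti[of v1 v3] br_anti[of v1 v4] br_anti[of v2 v4] br_anti[of v1 v2]
  obtain r1 r2 a h where Dx: "D v3 = r1 *\<^sub>R v1 + r2 *\<^sub>R v2 + a *\<^sub>R v3 + h *\<^sub>R v4" using kernel_expand[OF delta_br] by blast
  obtain s1 s2 c d where Dy: "D v4 = s1 *\<^sub>R v1 + s2 *\<^sub>R v2 + c *\<^sub>R v3 + d *\<^sub>R v4" using kernel_expand[OF delta_br] by blast
  have nz: "v1 \<noteq> 0" "v2 \<noteq> 0" using frameD[OF fr, of 1 0 0 0 0] frameD[OF fr, of 0 1 0 0 0] by auto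
  have Dw: "D v2 = (a + d) *\<^sub>R v2 + s2 *\<^sub>R v1" using jacobi[of "e 5" v3 v4] by (simp add: Dx Dy br_simps b b' algebra_simps)
  have "c = 0" using jacobi[of "e 5" v4 v2] nz by (simp add: Dw Dy br_simps b b')
  have Dz: "D v1 = (2 * a + d) *\<^sub>R v1" using jacobi[of "e 5" v3 v2] by (simp add: Dw Dx br_simps b b' algebra_simps flip: scaleR_2)
  have wz: "om1 \<phi> v2 v1 = 0" using kahler[of v3 v4 v1] by (simp add: b om1_simps)
  have zy: "om1 \<phi> v1 v4 = 0" using kahler[of v3 v2 v4] om1_anti[of v2 v2] by (simp add: b b' om1_simps)
  have anti: "om1 \<phi> v1 v2 = 0" "om1 \<phi> v4 v1 = 0" using wz zy om1_anti[of v2 v1] om1_anti[of v1 v4] by simp_all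
  have zx: "om1 \<phi> v1 v3 \<noteq> 0"
  proof
    assume 0: "om1 \<phi> v1 v3 = 0"
    have "om1 \<phi> v1 y = 0" if "\<delta> y = 0" for y
      by (subst kernel_expand[OF that]) (simp add: om1_simps anti zy 0)
    then show False using om1_nondegenerate[of v1] nz kernel_vectors by blast
  qed
  have "(3 * a + d) * om1 \<phi> v1 v3 = 0" using om1_D[of v1 v3] by (simp add: Dz Dx om1_simps anti zy algebra_simps)
  then have e1: "3 * a + d = 0" using zx by simp
  have wy: "om1 \<phi> v2 v4 \<noteq> 0"
  proof
    assume 0: "om1 \<phi> v2 v4 = 0"
    define w where "w = om1 \<phi> v1 v3 *\<^sub>R v2 - om1 \<phi> v2 v3 *\<^sub>R v1"
    have "om1 \<phi> w y = 0" if "\<delta> y = 0" for y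
      by (subst kernel_expand[OF that]) (simp add: w_def om1_simps anti zy wz 0)
    then have "w = 0" using om1_nondegenerate[of w] kernel_vectors by (simp add: w_def delta_simps)
    then have "\<psi> 2 w = 0" by (simp add: psi_simps)
    then show False using zx by (simp add: w_def psi_simps psi_dual)
  qed
  have "(a + 2 * d) * om1 \<phi> v2 v4 = 0" using om1_D[of v2 v4] \<open>c = 0\<close> by (simp add: Dw Dy om1_simps anti zy wz algebra_simps)
  then have "a = 0" "d = 0" using e1 wy by simp_all
  have "\<psi> 3 v3 = 0"
  proof (rule functional_zero[OF psi_linear])
    fix x y assume u: "\<delta> x = 0" "\<delta> y = 0"
    show "\<psi> 3 (br x y) = 0"
      by (subst kernel_expand[OF u(1)], subst kernel_expand[OF u(2)]) (simp add: br_simps b b' psi_simps psi_dual)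
  next
    fix x assume u: "\<delta> x = 0"
    show "\<psi> 3 (D x) = 0"
      by (subst kernel_expand[OF u(1)]) (simp add: br_simps Dx Dy Dw Dz \<open>c = 0\<close> \<open>a = 0\<close> psi_simps psi_dual)
  qed (simp add: psi_dual)
  then show False by (simp add: psi_dual)
qed

end

section \<open>The kernel is abelian\<close>

text \<open>Multiplying \<open>D G - G D = \<nu> G\<close> by the inverse of \<open>G\<close> and taking traces on \<open>V\<close> gives \<open>\<nu> dim V = 0\<close>. To work with
matrices, \<open>G\<close> is extended by the identity on the orthogonal complement of \<open>V\<close>, and \<open>D\<close> by zero.\<close>

lemma shifting_commutator_trivial:
  fixes V :: "(real^'n) set" and D G :: "real^'n \<Rightarrow> real^'n"
  assumes V: "subspace V" and lin: "linear D" "linear G"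
    and inv: "\<And>x. x \<in> V \<Longrightarrow> D x \<in> V" "\<And>x. x \<in> V \<Longrightarrow> G x \<in> V"
    and inj: "\<And>x. x \<in> V \<Longrightarrow> G x = 0 \<Longrightarrow> x = 0"
    and comm: "\<And>x. x \<in> V \<Longrightarrow> D (G x) - G (D x) = \<nu> *\<^sub>R G x"
    and x: "x \<in> V" "x \<noteq> 0"
  shows "\<nu> = 0"
proof -
  obtain B where B: "B \<subseteq> V" "pairwise orthogonal B" "\<And>x. x \<in> B \<Longrightarrow> norm x = 1" "independent B" "span B = V"
    using orthonormal_basis_subspace[OF V] by blast
  have fB: "finite B" by (rule independent_imp_finite[OF B(4)])
  define P where "P = (\<lambda>x. \<Sum>b\<in>B. (x \<bullet> b) *\<^sub>R b)"
  have linP: "linear P" unfolding P_def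
    by (rule linearI) (simp_all add: inner_add_left scaleR_add_left sum.distrib scaleR_sum_right)
  have PV: "P x \<in> V" for x unfolding P_def B(5)[symmetric] by (intro span_sum span_scale span_base)
  have Pb: "P b = b" if "b \<in> B" for b
  proof -
    have "P b = (\<Sum>c\<in>B. if c = b then b else 0)" unfolding P_def
    proof (rule sum.cong)
      fix c assume c: "c \<in> B"
      show "(b \<bullet> c) *\<^sub>R c = (if c = b then b else 0)"
        using B(2,3) c that by (auto simp: pairwise_def orthogonal_def norm_eq_1)
    qed simp
    then show ?thesis using fB that by simp
  qed
  have Pid: "P x = x" if "x \<in> V" for x
    using linear_eq_on_span[OF linP linear_ident, of B x] Pb that B(5) by simp
  define H where "H = (\<lambda>x. G (P x) + (x - P x))"
  have linH: "linear H" unfolding H_def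
    by (intro linear_compose_add linear_compose_sub linear_ident linP linear_compose[OF linP lin(2), unfolded o_def])
  have "inj H"
    unfolding linear_injective_0[OF linH]
  proof (intro allI impI)
    fix x assume 0: "H x = 0"
    have "P (H x) = G (P x) + (P x - P x)"
      by (simp add: H_def linear_add[OF linP] linear_diff[OF linP] Pid PV inv)
    then have "G (P x) = 0" using 0 linear_0[OF linP] by simp
    then have "P x = 0" using inj PV by blast
    then show "x = 0" using 0 linear_0[OF lin(2)] by (simp add: H_def)
  qed
  define A where "A = matrix H"
  define K where "K = matrix (\<lambda>x. D (P x))"
  define Q where "Q = matrix P"
  have linDP: "linear (\<lambda>x. D (P x))" using linear_compose[OF linP lin(1)] by (simp add: o_def)
  have mat: "A *v x = H x" "K *v x = D (P x)" "Q *v x = P x" for x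
    unfolding A_def K_def Q_def by (simp_all add: matrix_works linH linDP linP)
  have "(*v) A = H" using mat(1) by blast
  then have "invertible A" using \<open>inj H\<close> by (simp add: invertible_left_inverse matrix_left_invertible_injective)
  then obtain A' where A': "A' ** A = mat 1" "A ** A' = mat 1" unfolding invertible_def by blast
  have "K ** A = A ** K + A ** (\<nu> *\<^sub>R Q)"
  proof (rule matrix_eq[THEN iffD2], rule allI)
    fix x
    have "D (P (H x)) = D (G (P x))"
      by (simp add: H_def linear_add[OF linP] linear_diff[OF linP] Pid PV inv)
    moreover have "H (D (P x)) = G (D (P x))" by (simp add: H_def Pid PV inv)
    moreover have "H (P x) = G (P x)" by (simp add: H_def Pid PV)
    ultimately show "(K ** A) *v x = (A ** K + A ** (\<nu> *\<^sub>R Q)) *v x"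
      using comm[OF PV, of x]
      by (simp add: matrix_vector_mult_add_rdistrib scaleR_matrix_vector_assoc[symmetric] mat linear_cmul[OF linH] algebra_simps
          flip: matrix_vector_mul_assoc)
  qed
  then have "A' ** (K ** A) = A' ** (A ** K) + A' ** (A ** (\<nu> *\<^sub>R Q))" by (simp only: matrix_add_ldistrib)
  then have "A' ** (K ** A) = K + \<nu> *\<^sub>R Q" by (simp only: matrix_mul_assoc A' matrix_mul_lid)
  then have "trace (A' ** (K ** A)) = trace K + \<nu> * trace Q"
    by (simp add: trace_def sum.distrib sum_distrib_left)
  moreover have "trace (A' ** (K ** A)) = trace K"
    by (metis trace_mul_sym matrix_mul_assoc A'(2) matrix_mul_rid)
  ultimately have "\<nu> * trace Q = 0" by simp
  moreover have "trace Q > 0"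
  proof -
    have "trace Q = (\<Sum>i\<in>UNIV. \<Sum>b\<in>B. (b $ i) * (b $ i))"
      by (simp add: trace_def Q_def matrix_def P_def inner_axis inner_axis')
    also have "\<dots> = (\<Sum>b\<in>B. \<Sum>i\<in>UNIV. (b $ i) * (b $ i))" by (rule sum.swap)
    also have "\<dots> = (\<Sum>b\<in>B. 1)" using B(3) by (intro sum.cong) (simp_all add: inner_vec_def norm_eq_1)
    also have "\<dots> = card B" by simp
    finally have "trace Q = card B" .
    moreover have "B \<noteq> {}" using x B(5) by auto
    ultimately show ?thesis using fB by (simp add: card_gt_0_iff)
  qed
  ultimately show ?thesis by simp
qed

context reeb5
begin

definition kernel_brackets :: "'a set" where
  "kernel_brackets = {br x y | x y. \<delta> x = 0 \<and> \<delta> y = 0}"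

text \<open>A basis of the derived algebra of the kernel of \<open>\<delta>\<close>, chosen among brackets, is extended to the kernel; at most
three of the four vectors belong to the derived algebra, because the algebra is solvable.\<close>

lemma adapted_kernel_basis:
  assumes solv: "solvable_lie br"
  obtains v1 v2 v3 v4 k where "kernel_frame br \<phi> e \<delta> v1 v2 v3 v4" "k \<le> 3"
    "kernel_brackets \<subseteq> span (set (take k [v1, v2, v3, v4]))" "set (take k [v1, v2, v3, v4]) \<subseteq> kernel_brackets"
proof -
  let ?U = kernel_brackets and ?K = "{x. \<delta> x = 0}"
  obtain B where B: "B \<subseteq> ?U" "independent B" "?U \<subseteq> span B" by (metis maximal_independent_subset)
  have "B \<subseteq> ?K" using B(1) by (auto simp: kernel_brackets_def)
  then obtain C where C: "B \<subseteq> C" "C \<subseteq> ?K" "independent C" "?K \<subseteq> span C"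
    using maximal_independent_subset_extend[OF _ B(2)] by metis
  have "\<delta> y = 0" if "y \<in> span C" for y
    using linear_eq_0_on_span[OF lin_delta _ that] C(2) by blast
  then have nC: "e 5 \<notin> span C" using delta_reeb by force
  then have ind: "independent (insert (e 5) C)" using C(3) by (simp add: independent_insert)
  have "UNIV \<subseteq> span (insert (e 5) C)"
  proof
    fix y
    have "y - \<delta> y *\<^sub>R e 5 \<in> span C" using C(4) by (auto simp: delta_simps delta_reeb)
    then show "y \<in> span (insert (e 5) C)" unfolding span_insert by blast
  qed
  then have "card (insert (e 5) C) = 5" using basis_card_eq_dim[of "insert (e 5) C" UNIV] ind dim5 by auto
  moreover have e5: "e 5 \<notin> C" using nC span_base by blast
  moreover have fC: "finite C" using calculation(1) by (metis card.infinite finite_insert zero_neq_numeral)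
  ultimately have "card C = 4" by (simp add: card_insert_if)
  note fC = fC this
  have "B \<noteq> C"
  proof
    assume "B = C"
    then have "?K \<subseteq> span ?U" using C(4) B(1) span_mono by blast
    moreover have "?U = {br x y |x y. x \<in> ?K \<and> y \<in> ?K}" by (auto simp: kernel_brackets_def)
    ultimately have "?K \<subseteq> {0}" using solvable_no_perfect_subset[OF solv, of ?K] by simp
    then have "C \<subseteq> {0}" using C(2) by blast
    then have "card C \<le> 1" using card_mono[of "{0}" C] by simp
    then show False using fC by simp
  qed
  then have "B \<subset> C" using C(1) by blast
  then have cB: "card B < 4" "finite B" using fC psubset_card_mono finite_subset by (metis, metis psubset_imp_subset)
  obtain xs where xs: "set xs = B" "distinct xs" using finite_distinct_list[OF cB(2)] by blast
  obtain ys where ys: "set ys = C - B" "distinct ys" using finite_distinct_list[of "C - B"] fC by blast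
  have zs: "set (xs @ ys) = C" "distinct (xs @ ys)" using xs ys C(1) by auto
  then have "length (xs @ ys) = 4" using fC distinct_card by metis
  then obtain v1 v2 v3 v4 where v: "xs @ ys = [v1, v2, v3, v4]"
    by (auto simp: numeral_eq_Suc length_Suc_conv simp del: length_append)
  have tk: "take (card B) [v1, v2, v3, v4] = xs" using v xs by (metis append_eq_conv_conj distinct_card)
  have Cv: "C = {v1, v2, v3, v4}" and dv: "distinct [v1, v2, v3, v4]" using zs v by auto
  have "frame v1 v2 v3 v4 (e 5)"
  proof (rule frameI)
    fix a b c d f assume E: "a *\<^sub>R v1 + b *\<^sub>R v2 + c *\<^sub>R v3 + d *\<^sub>R v4 + f *\<^sub>R e 5 = 0"
    define u where "u x = (if x = v1 then a else if x = v2 then b else if x = v3 then c else if x = v4 then d else f)" for x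
    have "(\<Sum>x\<in>insert (e 5) C. u x *\<^sub>R x) = a *\<^sub>R v1 + b *\<^sub>R v2 + c *\<^sub>R v3 + d *\<^sub>R v4 + f *\<^sub>R e 5"
      using dv e5 by (auto simp: Cv u_def)
    then have "(\<Sum>x\<in>insert (e 5) C. u x *\<^sub>R x) = 0" using E by simp
    then have "\<forall>x\<in>insert (e 5) C. u x = 0" using ind fC(1) by (simp only: real_vector.dependent_finite finite_insert) blast
    then have "u v1 = 0" "u v2 = 0" "u v3 = 0" "u v4 = 0" "u (e 5) = 0" by (simp_all add: Cv)
    then show "a = 0 \<and> b = 0 \<and> c = 0 \<and> d = 0 \<and> f = 0" using dv e5 by (auto simp: u_def Cv)
  qed
  moreover have "\<delta> v1 = 0" "\<delta> v2 = 0" "\<delta> v3 = 0" "\<delta> v4 = 0" using C(2) by (auto simp: Cv)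
  ultimately have "kernel_frame br \<phi> e \<delta> v1 v2 v3 v4" by unfold_locales
  then show ?thesis using that[of v1 v2 v3 v4 "card B"] tk xs(1) B cB by simp
qed

end

context reeb5
begin

lemma kernel_bracketsI: "\<delta> x = 0 \<Longrightarrow> \<delta> y = 0 \<Longrightarrow> br x y \<in> kernel_brackets"
  by (auto simp: kernel_brackets_def)

lemma D_kernel_brackets_span:
  assumes "kernel_brackets \<subseteq> span W" "x \<in> kernel_brackets"
  shows "D x \<in> span W"
proof -
  obtain a b where x: "x = br a b" "\<delta> a = 0" "\<delta> b = 0" using assms(2) by (auto simp: kernel_brackets_def)
  have "D x = br (D a) b + br a (D b)" unfolding x(1) by (rule jacobi)
  moreover have "br (D a) b \<in> kernel_brackets" "br a (D b) \<in> kernel_brackets"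
    using x delta_br by (auto intro: kernel_bracketsI)
  ultimately show ?thesis using assms(1) by (metis span_add subsetD)
qed

lemma span_one: "x \<in> span {a} \<Longrightarrow> \<exists>p. x = p *\<^sub>R a"
  by (auto simp: span_singleton)

lemma span_two: "x \<in> span {a, b} \<Longrightarrow> \<exists>p q. x = p *\<^sub>R a + q *\<^sub>R b"
  unfolding span_insert[of a "{b}"] span_singleton by (auto simp: algebra_simps) (metis add.commute diff_add_cancel)

text \<open>Unimodularity makes \<open>z\<close> central in the kernel. Correcting \<open>t\<close> by multiples of \<open>x\<close> and \<open>y\<close> makes it central as well,
which is the Heisenberg situation.\<close>

lemma derived_kernel_not_line:
  assumes kf: "kernel_frame br \<phi> e \<delta> z x y t" and U: "kernel_brackets \<subseteq> span {z}" and xy: "br x y \<noteq> 0"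
  shows False
proof -
  interpret k: kernel_frame br \<phi> e \<delta> z x y t by fact
  define \<beta> where "\<beta> a b = k.\<psi> 1 (br a b)" for a b
  have br1: "br a b = \<beta> a b *\<^sub>R z" if ab: "\<delta> a = 0" "\<delta> b = 0" for a b
  proof -
    obtain p where p: "br a b = p *\<^sub>R z" using U kernel_bracketsI[OF ab] span_one by blast
    then have "\<beta> a b = p" by (simp add: \<beta>_def k.psi_simps k.psi_dual)
    then show ?thesis using p by simp
  qed
  have central: "br a z = 0" if a: "\<delta> a = 0" for a
  proof -
    have "\<beta> a z = 0" using k.kernel_trace[of a] by (simp add: br1 a k.kernel_vectors k.psi_simps k.psi_dual)
    then show ?thesis using br1[OF a k.kernel_vectors(1)] by simp
  qed
  note u = k.kernel_vectors
  define c where "c = \<beta> x y"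
  have c: "br x y = c *\<^sub>R z" "br y x = - c *\<^sub>R z" using br1 u br_anti[of y x] by (simp_all add: c_def)
  then have c0: "c \<noteq> 0" using xy by auto
  \<comment> \<open>\<open>[x, y] = c z\<close>, so these multiples of \<open>x\<close> and \<open>y\<close> cancel \<open>[x, t]\<close> and \<open>[y, t]\<close>.\<close>
  define p q where "p = \<beta> y t / c" and "q = - \<beta> x t / c"
  define t' where "t' = t + p *\<^sub>R x + q *\<^sub>R y"
  have "br x t' = (\<beta> x t + q * c) *\<^sub>R z" "br y t' = (\<beta> y t - p * c) *\<^sub>R z"
    by (simp_all add: t'_def br_simps c br1[OF u(2,4)] br1[OF u(3,4)] algebra_simps)
  then have "br x t' = 0" "br y t' = 0" using c0 by (simp_all add: p_def q_def)
  moreover have "kernel_frame br \<phi> e \<delta> (c *\<^sub>R z) x y t'"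
  proof
    show "\<delta> (c *\<^sub>R z) = 0" "\<delta> x = 0" "\<delta> y = 0" "\<delta> t' = 0" using u by (simp_all add: t'_def delta_simps)
    show "frame (c *\<^sub>R z) x y t' (e 5)"
    proof (rule frameI)
      fix a b f g h assume "a *\<^sub>R c *\<^sub>R z + b *\<^sub>R x + f *\<^sub>R y + g *\<^sub>R t' + h *\<^sub>R e 5 = 0"
      then have "(a * c) *\<^sub>R z + (b + g * p) *\<^sub>R x + (f + g * q) *\<^sub>R y + g *\<^sub>R t + h *\<^sub>R e 5 = 0"
        by (simp add: t'_def algebra_simps)
      from frameD[OF k.fr this] show "a = 0 \<and> b = 0 \<and> f = 0 \<and> g = 0 \<and> h = 0" using c0 by auto
    qed
  qed
  moreover have "br z x = 0" "br z y = 0" "br z t' = 0"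
    using central[of x] central[of y] central[of t'] u br_anti[of x z] br_anti[of y z] br_anti[of t' z] by (simp_all add: t'_def delta_simps)
  ultimately show False using c by (intro kernel_frame.kernel_not_heisenberg[of br \<phi> e \<delta> "c *\<^sub>R z" x y t']) (simp_all add: br_simps)
qed

text \<open>The matrix of \<open>x\<close> on the plane of \<open>z\<close> and \<open>w\<close> is nilpotent and nonzero, that of \<open>y\<close> a multiple of it. Since \<open>z\<close> and \<open>w\<close> are
combinations of brackets, \<open>[x, y]\<close> is not in the kernel of the nilpotent matrix, which is what \<open>?\<Delta> \<noteq> 0\<close>
expresses; so \<open>[x, y]\<close>, \<open>[x, [x, y]]\<close>, \<open>x\<close> and a corrected \<open>y\<close> are a filiform basis.\<close>

lemma derived_kernel_not_plane_aux:
  assumes kf: "kernel_frame br \<phi> e \<delta> z w x y" and zw: "br z w = 0"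
    and xz: "br x z = m *\<^sub>R z + n *\<^sub>R w" and xw: "br x w = k *\<^sub>R z - m *\<^sub>R w"
    and y: "br y z = \<mu> *\<^sub>R br x z" "br y w = \<mu> *\<^sub>R br x w" and xy: "br x y = a *\<^sub>R z + b *\<^sub>R w"
    and nil: "m * m + n * k = 0" and nz: "n \<noteq> 0 \<or> k \<noteq> 0"
    and derived: "z \<in> span kernel_brackets" "w \<in> span kernel_brackets"
  shows False
proof -
  interpret k: kernel_frame br \<phi> e \<delta> z w x y by fact
  note u = k.kernel_vectors
  note anti = br_anti[of w z] br_anti[of z x] br_anti[of w x] br_anti[of z y] br_anti[of w y] br_anti[of y x]
  note ev = br_simps zw anti y xz xw xy
  let ?\<Delta> = "n * a * a - 2 * m * a * b - k * b * b"
  have vanish: "f z = 0" "f w = 0"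
    if f: "linear f" and f0: "f (br x z) = 0" "f (br x w) = 0" "f (br x y) = 0" for f :: "'a \<Rightarrow> real"
  proof -
    note fs = linear_add[OF f] linear_diff[OF f] linear_cmul[OF f] linear_neg[OF f] linear_0[OF f]
    have "f v = 0" if v: "v \<in> kernel_brackets" for v
    proof -
      obtain s t where v: "v = br s t" "\<delta> s = 0" "\<delta> t = 0" using v by (auto simp: kernel_brackets_def)
      show ?thesis unfolding v(1)
        by (subst k.kernel_expand[OF v(2)], subst k.kernel_expand[OF v(3)])
           (simp add: br_simps zw anti y fs f0)
    qed
    then have "f v = 0" if "v \<in> span kernel_brackets" for v using linear_eq_0_on_span[OF f] that by blast
    then show "f z = 0" "f w = 0" using derived by blast+
  qed
  have \<Delta>: "?\<Delta> \<noteq> 0"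
  proof
    assume 0: "?\<Delta> = 0"
    show False
    proof (cases "n = 0")
      case False
      have "(n * a - m * b) * (n * a - m * b) = 0" using 0 nil by algebra
      then have nb: "n * a - m * b = 0" by simp
      have lin: "linear (\<lambda>v. n * k.\<psi> 1 v - m * k.\<psi> 2 v)"
        by (rule linearI) (simp_all add: k.psi_simps algebra_simps)
      have "n * k.\<psi> 1 z - m * k.\<psi> 2 z = 0"
        by (rule vanish(1)[OF lin]) (use nb nil in \<open>simp_all add: xz xw xy k.psi_simps k.psi_dual algebra_simps\<close>)
      then show False using False by (simp add: k.psi_dual)
    next
      case True
      then have k: "k \<noteq> 0" using nz by simp
      have "(m * a + k * b) * (m * a + k * b) = 0" using 0 nil by algebra
      then have nb: "m * a + k * b = 0" by simp
      have lin: "linear (\<lambda>v. m * k.\<psi> 1 v + k * k.\<psi> 2 v)"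
        by (rule linearI) (simp_all add: k.psi_simps algebra_simps)
      have "m * k.\<psi> 1 w + k * k.\<psi> 2 w = 0"
        by (rule vanish(2)[OF lin]) (use nb nil in \<open>simp_all add: xz xw xy k.psi_simps k.psi_dual algebra_simps\<close>)
      then show False using k by (simp add: k.psi_dual)
    qed
  qed
  let ?w = "a *\<^sub>R z + b *\<^sub>R w" and ?z = "(m * a + k * b) *\<^sub>R z + (n * a - m * b) *\<^sub>R w" and ?y = "y - \<mu> *\<^sub>R x"
  have "kernel_frame br \<phi> e \<delta> ?z ?w x ?y"
  proof
    show "\<delta> ?z = 0" "\<delta> ?w = 0" "\<delta> x = 0" "\<delta> ?y = 0" using u by (simp_all add: delta_simps)
    show "frame ?z ?w x ?y (e 5)"
    proof (rule frameI)
      fix p q r s h assume "p *\<^sub>R ?z + q *\<^sub>R ?w + r *\<^sub>R x + s *\<^sub>R ?y + h *\<^sub>R e 5 = 0"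
      then have "(p * (m * a + k * b) + q * a) *\<^sub>R z + (p * (n * a - m * b) + q * b) *\<^sub>R w + (r - s * \<mu>) *\<^sub>R x + s *\<^sub>R y + h *\<^sub>R e 5 = 0"
        by (simp add: algebra_simps)
      from frameD[OF k.fr this] have E: "p * (m * a + k * b) + q * a = 0" "p * (n * a - m * b) + q * b = 0" "r - s * \<mu> = 0" "s = 0" "h = 0" by auto
      have "?\<Delta> * p = 0" "?\<Delta> * q = 0" using E(1,2) by algebra+
      then show "p = 0 \<and> q = 0 \<and> r = 0 \<and> s = 0 \<and> h = 0" using \<Delta> E by simp
    qed
  qed
  moreover have "br x ?z = 0"
  proof -
    have "br x ?z = (m * m + n * k) *\<^sub>R (a *\<^sub>R z + b *\<^sub>R w)" by (simp add: ev algebra_simps)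
    then show ?thesis using nil by simp
  qed
  ultimately show False
    by (intro kernel_frame.kernel_not_filiform[of br \<phi> e \<delta> ?z ?w x ?y]) (simp_all add: ev algebra_simps)
qed

text \<open>The plane is abelian by unimodularity, and \<open>x\<close>, \<open>y\<close> act on it by commuting traceless matrices. As \<open>D\<close> maps onto
the quotient by the plane, each of these matrices is a commutator with the matrix of \<open>D\<close>; by commutativity the
trace form of the pair vanishes, so both matrices are nilpotent.\<close>

lemma derived_kernel_not_plane:
  assumes kf: "kernel_frame br \<phi> e \<delta> z w x y" and U: "kernel_brackets \<subseteq> span {z, w}"
    and zU: "z \<in> kernel_brackets" "w \<in> kernel_brackets"
  shows False
proof -
  interpret k: kernel_frame br \<phi> e \<delta> z w x y by fact
  note u = k.kernel_vectors
  have in_span: "\<exists>p q. br a b = p *\<^sub>R z + q *\<^sub>R w" if "\<delta> a = 0" "\<delta> b = 0" for a b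
    using U kernel_bracketsI[OF that] span_two by blast
  have tr: "k.\<psi> 1 (br a z) + k.\<psi> 2 (br a w) = 0" if a: "\<delta> a = 0" for a
  proof -
    have "k.\<psi> i (br a b) = 0" if "\<delta> b = 0" "i \<noteq> 1" "i \<noteq> 2" for b i
      using in_span[OF a that(1)] that(2,3) by (auto simp: k.psi_simps k.psi_dual)
    then show ?thesis using k.kernel_trace[of a] u by simp
  qed
  obtain \<alpha> \<beta> where zw0: "br z w = \<alpha> *\<^sub>R z + \<beta> *\<^sub>R w" using in_span u by blast
  have zw: "br z w = 0"
    using tr[OF u(1)] tr[OF u(2)] br_anti[of w z] zw0 by (simp add: br_simps k.psi_simps k.psi_dual)
  have G: "\<exists>m n l. br a z = m *\<^sub>R z + n *\<^sub>R w \<and> br a w = l *\<^sub>R z - m *\<^sub>R w" if a: "\<delta> a = 0" for a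
  proof -
    obtain m n l h where "br a z = m *\<^sub>R z + n *\<^sub>R w" "br a w = l *\<^sub>R z + h *\<^sub>R w" using in_span a u by metis
    moreover from this have "h = - m" using tr[OF a] by (simp add: k.psi_simps k.psi_dual)
    ultimately show ?thesis by auto
  qed
  obtain m n l where x: "br x z = m *\<^sub>R z + n *\<^sub>R w" "br x w = l *\<^sub>R z - m *\<^sub>R w" using G u by blast
  obtain m' n' l' where y: "br y z = m' *\<^sub>R z + n' *\<^sub>R w" "br y w = l' *\<^sub>R z - m' *\<^sub>R w" using G u by blast
  obtain a0 b0 where xy: "br x y = a0 *\<^sub>R z + b0 *\<^sub>R w" using in_span u by blast
  have eqI: "p = p' \<and> q = q'" if "p *\<^sub>R z + q *\<^sub>R w = p' *\<^sub>R z + q' *\<^sub>R w" for p q p' q'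
    using arg_cong[OF that, of "k.\<psi> 1"] arg_cong[OF that, of "k.\<psi> 2"] by (simp add: k.psi_simps k.psi_dual)
  have comm: "n * l' = n' * l" "m * n' = m' * n" "m * l' = m' * l"
  proof -
    have "br x (br y z) = br (br x y) z + br y (br x z)" "br x (br y w) = br (br x y) w + br y (br x w)" by (rule jacobi)+
    then have "(m' * m + n' * l) *\<^sub>R z + (m' * n - n' * m) *\<^sub>R w = (m * m' + n * l') *\<^sub>R z + (m * n' - n * m') *\<^sub>R w"
      "(l' * m - m' * l) *\<^sub>R z + (l' * n + m' * m) *\<^sub>R w = (l * m' - m * l') *\<^sub>R z + (l * n' + m * m') *\<^sub>R w"
      using br_anti[of w z] by (simp_all add: xy x y br_simps zw algebra_simps)
    from this[THEN eqI] show "n * l' = n' * l" "m * n' = m' * n" "m * l' = m' * l" by (auto simp: mult.commute)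
  qed
  obtain r1 r2 a b where Dx: "D x = r1 *\<^sub>R z + r2 *\<^sub>R w + a *\<^sub>R x + b *\<^sub>R y" using k.kernel_expand[OF delta_br] by blast
  obtain s1 s2 c d where Dy: "D y = s1 *\<^sub>R z + s2 *\<^sub>R w + c *\<^sub>R x + d *\<^sub>R y" using k.kernel_expand[OF delta_br] by blast
  obtain f g where Dz: "D z = f *\<^sub>R z + g *\<^sub>R w" using D_kernel_brackets_span[OF U zU(1)] span_two by blast
  obtain h i where Dw: "D w = h *\<^sub>R z + i *\<^sub>R w" using D_kernel_brackets_span[OF U zU(2)] span_two by blast
  have det: "a * d - b * c \<noteq> 0"
  proof
    assume 0: "a * d - b * c = 0"
    have no: "p = 0 \<and> q = 0" if pq: "p * a + q * b = 0" "p * c + q * d = 0" for p q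
    proof -
      have lin: "linear (\<lambda>v. p * k.\<psi> 3 v + q * k.\<psi> 4 v)" by (rule linearI) (simp_all add: k.psi_simps algebra_simps)
      have "p * k.\<psi> 3 v + q * k.\<psi> 4 v = 0" for v
      proof (rule functional_zero[OF lin])
        fix s t assume "\<delta> s = 0" "\<delta> t = 0"
        then obtain p' q' where "br s t = p' *\<^sub>R z + q' *\<^sub>R w" using in_span by blast
        then show "p * k.\<psi> 3 (br s t) + q * k.\<psi> 4 (br s t) = 0" by (simp add: k.psi_simps k.psi_dual)
      next
        fix s assume s: "\<delta> s = 0"
        have "p * k.\<psi> 3 (D s) + q * k.\<psi> 4 (D s) = k.\<psi> 3 s * (p * a + q * b) + k.\<psi> 4 s * (p * c + q * d)"
          using arg_cong[OF k.kernel_expand[OF s], of "\<lambda>v. p * k.\<psi> 3 (D v) + q * k.\<psi> 4 (D v)"]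
          by (simp add: br_simps Dx Dy Dz Dw k.psi_simps k.psi_dual algebra_simps)
        then show "p * k.\<psi> 3 (D s) + q * k.\<psi> 4 (D s) = 0" using pq by simp
      qed (simp add: k.psi_dual)
      from this[of x] this[of y] show ?thesis by (simp add: k.psi_dual)
    qed
    have "b = 0 \<and> - a = 0" by (rule no) (use 0 in \<open>simp_all add: algebra_simps\<close>)
    moreover have "d = 0 \<and> - c = 0" by (rule no) (use 0 in \<open>simp_all add: algebra_simps\<close>)
    ultimately show False using no[of 1 0] by simp
  qed
  have E: "m * f + n * h = a * m + b * m' + f * m + g * l" "m * g + n * i = a * n + b * n' + f * n - g * m"
    "l * f - m * h = a * l + b * l' + h * m + i * l" "l * g - m * i = - a * m - b * m' + h * n - i * m"
    "m' * f + n' * h = c * m + d * m' + f * m' + g * l'" "m' * g + n' * i = c * n + d * n' + f * n' - g * m'"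
    "l' * f - m' * h = c * l + d * l' + h * m' + i * l'" "l' * g - m' * i = - c * m - d * m' + h * n' - i * m'"
  proof -
    have "D (br x z) = br (D x) z + br x (D z)" "D (br x w) = br (D x) w + br x (D w)"
      "D (br y z) = br (D y) z + br y (D z)" "D (br y w) = br (D y) w + br y (D w)" by (rule jacobi)+
    then have "(m * f + n * h) *\<^sub>R z + (m * g + n * i) *\<^sub>R w = (a * m + b * m' + f * m + g * l) *\<^sub>R z + (a * n + b * n' + f * n - g * m) *\<^sub>R w"
      "(l * f - m * h) *\<^sub>R z + (l * g - m * i) *\<^sub>R w = (a * l + b * l' + h * m + i * l) *\<^sub>R z + (- a * m - b * m' + h * n - i * m) *\<^sub>R w"
      "(m' * f + n' * h) *\<^sub>R z + (m' * g + n' * i) *\<^sub>R w = (c * m + d * m' + f * m' + g * l') *\<^sub>R z + (c * n + d * n' + f * n' - g * m') *\<^sub>R w"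
      "(l' * f - m' * h) *\<^sub>R z + (l' * g - m' * i) *\<^sub>R w = (c * l + d * l' + h * m' + i * l') *\<^sub>R z + (- c * m - d * m' + h * n' - i * m') *\<^sub>R w"
      using br_anti[of w z] by (simp_all add: Dx Dy Dz Dw x y br_simps zw algebra_simps)
    from this[THEN eqI] show "m * f + n * h = a * m + b * m' + f * m + g * l" "m * g + n * i = a * n + b * n' + f * n - g * m"
      "l * f - m * h = a * l + b * l' + h * m + i * l" "l * g - m * i = - a * m - b * m' + h * n - i * m"
      "m' * f + n' * h = c * m + d * m' + f * m' + g * l'" "m' * g + n' * i = c * n + d * n' + f * n' - g * m'"
      "l' * f - m' * h = c * l + d * l' + h * m' + i * l'" "l' * g - m' * i = - c * m - d * m' + h * n' - i * m'" by auto
  qed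
  \<comment> \<open>the values of the trace form on the matrices of \<open>x\<close> and \<open>y\<close>\<close>
  let ?K11 = "2 * m * m + 2 * n * l" and ?K12 = "2 * m * m' + n * l' + n' * l" and ?K22 = "2 * m' * m' + 2 * n' * l'"
  have "a * ?K11 + b * ?K12 = 0" "c * ?K12 + d * ?K22 = 0" using E by algebra+
  moreover have "a * ?K12 + b * ?K22 = 0" "c * ?K11 + d * ?K12 = 0" using E comm by algebra+
  ultimately have "(a * d - b * c) * ?K11 = 0" "(a * d - b * c) * ?K22 = 0" by algebra+
  then have "?K11 = 0" "?K22 = 0" using det by (simp_all only: mult_eq_0_iff simp_thms)
  then have nil: "m * m + n * l = 0" "m' * m' + n' * l' = 0" by simp_all
  have zU': "z \<in> span kernel_brackets" "w \<in> span kernel_brackets" using zU span_base by auto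
  consider "n \<noteq> 0 \<or> l \<noteq> 0" | "n = 0" "l = 0" "n' \<noteq> 0 \<or> l' \<noteq> 0" | "n = 0" "l = 0" "n' = 0" "l' = 0" by blast
  then show False
  proof cases
    case 1
    then obtain \<mu> where mu: "m' = \<mu> * m" "n' = \<mu> * n" "l' = \<mu> * l"
    proof
      assume n: "n \<noteq> 0"
      show thesis by (rule that[of "n' / n"]) (use n comm in \<open>simp_all add: field_simps\<close>)
    next
      assume l: "l \<noteq> 0"
      show thesis by (rule that[of "l' / l"]) (use l comm in \<open>simp_all add: field_simps\<close>)
    qed
    have "br y z = \<mu> *\<^sub>R br x z" "br y w = \<mu> *\<^sub>R br x w"
      by (simp_all add: x y mu scaleR_add_right scaleR_diff_right)
    then show False by (rule derived_kernel_not_plane_aux[OF kf zw x _ _ xy nil(1) 1 zU'])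
  next
    case 2
    then have "m = 0" using nil by simp
    have kf': "kernel_frame br \<phi> e \<delta> z w y x"
    proof
      show "frame z w y x (e 5)"
      proof (rule frameI)
        fix p q r s h assume "p *\<^sub>R z + q *\<^sub>R w + r *\<^sub>R y + s *\<^sub>R x + h *\<^sub>R e 5 = 0"
        then have "p *\<^sub>R z + q *\<^sub>R w + s *\<^sub>R x + r *\<^sub>R y + h *\<^sub>R e 5 = 0" by (simp add: ac_simps)
        from frameD[OF k.fr this] show "p = 0 \<and> q = 0 \<and> r = 0 \<and> s = 0 \<and> h = 0" by auto
      qed
    qed (use u in simp_all)
    show False
      by (rule derived_kernel_not_plane_aux[OF kf' zw y, of 0 "- a0" "- b0"])
         (use 2 nil zU' br_anti[of y x] in \<open>simp_all add: x \<open>m = 0\<close> xy\<close>)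
  next
    case 3
    then have m: "m = 0" "m' = 0" using nil by simp_all
    note anti = br_anti[of w z] br_anti[of z x] br_anti[of w x] br_anti[of z y] br_anti[of w y] br_anti[of y x]
    have all: "\<exists>q. v = q *\<^sub>R br x y" if v: "v \<in> kernel_brackets" for v
    proof -
      obtain s t where v: "v = br s t" "\<delta> s = 0" "\<delta> t = 0" using v by (auto simp: kernel_brackets_def)
      have "v = (k.\<psi> 3 s * k.\<psi> 4 t - k.\<psi> 4 s * k.\<psi> 3 t) *\<^sub>R br x y"
        unfolding v(1) using arg_cong2[OF k.kernel_expand[OF v(2)] k.kernel_expand[OF v(3)], of br]
        by (simp add: br_simps zw anti x y 3 m algebra_simps)
      then show ?thesis by blast
    qed
    obtain q1 q2 where q: "z = q1 *\<^sub>R br x y" "w = q2 *\<^sub>R br x y" using all zU by metis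
    then have "q2 *\<^sub>R z + (- q1) *\<^sub>R w + 0 *\<^sub>R x + 0 *\<^sub>R y + 0 *\<^sub>R e 5 = 0" by simp
    from frameD[OF k.fr this] have "q1 = 0" by simp
    then have "1 *\<^sub>R z + 0 *\<^sub>R w + 0 *\<^sub>R x + 0 *\<^sub>R y + 0 *\<^sub>R e 5 = 0" using q by simp
    from frameD[OF k.fr this] show False by simp
  qed
qed

text \<open>Let \<open>N\<close> be the derived algebra of the kernel, of dimension three, and \<open>V\<close> the space of functionals on \<open>N\<close> that
vanish on \<open>[N, N]\<close>; it is nonzero by solvability. The transpose \<open>G\<close> of \<open>ad t\<close> is injective on \<open>V\<close>, because \<open>N\<close> is spanned
by \<open>[t, N]\<close> and \<open>[N, N]\<close>. As \<open>D t\<close> is \<open>\<nu> t\<close> modulo \<open>N\<close> with \<open>\<nu> \<noteq> 0\<close>, the transpose of \<open>D\<close> shifts \<open>G\<close>, contradicting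
\<open>shifting_commutator_trivial\<close>.\<close>

lemma derived_kernel_not_hyperplane:
  assumes solv: "solvable_lie br" and kf: "kernel_frame br \<phi> e \<delta> v1 v2 v3 t" and U: "kernel_brackets \<subseteq> span {v1, v2, v3}"
    and vU: "v1 \<in> kernel_brackets" "v2 \<in> kernel_brackets" "v3 \<in> kernel_brackets"
  shows False
proof -
  interpret k: kernel_frame br \<phi> e \<delta> v1 v2 v3 t by fact
  note u = k.kernel_vectors
  define N where "N = {x. \<delta> x = 0 \<and> k.\<psi> 4 x = 0}"
  have subN: "subspace N" unfolding N_def subspace_def by (simp add: delta_simps k.psi_simps)
  have vN: "v1 \<in> N" "v2 \<in> N" "v3 \<in> N" using u by (simp_all add: N_def k.psi_dual)
  then have spN: "span {v1, v2, v3} \<subseteq> N" using span_minimal[OF _ subN] by simp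
  have brN: "br a b \<in> N" if "\<delta> a = 0" "\<delta> b = 0" for a b
    using U spN that by (auto simp: kernel_brackets_def)
  have DN: "D x \<in> N" if "x \<in> N" for x
  proof -
    have x: "x = k.\<psi> 1 x *\<^sub>R v1 + k.\<psi> 2 x *\<^sub>R v2 + k.\<psi> 3 x *\<^sub>R v3"
      using that k.kernel_expand[of x] by (simp add: N_def)
    have "D v1 \<in> N" "D v2 \<in> N" "D v3 \<in> N" using D_kernel_brackets_span[OF U] vU spN by blast+
    then show ?thesis by (subst x) (simp add: br_simps subspace_add[OF subN] subspace_scale[OF subN])
  qed
  define \<nu> where "\<nu> = k.\<psi> 4 (D t)"
  have nu: "\<nu> \<noteq> 0"
  proof
    assume 0: "\<nu> = 0"
    have "k.\<psi> 4 t = 0"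
    proof (rule functional_zero[OF k.psi_linear])
      show "k.\<psi> 4 (e 5) = 0" by (simp add: k.psi_dual)
      show "k.\<psi> 4 (br x y) = 0" if "\<delta> x = 0" "\<delta> y = 0" for x y using brN[OF that] by (simp add: N_def)
      fix x assume x: "\<delta> x = 0"
      define y where "y = x - k.\<psi> 4 x *\<^sub>R t"
      have "y \<in> N" using x u by (simp add: y_def N_def delta_simps k.psi_simps k.psi_dual)
      then have "k.\<psi> 4 (D y) = 0" using DN by (simp add: N_def)
      then show "k.\<psi> 4 (D x) = 0" using 0 by (simp add: y_def br_simps k.psi_simps \<nu>_def)
    qed
    then show False by (simp add: k.psi_dual)
  qed
  define F :: "real^3 \<Rightarrow> 'a \<Rightarrow> real" where "F f x = f $ 1 * k.\<psi> 1 x + f $ 2 * k.\<psi> 2 x + f $ 3 * k.\<psi> 3 x" for f x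
  have Fs: "F f (x + y) = F f x + F f y" "F f (x - y) = F f x - F f y" "F f (c *\<^sub>R x) = c * F f x" "F f (- x) = - F f x" "F f 0 = 0" for f x y c
    by (simp_all add: F_def k.psi_simps algebra_simps)
  have Ff: "F (f + g) x = F f x + F g x" "F (c *\<^sub>R f) x = c * F f x" "F 0 x = 0" for f g x c
    by (simp_all add: F_def algebra_simps)
  have Fv: "F f v1 = f $ 1" "F f v2 = f $ 2" "F f v3 = f $ 3" "F f t = 0" for f
    by (simp_all add: F_def k.psi_dual)
  define V where "V = {f. \<forall>a\<in>N. \<forall>b\<in>N. F f (br a b) = 0}"
  define G where "G f = (vector [F f (br t v1), F f (br t v2), F f (br t v3)] :: real^3)" for f
  define D' where "D' f = (vector [F f (D v1), F f (D v2), F f (D v3)] :: real^3)" for f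
  have N_kernel: "\<delta> x = 0" if "x \<in> N" for x using that by (simp add: N_def)
  have Nx: "x = k.\<psi> 1 x *\<^sub>R v1 + k.\<psi> 2 x *\<^sub>R v2 + k.\<psi> 3 x *\<^sub>R v3" if "x \<in> N" for x
    using that k.kernel_expand[of x] by (simp add: N_def)
  have FG: "F (G f) x = F f (br t x)" if "\<delta> x = 0" for f x
  proof -
    have "F f (br t x) = k.\<psi> 1 x * F f (br t v1) + k.\<psi> 2 x * F f (br t v2) + k.\<psi> 3 x * F f (br t v3)"
      using arg_cong[OF k.kernel_expand[OF that], of "\<lambda>x. F f (br t x)"] by (simp add: br_simps Fs)
    then show ?thesis unfolding F_def[of "G f"] unfolding G_def vector_3 by (simp only: mult.commute)
  qed
  have FD: "F (D' f) x = F f (D x)" if "x \<in> N" for f x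
  proof -
    have "F f (D x) = k.\<psi> 1 x * F f (D v1) + k.\<psi> 2 x * F f (D v2) + k.\<psi> 3 x * F f (D v3)"
      using arg_cong[OF Nx[OF that], of "\<lambda>x. F f (D x)"] by (simp add: br_simps Fs)
    then show ?thesis unfolding F_def[of "D' f"] unfolding D'_def vector_3 by (simp only: mult.commute)
  qed
  have "\<exists>x\<in>N. x \<notin> span {br a b | a b. a \<in> N \<and> b \<in> N}"
  proof (rule ccontr)
    assume "\<not> ?thesis"
    then have "N \<subseteq> {0}" by (intro solvable_no_perfect_subset[OF solv]) blast
    then show False using vN frameD[OF k.fr, of 1 0 0 0 0] by auto
  qed
  then obtain x0 where x0: "x0 \<in> N" "x0 \<notin> span {br a b | a b. a \<in> N \<and> b \<in> N}" by blast
  obtain g :: "'a \<Rightarrow> real" where g: "linear g" "\<And>y. y \<in> {br a b | a b. a \<in> N \<and> b \<in> N} \<Longrightarrow> g y = 0" "g x0 = 1"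
    using exists_functional_separating[OF x0(2)] by blast
  define f0 :: "real^3" where "f0 = vector [g v1, g v2, g v3]"
  have gN: "F f0 x = g x" if "x \<in> N" for x
    using arg_cong[OF Nx[OF that], of g] by (simp add: linear_add[OF g(1)] linear_cmul[OF g(1)] F_def f0_def vector_3)
  have f0: "f0 \<in> V" "f0 \<noteq> 0"
  proof -
    show "f0 \<in> V" unfolding V_def
    proof (intro CollectI ballI)
      fix a b assume ab: "a \<in> N" "b \<in> N"
      then have "F f0 (br a b) = g (br a b)" by (intro gN brN N_kernel)
      also have "\<dots> = 0" using ab by (intro g(2)) blast
      finally show "F f0 (br a b) = 0" .
    qed
    show "f0 \<noteq> 0" using gN[OF x0(1)] g(3) by (auto simp: F_def)
  qed
  have tN: "br t x \<in> N" if "\<delta> x = 0" for x using brN u that by blast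
  have "- \<nu> = 0"
  proof (rule shifting_commutator_trivial[of V D' G, OF _ _ _ _ _ _ _ f0])
    show "subspace V" unfolding subspace_def V_def by (simp add: Ff)
    show "linear D'" by (rule linearI) (simp_all add: D'_def F_def vec_eq_iff forall_3 vector_3 algebra_simps)
    show "linear G" by (rule linearI) (simp_all add: G_def F_def vec_eq_iff forall_3 vector_3 algebra_simps)
    fix f assume f: "f \<in> V"
    have f0: "F f (br a b) = 0" if "a \<in> N" "b \<in> N" for a b using f that by (simp add: V_def)
    have "F (D' f) (br a b) = 0" if ab: "a \<in> N" "b \<in> N" for a b
    proof -
      have "F (D' f) (br a b) = F f (br (D a) b) + F f (br a (D b))"
        using FD[OF brN[OF N_kernel N_kernel, OF ab]] jacobi[of "e 5" a b] by (simp add: Fs)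
      then show ?thesis using f0 DN ab by simp
    qed
    then show "D' f \<in> V" by (simp add: V_def)
    have "F (G f) (br a b) = 0" if ab: "a \<in> N" "b \<in> N" for a b
    proof -
      have "F (G f) (br a b) = F f (br (br t a) b) + F f (br a (br t b))"
        using FG[of "br a b"] jacobi[of t a b] by (simp add: Fs)
      then show ?thesis using f0 tN N_kernel ab by simp
    qed
    then show "G f \<in> V" by (simp add: V_def)
    have "F f (br t (D v)) - F f (D (br t v)) = - \<nu> * F f (br t v)" if v: "v \<in> N" for v
    proof -
      define n where "n = D t - \<nu> *\<^sub>R t"
      have n: "n \<in> N" by (simp add: n_def N_def delta_simps u k.psi_simps k.psi_dual \<nu>_def)
      have "D (br t v) = br (D t) v + br t (D v)" by (rule jacobi)
      also have "D t = \<nu> *\<^sub>R t + n" by (simp add: n_def)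
      finally show ?thesis using f0[OF n v] by (simp add: br_simps Fs)
    qed
    moreover have "F (G f) (D v) = F f (br t (D v))" for v by (rule FG) simp
    moreover have "F (D' f) (br t v) = F f (D (br t v))" if "v \<in> N" for v using FD tN N_kernel that by blast
    ultimately have key: "F (G f) (D v) - F (D' f) (br t v) = - \<nu> * F f (br t v)" if "v \<in> N" for v using that by simp
    have "G f $ 1 = F f (br t v1)" "G f $ 2 = F f (br t v2)" "G f $ 3 = F f (br t v3)" by (simp_all add: G_def vector_3)
    then show "D' (G f) - G (D' f) = (- \<nu>) *\<^sub>R G f"
      using key[OF vN(1)] key[OF vN(2)] key[OF vN(3)]
      by (simp add: vec_eq_iff forall_3 D'_def[of "G f"] G_def[of "D' f"] vector_3)
  next
    fix f assume f: "f \<in> V" and G0: "G f = 0"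
    have tx: "F f (br t x) = 0" if "\<delta> x = 0" for x using FG[OF that, of f] G0 by (simp add: F_def)
    have "F f v = 0" if v: "v \<in> kernel_brackets" for v
    proof -
      obtain a b where v: "v = br a b" "\<delta> a = 0" "\<delta> b = 0" using v by (auto simp: kernel_brackets_def)
      define a' b' where "a' = a - k.\<psi> 4 a *\<^sub>R t" and "b' = b - k.\<psi> 4 b *\<^sub>R t"
      have ab: "a' \<in> N" "b' \<in> N" using v u by (simp_all add: a'_def b'_def N_def delta_simps k.psi_simps k.psi_dual)
      have "v = br a' b' + k.\<psi> 4 a *\<^sub>R br t b' - k.\<psi> 4 b *\<^sub>R br t a'"
        using br_anti[of a t] by (simp add: v(1) a'_def b'_def br_simps algebra_simps)
      then show ?thesis using f ab tx N_kernel by (simp add: Fs V_def)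
    qed
    then show "f = 0" using vU Fv[of f] by (simp add: vec_eq_iff forall_3)
  qed
  then show False using nu by simp
qed

lemma kernel_abelian:
  assumes solv: "solvable_lie br" and xy: "\<delta> x = 0" "\<delta> y = 0"
  shows "br x y = 0"
proof (rule ccontr)
  assume nz: "br x y \<noteq> 0"
  have xyU: "br x y \<in> kernel_brackets" using xy by (auto simp: kernel_brackets_def)
  obtain v1 v2 v3 v4 k where kf: "kernel_frame br \<phi> e \<delta> v1 v2 v3 v4" and k: "k \<le> 3"
    and U: "kernel_brackets \<subseteq> span (set (take k [v1, v2, v3, v4]))" "set (take k [v1, v2, v3, v4]) \<subseteq> kernel_brackets"
    by (rule adapted_kernel_basis[OF solv])
  interpret k: kernel_frame br \<phi> e \<delta> v1 v2 v3 v4 by fact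
  note u = k.kernel_vectors
  consider "k = 0" | "k = 1" | "k = 2" | "k = 3" using k by linarith
  then show False
  proof cases
    case 1
    then show False using U(1) xyU nz by auto
  next
    case 2
    then have U1: "kernel_brackets \<subseteq> span {v1}" and v1U: "v1 \<in> kernel_brackets" using U by auto
    have v1: "v1 \<noteq> 0" using frameD[OF k.fr, of 1 0 0 0 0] by auto
    have "br a b = 0" if "a \<in> {v2, v3, v4}" "b \<in> {v2, v3, v4}" for a b
    proof (rule ccontr)
      assume ne: "br a b \<noteq> 0"
      have "br v2 v3 \<noteq> 0 \<or> br v2 v4 \<noteq> 0 \<or> br v3 v4 \<noteq> 0"
        using ne that br_anti[of v3 v2] br_anti[of v4 v2] br_anti[of v4 v3] by (auto simp: br_simps)
      moreover have "kernel_frame br \<phi> e \<delta> v1 v2 v4 v3" "kernel_frame br \<phi> e \<delta> v1 v3 v4 v2"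
      proof -
        have "frame v1 v2 v4 v3 (e 5)" "frame v1 v3 v4 v2 (e 5)"
        proof -
          have "\<And>a b c d f. a *\<^sub>R v1 + b *\<^sub>R v2 + c *\<^sub>R v4 + d *\<^sub>R v3 + f *\<^sub>R e 5 = a *\<^sub>R v1 + b *\<^sub>R v2 + d *\<^sub>R v3 + c *\<^sub>R v4 + f *\<^sub>R e 5"
            "\<And>a b c d f. a *\<^sub>R v1 + b *\<^sub>R v3 + c *\<^sub>R v4 + d *\<^sub>R v2 + f *\<^sub>R e 5 = a *\<^sub>R v1 + d *\<^sub>R v2 + b *\<^sub>R v3 + c *\<^sub>R v4 + f *\<^sub>R e 5"
            by (simp_all add: ac_simps)
          then show "frame v1 v2 v4 v3 (e 5)" "frame v1 v3 v4 v2 (e 5)" using k.fr unfolding frame_def by metis+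
        qed
        then show "kernel_frame br \<phi> e \<delta> v1 v2 v4 v3" "kernel_frame br \<phi> e \<delta> v1 v3 v4 v2"
          using u by (unfold_locales; blast)+
      qed
      ultimately show False using derived_kernel_not_line kf U1 by blast
    qed
    note z = this
    have "br a v1 = 0" if a: "\<delta> a = 0" for a
    proof -
      have ex: "\<exists>p. br a b = p *\<^sub>R v1" if "\<delta> b = 0" for b using U1 kernel_bracketsI[OF a that] span_one by blast
      obtain p1 p2 p3 p4 where p: "br a v1 = p1 *\<^sub>R v1" "br a v2 = p2 *\<^sub>R v1" "br a v3 = p3 *\<^sub>R v1" "br a v4 = p4 *\<^sub>R v1"
        using ex u by metis
      then show ?thesis using k.kernel_trace[of a] by (simp add: k.psi_simps k.psi_dual)
    qed
    then have c: "br a v1 = 0" "br v1 a = 0" if "\<delta> a = 0" for a using that br_anti[of v1 a] by simp_all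
    have "br x y = 0"
      using arg_cong2[OF k.kernel_expand[OF xy(1)] k.kernel_expand[OF xy(2)], of br] u
      by (simp add: br_simps z c)
    then show False using nz by simp
  next
    case 3
    then show False using derived_kernel_not_plane[OF kf] U by (simp add: numeral_2_eq_2)
  next
    case 4
    then show False using derived_kernel_not_hyperplane[OF solv kf] U by (simp add: numeral_3_eq_3)
  qed
qed

lemma listed_reeb:
  assumes "solvable_lie br"
  shows "listed br"
proof -
  interpret reeb5_abelian br \<phi> e \<delta> by unfold_locales (rule kernel_abelian[OF assms])
  show ?thesis by (rule listed_abelian_kernel)
qed

end

text \<open>The dichotomy: either a closed one-form vanishing on \<open>e 5\<close> is rotated to a multiple of \<open>\<phi> 4\<close>, or every closed
one-form is determined by its value on \<open>e 5\<close>.\<close>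

lemma (in hypo5) listed_hypo5:
  assumes solv: "solvable_lie br"
  shows "listed br"
proof (cases "\<exists>\<epsilon>. linear \<epsilon> \<and> closed1 br \<epsilon> \<and> \<epsilon> (e 5) = 0 \<and> (\<exists>x. \<epsilon> x \<noteq> 0)")
  case True
  have "\<exists>\<epsilon>. linear \<epsilon> \<and> closed1 br \<epsilon> \<and> \<epsilon> (e 5) = 0 \<and> (\<exists>x. \<epsilon> x \<noteq> 0) \<and> (\<forall>x. \<epsilon> x = 0 \<longrightarrow> trace_ad br \<phi> e x = 0)"
  proof (cases "\<exists>x. trace_ad br \<phi> e x \<noteq> 0")
    case True
    then show ?thesis by (intro exI[of _ "trace_ad br \<phi> e"] conjI trace_ad_linear trace_ad_closed trace_ad_reeb) auto
  next
    case False
    then show ?thesis using \<open>\<exists>\<epsilon>. linear \<epsilon> \<and> closed1 br \<epsilon> \<and> \<epsilon> (e 5) = 0 \<and> (\<exists>x. \<epsilon> x \<noteq> 0)\<close> by simp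
  qed
  then obtain \<epsilon> where eps: "linear \<epsilon>" "closed1 br \<epsilon>" "\<epsilon> (e 5) = 0" "\<exists>x. \<epsilon> x \<noteq> 0" and tr: "\<And>x. \<epsilon> x = 0 \<Longrightarrow> trace_ad br \<phi> e x = 0"
    by metis
  have ex: "\<epsilon> x = \<epsilon> (e 1) * \<phi> 1 x + \<epsilon> (e 2) * \<phi> 2 x + \<epsilon> (e 3) * \<phi> 3 x + \<epsilon> (e 4) * \<phi> 4 x" for x
    using arg_cong[OF expand5[of x], of \<epsilon>] by (simp add: linear_add[OF eps(1)] linear_cmul[OF eps(1)] eps(3) mult.commute)
  define n where "n = sqrt ((\<epsilon> (e 1))\<^sup>2 + (\<epsilon> (e 2))\<^sup>2 + (\<epsilon> (e 3))\<^sup>2 + (\<epsilon> (e 4))\<^sup>2)"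
  have n2: "n\<^sup>2 = (\<epsilon> (e 1))\<^sup>2 + (\<epsilon> (e 2))\<^sup>2 + (\<epsilon> (e 3))\<^sup>2 + (\<epsilon> (e 4))\<^sup>2" by (simp add: n_def)
  have n: "n \<noteq> 0"
  proof
    assume "n = 0"
    then have "\<epsilon> (e 1) = 0" "\<epsilon> (e 2) = 0" "\<epsilon> (e 3) = 0" "\<epsilon> (e 4) = 0" using n2 by (simp_all add: add_nonneg_eq_0_iff)
    then have "\<epsilon> x = 0" for x by (simp add: ex[of x])
    then show False using eps(4) by simp
  qed
  have "(\<epsilon> (e 1) / n)\<^sup>2 + (\<epsilon> (e 2) / n)\<^sup>2 + (\<epsilon> (e 3) / n)\<^sup>2 + (\<epsilon> (e 4) / n)\<^sup>2 = n\<^sup>2 / n\<^sup>2"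
    by (subst n2) (simp add: power_divide add_divide_distrib)
  then have "(\<epsilon> (e 1) / n)\<^sup>2 + (\<epsilon> (e 2) / n)\<^sup>2 + (\<epsilon> (e 3) / n)\<^sup>2 + (\<epsilon> (e 4) / n)\<^sup>2 = 1" using n by simp
  from rotate_hypo[OF this] obtain \<theta> where chi: "hypo_coframe br \<theta>"
    "\<theta> 4 = (\<lambda>x. \<epsilon> (e 1) / n * \<phi> 1 x + \<epsilon> (e 2) / n * \<phi> 2 x + \<epsilon> (e 3) / n * \<phi> 3 x + \<epsilon> (e 4) / n * \<phi> 4 x)" by auto
  have chi4: "\<theta> 4 x = \<epsilon> x / n" for x unfolding chi(2) ex[of x] by (simp add: add_divide_distrib)
  obtain h where h: "hypo5 br \<theta> h" by (rule hypo5_exists[OF chi(1)])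
  interpret h: hypo5 br \<theta> h by (rule h)
  interpret t: transverse br \<theta> h
  proof
    show "closed1 br (\<theta> 4)" using eps(2) by (simp add: closed1_def chi4)
    fix x assume "\<theta> 4 x = 0"
    then have "trace_ad br \<phi> e x = 0" using chi4 n tr by simp
    then show "trace_ad br \<theta> h x = 0"
      using trace_ad_frame_independent[OF coframe5_axioms h.coframe5_axioms, of x] by simp
  qed
  show ?thesis by (rule t.listed_transverse[OF solv])
next
  case False
  obtain \<delta> x where d: "linear \<delta>" "closed1 br \<delta>" "\<delta> x = (1::real)" by (rule nonzero_closed_form[OF solv])
  then have nz: "\<delta> (e 5) \<noteq> 0" using False by (metis zero_neq_one)
  interpret reeb5 br \<phi> e "\<lambda>x. \<delta> x / \<delta> (e 5)"
  proof (intro reeb5.intro reeb5_axioms.intro hypo5_axioms)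
    show "linear (\<lambda>x. \<delta> x / \<delta> (e 5))" by (rule linearI) (simp_all add: linear_add[OF d(1)] linear_cmul[OF d(1)] add_divide_distrib)
    show "closed1 br (\<lambda>x. \<delta> x / \<delta> (e 5))" using d(2) by (simp add: closed1_def)
  qed (use nz False in auto)
  show ?thesis by (rule listed_reeb[OF solv])
qed

lemma hypo_iff_listed:
  assumes "lie_algebra br" "dim (UNIV :: 'a::real_vector set) = 5" "solvable_lie br"
  shows "has_hypo_structure (br :: 'a \<Rightarrow> 'a \<Rightarrow> 'a) \<longleftrightarrow> listed br"
proof
  interpret lie5 br using assms by unfold_locales
  assume "has_hypo_structure br"
  then obtain \<phi> where "hypo_coframe br \<phi>" using has_hypo_structure_iff_coframe[OF assms(2)] by blast
  then obtain e where "hypo5 br \<phi> e" using hypo5_exists by blast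
  then show "listed br" using hypo5.listed_hypo5 assms(3) by blast
next
  assume "listed br"
  then show "has_hypo_structure br" using listed_imp_has_hypo_structure assms(2) by blast
qed

theorem theorem17:
  fixes br :: "'a::real_vector \<Rightarrow> 'a \<Rightarrow> 'a"
  assumes "lie_algebra br" and "dim (UNIV :: 'a set) = 5" and "solvable_lie br"
  shows "has_hypo_structure br \<longleftrightarrow>
    \<comment> \<open>(A)\<close>
    br \<simeq>\<^sub>L structure_bracket (e2 2 4 + e2 3 5) 0 0 0 0 \<or>
    br \<simeq>\<^sub>L structure_bracket (e2 3 4 + e2 2 5) (e2 3 5) 0 0 0 \<or>
    br \<simeq>\<^sub>L structure_bracket (- (1/2) *\<^sub>F e2 1 5 - e2 2 3) (- e2 2 5) ((1/2) *\<^sub>F e2 3 5) ((3/2) *\<^sub>F e2 4 5) 0 \<or>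
    br \<simeq>\<^sub>L structure_bracket (- e2 2 3 - 2 *\<^sub>F e2 1 5) (- e2 2 5) (- e2 3 5) (3 *\<^sub>F e2 4 5) 0 \<or>
    br \<simeq>\<^sub>L structure_bracket (e2 1 5 - e2 2 3) (- e2 2 5) (2 *\<^sub>F e2 3 5) (- 3 *\<^sub>F e2 4 5) 0 \<or>
    br \<simeq>\<^sub>L structure_bracket (- e2 1 5 - e2 2 4) (- e2 3 4) (e2 3 5) (- e2 4 5) 0 \<or>
    br \<simeq>\<^sub>L structure_bracket (- e2 1 4) (- e2 2 5) (e2 3 4 + e2 3 5) 0 0 \<or>
    br \<simeq>\<^sub>L structure_bracket (2 *\<^sub>F e2 1 4) (- e2 2 4 - e2 3 5) (e2 2 5 - e2 3 4) 0 0 \<or>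
    br \<simeq>\<^sub>L structure_bracket (e2 2 3 + 2 *\<^sub>F e2 1 4) (e2 2 4 + e2 3 5) (e2 3 4 - e2 2 5) 0 0 \<or>
    \<comment> \<open>(B)\<close>
    br \<simeq>\<^sub>L structure_bracket (e2 3 5) (e2 4 5) 0 0 0 \<or>
    br \<simeq>\<^sub>L structure_bracket (e2 2 5) (e2 3 5) (e2 4 5) 0 0 \<or>
    (\<exists>p::real. p \<noteq> 0 \<and> br \<simeq>\<^sub>L structure_bracket (e2 1 5) (p *\<^sub>F e2 2 5) (- p *\<^sub>F e2 3 5) (- e2 4 5) 0) \<or>
    br \<simeq>\<^sub>L structure_bracket (e2 2 5) 0 (e2 3 5) (- e2 4 5) 0 \<or>
    (\<exists>r::real. r \<noteq> 0 \<and> br \<simeq>\<^sub>L structure_bracket (e2 1 5) (- e2 2 5) (r *\<^sub>F e2 4 5) (- r *\<^sub>F e2 3 5) 0) \<or>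
    br \<simeq>\<^sub>L structure_bracket (e2 2 5) 0 (e2 4 5) (- e2 3 5) 0 \<or>
    br \<simeq>\<^sub>L structure_bracket (e2 1 5 + e2 2 5) (e2 2 5) (e2 4 5 - e2 3 5) (- e2 4 5) 0 \<or>
    (\<exists>r::real. r \<noteq> 0 \<and> br \<simeq>\<^sub>L structure_bracket (e2 2 5) (- e2 1 5) (r *\<^sub>F e2 4 5) (- r *\<^sub>F e2 3 5) 0) \<or>
    (\<exists>p::real. br \<simeq>\<^sub>L structure_bracket (e2 2 5 + p *\<^sub>F e2 1 5) (- e2 1 5 + p *\<^sub>F e2 2 5)
                                    (e2 4 5 - p *\<^sub>F e2 3 5) (- e2 3 5 - p *\<^sub>F e2 4 5) 0) \<or>
    (\<exists>p::real. br \<simeq>\<^sub>L structure_bracket (e2 2 5 + p *\<^sub>F e2 1 5) (- e2 1 5 + p *\<^sub>F e2 2 5)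
                                    (- e2 4 5 - p *\<^sub>F e2 3 5) (e2 3 5 - p *\<^sub>F e2 4 5) 0) \<or>
    br \<simeq>\<^sub>L structure_bracket (e2 3 5 + e2 2 5) (- e2 1 5 + e2 4 5) (e2 4 5) (- e2 3 5) 0 \<or>
    \<comment> \<open>(C)\<close>
    br \<simeq>\<^sub>L structure_bracket 0 0 0 0 0 \<or>
    br \<simeq>\<^sub>L structure_bracket (e2 2 3) 0 0 0 0 \<or>
    br \<simeq>\<^sub>L structure_bracket (e2 2 3) (- e2 1 3) 0 0 0 \<or>
    br \<simeq>\<^sub>L structure_bracket (e2 1 3) (- e2 2 3) 0 0 0 \<or>
    br \<simeq>\<^sub>L structure_bracket (e2 2 3) (- e2 1 3) 0 0 (e2 4 5)"
  using hypo_iff_listed[OF assms] unfolding listed_def .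

end
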